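(* Let $\mathcal{V}$ be a normed finite dimensional real vector space and let $\mathcal{D}$ be a cone of directions in $\mathcal{V}$ for which there exists $\ell\in\mathcal{V}^*$ with $\overline{\mathcal{D}}\cap\ker\ell=\{0\}$. Then the following two conditions are equivalent: (a) for every $\mathcal{D}$-convex function $f\colon\mathcal{V}\to\mathbb{R}$ the distributional Hessian of $f$ is a $\odot^2\mathcal{V}$-valued Radon measure on $\mathcal{V}$; (b) the only $\mathcal{D}$-affine functions $\mathcal{V}\to\mathbb{R}$ are the affine functions. Moreover, when there exists a nontrivial (i.e. non-affine) $\mathcal{D}$-affine function, then there also exists a $\mathcal{D}$-convex $C^1$ function $f\colon\mathcal{V}\to\mathbb{R}$ whose differential $Df\colon\mathcal{V}\to\mathcal{V}^*$ is locally Hölder continuous, in the sense that for every compact $K\subset\mathcal{V}$ and every $\alpha\in(0,1)$ there is $c>0$ with $\|Df(x)-Df(y)\|\leq c\|x-y\|^\alpha$ for all $x,y\in K$, but for which the distributional Hessian fails to be a measure in any nonempty open subset $O$ of $\mathcal{V}$, in the sense that for some unit vector $e\in\mathcal{V}$ we have $$\sup\left\{\int_O f(x)\,D^2\varphi(x)(e,e)\,dx\;:\;\varphi\in C^\infty_c(O),\ \sup|\varphi|\leq 1\right\}=\infty.$$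
   Context: A cone of directions $\mathcal{D}$ in $\mathcal{V}$ is a subset such that $tx\in\mathcal{D}$ for all $x\in\mathcal{D}$, $t\in\mathbb{R}$, and whose linear span is $\mathcal{V}$; $\overline{\mathcal{D}}$ is its closure, $\mathcal{V}^*$ the dual space. A function $f\colon\mathcal{V}\to\mathbb{R}$ is $\mathcal{D}$-convex if its restriction to every segment $[x,y]$ with $x-y\in\mathcal{D}$ is convex; it is $\mathcal{D}$-affine if both $f$ and $-f$ are $\mathcal{D}$-convex. $\odot^2\mathcal{V}$ denotes the space of symmetric bilinear forms $\mathcal{V}\times\mathcal{V}\to\mathbb{R}$. Integration $dx$ is with respect to Lebesgue measure on $\mathcal{V}$ (for some fixed choice of basis). $C^\infty_c(O)$ denotes the real-valued smooth functions with compact support in $O$. $\mathcal{D}$-convex functions are locally Lipschitz, so their distributional Hessian is defined. *)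

theory Defs
  imports "HOL-Analysis.Analysis"
begin

text \<open>
  Finite dimensional normed real vector spaces, with an arbitrary norm (the zero space included).
\<close>

class fin_dim_normed = real_normed_vector +
  assumes ex_finite_spanning_set:
    "\<exists>B. finite B \<and> (\<forall>x. \<exists>c. x = (\<Sum>b\<in>B. c b *\<^sub>R b))"

instance euclidean_space \<subseteq> fin_dim_normed
proof
  have "\<exists>c. x = (\<Sum>b\<in>Basis. c b *\<^sub>R b)" for x :: 'a
    by (rule exI[of _ "\<lambda>b. x \<bullet> b"]) (simp add: euclidean_representation)
  then show "\<exists>B. finite B \<and> (\<forall>x::'a. \<exists>c. x = (\<Sum>b\<in>B. c b *\<^sub>R b))"
    using finite_Basis by blast
qed

lemma finite_independent:
  fixes B :: "'v::fin_dim_normed set"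
  assumes "independent B"
  shows "finite B"
proof -
  obtain C :: "'v set" where C: "finite C" "\<forall>x. \<exists>c. x = (\<Sum>b\<in>C. c b *\<^sub>R b)"
    using ex_finite_spanning_set by blast
  have "x \<in> span C" for x
  proof -
    obtain c where "x = (\<Sum>b\<in>C. c b *\<^sub>R b)" using C by blast
    then show ?thesis by (simp add: span_sum span_scale span_base)
  qed
  then show ?thesis
    using independent_span_bound[OF C(1) assms] by auto
qed


definition cone_of_directions :: "'v::real_normed_vector set \<Rightarrow> bool" where
  "cone_of_directions D \<longleftrightarrow> (\<forall>x\<in>D. \<forall>t::real. t *\<^sub>R x \<in> D) \<and> span D = UNIV"

definition D_convex :: "'v::real_normed_vector set \<Rightarrow> ('v \<Rightarrow> real) \<Rightarrow> bool" where
  "D_convex D f \<longleftrightarrow> (\<forall>x y. x - y \<in> D \<longrightarrow> convex_on (closed_segment x y) f)"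

definition D_affine :: "'v::real_normed_vector set \<Rightarrow> ('v \<Rightarrow> real) \<Rightarrow> bool" where
  "D_affine D f \<longleftrightarrow> D_convex D f \<and> D_convex D (\<lambda>x. - f x)"

definition affine_function :: "('v::real_vector \<Rightarrow> real) \<Rightarrow> bool" where
  "affine_function f \<longleftrightarrow> (\<exists>l c. linear l \<and> f = (\<lambda>x. l x + c))"


text \<open>
  Lebesgue measure on the Borel sets of a finite dimensional space with respect to a basis
  \<open>B\<close>: the image of the product measure under the coordinate isomorphism.
\<close>

definition lebesgue_wrt :: "'v::real_normed_vector set \<Rightarrow> 'v measure" where
  "lebesgue_wrt B = distr (Pi\<^sub>M B (\<lambda>_. lborel)) borel (\<lambda>c. \<Sum>b\<in>B. c b *\<^sub>R b)"

lemma lebesgue_wrt_Basis: "lebesgue_wrt Basis = (lborel :: 'a::euclidean_space measure)"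
  unfolding lebesgue_wrt_def by (rule lborel_eq[symmetric])


text \<open>
  In finite dimension a function is of class \<open>C\<^sup>k\<^sup>+\<^sup>1\<close> iff it is differentiable and all its
  directional derivatives are of class \<open>C\<^sup>k\<close>.
\<close>

fun class_C :: "nat \<Rightarrow> ('v::real_normed_vector \<Rightarrow> real) \<Rightarrow> bool" where
  "class_C 0 f \<longleftrightarrow> continuous_on UNIV f"
| "class_C (Suc k) f \<longleftrightarrow>
     f differentiable_on UNIV \<and> (\<forall>v. class_C k (\<lambda>x. frechet_derivative f (at x) v))"

definition smooth :: "('v::real_normed_vector \<Rightarrow> real) \<Rightarrow> bool" where
  "smooth f \<longleftrightarrow> (\<forall>k. class_C k f)"

text \<open>
  \<open>C\<^sub>c\<^sup>\<infinity>(U)\<close>; the functions are regarded as defined on the whole space (extended by zero).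
\<close>

definition test_functions :: "'v::real_normed_vector set \<Rightarrow> ('v \<Rightarrow> real) set" where
  "test_functions U =
     {\<phi>. smooth \<phi> \<and> compact (closure {x. \<phi> x \<noteq> 0}) \<and> closure {x. \<phi> x \<noteq> 0} \<subseteq> U}"

definition second_deriv ::
  "('v::real_normed_vector \<Rightarrow> real) \<Rightarrow> 'v \<Rightarrow> 'v \<Rightarrow> 'v \<Rightarrow> real" where
  "second_deriv \<phi> x u v =
     frechet_derivative (\<lambda>y. frechet_derivative \<phi> (at y) u) (at x) v"

text \<open>
  The \<open>(u,v)\<close> entry of the distributional Hessian of \<open>f\<close>, evaluated at the test function \<open>\<phi>\<close>.
\<close>

definition distr_Hessian ::
  "'v::real_normed_vector set \<Rightarrow> ('v \<Rightarrow> real) \<Rightarrow> ('v \<Rightarrow> real) \<Rightarrow> 'v \<Rightarrow> 'v \<Rightarrow> real" where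
  "distr_Hessian B f \<phi> u v = (LINT x|lebesgue_wrt B. f x * second_deriv \<phi> x u v)"


definition rel_compact_borel :: "'v::real_normed_vector set set" where
  "rel_compact_borel = {A \<in> sets borel. compact (closure A)}"

text \<open>
  A vector valued Radon measure is a set function on the relatively compact Borel sets that is
  countably additive on the Borel subsets of every compact set.
\<close>

definition vector_Radon_measure ::
  "('v::real_normed_vector set \<Rightarrow> 'w::real_normed_vector) \<Rightarrow> bool" where
  "vector_Radon_measure M \<longleftrightarrow>
     (\<forall>A. disjoint_family A \<longrightarrow> range A \<subseteq> rel_compact_borel \<longrightarrow>
        (\<Union>n::nat. A n) \<in> rel_compact_borel \<longrightarrow> (\<lambda>n. M (A n)) sums M (\<Union>n. A n))"

definition sym_bilinear :: "('v::real_normed_vector \<Rightarrow>\<^sub>L 'v \<Rightarrow>\<^sub>L real) set" where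
  "sym_bilinear = {S. \<forall>u v. blinfun_apply (blinfun_apply S u) v = blinfun_apply (blinfun_apply S v) u}"

definition pos_Radon_measure :: "'v::real_normed_vector measure \<Rightarrow> bool" where
  "pos_Radon_measure P \<longleftrightarrow>
     sets P = sets borel \<and> (\<forall>K. compact K \<longrightarrow> emeasure P K < \<infinity>)"

text \<open>
  The integral of a compactly supported continuous function against a real valued Radon measure
  \<open>\<nu>\<close> is computed from a decomposition \<open>\<nu> = P - N\<close> into positive Radon measures; it does not
  depend on the choice of the decomposition.
\<close>

definition Radon_decomposition ::
  "('v::real_normed_vector set \<Rightarrow> real) \<Rightarrow> 'v measure \<Rightarrow> 'v measure \<Rightarrow> bool" where
  "Radon_decomposition \<nu> P N \<longleftrightarrow> pos_Radon_measure P \<and> pos_Radon_measure N \<and>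
     (\<forall>A\<in>rel_compact_borel. \<nu> A = measure P A - measure N A)"

definition Hessian_is_Radon_measure ::
  "'v::real_normed_vector set \<Rightarrow> ('v \<Rightarrow> real) \<Rightarrow> bool" where
  "Hessian_is_Radon_measure B f \<longleftrightarrow>
     (\<exists>M :: 'v set \<Rightarrow> ('v \<Rightarrow>\<^sub>L 'v \<Rightarrow>\<^sub>L real).
        vector_Radon_measure M \<and> (\<forall>A\<in>rel_compact_borel. M A \<in> sym_bilinear) \<and>
        (\<forall>u v. \<exists>P N. Radon_decomposition (\<lambda>A. blinfun_apply (blinfun_apply (M A) u) v) P N \<and>
           (\<forall>\<phi>\<in>test_functions UNIV.
              distr_Hessian B f \<phi> u v = (LINT x|P. \<phi> x) - (LINT x|N. \<phi> x))))"

definition locally_Holder :: "('v::real_normed_vector \<Rightarrow> 'w::real_normed_vector) \<Rightarrow> bool" where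
  "locally_Holder g \<longleftrightarrow>
     (\<forall>K. compact K \<longrightarrow> (\<forall>\<alpha>::real. 0 < \<alpha> \<and> \<alpha> < 1 \<longrightarrow>
        (\<exists>c>0. \<forall>x\<in>K. \<forall>y\<in>K. norm (g x - g y) \<le> c * norm (x - y) powr \<alpha>)))"

end

(*
  If f is D-convex and d is in D, the second derivative of f in direction d is a positive Radon
  measure: on lines it is the Stieltjes measure of the one-sided derivative. When every D-affine
  function is affine, a quadratic form vanishing on D vanishes, so the squares of the elements of D
  span the symmetric tensors and every entry of the Hessian is a combination of such measures.

  Conversely a D-affine function is polynomial in the coordinates of a basis contained in D; if it
  is not affine, some second derivative q is a nonzero quadratic form vanishing on D. Write q as a
  combination c of squares of functionals a_i, one of which is the given l, bounded below on D.
  Consider quadratic forms x with Sum_i x_i a_i^2 positive on D, and perturb them by test functions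
  phi keeping the Hessian nonnegative on D. Superposing plane waves in the directions a_i (laminates)
  shows that the largest average of |Hessian(e,e)| is positively homogeneous and concave in each x_i.
  If it were finite, blowing up at a square of l would bound it by a linear functional of x, which
  is incompatible with a positive value at both c and -c. So the average can be made arbitrarily
  large by perturbations that are as small as desired together with their gradients, with Hessians
  bounded independently of that smallness; a gliding hump over a countable base of open sets sums
  them to the required function.
*)

theory Submission
  imports Defs
begin

text \<open>Squares of functionals enter because \<delta>^2 times a plane wave
  \<open>w (a i y / \<delta>)\<close> has Hessian \<open>w''\<close> times the square of
  \<open>a i\<close>: at negligible cost in size and gradient it splits a form into two along the
  coordinate \<open>i\<close>. This yields concavity of the largest average in each coordinate, but
  not jointly. Homogeneity makes up for it: the directional derivative at the interior point
  \<open>unit_vec k\<close> is again homogeneous and separately concave, lies above, is defined on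
  the whole space and is additive along \<open>k\<close>; repeating this for every coordinate leaves
  a linear majorant. The functional l serves twice: its square is interior to the cone of forms
  positive on D, and \<open>C * (l y * l y)\<close> is the convex background that pays for the
  negative part of the Hessians of the perturbations. The decisive uniformity is that the Hessian
  bound \<open>M\<close> is fixed before the size \<tau> of the perturbation: at stage
  \<open>n\<close> one may take \<tau> below the n-th power of \<open>1 / (M + 1)\<close>, and
  interpolation gives every Hoelder exponent below 1 although the bounds \<open>M n\<close> are not
  controlled.\<close>

section \<open>Coordinates and topology of finite dimensional normed spaces\<close>

text \<open>No inner product is at hand, so the coordinate of a new vector \<open>x\<close> is
  controlled by its distance to the span of the others. That distance is positive because the span
  is closed, which follows from the bound already known for the smaller basis: the coordinates of a
  convergent sequence are Cauchy.\<close>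

lemma basis_coordinates_bounded:
  fixes B :: "'v::real_normed_vector set"
  assumes "finite B" "independent B"
  shows "\<exists>K>0. \<forall>c. \<forall>b\<in>B. \<bar>c b\<bar> \<le> K * norm (\<Sum>b\<in>B. c b *\<^sub>R b)"
  using assms
proof (induction B rule: finite_induct)
  case empty
  then show ?case by (auto intro!: exI[of _ 1])
next
  case (insert x F)
  then have indF: "independent F" and xF: "x \<notin> span F"
    by (auto simp: independent_insert)
  from insert.IH[OF indF] obtain K where K: "K > 0"
    "\<And>c b. b \<in> F \<Longrightarrow> \<bar>c b\<bar> \<le> K * norm (\<Sum>b\<in>F. c b *\<^sub>R b)" by blast
  have "closed (span F)"
    unfolding closed_sequential_limits
  proof (intro allI impI)
    fix s l assume *: "(\<forall>n. s n \<in> span F) \<and> s \<longlonglongrightarrow> l"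
    have "\<forall>n. \<exists>c. s n = (\<Sum>b\<in>F. c b *\<^sub>R b)"
      using * span_finite[OF insert.hyps(1)] by (metis (no_types, lifting) image_iff)
    then obtain c where c: "\<And>n. s n = (\<Sum>b\<in>F. c n b *\<^sub>R b)" by metis
    have "\<exists>m. (\<lambda>n. c n b) \<longlonglongrightarrow> m" if "b \<in> F" for b
    proof -
      have "Cauchy (\<lambda>n. c n b)"
      proof (rule metric_CauchyI)
        fix e :: real assume "e > 0"
        have "Cauchy s" using * LIMSEQ_imp_Cauchy by blast
        then obtain M where M: "\<And>m n. m \<ge> M \<Longrightarrow> n \<ge> M \<Longrightarrow> dist (s m) (s n) < e / K"
          using \<open>e > 0\<close> K(1) by (meson divide_pos_pos metric_CauchyD)
        have "dist (c m b) (c n b) < e" if "m \<ge> M" "n \<ge> M" for m n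
        proof -
          have "\<bar>c m b - c n b\<bar> \<le> K * norm (\<Sum>b\<in>F. (c m b - c n b) *\<^sub>R b)"
            using K(2)[OF \<open>b \<in> F\<close>, of "\<lambda>b. c m b - c n b"] by simp
          also have "(\<Sum>b\<in>F. (c m b - c n b) *\<^sub>R b) = s m - s n"
            by (simp add: c scaleR_left_diff_distrib sum_subtractf)
          also have "K * norm (s m - s n) < e"
            using M[OF that] K(1) by (simp add: dist_norm field_simps)
          finally show ?thesis by (simp add: dist_real_def)
        qed
        then show "\<exists>M. \<forall>m\<ge>M. \<forall>n\<ge>M. dist (c m b) (c n b) < e" by blast
      qed
      then show ?thesis using Cauchy_convergent convergent_def by blast
    qed
    then obtain m where m: "\<And>b. b \<in> F \<Longrightarrow> (\<lambda>n. c n b) \<longlonglongrightarrow> m b" by metis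
    have "s \<longlonglongrightarrow> (\<Sum>b\<in>F. m b *\<^sub>R b)"
      unfolding c using m by (intro tendsto_intros) auto
    then have "l = (\<Sum>b\<in>F. m b *\<^sub>R b)" using * LIMSEQ_unique by blast
    then show "l \<in> span F" by (simp add: span_sum span_scale span_base)
  qed
  moreover have "x \<in> - span F" using xF by simp
  ultimately obtain \<delta> where \<delta>: "\<delta> > 0" "ball x \<delta> \<subseteq> - span F"
    using open_Compl by (meson open_contains_ball)
  have x_bound: "\<bar>c x\<bar> * \<delta> \<le> norm (\<Sum>b\<in>insert x F. c b *\<^sub>R b)" for c
  proof (cases "c x = 0")
    case False
    \<comment> \<open>\<open>c x *\<^sub>R (x - y)\<close> is the whole combination, and
      \<open>y\<close> lies in the span of \<open>F\<close>, hence at distance at least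
      \<open>\<delta>\<close> from \<open>x\<close>.\<close>
    define y where "y = - (\<Sum>b\<in>F. (c b / c x) *\<^sub>R b)"
    have "y \<in> span F" unfolding y_def by (intro span_neg span_sum span_scale span_base)
    then have "\<delta> \<le> norm (x - y)" using \<delta>(2) by (force simp: dist_norm not_le)
    then have "\<bar>c x\<bar> * \<delta> \<le> norm (c x *\<^sub>R (x - y))" by (simp add: mult_left_mono)
    also have "c x *\<^sub>R (x - y) = (\<Sum>b\<in>insert x F. c b *\<^sub>R b)"
      using False insert.hyps by (simp add: y_def scaleR_sum_right algebra_simps)
    finally show ?thesis .
  qed (use \<delta> in auto)
  \<comment> \<open>The first entry serves the coordinate of \<open>x\<close>; the second serves the
    others, after \<open>c x *\<^sub>R x\<close> has been subtracted from the sum.\<close>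
  define K' where "K' = max (1/\<delta>) (K * (1 + norm x / \<delta>))"
  have "\<bar>c b\<bar> \<le> K' * norm (\<Sum>b\<in>insert x F. c b *\<^sub>R b)" if "b \<in> insert x F" for c b
  proof -
    let ?s = "\<Sum>b\<in>insert x F. c b *\<^sub>R b"
    have cx: "\<bar>c x\<bar> \<le> norm ?s / \<delta>" using x_bound[of c] \<delta>(1) by (simp add: pos_le_divide_eq)
    show ?thesis
    proof (cases "b = x")
      case True
      have "norm ?s / \<delta> \<le> K' * norm ?s" unfolding K'_def
        using mult_right_mono[OF max.cobounded1[of "1/\<delta>"] norm_ge_zero[of ?s]] by simp
      then show ?thesis using True cx by simp
    next
      case False
      then have b: "b \<in> F" using that by simp
      have "\<bar>c b\<bar> \<le> K * norm (\<Sum>b\<in>F. c b *\<^sub>R b)" by (rule K(2)[OF b])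
      also have "(\<Sum>b\<in>F. c b *\<^sub>R b) = ?s - c x *\<^sub>R x" using insert.hyps by simp
      also have "norm (?s - c x *\<^sub>R x) \<le> norm ?s + \<bar>c x\<bar> * norm x"
        by (metis norm_triangle_ineq4 norm_scaleR)
      also have "\<dots> \<le> norm ?s + (norm ?s / \<delta>) * norm x"
        using cx by (intro add_left_mono mult_right_mono) auto
      also have "\<dots> = (1 + norm x / \<delta>) * norm ?s" by (simp add: algebra_simps)
      finally have "\<bar>c b\<bar> \<le> (K * (1 + norm x / \<delta>)) * norm ?s" using K(1) by simp
      also have "\<dots> \<le> K' * norm ?s" unfolding K'_def by (intro mult_right_mono) auto
      finally show ?thesis .
    qed
  qed
  moreover have "K' > 0" unfolding K'_def using \<delta>(1) by (simp add: less_max_iff_disj)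
  ultimately show ?case by blast
qed

lemma ex_finite_basis:
  "\<exists>B :: 'v::fin_dim_normed set. finite B \<and> independent B \<and> span B = UNIV"
proof -
  obtain B :: "'v set" where B: "independent B" "UNIV \<subseteq> span B"
    using maximal_independent_subset[of "UNIV :: 'v set"] by auto
  then show ?thesis using finite_independent by auto
qed

definition coord :: "'v::real_normed_vector set \<Rightarrow> 'v \<Rightarrow> 'v \<Rightarrow> real" where
  "coord B b x = representation B x b"

lemma
  fixes B :: "'v::fin_dim_normed set"
  assumes "independent B" "span B = UNIV"
  shows coord_sum: "(\<Sum>b\<in>B. coord B b x *\<^sub>R b) = x"
    and bounded_linear_coord: "bounded_linear (coord B b)"
    and coord_lincomb: "b \<in> B \<Longrightarrow> coord B b (\<Sum>b\<in>B. c b *\<^sub>R b) = c b"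
    and coord_base: "b \<in> B \<Longrightarrow> b' \<in> B \<Longrightarrow> coord B b b' = (if b = b' then 1 else 0)"
proof -
  have fin: "finite B" by (rule finite_independent[OF assms(1)])
  show sum: "(\<Sum>b\<in>B. coord B b x *\<^sub>R b) = x" for x
    unfolding coord_def using sum_representation_eq[OF assms(1) _ fin order_refl] assms(2) by auto
  have lin: "linear (coord B b)" for b
    using assms by (intro linearI) (auto simp: coord_def representation_add representation_scale)
  obtain K where K: "\<And>c b. b \<in> B \<Longrightarrow> \<bar>c b\<bar> \<le> K * norm (\<Sum>b\<in>B. c b *\<^sub>R b)"
    using basis_coordinates_bounded[OF fin assms(1)] by blast
  show "bounded_linear (coord B b)"
  proof (cases "b \<in> B")
    case True
    have "norm (coord B b x) \<le> norm x * K" for x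
      using K[OF True, of "\<lambda>b. coord B b x"] by (simp add: sum mult.commute)
    then show ?thesis
      using lin by (intro bounded_linear_intro[where K=K])
        (auto simp: linear_add linear_scale)
  next
    case False
    then have "coord B b = (\<lambda>x. 0)"
      unfolding coord_def using representation_ne_zero by blast
    then show ?thesis by simp
  qed
  have base: "coord B b b' = (if b = b' then 1 else 0)" if "b' \<in> B" for b b'
    unfolding coord_def using representation_basis[OF assms(1) that] by auto
  then show "b \<in> B \<Longrightarrow> b' \<in> B \<Longrightarrow> coord B b b' = (if b = b' then 1 else 0)" .
  show "coord B b (\<Sum>b\<in>B. c b *\<^sub>R b) = c b" if "b \<in> B"
  proof -
    have "coord B b (\<Sum>b\<in>B. c b *\<^sub>R b) = (\<Sum>b'\<in>B. c b' * coord B b b')"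
      using lin by (simp add: linear_sum linear_scale)
    also have "\<dots> = (\<Sum>b'\<in>B. if b' = b then c b' else 0)"
      by (intro sum.cong) (auto simp: base)
    finally show ?thesis using that fin by simp
  qed
qed

lemma linear_imp_bounded_linear:
  fixes f :: "'v::fin_dim_normed \<Rightarrow> 'w::real_normed_vector"
  assumes "linear f"
  shows "bounded_linear f"
proof -
  obtain B :: "'v set" where B: "finite B" "independent B" "span B = UNIV"
    using ex_finite_basis by blast
  have "f = (\<lambda>x. \<Sum>b\<in>B. coord B b x *\<^sub>R f b)"
  proof
    fix x
    have "f x = f (\<Sum>b\<in>B. coord B b x *\<^sub>R b)" by (simp add: coord_sum[OF B(2,3)])
    then show "f x = (\<Sum>b\<in>B. coord B b x *\<^sub>R f b)"
      using assms by (simp add: linear_sum linear_scale)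
  qed
  moreover have "bounded_linear (\<lambda>x. \<Sum>b\<in>B. coord B b x *\<^sub>R f b)"
    by (intro bounded_linear_sum bounded_linear_scaleR_const bounded_linear_coord[OF B(2,3)])
  ultimately show ?thesis by simp
qed

text \<open>A countable base makes sums, scalar multiples and translates Borel measurable in the
  measure theory below. It consists of balls of radius \<open>1 / Suc n\<close> around rational
  combinations of a basis.\<close>

instance fin_dim_normed \<subseteq> second_countable_topology
proof
  obtain B :: "'a set" where B: "finite B" "independent B" "span B = UNIV"
    using ex_finite_basis by blast
  define Q where "Q = (\<lambda>c. \<Sum>b\<in>B. c b *\<^sub>R b) ` (B \<rightarrow>\<^sub>E \<rat>)"
  have Q: "countable Q"
    unfolding Q_def using B(1) by (intro countable_image countable_PiE) (auto simp: countable_rat)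
  have dense: "\<exists>q\<in>Q. dist q x < e" if "e > 0" for x and e :: real
  proof -
    define s where "s = (\<Sum>b\<in>B. norm b) + 1"
    have s: "s > 0" unfolding s_def by (simp add: sum_nonneg add_nonneg_pos)
    have "\<exists>r\<in>\<rat>. \<bar>r - coord B b x\<bar> < e / s" for b
      using Rats_dense_in_real[of "coord B b x" "coord B b x + e / s"] \<open>e > 0\<close> s by force
    then obtain r where r: "\<And>b. r b \<in> \<rat>" "\<And>b. \<bar>r b - coord B b x\<bar> < e / s" by metis
    define q where "q = (\<Sum>b\<in>B. r b *\<^sub>R b)"
    have "q = (\<Sum>b\<in>B. restrict r B b *\<^sub>R b)" unfolding q_def by (intro sum.cong) auto
    then have "q \<in> Q" unfolding Q_def using r(1) by (intro image_eqI[of _ _ "restrict r B"]) auto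
    moreover have "dist q x < e"
    proof -
      have "q - x = (\<Sum>b\<in>B. (r b - coord B b x) *\<^sub>R b)"
        by (simp add: q_def scaleR_left_diff_distrib sum_subtractf coord_sum[OF B(2,3)])
      moreover have "norm ((r b - coord B b x) *\<^sub>R b) \<le> (e / s) * norm b" for b
        unfolding norm_scaleR real_norm_def
        by (intro mult_right_mono less_imp_le[OF r(2)]) auto
      ultimately have "norm (q - x) \<le> (\<Sum>b\<in>B. (e / s) * norm b)"
        by (metis (no_types, lifting) sum_norm_le)
      also have "\<dots> = (e / s) * (s - 1)" by (simp add: s_def sum_distrib_left)
      also have "\<dots> < e" using s \<open>e > 0\<close> by (simp add: field_simps)
      finally show ?thesis by (simp add: dist_norm)
    qed
    ultimately show ?thesis by blast
  qed
  define \<B> where "\<B> = (\<lambda>(q, n). ball q (1 / Suc n)) ` (Q \<times> (UNIV :: nat set))"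
  have "countable \<B>" unfolding \<B>_def using Q by auto
  moreover have "topological_basis \<B>"
  proof (rule topological_basisI)
    show "open b" if "b \<in> \<B>" for b using that unfolding \<B>_def by auto
    show "\<exists>b\<in>\<B>. x \<in> b \<and> b \<subseteq> O'" if "open O'" "x \<in> O'" for O' x
    proof -
      obtain e where e: "e > 0" "ball x e \<subseteq> O'" using \<open>open O'\<close> \<open>x \<in> O'\<close> by (meson open_contains_ball)
      obtain n where n: "1 / Suc n < e / 2" using e(1) nat_approx_posE[of "e/2"] by auto
      obtain q where q: "q \<in> Q" "dist q x < 1 / Suc n" using dense[of "1 / Suc n" x] by auto
      have "ball q (1 / Suc n) \<subseteq> O'"
      proof
        fix y assume "y \<in> ball q (1 / Suc n)"
        then have "dist x y < 1 / Suc n + 1 / Suc n"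
          using q(2) dist_triangle[of x y q] by (simp add: dist_commute)
        then show "y \<in> O'" using n e(2) by (intro subsetD[OF e(2)]) simp
      qed
      moreover have "ball q (1 / Suc n) \<in> \<B>" using q(1) unfolding \<B>_def by force
      moreover have "x \<in> ball q (1 / Suc n)" using q(2) by simp
      ultimately show ?thesis by blast
    qed
  qed
  ultimately show "\<exists>B::'a set set. countable B \<and> open = generate_topology B"
    using topological_basis_imp_subbasis by blast
qed

text \<open>Compactness is transferred coordinate by coordinate: a bounded sequence has bounded
  coordinates, and convergence of all coordinates along one subsequence gives convergence in
  norm.\<close>

instance fin_dim_normed \<subseteq> heine_borel
proof
  fix f :: "nat \<Rightarrow> 'a" assume bnd: "bounded (range f)"
  obtain B :: "'a set" where B: "finite B" "independent B" "span B = UNIV"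
    using ex_finite_basis by blast
  have "\<forall>d\<subseteq>B. \<exists>l::'a. \<exists>r. strict_mono r \<and>
      (\<forall>e>0. eventually (\<lambda>n. \<forall>i\<in>d. dist (coord B i (f (r n))) (coord B i l) < e) sequentially)"
  proof (rule compact_lemma_general[where unproj = "\<lambda>c. \<Sum>b\<in>B. c b *\<^sub>R b"])
    show "bounded ((\<lambda>x. coord B k x) ` range f)" if "k \<in> B" for k
      using bounded_linear_image[OF bnd bounded_linear_coord[OF B(2,3)]] .
    show "(\<Sum>b\<in>B. coord B b x *\<^sub>R b) = x" for x by (rule coord_sum[OF B(2,3)])
  qed (use B in \<open>auto simp: coord_lincomb\<close>)
  then obtain l :: 'a and r where r: "strict_mono r"
    and l: "\<And>e. e > 0 \<Longrightarrow> eventually (\<lambda>n. \<forall>i\<in>B. dist (coord B i (f (r n))) (coord B i l) < e) sequentially"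
    by blast
  have "(\<lambda>n. coord B b (f (r n))) \<longlonglongrightarrow> coord B b l" if "b \<in> B" for b
    using that by (intro tendstoI eventually_mono[OF l]) auto
  then have "(\<lambda>n. \<Sum>b\<in>B. coord B b (f (r n)) *\<^sub>R b) \<longlonglongrightarrow> (\<Sum>b\<in>B. coord B b l *\<^sub>R b)"
    by (intro tendsto_intros) auto
  then have "(f \<circ> r) \<longlonglongrightarrow> l" by (simp add: coord_sum[OF B(2,3)] o_def)
  then show "\<exists>l r. strict_mono r \<and> (f \<circ> r) \<longlonglongrightarrow> l" using r by blast
qed

subsection \<open>Separately convex functions\<close>

text \<open>Coordinates outside \<open>I\<close> are frozen at the centre, so that for finite
  \<open>I\<close> the box is a finite dimensional cube even if the index type is larger.\<close>

definition coord_box :: "'i set \<Rightarrow> ('i \<Rightarrow> real) \<Rightarrow> real \<Rightarrow> ('i \<Rightarrow> real) set" where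
  "coord_box I y r = {z. (\<forall>i\<in>I. \<bar>z i - y i\<bar> \<le> r) \<and> (\<forall>i. i \<notin> I \<longrightarrow> z i = y i)}"

text \<open>The estimates for such functions are used twice: for a D-convex function in the
  coordinates of a basis contained in D, and for the negative of a homogeneous separately concave
  function near an interior point of its domain.\<close>

definition sep_convex_on :: "'i set \<Rightarrow> ('i \<Rightarrow> real) set \<Rightarrow> (('i \<Rightarrow> real) \<Rightarrow> real) \<Rightarrow> bool" where
  "sep_convex_on I S F \<longleftrightarrow>
     (\<forall>y. \<forall>i\<in>I. \<forall>a b. \<forall>t. 0 \<le> t \<and> t \<le> 1 \<and> y(i := a) \<in> S \<and> y(i := b) \<in> S \<longrightarrow>
        F (y(i := (1 - t) * a + t * b)) \<le> (1 - t) * F (y(i := a)) + t * F (y(i := b)))"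

lemma sep_convex_onD:
  assumes "sep_convex_on I S F" "i \<in> I" "0 \<le> t" "t \<le> 1" "y(i := a) \<in> S" "y(i := b) \<in> S"
  shows "F (y(i := (1 - t) * a + t * b)) \<le> (1 - t) * F (y(i := a)) + t * F (y(i := b))"
  using assms unfolding sep_convex_on_def by blast

lemma coord_box_upd:
  assumes "z \<in> coord_box I y r" "i \<in> I" "\<bar>s - y i\<bar> \<le> r"
  shows "z(i := s) \<in> coord_box I y r"
  using assms unfolding coord_box_def by auto

text \<open>Along one coordinate a convex function is at most the larger of its values at the two
  end faces, so the bound passes to the corners.\<close>

lemma sep_convex_bounded_above:
  assumes "finite J" "J \<subseteq> I" "r > 0" "sep_convex_on I (coord_box I y r) F"
  shows "\<exists>M. \<forall>z\<in>coord_box J y r. F z \<le> M"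
  using assms(1,2)
proof -
  \<comment> \<open>The induction needs a moving centre: \<open>w\<close> records the faces already
    chosen for the coordinates outside \<open>J\<close>, and must stay in the big box where
    \<open>F\<close> is convex.\<close>
  have "\<exists>M. \<forall>z\<in>coord_box J w r. F z \<le> M" if "w \<in> coord_box I y r" "\<forall>i\<in>J. w i = y i" for w
    using assms(1,2) that
  proof (induction J arbitrary: w rule: finite_induct)
    case empty
    have "coord_box {} w r = {w}" unfolding coord_box_def by auto
    then show ?case by auto
  next
    case (insert k J)
    have yk: "w k = y k" using insert.prems by auto
    have p: "w(k := y k + r) \<in> coord_box I y r" "w(k := y k - r) \<in> coord_box I y r"
      using insert.prems assms(3) by (auto intro!: coord_box_upd)
    have q: "\<forall>i\<in>J. (w(k := s)) i = y i" for s using insert.prems insert.hyps by auto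
    have JI: "J \<subseteq> I" using insert.prems by auto
    obtain M1 where M1: "\<And>z. z \<in> coord_box J (w(k := y k + r)) r \<Longrightarrow> F z \<le> M1"
      using insert.IH[OF JI p(1) q] by blast
    obtain M2 where M2: "\<And>z. z \<in> coord_box J (w(k := y k - r)) r \<Longrightarrow> F z \<le> M2"
      using insert.IH[OF JI p(2) q] by blast
    have "F z \<le> max M1 M2" if z: "z \<in> coord_box (insert k J) w r" for z
    proof -
      define t where "t = (z k - (y k - r)) / (2 * r)"
      have zk: "\<bar>z k - y k\<bar> \<le> r" using z yk by (auto simp: coord_box_def)
      then have t: "0 \<le> t" "t \<le> 1" unfolding t_def using assms(3) by (auto simp: field_simps)
      have e: "(1 - t) * (y k - r) + t * (y k + r) = z k"
        unfolding t_def using assms(3) by (simp add: field_simps)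
      have zb: "z(k := y k + s) \<in> coord_box J (w(k := y k + s)) r" for s
        using z insert.hyps unfolding coord_box_def by auto
      have zI: "z \<in> coord_box I y r"
        unfolding coord_box_def
      proof (safe)
        fix i assume "i \<in> I"
        show "\<bar>z i - y i\<bar> \<le> r"
        proof (cases "i \<in> insert k J")
          case True
          then show ?thesis using z insert.prems unfolding coord_box_def by auto
        next
          case False
          then have "z i = w i" using z unfolding coord_box_def by auto
          then show ?thesis using insert.prems \<open>i \<in> I\<close> unfolding coord_box_def by auto
        qed
      next
        fix i assume "i \<notin> I"
        then have "z i = w i" "w i = y i" using z insert.prems unfolding coord_box_def by auto
        then show "z i = y i" by simp
      qed
      have "F (z(k := (1 - t) * (y k - r) + t * (y k + r)))
          \<le> (1 - t) * F (z(k := y k - r)) + t * F (z(k := y k + r))"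
        using insert.prems assms(3) t
        by (intro sep_convex_onD[OF assms(4)] coord_box_upd[OF zI]) auto
      also have "\<dots> \<le> (1 - t) * max M1 M2 + t * max M1 M2"
        using M1[OF zb[of r]] M2[OF zb[of "-r", simplified]] t
        by (intro add_mono mult_left_mono) auto
      finally show ?thesis unfolding e by (simp add: algebra_simps)
    qed
    then show ?case by blast
  qed
  moreover have "y \<in> coord_box I y r" using assms(3) by (auto simp: coord_box_def)
  ultimately show ?thesis by auto
qed

text \<open>The value at \<open>y k\<close> is at most the mean of the values at \<open>z k\<close>
  and at its mirror image \<open>2 * y k - z k\<close>; the upper bound \<open>M\<close> at the
  mirror image thus turns a lower bound on the section through \<open>y k\<close> into one at
  \<open>z\<close>.\<close>

lemma sep_convex_bounded_below:
  assumes "finite J" "J \<subseteq> I" "r > 0" "sep_convex_on I (coord_box I y r) F"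
    and M: "\<And>z. z \<in> coord_box I y r \<Longrightarrow> F z \<le> M"
  shows "\<exists>m. \<forall>z\<in>coord_box J y r. m \<le> F z"
  using assms(1,2)
proof (induction J rule: finite_induct)
  case empty
  have "coord_box {} y r = {y}" unfolding coord_box_def by auto
  then show ?case by auto
next
  case (insert k J)
  then obtain m where m: "\<And>z. z \<in> coord_box J y r \<Longrightarrow> m \<le> F z" by auto
  have "2 * m - M \<le> F z" if z: "z \<in> coord_box (insert k J) y r" for z
  proof -
    have zI: "z \<in> coord_box I y r"
      using z insert.prems assms(3) unfolding coord_box_def by force
    have zk: "\<bar>z k - y k\<bar> \<le> r" using z by (auto simp: coord_box_def)
    have b: "z(k := z k) \<in> coord_box I y r" "z(k := 2 * y k - z k) \<in> coord_box I y r"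
      using zI zk insert.prems by (auto intro!: coord_box_upd simp: fun_upd_idem)
    have "F (z(k := (1 - 1/2) * z k + 1/2 * (2 * y k - z k)))
        \<le> (1 - 1/2) * F (z(k := z k)) + 1/2 * F (z(k := 2 * y k - z k))"
      using insert.prems b by (intro sep_convex_onD[OF assms(4)]) auto
    moreover have "z(k := (1 - 1/2) * z k + 1/2 * (2 * y k - z k)) = z(k := y k)"
      by (simp add: field_simps)
    moreover have "z(k := y k) \<in> coord_box J y r"
      using z insert.hyps unfolding coord_box_def by auto
    ultimately show ?thesis using m M[OF b(2)] by (fastforce simp: fun_upd_idem)
  qed
  then show ?case by blast
qed

text \<open>The segment from \<open>z k\<close> to \<open>s\<close> is prolonged by length
  \<open>r\<close> beyond \<open>s\<close>, which stays in the doubled box. Convexity compares the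
  slope up to \<open>s\<close> with the slope over the prolonged segment, where the increment is at
  most \<open>2 * K\<close> and the length at least \<open>r\<close>.\<close>

lemma sep_convex_slope:
  assumes "r > 0" "sep_convex_on I (coord_box I y (2 * r)) F" "k \<in> I"
    and K: "\<And>z. z \<in> coord_box I y (2 * r) \<Longrightarrow> \<bar>F z\<bar> \<le> K"
    and z: "z \<in> coord_box I y r" and s: "\<bar>s - y k\<bar> \<le> r"
  shows "F (z(k := s)) - F z \<le> 2 * K / r * \<bar>s - z k\<bar>"
proof (cases "s = z k")
  case False
  define d where "d = \<bar>s - z k\<bar>"
  define sg where "sg = sgn (s - z k)"
  define t where "t = d / (r + d)"
  have d: "d > 0" unfolding d_def using False by auto
  have sd: "s = z k + sg * d" unfolding d_def sg_def by (simp add: sgn_mult_abs)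
  have sg1: "\<bar>sg\<bar> = 1" unfolding sg_def using False by (simp add: abs_sgn_eq)
  have t: "0 \<le> t" "t \<le> 1" "t \<le> d / r"
    unfolding t_def using d assms(1) by (auto intro!: divide_left_mono simp: field_simps)
  have z2: "z \<in> coord_box I y (2 * r)" using z assms(1) unfolding coord_box_def by force
  have far: "\<bar>s + sg * r - y k\<bar> \<le> 2 * r"
    using s sg1 assms(1) by (auto simp: abs_if split: if_splits)
  have b: "z(k := z k) \<in> coord_box I y (2 * r)" "z(k := s + sg * r) \<in> coord_box I y (2 * r)"
    using z2 far assms(3) by (auto intro!: coord_box_upd simp: fun_upd_idem)
  have e: "(1 - t) * z k + t * (s + sg * r) = s"
  proof -
    have "t * (r + d) = d" unfolding t_def using d assms(1) by simp
    then have "t * (sg * (r + d)) = sg * d" by (simp add: mult.left_commute)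
    then show ?thesis unfolding sd by (simp add: algebra_simps)
  qed
  have "F (z(k := (1 - t) * z k + t * (s + sg * r))) \<le> (1 - t) * F (z(k := z k)) + t * F (z(k := s + sg * r))"
    by (rule sep_convex_onD[OF assms(2,3) t(1,2) b])
  then have "F (z(k := s)) - F z \<le> t * (F (z(k := s + sg * r)) - F z)"
    unfolding e by (simp add: algebra_simps)
  also have "\<dots> \<le> t * (2 * K)"
    using K[OF b(2)] K[OF z2] t(1) by (intro mult_left_mono) auto
  also have "\<dots> \<le> (d / r) * (2 * K)"
    using t(3) K[OF z2] by (intro mult_right_mono) auto
  finally show ?thesis by (simp add: d_def mult.commute)
qed simp

lemma sep_convex_Lipschitz:
  assumes fin: "finite I" and r: "r > 0" and conv: "sep_convex_on I (coord_box I y (2 * r)) F"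
    and K: "\<And>z. z \<in> coord_box I y (2 * r) \<Longrightarrow> \<bar>F z\<bar> \<le> K"
    and z: "z \<in> coord_box I y r" and w: "w \<in> coord_box I y r"
  shows "\<bar>F z - F w\<bar> \<le> 2 * K / r * (\<Sum>i\<in>I. \<bar>z i - w i\<bar>)"
proof -
  have K0: "0 \<le> K"
  proof -
    have "z \<in> coord_box I y (2 * r)" using z r unfolding coord_box_def by force
    from K[OF this] show ?thesis by simp
  qed
  have slope: "\<bar>F (u(k := s)) - F u\<bar> \<le> 2 * K / r * \<bar>s - u k\<bar>"
    if "k \<in> I" "u \<in> coord_box I y r" "\<bar>s - y k\<bar> \<le> r" for u k s
  proof -
    have "F (u(k := s)) - F u \<le> 2 * K / r * \<bar>s - u k\<bar>"
      by (rule sep_convex_slope[OF r conv that(1) K that(2,3)])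
    moreover have "F ((u(k := s))(k := u k)) - F (u(k := s)) \<le> 2 * K / r * \<bar>u k - (u(k := s)) k\<bar>"
      using that by (intro sep_convex_slope[OF r conv that(1) K] coord_box_upd)
        (auto simp: coord_box_def)
    ultimately show ?thesis by (simp add: abs_minus_commute)
  qed
  have "\<bar>F (\<lambda>i. if i \<in> J then z i else w i) - F w\<bar> \<le> 2 * K / r * (\<Sum>i\<in>J. \<bar>z i - w i\<bar>)"
    if "finite J" "J \<subseteq> I" for J
    using that
  proof (induction J rule: finite_induct)
    case (insert k J)
    let ?u = "\<lambda>i. if i \<in> J then z i else w i"
    have u: "?u \<in> coord_box I y r" using z w unfolding coord_box_def by auto
    have "(\<lambda>i. if i \<in> insert k J then z i else w i) = ?u(k := z k)" by auto
    moreover have "\<bar>F (?u(k := z k)) - F ?u\<bar> \<le> 2 * K / r * \<bar>z k - w k\<bar>"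
      using slope[OF _ u, of k "z k"] insert z by (auto simp: coord_box_def)
    moreover have "\<bar>F ?u - F w\<bar> \<le> 2 * K / r * (\<Sum>i\<in>J. \<bar>z i - w i\<bar>)"
      using insert by auto
    ultimately show ?case using insert.hyps by (simp add: algebra_simps)
  qed simp
  from this[OF fin order_refl] moreover have "(\<lambda>i. if i \<in> I then z i else w i) = z"
    using z w unfolding coord_box_def by auto
  ultimately show ?thesis by simp
qed

subsection \<open>Continuity of \<open>D\<close>-convex functions\<close>

lemma D_convexD:
  assumes "D_convex D f" "x - y \<in> D" "0 \<le> t" "t \<le> 1"
  shows "f ((1 - t) *\<^sub>R x + t *\<^sub>R y) \<le> (1 - t) * f x + t * f y"
  using assms unfolding D_convex_def by (auto dest!: convex_onD)

lemma D_convexI: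
  assumes "\<And>x d. d \<in> D \<Longrightarrow> convex_on UNIV (\<lambda>t. f (x + t *\<^sub>R d))"
  shows "D_convex D f"
  unfolding D_convex_def
proof (intro allI impI)
  fix x y assume d: "x - y \<in> D"
  show "convex_on (closed_segment x y) f"
  proof (rule convex_onI)
    fix t :: real and u v assume t: "0 < t" "t < 1"
      and u: "u \<in> closed_segment x y" and v: "v \<in> closed_segment x y"
    obtain a where a: "u = (1 - a) *\<^sub>R x + a *\<^sub>R y" using u unfolding closed_segment_def by auto
    obtain b where b: "v = (1 - b) *\<^sub>R x + b *\<^sub>R y" using v unfolding closed_segment_def by auto
    have ua: "u = y + (1 - a) *\<^sub>R (x - y)" and vb: "v = y + (1 - b) *\<^sub>R (x - y)"
      unfolding a b by (simp_all add: algebra_simps)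
    have "(1 - t) *\<^sub>R u + t *\<^sub>R v = y + ((1 - t) * (1 - a) + t * (1 - b)) *\<^sub>R (x - y)"
      unfolding a b by (simp add: algebra_simps)
    moreover have "f (y + ((1 - t) * (1 - a) + t * (1 - b)) *\<^sub>R (x - y))
        \<le> (1 - t) * f (y + (1 - a) *\<^sub>R (x - y)) + t * f (y + (1 - b) *\<^sub>R (x - y))"
      using convex_onD[OF assms[OF d, of y], of t "1 - a" "1 - b"] t by simp
    ultimately show "f ((1 - t) *\<^sub>R u + t *\<^sub>R v) \<le> (1 - t) * f u + t * f v"
      unfolding ua vb by simp
  qed simp
qed

lemma D_convex_line:
  assumes "D_convex D f" "cone_of_directions D" "d \<in> D"
  shows "convex_on UNIV (\<lambda>t. f (x + t *\<^sub>R d))"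
proof (rule convex_onI)
  fix t a b :: real assume t: "0 < t" "t < 1"
  have "(x + a *\<^sub>R d) - (x + b *\<^sub>R d) = (a - b) *\<^sub>R d" by (simp add: algebra_simps)
  then have "(x + a *\<^sub>R d) - (x + b *\<^sub>R d) \<in> D"
    using assms(2,3) unfolding cone_of_directions_def by auto
  from D_convexD[OF assms(1) this, of t] t
  show "f (x + ((1 - t) *\<^sub>R a + t *\<^sub>R b) *\<^sub>R d) \<le> (1 - t) * f (x + a *\<^sub>R d) + t * f (x + b *\<^sub>R d)"
    by (simp add: algebra_simps)
qed simp

lemma cone_basis:
  fixes D :: "'v::fin_dim_normed set"
  assumes "cone_of_directions D"
  shows "\<exists>C. C \<subseteq> D \<and> finite C \<and> independent C \<and> span C = UNIV"
proof -
  obtain C where C: "C \<subseteq> D" "independent C" "D \<subseteq> span C"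
    using maximal_independent_subset by blast
  moreover have "span C = UNIV"
    using assms C(3) unfolding cone_of_directions_def
    by (metis span_mono span_span top.extremum_uniqueI)
  ultimately show ?thesis using finite_independent by blast
qed

text \<open>In the coordinates of a basis contained in D every coordinate line has its direction in
  D, so \<open>f\<close> becomes separately convex.\<close>

lemma D_convex_Lipschitz_on_bounded:
  fixes f :: "'v::fin_dim_normed \<Rightarrow> real"
  assumes "cone_of_directions D" "D_convex D f" "bounded S"
  shows "\<exists>L>0. \<forall>x\<in>S. \<forall>y\<in>S. \<bar>f x - f y\<bar> \<le> L * norm (x - y)"
proof -
  obtain C where C: "C \<subseteq> D" "finite C" "independent C" "span C = UNIV"
    using cone_basis[OF assms(1)] by blast
  define F where "F = (\<lambda>z. f (\<Sum>b\<in>C. z b *\<^sub>R b))"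
  \<comment> \<open>\<open>coord_box\<close> with centre 0 requires the coordinates outside
    \<open>C\<close> to be exactly 0.\<close>
  define cs where "cs = (\<lambda>x. \<lambda>b. if b \<in> C then coord C b x else 0)"
  have Fcs: "F (cs x) = f x" for x
    unfolding F_def cs_def using coord_sum[OF C(3,4), of x] by simp
  have "\<exists>K>0. \<forall>x. norm (coord C b x) \<le> norm x * K" for b
    using bounded_linear.pos_bounded[OF bounded_linear_coord[OF C(3,4)]] .
  then obtain K where K: "\<And>b. K b > 0" "\<And>b x. \<bar>coord C b x\<bar> \<le> norm x * K b" by (metis real_norm_def)
  obtain R where R: "R > 0" "\<And>x. x \<in> S \<Longrightarrow> norm x \<le> R" using assms(3) bounded_pos by metis
  define r where "r = R * (1 + (\<Sum>b\<in>C. K b))"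
  have r: "r > 0" unfolding r_def using R K(1) by (simp add: add_pos_nonneg less_imp_le sum_nonneg)
  have box: "cs x \<in> coord_box C (\<lambda>_. 0) r" if "x \<in> S" for x
  proof -
    have "\<bar>coord C b x\<bar> \<le> r" if "b \<in> C" for b
    proof -
      have "K b \<le> (\<Sum>b\<in>C. K b)" using C(2) that K(1) by (intro member_le_sum) (auto intro: less_imp_le)
      then have "norm x * K b \<le> R * (1 + (\<Sum>b\<in>C. K b))"
        using R(2)[OF \<open>x \<in> S\<close>] K(1)[of b] R(1) by (intro mult_mono) auto
      then show ?thesis using K(2)[of b x] unfolding r_def by linarith
    qed
    then show ?thesis unfolding coord_box_def cs_def by auto
  qed
  have sep: "sep_convex_on C T F" for T
    unfolding sep_convex_on_def
  proof (intro allI ballI impI, elim conjE)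
    fix y b s t \<theta> assume b: "b \<in> C" and \<theta>: "0 \<le> \<theta>" "\<theta> \<le> (1::real)"
    define x where "x = (\<Sum>i\<in>C - {b}. y i *\<^sub>R i)"
    have e: "F (y(b := s)) = f (x + s *\<^sub>R b)" for s
      unfolding F_def x_def using C(2) b by (simp add: sum.remove add.commute)
    show "F (y(b := (1 - \<theta>) * s + \<theta> * t)) \<le> (1 - \<theta>) * F (y(b := s)) + \<theta> * F (y(b := t))"
      unfolding e using convex_onD[OF D_convex_line[OF assms(2,1), of b x], of \<theta> s t] b C(1) \<theta> by auto
  qed
  obtain M where M: "\<And>z. z \<in> coord_box C (\<lambda>_. 0) (2 * r) \<Longrightarrow> F z \<le> M"
    using sep_convex_bounded_above[OF C(2) order_refl _ sep, of "2 * r" "\<lambda>_. 0"] r by auto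
  obtain m where m: "\<And>z. z \<in> coord_box C (\<lambda>_. 0) (2 * r) \<Longrightarrow> m \<le> F z"
    using sep_convex_bounded_below[OF C(2) order_refl _ sep, of "2 * r" "\<lambda>_. 0" M] M r by auto
  define A where "A = max \<bar>M\<bar> \<bar>m\<bar>"
  have A: "\<bar>F z\<bar> \<le> A" if "z \<in> coord_box C (\<lambda>_. 0) (2 * r)" for z
    using M[OF that] m[OF that] unfolding A_def by auto
  have "\<bar>f x - f y\<bar> \<le> (2 * A / r * (\<Sum>b\<in>C. K b) + 1) * norm (x - y)" if "x \<in> S" "y \<in> S" for x y
  proof -
    have "\<bar>f x - f y\<bar> \<le> 2 * A / r * (\<Sum>b\<in>C. \<bar>cs x b - cs y b\<bar>)"
      using sep_convex_Lipschitz[OF C(2) r sep A box[OF that(1)] box[OF that(2)]] by (simp add: Fcs)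
    also have "\<dots> \<le> 2 * A / r * (\<Sum>b\<in>C. norm (x - y) * K b)"
    proof (intro mult_left_mono sum_mono)
      fix b assume "b \<in> C"
      then have "cs x b - cs y b = coord C b (x - y)"
        using linear_diff[OF bounded_linear.linear[OF bounded_linear_coord[OF C(3,4)]]]
        by (simp add: cs_def)
      then show "\<bar>cs x b - cs y b\<bar> \<le> norm (x - y) * K b" using K(2) by simp
    qed (use r in \<open>simp add: A_def\<close>)
    also have "2 * A / r * (\<Sum>b\<in>C. norm (x - y) * K b) = (2 * A / r * (\<Sum>b\<in>C. K b)) * norm (x - y)"
      by (simp add: sum_distrib_left sum_distrib_right sum_divide_distrib mult_ac)
    finally show ?thesis by (simp add: distrib_right add_increasing2)
  qed
  moreover have "2 * A / r * (\<Sum>b\<in>C. K b) + 1 > 0"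
    using r K(1) by (intro add_nonneg_pos mult_nonneg_nonneg sum_nonneg) (auto simp: A_def intro: less_imp_le)
  ultimately show ?thesis by blast
qed

lemma D_convex_continuous:
  fixes f :: "'v::fin_dim_normed \<Rightarrow> real"
  assumes "cone_of_directions D" "D_convex D f"
  shows "continuous_on UNIV f"
proof -
  have "isCont f x" for x
  proof -
    obtain L where L: "\<And>y z. y \<in> ball x 1 \<Longrightarrow> z \<in> ball x 1 \<Longrightarrow> \<bar>f y - f z\<bar> \<le> L * norm (y - z)"
      using D_convex_Lipschitz_on_bounded[OF assms bounded_ball] by blast
    have ev: "\<forall>\<^sub>F y in at x. y \<in> ball x 1"
      using eventually_at_ball[of 1 x UNIV] by simp
    have lim: "((\<lambda>y. L * norm (y - x)) \<longlongrightarrow> L * norm (x - x)) (at x)" by (intro tendsto_intros)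
    have "\<forall>\<^sub>F y in at x. norm (f y - f x) \<le> L * norm (y - x)"
      using ev by eventually_elim (simp add: L)
    from Lim_null_comparison[OF this] lim have "((\<lambda>y. f y - f x) \<longlongrightarrow> 0) (at x)" by simp
    then show ?thesis unfolding isCont_def by (simp add: LIM_zero_iff)
  qed
  then show ?thesis by (simp add: continuous_on_eq_continuous_at)
qed

subsection \<open>Calculus of smooth functions\<close>

text \<open>The direction comes first so that higher derivatives are iterates, as in
  \<open>dd u (dd v f)\<close>. The value is meaningful only where \<open>f\<close> is
  differentiable.\<close>

definition dd :: "'v::real_normed_vector \<Rightarrow> ('v \<Rightarrow> real) \<Rightarrow> 'v \<Rightarrow> real" where
  "dd v f = (\<lambda>x. frechet_derivative f (at x) v)"

lemma class_C_Suc: "class_C (Suc k) f \<longleftrightarrow> (\<forall>x. f differentiable (at x)) \<and> (\<forall>v. class_C k (dd v f))"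
  by (auto simp: dd_def differentiable_on_def)

declare class_C.simps(2)[simp del]

lemma second_deriv_dd: "second_deriv f x u v = dd v (dd u f) x"
  by (simp add: second_deriv_def dd_def)

lemma dd_eqI: "(f has_derivative f') (at x) \<Longrightarrow> dd v f x = f' v"
  unfolding dd_def by (metis frechet_derivative_at)

lemma has_derivative_dd:
  assumes "f differentiable (at x)"
  shows "(f has_derivative (\<lambda>v. dd v f x)) (at x)"
  using assms frechet_derivative_works unfolding dd_def by blast

lemma bounded_linear_dd: "f differentiable (at x) \<Longrightarrow> bounded_linear (\<lambda>v. dd v f x)"
  using has_derivative_bounded_linear[OF has_derivative_dd] .

lemma class_C_mono: "class_C (Suc k) f \<Longrightarrow> class_C k f"
proof (induction k arbitrary: f)
  case 0
  then show ?case
    by (auto simp: class_C_Suc continuous_on_eq_continuous_at differentiable_imp_continuous_within)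
next
  case (Suc k)
  then show ?case by (subst class_C_Suc) (auto simp: class_C_Suc[of "Suc k"])
qed

lemma class_C_const [simp]: "class_C k (\<lambda>x. c)"
proof (induction k arbitrary: c)
  case (Suc k)
  have "dd v (\<lambda>x::'a. c) = (\<lambda>x. 0)" for v by (rule ext, rule dd_eqI) simp
  then show ?case using Suc by (simp add: class_C_Suc)
qed simp

lemma class_C_bounded_linear: "bounded_linear a \<Longrightarrow> class_C k a"
proof (cases k)
  case (Suc n)
  assume a: "bounded_linear a"
  then have h: "(a has_derivative a) (at x)" for x by (rule bounded_linear_imp_has_derivative)
  have "dd v a = (\<lambda>x. a v)" for v by (rule ext, rule dd_eqI[OF h])
  then show ?thesis using h Suc by (auto simp: class_C_Suc differentiable_def)
qed (simp add: linear_continuous_on)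

lemma dd_add: "f differentiable (at x) \<Longrightarrow> g differentiable (at x) \<Longrightarrow>
    dd v (\<lambda>x. f x + g x) x = dd v f x + dd v g x"
  by (rule dd_eqI) (intro derivative_intros has_derivative_dd)

lemma dd_mult: "f differentiable (at x) \<Longrightarrow> g differentiable (at x) \<Longrightarrow>
    dd v (\<lambda>x. f x * g x) x = f x * dd v g x + dd v f x * g x"
  by (rule dd_eqI) (intro derivative_intros has_derivative_dd)

lemma class_C_add: "class_C k f \<Longrightarrow> class_C k g \<Longrightarrow> class_C k (\<lambda>x. f x + g x)"
proof (induction k arbitrary: f g)
  case (Suc k)
  then have "dd v (\<lambda>x. f x + g x) = (\<lambda>x. dd v f x + dd v g x)" for v
    by (intro ext dd_add) (auto simp: class_C_Suc)
  moreover have "class_C k (\<lambda>x. dd v f x + dd v g x)" for v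
    by (rule Suc.IH) (use Suc.prems in \<open>auto simp: class_C_Suc\<close>)
  ultimately show ?case using Suc.prems by (simp add: class_C_Suc differentiable_add)
qed (simp add: continuous_on_add)

lemma class_C_mult: "class_C k f \<Longrightarrow> class_C k g \<Longrightarrow> class_C k (\<lambda>x. f x * g x)"
proof (induction k arbitrary: f g)
  case (Suc k)
  then have "dd v (\<lambda>x. f x * g x) = (\<lambda>x. f x * dd v g x + dd v f x * g x)" for v
    by (intro ext dd_mult) (auto simp: class_C_Suc)
  moreover have "class_C k (\<lambda>x. f x * dd v g x + dd v f x * g x)" for v
    using Suc.IH[OF class_C_mono[OF Suc.prems(1)], of "dd v g"]
      Suc.IH[OF _ class_C_mono[OF Suc.prems(2)], of "dd v f"] Suc.prems
    by (intro class_C_add) (simp_all only: class_C_Suc)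
  ultimately show ?case using Suc.prems by (simp add: class_C_Suc differentiable_mult)
qed (simp add: continuous_on_mult)

lemma has_derivative_real_dd:
  fixes g :: "real \<Rightarrow> real"
  assumes "g differentiable (at x)"
  shows "(g has_derivative (\<lambda>h. h * dd 1 g x)) (at x)"
proof -
  have "dd (h *\<^sub>R 1) g x = h *\<^sub>R dd 1 g x" for h
    by (rule linear_scale[OF bounded_linear.linear[OF bounded_linear_dd[OF assms]]])
  then have "(\<lambda>h. h * dd 1 g x) = (\<lambda>h. dd h g x)"
    unfolding real_scaleR_def mult_1_right by metis
  then show ?thesis using has_derivative_dd[OF assms] by metis
qed

lemma dd_real: "(g has_real_derivative g') (at x) \<Longrightarrow> dd h g x = h * g'"
  by (rule dd_eqI) (auto simp: has_field_derivative_def mult.commute[of _ g'] fun_eq_iff)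

lemma dd_compose:
  fixes g :: "real \<Rightarrow> real"
  assumes "g differentiable (at (f x))" "f differentiable (at x)"
  shows "dd v (\<lambda>x. g (f x)) x = dd 1 g (f x) * dd v f x"
    and "(\<lambda>x. g (f x)) differentiable (at x)"
proof -
  have *: "((\<lambda>x. g (f x)) has_derivative (\<lambda>v. dd v f x * dd 1 g (f x))) (at x)"
    using has_derivative_compose[OF has_derivative_dd[OF assms(2)] has_derivative_real_dd[OF assms(1)]] .
  show "dd v (\<lambda>x. g (f x)) x = dd 1 g (f x) * dd v f x" using dd_eqI[OF *] by simp
  show "(\<lambda>x. g (f x)) differentiable (at x)" using * differentiable_def by blast
qed

lemma class_C_compose:
  fixes g :: "real \<Rightarrow> real"
  shows "class_C k g \<Longrightarrow> class_C k f \<Longrightarrow> class_C k (\<lambda>x. g (f x))"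
proof (induction k arbitrary: f g)
  case 0
  then show ?case using continuous_on_compose2[of UNIV g UNIV f] by simp
next
  case (Suc k)
  have "dd v (\<lambda>x. g (f x)) = (\<lambda>x. dd 1 g (f x) * dd v f x)" for v
    by (rule ext, rule dd_compose) (use Suc.prems in \<open>simp_all only: class_C_Suc\<close>)
  moreover have "class_C k (\<lambda>x. dd 1 g (f x) * dd v f x)" for v
    using Suc.IH[OF _ class_C_mono[OF Suc.prems(2)], of "dd 1 g"] Suc.prems
    by (intro class_C_mult) (simp_all only: class_C_Suc)
  moreover have "(\<lambda>x. g (f x)) differentiable (at x)" for x
    by (rule dd_compose) (use Suc.prems in \<open>simp_all only: class_C_Suc\<close>)
  ultimately show ?case by (simp only: class_C_Suc) blast
qed

lemma class_C_local:
  assumes "\<And>x. \<exists>g U. open U \<and> x \<in> U \<and> class_C k g \<and> (\<forall>y\<in>U. f y = g y)"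
  shows "class_C k f"
  using assms
proof (induction k arbitrary: f)
  case 0
  have "isCont f x" for x
  proof -
    obtain g U where g: "open U" "x \<in> U" "class_C 0 g" "\<forall>y\<in>U. f y = g y" using 0 by metis
    have "\<forall>\<^sub>F y in nhds x. f y = g y" using g by (auto simp: eventually_nhds)
    then have "isCont f x = isCont g x" by (rule isCont_cong)
    then show ?thesis using g by (simp add: continuous_on_eq_continuous_at)
  qed
  then show ?case by (simp add: continuous_at_imp_continuous_on)
next
  case (Suc k)
  have *: "(f has_derivative (\<lambda>v. dd v g x)) (at x)"
    if g: "open U" "x \<in> U" "class_C (Suc k) g" "\<forall>y\<in>U. f y = g y" for x g U
  proof -
    have "(g has_derivative (\<lambda>v. dd v g x)) (at x)"
      using g(3) by (intro has_derivative_dd) (auto simp: class_C_Suc)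
    then show ?thesis using has_derivative_transform_within_open[OF _ g(1,2)] g(4) by metis
  qed
  have "class_C k (dd v f)" for v
  proof (rule Suc.IH)
    fix x
    obtain g U where g: "open U" "x \<in> U" "class_C (Suc k) g" "\<forall>y\<in>U. f y = g y" using Suc.prems by metis
    have "dd v f y = dd v g y" if "y \<in> U" for y
      by (rule dd_eqI[OF *[OF g(1) that g(3,4)]])
    then show "\<exists>g U. open U \<and> x \<in> U \<and> class_C k g \<and> (\<forall>y\<in>U. dd v f y = g y)"
      using g by (intro exI[of _ "dd v g"] exI[of _ U]) (auto simp: class_C_Suc)
  qed
  moreover have "f differentiable (at x)" for x
    using Suc.prems[of x] * differentiable_def by blast
  ultimately show ?case by (simp add: class_C_Suc)
qed

lemma smooth_const [simp]: "smooth (\<lambda>x. c)"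
  and smooth_bounded_linear: "bounded_linear a \<Longrightarrow> smooth a"
  and smooth_add: "smooth f \<Longrightarrow> smooth g \<Longrightarrow> smooth (\<lambda>x. f x + g x)"
  and smooth_mult: "smooth f \<Longrightarrow> smooth g \<Longrightarrow> smooth (\<lambda>x. f x * g x)"
  and smooth_compose: "smooth h \<Longrightarrow> smooth f \<Longrightarrow> smooth (\<lambda>x. h (f x))" for h :: "real \<Rightarrow> real"
  by (auto simp: smooth_def class_C_bounded_linear class_C_add class_C_mult class_C_compose)

lemma smooth_local:
  assumes "\<And>x. \<exists>g U. open U \<and> x \<in> U \<and> smooth g \<and> (\<forall>y\<in>U. f y = g y)"
  shows "smooth f"
  unfolding smooth_def by (intro allI class_C_local) (use assms smooth_def in metis)

lemma smooth_dd: "smooth f \<Longrightarrow> smooth (dd v f)"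
  unfolding smooth_def using class_C_Suc by blast

lemma smooth_differentiable: "smooth f \<Longrightarrow> f differentiable (at x)"
  unfolding smooth_def using class_C_Suc by blast

lemma smooth_continuous_on: "smooth f \<Longrightarrow> continuous_on S f"
  unfolding smooth_def using class_C.simps(1) continuous_on_subset by blast

lemma smooth_real_derivI:
  fixes f :: "real \<Rightarrow> real"
  assumes "\<And>x. (f has_real_derivative f' x) (at x)" "smooth f'"
  shows "smooth f"
proof -
  have "class_C (Suc k) f" for k
  proof -
    have "dd h f = (\<lambda>x. h * f' x)" for h by (rule ext, rule dd_real[OF assms(1)])
    then show ?thesis
      using assms by (auto simp: class_C_Suc smooth_def real_differentiable_def intro!: class_C_mult
          intro: field_differentiable_imp_differentiable)
  qed
  then show ?thesis unfolding smooth_def using class_C_mono by blast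
qed

lemma smooth_sum: "(\<And>i. i \<in> I \<Longrightarrow> smooth (f i)) \<Longrightarrow> smooth (\<lambda>x. \<Sum>i\<in>I. f i x)"
  by (induction I rule: infinite_finite_induct) (auto intro: smooth_add)

lemma smooth_cmult: "smooth f \<Longrightarrow> smooth (\<lambda>x. c * f x)"
  by (intro smooth_mult) auto

lemma smooth_minus: "smooth f \<Longrightarrow> smooth (\<lambda>x. - f x)"
  using smooth_cmult[of f "-1"] by simp

lemma smooth_diff: "smooth f \<Longrightarrow> smooth g \<Longrightarrow> smooth (\<lambda>x. f x - g x)"
  using smooth_add[OF _ smooth_minus, of f g] by simp

lemma smooth_ident_real: "smooth (\<lambda>x::real. x)"
  by (rule smooth_bounded_linear) (rule bounded_linear_ident)

lemma dd_linear_arg: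
  assumes "f differentiable (at x)"
  shows "dd (u + v) f x = dd u f x + dd v f x" "dd (c *\<^sub>R v) f x = c * dd v f x"
  using linear_add[OF bounded_linear.linear[OF bounded_linear_dd[OF assms]], of u v]
    linear_scale[OF bounded_linear.linear[OF bounded_linear_dd[OF assms]], of c v] by simp_all

lemma DERIV_dd_line:
  assumes "f differentiable (at (x + t *\<^sub>R v))"
  shows "((\<lambda>t. f (x + t *\<^sub>R v)) has_real_derivative dd v f (x + t *\<^sub>R v)) (at t)"
proof -
  have "((\<lambda>t. x + t *\<^sub>R v) has_derivative (\<lambda>h. h *\<^sub>R v)) (at t)"
    by (auto intro!: derivative_eq_intros)
  from has_derivative_compose[OF this has_derivative_dd[OF assms]]
  show ?thesis by (simp add: has_field_derivative_def dd_linear_arg[OF assms] mult.commute[of _ "dd v f _"])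
qed

text \<open>Both iterated derivatives are the limit of
  \<open>(f (x + su + tv) - f (x + su) - f (x + tv) + f x) / (s t)\<close>, which by the mean value theorem
  is a value of each of them near \<open>x\<close>.\<close>

lemma dd_commute:
  assumes "smooth f"
  shows "dd u (dd v f) x = dd v (dd u f) x"
proof -
  define S where "S = (\<lambda>t. f (x + t *\<^sub>R u + t *\<^sub>R v) - f (x + t *\<^sub>R u) - f (x + t *\<^sub>R v) + f x)"
  have diff: "f differentiable (at y)" "dd w f differentiable (at y)" for y w
    using assms smooth_dd smooth_differentiable by blast+
  have mv: "\<exists>y. norm (y - x) \<le> t * (norm u + norm v) \<and> S t = t * t * dd a (dd b f) y"
    if t: "t > 0" and ab: "(a = u \<and> b = v) \<or> (a = v \<and> b = u)" for t a b
  proof -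
    define g where "g = (\<lambda>s. f (x + t *\<^sub>R a + s *\<^sub>R b) - f (x + s *\<^sub>R b))"
    have "(g has_real_derivative (dd b f (x + t *\<^sub>R a + s *\<^sub>R b) - dd b f (x + s *\<^sub>R b))) (at s)" for s
      unfolding g_def by (intro DERIV_diff DERIV_dd_line diff)
    from MVT2[OF t, of g, OF this] obtain s where s: "0 < s" "s < t"
      "g t - g 0 = t * (dd b f (x + t *\<^sub>R a + s *\<^sub>R b) - dd b f (x + s *\<^sub>R b))" by auto
    have "((\<lambda>r. dd b f ((x + s *\<^sub>R b) + r *\<^sub>R a)) has_real_derivative
        dd a (dd b f) ((x + s *\<^sub>R b) + r *\<^sub>R a)) (at r)" for r
      by (intro DERIV_dd_line diff)
    from MVT2[OF t, of "\<lambda>r. dd b f ((x + s *\<^sub>R b) + r *\<^sub>R a)", OF this] obtain r where r: "0 < r" "r < t"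
      "dd b f ((x + s *\<^sub>R b) + t *\<^sub>R a) - dd b f (x + s *\<^sub>R b) = t * dd a (dd b f) ((x + s *\<^sub>R b) + r *\<^sub>R a)"
      by auto
    have "S t = g t - g 0" unfolding S_def g_def using ab by (auto simp: algebra_simps)
    also have "\<dots> = t * t * dd a (dd b f) ((x + s *\<^sub>R b) + r *\<^sub>R a)"
      unfolding s(3) using r(3) by (simp add: algebra_simps)
    finally have "S t = t * t * dd a (dd b f) ((x + s *\<^sub>R b) + r *\<^sub>R a)" .
    moreover have "norm (((x + s *\<^sub>R b) + r *\<^sub>R a) - x) \<le> t * (norm u + norm v)"
    proof -
      have "norm (((x + s *\<^sub>R b) + r *\<^sub>R a) - x) \<le> norm (s *\<^sub>R b) + norm (r *\<^sub>R a)"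
        using norm_triangle_ineq[of "s *\<^sub>R b" "r *\<^sub>R a"] by simp
      also have "\<dots> \<le> t * norm b + t * norm a"
        using s r by (auto intro!: add_mono mult_right_mono)
      finally show ?thesis using ab by (auto simp: algebra_simps)
    qed
    ultimately show ?thesis by blast
  qed
  have lim: "(\<lambda>n. S (1 / Suc n) / ((1 / Suc n) * (1 / Suc n))) \<longlonglongrightarrow> dd a (dd b f) x"
    if ab: "(a = u \<and> b = v) \<or> (a = v \<and> b = u)" for a b
  proof -
    have "\<exists>y. norm (y - x) \<le> 1 / Suc n * (norm u + norm v) \<and> S (1 / Suc n) = 1 / Suc n * (1 / Suc n) * dd a (dd b f) y" for n
      using mv[OF _ ab, of "1 / Suc n"] by simp
    then obtain y where y: "\<And>n. norm (y n - x) \<le> 1 / Suc n * (norm u + norm v)"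
      "\<And>n. S (1 / Suc n) = 1 / Suc n * (1 / Suc n) * dd a (dd b f) (y n)" by metis
    have "(\<lambda>n. 1 / real (Suc n)) \<longlonglongrightarrow> 0"
      using LIMSEQ_inverse_real_of_nat by (simp add: inverse_eq_divide)
    then have "(\<lambda>n. 1 / Suc n * (norm u + norm v)) \<longlonglongrightarrow> 0 * (norm u + norm v)"
      by (intro tendsto_mult tendsto_const)
    then have "(\<lambda>n. y n - x) \<longlonglongrightarrow> 0"
      by (intro Lim_null_comparison[OF always_eventually[OF allI[OF y(1)]]]) simp
    then have "y \<longlonglongrightarrow> x" using LIM_zero_cancel by blast
    moreover have "isCont (dd a (dd b f)) x"
      using smooth_continuous_on[OF smooth_dd[OF smooth_dd[OF assms]], of UNIV]
      by (simp add: continuous_on_eq_continuous_at)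
    ultimately have "(\<lambda>n. dd a (dd b f) (y n)) \<longlonglongrightarrow> dd a (dd b f) x"
      using isCont_tendsto_compose by blast
    then show ?thesis using y(2) by simp
  qed
  show ?thesis using LIMSEQ_unique[OF lim lim] by blast
qed

lemma mvt_line:
  assumes "\<And>y. f differentiable (at y)" "\<And>y. \<bar>dd v f y\<bar> \<le> C"
  shows "\<bar>f (x + v) - f x\<bar> \<le> C"
proof -
  have "((\<lambda>t. f (x + t *\<^sub>R v)) has_real_derivative dd v f (x + t *\<^sub>R v)) (at t)" for t
    by (intro DERIV_dd_line assms)
  from MVT2[OF zero_less_one, of "\<lambda>t. f (x + t *\<^sub>R v)", OF this] obtain t where
    "f (x + v) - f x = dd v f (x + t *\<^sub>R v)" by auto
  then show ?thesis using assms(2) by simp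
qed

lemma D_convex_of_Hessian:
  assumes "smooth f" "\<And>x d. d \<in> D \<Longrightarrow> 0 \<le> dd d (dd d f) x"
  shows "D_convex D f"
proof (rule D_convexI)
  fix x d assume d: "d \<in> D"
  have 1: "((\<lambda>t. f (x + t *\<^sub>R d)) has_real_derivative dd d f (x + t *\<^sub>R d)) (at t)" for t
    by (intro DERIV_dd_line smooth_differentiable assms)
  have 2: "((\<lambda>t. dd d f (x + t *\<^sub>R d)) has_real_derivative dd d (dd d f) (x + t *\<^sub>R d)) (at t)" for t
    by (intro DERIV_dd_line smooth_differentiable smooth_dd assms)
  show "convex_on UNIV (\<lambda>t. f (x + t *\<^sub>R d))"
    by (rule f''_ge0_imp_convex[OF convex_UNIV 1 2]) (use assms d in auto)
qed

subsection \<open>A smooth step function\<close>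

text \<open>Products of a polynomial in 1/x with exp (-1/x) form a class closed under
  differentiation, so that a single derivative formula gives all orders by induction.\<close>

definition exp_recip :: "real poly \<Rightarrow> real \<Rightarrow> real" where
  "exp_recip p x = (if x > 0 then poly p (1 / x) * exp (- (1 / x)) else 0)"

lemma exp_recip_tendsto_0: "((\<lambda>x. poly p (1 / x) * exp (- (1 / x))) \<longlongrightarrow> (0::real)) (at_right 0)"
proof -
  have "((\<lambda>y. \<Sum>i\<le>degree p. coeff p i * (y ^ i / exp y)) \<longlongrightarrow> (\<Sum>i\<le>degree p. coeff p i * 0)) at_top"
    by (intro tendsto_intros tendsto_power_div_exp_0)
  moreover have "(\<lambda>y. \<Sum>i\<le>degree p. coeff p i * (y ^ i / exp y)) = (\<lambda>y::real. poly p y * exp (- y))"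
    by (auto simp: poly_altdef sum_distrib_left exp_minus divide_inverse mult_ac)
  ultimately have "((\<lambda>y. poly p y * exp (- y)) \<longlongrightarrow> 0) at_top" by simp
  from filterlim_compose[OF this filterlim_inverse_at_top_right]
  show ?thesis by (simp add: inverse_eq_divide)
qed

text \<open>In the variable y = 1/x one has d/dx = - y^2 d/dy, which turns the factor p into y^2 (p
  - p') in front of exp (- y).\<close>

lemma DERIV_exp_recip:
  "(exp_recip p has_real_derivative exp_recip (monom 1 2 * (p - pderiv p)) x) (at x)"
proof (cases x "0::real" rule: linorder_cases)
  case less
  have "((\<lambda>x. 0) has_real_derivative 0) (at x)" by simp
  then have "(exp_recip p has_real_derivative 0) (at x)"
    by (rule has_field_derivative_transform_within_open[of _ _ _ "{..<0}"])
      (use less in \<open>auto simp: exp_recip_def\<close>)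
  then show ?thesis using less by (simp add: exp_recip_def)
next
  case greater
  have "((\<lambda>x. poly p (1 / x) * exp (- (1 / x))) has_real_derivative
      exp_recip (monom 1 2 * (p - pderiv p)) x) (at x)"
    using greater
    by (auto intro!: derivative_eq_intros simp: exp_recip_def poly_monom power2_eq_square field_simps)
  then show ?thesis
    by (rule has_field_derivative_transform_within_open[of _ _ _ "{0<..}"])
      (use greater in \<open>auto simp: exp_recip_def\<close>)
next
  case equal
  have "((\<lambda>h. (exp_recip p (0 + h) - exp_recip p 0) / h) \<longlongrightarrow> 0) (at 0)"
  proof (rule filterlim_split_at_real)
    have "\<forall>\<^sub>F h in at_left 0. (exp_recip p (0 + h) - exp_recip p 0) / h = 0"
      by (auto simp: eventually_at_filter exp_recip_def)
    then show "((\<lambda>h. (exp_recip p (0 + h) - exp_recip p 0) / h) \<longlongrightarrow> 0) (at_left 0)"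
      by (rule tendsto_eventually)
    \<comment> \<open>\<open>pCons 0 p\<close> is \<open>p\<close> times the variable; the extra
      factor 1/h is the denominator of the difference quotient.\<close>
    have "\<forall>\<^sub>F h in at_right 0. poly (pCons 0 p) (1 / h) * exp (- (1 / h)) = (exp_recip p (0 + h) - exp_recip p 0) / h"
      by (auto simp: eventually_at_filter exp_recip_def)
    then show "((\<lambda>h. (exp_recip p (0 + h) - exp_recip p 0) / h) \<longlongrightarrow> 0) (at_right 0)"
      by (rule Lim_transform_eventually[OF exp_recip_tendsto_0])
  qed
  then show ?thesis using equal by (simp add: DERIV_def exp_recip_def)
qed

lemma class_C_real_derivI:
  fixes f :: "real \<Rightarrow> real"
  assumes "\<And>x. (f has_real_derivative f' x) (at x)" "class_C k f'"
  shows "class_C (Suc k) f"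
proof -
  have "dd h f = (\<lambda>x. h * f' x)" for h by (rule ext, rule dd_real[OF assms(1)])
  then show ?thesis
    using assms by (auto simp: class_C_Suc intro!: class_C_mult
        intro: field_differentiable_imp_differentiable simp: real_differentiable_def)
qed

lemma smooth_exp_recip: "smooth (exp_recip p)"
proof -
  have "class_C k (exp_recip p)" for k
  proof (induction k arbitrary: p)
    case 0
    then show ?case using DERIV_isCont[OF DERIV_exp_recip] by (simp add: continuous_at_imp_continuous_on)
  next
    case (Suc k)
    show ?case by (rule class_C_real_derivI[OF DERIV_exp_recip Suc])
  qed
  then show ?thesis by (simp add: smooth_def)
qed

lemma ex_smooth_germ: "\<exists>g :: real \<Rightarrow> real. smooth g \<and> (\<forall>x. 0 \<le> g x) \<and> (\<forall>x. g x > 0 \<longleftrightarrow> x > 0)"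
proof (intro exI[of _ "exp_recip 1"] conjI allI)
  show "(exp_recip 1 x > 0) = (x > 0)" for x by (cases "x > 0") (simp_all add: exp_recip_def)
  show "0 \<le> exp_recip 1 x" for x by (simp add: exp_recip_def)
qed (rule smooth_exp_recip)

lemma ex_antiderivative:
  fixes f :: "real \<Rightarrow> real"
  assumes "continuous_on UNIV f"
  shows "\<exists>F. F a = 0 \<and> (\<forall>x. (F has_real_derivative f x) (at x))"
proof -
  have "\<exists>F. \<forall>x :: real. - \<infinity> < ereal x \<longrightarrow> ereal x < \<infinity> \<longrightarrow> (F has_vector_derivative f x) (at x)"
    using assms by (intro einterval_antiderivative) (auto simp: continuous_on_eq_continuous_at)
  then obtain F where F: "\<And>x. (F has_real_derivative f x) (at x)"
    by (auto simp: has_real_derivative_iff_has_vector_derivative)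
  have "((\<lambda>x. F x - F a) has_real_derivative f x) (at x)" for x
    using DERIV_diff[OF F[of x] DERIV_const[of "F a"]] by simp
  then show ?thesis by (intro exI[of _ "\<lambda>x. F x - F a"]) auto
qed

lemma DERIV_zero_const_on:
  fixes F :: "real \<Rightarrow> real"
  assumes "a \<le> b" "\<And>x. (F has_real_derivative f x) (at x)" "\<And>x. a < x \<Longrightarrow> x < b \<Longrightarrow> f x = 0"
  shows "F a = F b"
proof (cases "a = b")
  case False
  then have "a < b" using assms(1) by simp
  obtain z where "a < z" "z < b" "F b - F a = (b - a) * f z"
    using MVT2[OF \<open>a < b\<close>, of F f] assms(2) by blast
  then show ?thesis using assms(3) by simp
qed simp

text \<open>The step must be explicit outside its transition zone together with two antiderivatives,
  since differences of shifted copies are later continued periodically. The bump \<beta> is even,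
  hence \<open>S x + S (- x) = 1\<close>, and this symmetry removes the constant in
  \<open>S1 x = x\<close>; only \<open>S2\<close> keeps a constant, which cancels in
  differences.\<close>

lemma ex_step_unit:
  "\<exists>(S :: real \<Rightarrow> real) S1 S2 c.
     smooth S \<and> smooth S1 \<and> smooth S2 \<and> (\<forall>x. 0 \<le> S x \<and> S x \<le> 1) \<and> mono S \<and>
     (\<forall>x. (S1 has_real_derivative S x) (at x)) \<and> (\<forall>x. (S2 has_real_derivative S1 x) (at x)) \<and>
     (\<forall>x\<le>-1. S x = 0 \<and> S1 x = 0 \<and> S2 x = 0) \<and>
     (\<forall>x\<ge>1. S x = 1 \<and> S1 x = x \<and> S2 x = x\<^sup>2 / 2 + c)"
proof -
  obtain g :: "real \<Rightarrow> real" where g: "smooth g" "\<And>x. 0 \<le> g x" "\<And>x. g x > 0 \<longleftrightarrow> x > 0"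
    using ex_smooth_germ by blast
  define \<beta> where "\<beta> = (\<lambda>x. g (1 + x) * g (1 - x))"
  have \<beta>0: "0 \<le> \<beta> x" for x unfolding \<beta>_def using g(2) by simp
  have \<beta>out: "\<beta> x = 0" if "\<bar>x\<bar> \<ge> 1" for x
  proof -
    have "g (1 + x) = 0 \<or> g (1 - x) = 0"
      using that g(2)[of "1 + x"] g(3)[of "1 + x"] g(2)[of "1 - x"] g(3)[of "1 - x"] by linarith
    then show ?thesis by (auto simp: \<beta>_def)
  qed
  have \<beta>sm: "smooth \<beta>" unfolding \<beta>_def
    by (intro smooth_mult smooth_compose[OF g(1)] smooth_add smooth_diff smooth_const smooth_ident_real)
  obtain F where F: "F (-1) = 0" "\<And>x. (F has_real_derivative \<beta> x) (at x)"
    using ex_antiderivative[OF smooth_continuous_on[OF \<beta>sm]] by blast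
  have Fmono: "F x \<le> F y" if "x \<le> y" for x y
    by (rule DERIV_nonneg_imp_nondecreasing[OF that]) (use F(2) \<beta>0 in blast)
  have Fpos: "F 1 > 0"
  proof -
    have p: "\<beta> x > 0" if "-1 < x" "x < 1" for x
      unfolding \<beta>_def using that g(3) by (intro mult_pos_pos) auto
    have "F (-1) < F 1"
      by (rule DERIV_pos_imp_increasing_open)
        (use F p in \<open>auto intro!: continuous_at_imp_continuous_on DERIV_isCont\<close>)
    then show ?thesis using F(1) by simp
  qed
  define S where "S = (\<lambda>x. F x / F 1)"
  have dS: "(S has_real_derivative \<beta> x / F 1) (at x)" for x
    unfolding S_def by (rule DERIV_cdivide[OF F(2)])
  have S_lo: "S x = 0" if "x \<le> -1" for x
    using DERIV_zero_const_on[OF that F(2)] \<beta>out F(1) unfolding S_def by force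
  have S_hi: "S x = 1" if "x \<ge> 1" for x
    using DERIV_zero_const_on[OF that F(2)] \<beta>out Fpos unfolding S_def by force
  have Smono: "mono S" unfolding S_def mono_def using Fmono Fpos by (simp add: divide_right_mono)
  have S01: "0 \<le> S x \<and> S x \<le> 1" for x
    using monoD[OF Smono, of "min x (-1)" x] monoD[OF Smono, of x "max x 1"] S_lo[of "min x (-1)"] S_hi[of "max x 1"]
    by simp
  have Ssm: "smooth S"
    by (rule smooth_real_derivI[OF dS]) (use smooth_cmult[OF \<beta>sm, of "1 / F 1"] in simp)
  have Ssym: "S x + S (- x) = 1" for x
  proof -
    have "((\<lambda>x. S x + S (- x)) has_real_derivative 0) (at x)" for x
    proof -
      have "((\<lambda>x. S (- x)) has_real_derivative - (\<beta> (- x) / F 1)) (at x)"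
        using DERIV_chain2[OF dS[of "- x"] DERIV_minus[OF DERIV_ident]] by simp
      moreover have "\<beta> (- x) = \<beta> x" by (simp add: \<beta>_def mult.commute)
      ultimately show ?thesis using DERIV_add[OF dS[of x]] by fastforce
    qed
    then have "S x + S (- x) = S 1 + S (- 1)" by (intro DERIV_isconst_all) blast
    then show ?thesis using S_lo[of "-1"] S_hi[of 1] by simp
  qed
  obtain S1 where S1: "S1 (-1) = 0" "\<And>x. (S1 has_real_derivative S x) (at x)"
    using ex_antiderivative[OF smooth_continuous_on[OF Ssm]] by blast
  have S1_lo: "S1 x = 0" if "x \<le> -1" for x
    using DERIV_zero_const_on[OF that S1(2)] S_lo S1(1) by force
  have S1_hi: "S1 x = x" if "x \<ge> 1" for x
  proof -
    have "((\<lambda>x. S1 x - S1 (- x) - x) has_real_derivative 0) (at x)" for x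
    proof -
      have "((\<lambda>x. S1 (- x)) has_real_derivative - S (- x)) (at x)"
        using DERIV_chain2[OF S1(2)[of "- x"] DERIV_minus[OF DERIV_ident]] by simp
      from DERIV_diff[OF DERIV_diff[OF S1(2)[of x] this] DERIV_ident]
      show ?thesis using Ssym[of x] by (simp add: algebra_simps)
    qed
    then have "S1 x - S1 (- x) - x = S1 0 - S1 (- 0) - 0" by (intro DERIV_isconst_all) blast
    then show ?thesis using S1_lo[of "- x"] that by simp
  qed
  have S1sm: "smooth S1" by (rule smooth_real_derivI[OF S1(2) Ssm])
  obtain S2 where S2: "S2 (-1) = 0" "\<And>x. (S2 has_real_derivative S1 x) (at x)"
    using ex_antiderivative[OF smooth_continuous_on[OF S1sm]] by blast
  have S2_lo: "S2 x = 0" if "x \<le> -1" for x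
    using DERIV_zero_const_on[OF that S2(2)] S1_lo S2(1) by force
  have S2_hi: "S2 x = x\<^sup>2 / 2 + (S2 1 - 1 / 2)" if "x \<ge> 1" for x
  proof -
    have d: "((\<lambda>x. S2 x - x\<^sup>2 / 2) has_real_derivative S1 x - x) (at x)" for x
      using DERIV_diff[OF S2(2)[of x] DERIV_cdivide[OF DERIV_pow[of 2 x], of 2]] by simp
    have "S2 1 - 1\<^sup>2 / 2 = S2 x - x\<^sup>2 / 2"
      by (rule DERIV_zero_const_on[OF that d]) (simp add: S1_hi)
    then show ?thesis by simp
  qed
  have S2sm: "smooth S2" by (rule smooth_real_derivI[OF S2(2) S1sm])
  show ?thesis
    by (intro exI[of _ S] exI[of _ S1] exI[of _ S2] exI[of _ "S2 1 - 1/2"] conjI allI impI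
        Ssm S1sm S2sm S01[THEN conjunct1] S01[THEN conjunct2] Smono S1(2) S2(2)
        S_lo S1_lo S2_lo S_hi S1_hi S2_hi)
qed

lemma smooth_rescale:
  fixes f :: "real \<Rightarrow> real"
  shows "smooth f \<Longrightarrow> smooth (\<lambda>x. f (x / r))"
  using smooth_compose[OF _ smooth_cmult[OF smooth_ident_real, of "1 / r"], of f] by simp

lemma ex_step:
  fixes r :: real
  assumes "r > 0"
  shows "\<exists>(S :: real \<Rightarrow> real) S1 S2 c.
     smooth S \<and> smooth S1 \<and> smooth S2 \<and> (\<forall>x. 0 \<le> S x \<and> S x \<le> 1) \<and> mono S \<and>
     (\<forall>x. (S1 has_real_derivative S x) (at x)) \<and> (\<forall>x. (S2 has_real_derivative S1 x) (at x)) \<and>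
     (\<forall>x\<le>-r. S x = 0 \<and> S1 x = 0 \<and> S2 x = 0) \<and>
     (\<forall>x\<ge>r. S x = 1 \<and> S1 x = x \<and> S2 x = x\<^sup>2 / 2 + c)"
proof -
  obtain S :: "real \<Rightarrow> real" and S1 S2 c where S: "smooth S" "smooth S1" "smooth S2"
    "\<And>x. 0 \<le> S x \<and> S x \<le> 1" "mono S"
    "\<And>x. (S1 has_real_derivative S x) (at x)" "\<And>x. (S2 has_real_derivative S1 x) (at x)"
    "\<And>x. x \<le> -1 \<Longrightarrow> S x = 0 \<and> S1 x = 0 \<and> S2 x = 0"
    "\<And>x. x \<ge> 1 \<Longrightarrow> S x = 1 \<and> S1 x = x \<and> S2 x = x\<^sup>2 / 2 + c"
    using ex_step_unit by metis
  have lo: "x / r \<le> -1" if "x \<le> -r" for x using that assms by (simp add: divide_le_eq)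
  have hi: "x / r \<ge> 1" if "x \<ge> r" for x using that assms by simp
  have d: "((\<lambda>x. x / r) has_real_derivative 1 / r) (at x)" for x
    using DERIV_cdivide[OF DERIV_ident, of r] by simp
  have d1: "((\<lambda>x. r * S1 (x / r)) has_real_derivative S (x / r)) (at x)" for x
    using DERIV_cmult[OF DERIV_chain2[OF S(6) d], of r] assms by simp
  have d2: "((\<lambda>x. r\<^sup>2 * S2 (x / r)) has_real_derivative r * S1 (x / r)) (at x)" for x
    using DERIV_cmult[OF DERIV_chain2[OF S(7) d], of "r\<^sup>2"] assms by (simp add: power2_eq_square)
  have q: "r\<^sup>2 * ((x / r)\<^sup>2 / 2 + c) = x\<^sup>2 / 2 + r\<^sup>2 * c" for x
    using assms by (simp add: field_simps power2_eq_square)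
  have m: "mono (\<lambda>x. S (x / r))"
    using S(5) assms by (auto simp: mono_def divide_right_mono)
  show ?thesis
    by (rule exI[of _ "\<lambda>x. S (x / r)"], rule exI[of _ "\<lambda>x. r * S1 (x / r)"],
        rule exI[of _ "\<lambda>x. r\<^sup>2 * S2 (x / r)"], rule exI[of _ "r\<^sup>2 * c"])
      (use S(4) lo hi m d1 d2 S(8,9) q assms in
        \<open>auto intro!: smooth_cmult smooth_rescale S(1-3)\<close>)
qed

subsection \<open>Test functions\<close>

definition tsupp :: "('v::real_normed_vector \<Rightarrow> real) \<Rightarrow> 'v set" where
  "tsupp \<phi> = closure {x. \<phi> x \<noteq> 0}"

lemma tsupp_zero: "x \<notin> tsupp \<phi> \<Longrightarrow> \<phi> x = 0"
  using closure_subset[of "{x. \<phi> x \<noteq> 0}"] unfolding tsupp_def by auto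

lemma closed_tsupp [simp]: "closed (tsupp \<phi>)"
  by (simp add: tsupp_def)

lemma test_functionsD:
  assumes "\<phi> \<in> test_functions U"
  shows "smooth \<phi>" "compact (tsupp \<phi>)" "tsupp \<phi> \<subseteq> U"
    and "x \<notin> U \<Longrightarrow> \<phi> x = 0"
  using assms closure_subset[of "{x. \<phi> x \<noteq> 0}"] unfolding test_functions_def tsupp_def by auto

lemma test_functionsI:
  fixes \<phi> :: "'v::fin_dim_normed \<Rightarrow> real"
  assumes "smooth \<phi>" "compact K" "K \<subseteq> U" "\<And>x. x \<notin> K \<Longrightarrow> \<phi> x = 0"
  shows "\<phi> \<in> test_functions U"
proof -
  have "{x. \<phi> x \<noteq> 0} \<subseteq> K" using assms(4) by auto
  then have sub: "tsupp \<phi> \<subseteq> K"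
    unfolding tsupp_def using compact_imp_closed[OF assms(2)] by (rule closure_minimal)
  have "compact (K \<inter> tsupp \<phi>)" by (rule compact_Int_closed[OF assms(2) closed_tsupp])
  then have "compact (tsupp \<phi>)" using sub by (simp add: Int_absorb1)
  then show ?thesis using assms(1,3) sub unfolding test_functions_def tsupp_def by simp
qed

lemma test_functions_mono: "\<phi> \<in> test_functions U \<Longrightarrow> U \<subseteq> W \<Longrightarrow> \<phi> \<in> test_functions W"
  unfolding test_functions_def by auto

lemma test_functions_zero [simp]: "(\<lambda>x. 0) \<in> test_functions (U :: 'v::real_normed_vector set)"
  unfolding test_functions_def by auto

lemma test_functions_add:
  fixes \<phi> :: "'v::fin_dim_normed \<Rightarrow> real"
  assumes "\<phi> \<in> test_functions U" "\<psi> \<in> test_functions U"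
  shows "(\<lambda>x. \<phi> x + \<psi> x) \<in> test_functions U"
proof (rule test_functionsI)
  show "compact (tsupp \<phi> \<union> tsupp \<psi>)"
    using assms test_functionsD(2) compact_Un by blast
  show "\<phi> x + \<psi> x = 0" if "x \<notin> tsupp \<phi> \<union> tsupp \<psi>" for x
    using that tsupp_zero[of x \<phi>] tsupp_zero[of x \<psi>] by auto
  show "tsupp \<phi> \<union> tsupp \<psi> \<subseteq> U"
    using assms test_functionsD(3) by blast
qed (intro smooth_add test_functionsD(1)[OF assms(1)] test_functionsD(1)[OF assms(2)])

lemma test_functions_mult_right:
  fixes \<phi> :: "'v::fin_dim_normed \<Rightarrow> real"
  assumes "\<phi> \<in> test_functions U" "smooth g"
  shows "(\<lambda>x. \<phi> x * g x) \<in> test_functions U"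
proof (rule test_functionsI)
  show "\<phi> x * g x = 0" if "x \<notin> tsupp \<phi>" for x
    using that tsupp_zero[of x \<phi>] by auto
qed (rule smooth_mult assms(2) test_functionsD[OF assms(1)])+

lemma test_functions_cmult:
  fixes \<phi> :: "'v::fin_dim_normed \<Rightarrow> real"
  assumes "\<phi> \<in> test_functions U"
  shows "(\<lambda>x. c * \<phi> x) \<in> test_functions U"
  using test_functions_mult_right[OF assms, of "\<lambda>_. c"] by (simp add: mult.commute)

lemma dd_cong_open:
  assumes "open W" "x \<in> W" "\<And>y. y \<in> W \<Longrightarrow> f y = g y" "g differentiable (at x)"
  shows "dd v f x = dd v g x"
  by (rule dd_eqI[OF has_derivative_transform_within_open[OF has_derivative_dd[OF assms(4)] assms(1,2)]])
    (use assms(3) in auto)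

lemma dd_const [simp]: "dd v (\<lambda>x. c) = (\<lambda>x. 0)"
  by (rule ext, rule dd_eqI) simp

lemma dd_vanish:
  assumes "open W" "x \<in> W" "\<And>y. y \<in> W \<Longrightarrow> f y = c"
  shows "dd v f x = 0"
  using dd_cong_open[of W x f "\<lambda>_. c" v] assms by simp

lemma test_functions_dd:
  fixes \<phi> :: "'v::fin_dim_normed \<Rightarrow> real"
  assumes "\<phi> \<in> test_functions U"
  shows "dd v \<phi> \<in> test_functions U"
proof (rule test_functionsI)
  show "dd v \<phi> x = 0" if "x \<notin> tsupp \<phi>" for x
  proof (rule dd_vanish)
    show "open (- tsupp \<phi>)" by (simp add: open_Compl)
    show "x \<in> - tsupp \<phi>" using that by simp
    show "\<phi> y = 0" if "y \<in> - tsupp \<phi>" for y using that tsupp_zero by simp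
  qed
qed (rule smooth_dd test_functionsD[OF assms])+

lemma test_functions_bounded:
  fixes \<phi> :: "'v::fin_dim_normed \<Rightarrow> real"
  assumes "\<phi> \<in> test_functions U"
  shows "\<exists>C. \<forall>x. \<bar>\<phi> x\<bar> \<le> C"
proof -
  have "compact (\<phi> ` tsupp \<phi>)"
    using test_functionsD[OF assms] smooth_continuous_on by (intro compact_continuous_image) auto
  then have "bounded (\<phi> ` tsupp \<phi>)" by (rule compact_imp_bounded)
  then obtain C where "\<forall>y\<in>\<phi> ` tsupp \<phi>. norm y \<le> C" unfolding bounded_iff by blast
  then have C: "\<bar>\<phi> x\<bar> \<le> C" if "x \<in> tsupp \<phi>" for x using that by simp
  have "\<bar>\<phi> x\<bar> \<le> \<bar>C\<bar>" for x
    using C[of x] tsupp_zero[of x \<phi>] by fastforce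
  then show ?thesis by blast
qed

text \<open>Uniform boundedness in its finite dimensional form: bounds at the vectors of a basis
  suffice.\<close>

lemma linear_functional_family_bound:
  fixes l :: "'a \<Rightarrow> 'v::fin_dim_normed \<Rightarrow> real"
  assumes "\<And>x. linear (l x)" "\<And>v. \<exists>C. \<forall>x. \<bar>l x v\<bar> \<le> C"
  shows "\<exists>C\<ge>0. \<forall>x v. \<bar>l x v\<bar> \<le> C * norm v"
proof -
  obtain B :: "'v set" where B: "finite B" "independent B" "span B = UNIV"
    using ex_finite_basis by blast
  obtain C where C: "\<And>v x. \<bar>l x v\<bar> \<le> C v" using assms(2) by metis
  have "\<exists>K>0. \<forall>x. norm (coord B b x) \<le> norm x * K" for b
    using bounded_linear.pos_bounded[OF bounded_linear_coord[OF B(2,3)]] .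
  then obtain K where K: "\<And>b. K b > 0" "\<And>b x. \<bar>coord B b x\<bar> \<le> norm x * K b" by (metis real_norm_def)
  have C0: "0 \<le> C v" for v using C abs_ge_zero order_trans by metis
  have "\<bar>l x v\<bar> \<le> (\<Sum>b\<in>B. K b * C b) * norm v" for x v
  proof -
    have "l x v = l x (\<Sum>b\<in>B. coord B b v *\<^sub>R b)" by (simp add: coord_sum[OF B(2,3)])
    also have "\<dots> = (\<Sum>b\<in>B. coord B b v * l x b)"
      using assms(1) by (simp add: linear_sum linear_scale)
    also have "\<bar>\<dots>\<bar> \<le> (\<Sum>b\<in>B. \<bar>coord B b v * l x b\<bar>)" by (rule sum_abs)
    also have "\<dots> \<le> (\<Sum>b\<in>B. (norm v * K b) * C b)"
      unfolding abs_mult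
      by (intro sum_mono mult_mono K(2) C mult_nonneg_nonneg) (auto intro: less_imp_le K)
    also have "\<dots> = (\<Sum>b\<in>B. K b * C b) * norm v" by (simp add: sum_distrib_left mult_ac)
    finally show ?thesis .
  qed
  moreover have "(\<Sum>b\<in>B. K b * C b) \<ge> 0"
    by (intro sum_nonneg mult_nonneg_nonneg less_imp_le[OF K(1)] C0)
  ultimately show ?thesis by blast
qed

lemma linear_dd: "smooth f \<Longrightarrow> linear (\<lambda>v. dd v f x)"
  by (intro bounded_linear.linear bounded_linear_dd smooth_differentiable)

lemma test_functions_dd_bound:
  fixes \<phi> :: "'v::fin_dim_normed \<Rightarrow> real"
  assumes "\<phi> \<in> test_functions U"
  shows "\<exists>C\<ge>0. \<forall>x v. \<bar>dd v \<phi> x\<bar> \<le> C * norm v"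
  by (rule linear_functional_family_bound)
    (use linear_dd test_functionsD(1)[OF assms] test_functions_bounded[OF test_functions_dd[OF assms]] in auto)

lemma test_functions_dd2_bound:
  fixes \<phi> :: "'v::fin_dim_normed \<Rightarrow> real"
  assumes "\<phi> \<in> test_functions U"
  shows "\<exists>C\<ge>0. \<forall>x u v. \<bar>dd u (dd v \<phi>) x\<bar> \<le> C * norm u * norm v"
proof -
  have sm: "smooth \<phi>" using test_functionsD(1)[OF assms] .
  \<comment> \<open>The family is indexed by a base point and a first direction, normalized by
    \<open>sgn\<close> so that for fixed \<open>v\<close> it is bounded; symmetry of the second
    derivative makes it linear in \<open>v\<close>.\<close>
  have "\<exists>C\<ge>0. \<forall>p v. \<bar>(\<lambda>v. dd (sgn (snd p)) (dd v \<phi>) (fst p)) v\<bar> \<le> C * norm v"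
  proof (rule linear_functional_family_bound)
    show "linear (\<lambda>v. dd (sgn (snd p)) (dd v \<phi>) (fst p))" for p :: "'v \<times> 'v"
      unfolding dd_commute[OF sm, of "sgn (snd p)"] by (rule linear_dd[OF smooth_dd[OF sm]])
    show "\<exists>C. \<forall>p. \<bar>dd (sgn (snd p)) (dd v \<phi>) (fst p)\<bar> \<le> C" for v
    proof -
      obtain C where C: "C \<ge> 0" "\<And>x u. \<bar>dd u (dd v \<phi>) x\<bar> \<le> C * norm u"
        using test_functions_dd_bound[OF test_functions_dd[OF assms]] by blast
      have "\<bar>dd (sgn (snd p)) (dd v \<phi>) (fst p)\<bar> \<le> C" for p :: "'v \<times> 'v"
        using C(2)[of "sgn (snd p)" "fst p"] C(1) by (auto simp: norm_sgn split: if_splits)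
      then show ?thesis by blast
    qed
  qed
  then obtain C where C: "C \<ge> 0" "\<And>x u v. \<bar>dd (sgn u) (dd v \<phi>) x\<bar> \<le> C * norm v" by fastforce
  have "\<bar>dd u (dd v \<phi>) x\<bar> \<le> C * norm u * norm v" for x u v
  proof -
    have "dd u (dd v \<phi>) x = norm u * dd (sgn u) (dd v \<phi>) x"
      using dd_linear_arg(2)[OF smooth_differentiable[OF smooth_dd[OF sm]], of "norm u" "sgn u"]
      by (cases "u = 0") (auto simp: sgn_div_norm)
    then show ?thesis using mult_left_mono[OF C(2)[of u v x], of "norm u"] by (simp add: abs_mult mult_ac)
  qed
  then show ?thesis using C(1) by blast
qed

text \<open>The given norm need not be smooth away from 0, so the bump is a function of the squared
  coordinates. Division of \<open>r\<close> by \<open>s\<close> ensures that coordinates bounded by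
  \<rho> force the norm below \<open>r\<close>.\<close>

lemma smooth_bump_at:
  fixes x :: "'v::fin_dim_normed"
  assumes "r > 0"
  shows "\<exists>h. smooth h \<and> (\<forall>y. 0 \<le> h y) \<and> h x > 0 \<and> (\<forall>y. h y \<noteq> 0 \<longrightarrow> y \<in> cball x r)"
proof -
  obtain B :: "'v set" where B: "finite B" "independent B" "span B = UNIV"
    using ex_finite_basis by blast
  obtain g :: "real \<Rightarrow> real" where g: "smooth g" "\<And>x. 0 \<le> g x" "\<And>x. g x > 0 \<longleftrightarrow> x > 0"
    using ex_smooth_germ by blast
  define s where "s = (\<Sum>b\<in>B. norm b) + 1"
  have s: "s > 0" unfolding s_def by (simp add: sum_nonneg add_nonneg_pos)
  define \<rho> where "\<rho> = r / s"
  have \<rho>: "\<rho> > 0" unfolding \<rho>_def using assms s by simp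
  define h where "h = (\<lambda>y. g (\<rho>\<^sup>2 - (\<Sum>b\<in>B. (coord B b y - coord B b x) * (coord B b y - coord B b x))))"
  have "smooth h" unfolding h_def
    by (intro smooth_compose[OF g(1)] smooth_diff smooth_const smooth_sum smooth_mult
        smooth_bounded_linear bounded_linear_coord[OF B(2,3)])
  moreover have "h x > 0" unfolding h_def using g(3) \<rho> by simp
  moreover have "y \<in> cball x r" if "h y \<noteq> 0" for y
  proof -
    have lt: "(\<Sum>b\<in>B. (coord B b y - coord B b x) * (coord B b y - coord B b x)) < \<rho>\<^sup>2"
      using that g(2,3) unfolding h_def by (metis diff_gt_0_iff_gt less_eq_real_def)
    have cb: "\<bar>coord B b (y - x)\<bar> \<le> \<rho>" if "b \<in> B" for b
    proof -
      have eq: "coord B b (y - x) = coord B b y - coord B b x"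
        using linear_diff[OF bounded_linear.linear[OF bounded_linear_coord[OF B(2,3)]]] .
      have "(coord B b (y - x))\<^sup>2 \<le> (\<Sum>b\<in>B. (coord B b y - coord B b x) * (coord B b y - coord B b x))"
        unfolding eq power2_eq_square using B(1) that
        by (intro member_le_sum[of b B "\<lambda>b. (coord B b y - coord B b x) * (coord B b y - coord B b x)"]) auto
      then have "(coord B b (y - x))\<^sup>2 \<le> \<rho>\<^sup>2" using lt by simp
      then show ?thesis using \<rho> abs_le_square_iff[of "coord B b (y - x)" \<rho>] by simp
    qed
    have "norm (y - x) = norm (\<Sum>b\<in>B. coord B b (y - x) *\<^sub>R b)" by (simp add: coord_sum[OF B(2,3)])
    also have "\<dots> \<le> (\<Sum>b\<in>B. \<rho> * norm b)"
      by (intro sum_norm_le) (simp add: mult_right_mono cb)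
    also have "\<dots> = \<rho> * (s - 1)" by (simp add: s_def sum_distrib_left)
    also have "\<dots> \<le> r" using s assms by (simp add: \<rho>_def field_simps)
    finally show ?thesis by (simp add: dist_norm norm_minus_commute)
  qed
  moreover have "0 \<le> h y" for y unfolding h_def by (rule g(2))
  ultimately show ?thesis by blast
qed

text \<open>A finite sum of bumps is bounded below on \<open>K\<close> by some \<open>c\<close>;
  composing it with a step that rises between c/4 and 3c/4 gives the value 1 on a neighbourhood
  \<open>W\<close> of \<open>K\<close>. The neighbourhood matters: all derivatives of the cut-off
  vanish there.\<close>

lemma smooth_Urysohn:
  fixes K :: "'v::fin_dim_normed set"
  assumes "compact K" "open U" "K \<subseteq> U"
  shows "\<exists>\<eta>\<in>test_functions U. (\<forall>x. 0 \<le> \<eta> x \<and> \<eta> x \<le> 1) \<and> (\<exists>W. open W \<and> K \<subseteq> W \<and> (\<forall>x\<in>W. \<eta> x = 1))"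
proof -
  have "\<exists>r>0. cball x r \<subseteq> U" if "x \<in> K" for x
    using assms(2,3) that open_contains_cball by blast
  then obtain r where r: "\<And>x. x \<in> K \<Longrightarrow> r x > 0" "\<And>x. x \<in> K \<Longrightarrow> cball x (r x) \<subseteq> U" by metis
  have "\<exists>h. smooth h \<and> (\<forall>y. 0 \<le> h y) \<and> h x > 0 \<and> (\<forall>y. h y \<noteq> 0 \<longrightarrow> y \<in> cball x (r x))" if "x \<in> K" for x
    using smooth_bump_at[OF r(1)[OF that]] .
  then obtain h where h: "\<And>x. x \<in> K \<Longrightarrow> smooth (h x)" "\<And>x y. x \<in> K \<Longrightarrow> 0 \<le> h x y"
    "\<And>x. x \<in> K \<Longrightarrow> h x x > 0" "\<And>x y. x \<in> K \<Longrightarrow> h x y \<noteq> 0 \<Longrightarrow> y \<in> cball x (r x)" by metis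
  have op: "open {y. h x y > 0}" if "x \<in> K" for x
    using open_Collect_less[of "\<lambda>_. 0" "h x"] smooth_continuous_on[OF h(1)[OF that]] by simp
  obtain T where T: "T \<subseteq> K" "finite T" "K \<subseteq> (\<Union>x\<in>T. {y. h x y > 0})"
  proof (rule compactE_image[OF assms(1), of K "\<lambda>x. {y. h x y > 0}"])
    show "K \<subseteq> (\<Union>x\<in>K. {y. h x y > 0})" using h(3) by auto
  qed (use op in auto)
  define \<Psi> where "\<Psi> = (\<lambda>y. \<Sum>x\<in>T. h x y)"
  have \<Psi>sm: "smooth \<Psi>" unfolding \<Psi>_def using h(1) T(1) by (intro smooth_sum) auto
  have \<Psi>cont: "continuous_on S \<Psi>" for S by (rule smooth_continuous_on[OF \<Psi>sm])
  have \<Psi>pos: "\<Psi> y > 0" if "y \<in> K" for y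
  proof -
    have "y \<in> (\<Union>x\<in>T. {y. h x y > 0})" using T(3) that by blast
    then obtain x where "x \<in> T" "h x y > 0" by auto
    then show ?thesis unfolding \<Psi>_def using T h(2) by (intro sum_pos2[of T x]) auto
  qed
  have "\<exists>c>0. \<forall>y\<in>K. c \<le> \<Psi> y"
  proof (cases "K = {}")
    case False
    then obtain y0 where "y0 \<in> K" "\<forall>y\<in>K. \<Psi> y0 \<le> \<Psi> y"
      using continuous_attains_inf[OF assms(1) _ \<Psi>cont] by blast
    then show ?thesis using \<Psi>pos by blast
  qed (auto intro: exI[of _ 1])
  then obtain c where c: "c > 0" "\<And>y. y \<in> K \<Longrightarrow> c \<le> \<Psi> y" by blast
  obtain S :: "real \<Rightarrow> real" where S: "smooth S" "\<And>x. 0 \<le> S x \<and> S x \<le> 1"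
    "\<And>x. x \<le> - (c / 4) \<Longrightarrow> S x = 0" "\<And>x. x \<ge> c / 4 \<Longrightarrow> S x = 1"
    using ex_step[of "c / 4"] c(1) by auto
  define \<eta> where "\<eta> = (\<lambda>y. S (\<Psi> y - c / 2))"
  have "\<eta> \<in> test_functions U"
  proof (rule test_functionsI)
    show "smooth \<eta>" unfolding \<eta>_def by (intro smooth_compose[OF S(1)] smooth_diff \<Psi>sm smooth_const)
    show "compact (\<Union>x\<in>T. cball x (r x))" using T(2) by (intro compact_UN) auto
    show "(\<Union>x\<in>T. cball x (r x)) \<subseteq> U" using r(2) T(1) by blast
    show "\<eta> y = 0" if "y \<notin> (\<Union>x\<in>T. cball x (r x))" for y
    proof -
      have "\<Psi> y = 0" unfolding \<Psi>_def using that h(4) T(1) by (intro sum.neutral) blast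
      then show ?thesis unfolding \<eta>_def using S(3) c(1) by simp
    qed
  qed
  moreover have "open {y. 3 * c / 4 < \<Psi> y}" by (rule open_Collect_less[OF continuous_on_const \<Psi>cont])
  moreover have "K \<subseteq> {y. 3 * c / 4 < \<Psi> y}" using c by force
  moreover have "\<forall>y\<in>{y. 3 * c / 4 < \<Psi> y}. \<eta> y = 1" unfolding \<eta>_def using S(4) by auto
  moreover have "\<forall>x. 0 \<le> \<eta> x \<and> \<eta> x \<le> 1" unfolding \<eta>_def using S(2) by blast
  ultimately show ?thesis by blast
qed

subsection \<open>Lebesgue measure with respect to a basis\<close>

locale basis_space =
  fixes B :: "'v::fin_dim_normed set"
  assumes basis: "independent B" "span B = UNIV"
begin

abbreviation L :: "'v measure" where "L \<equiv> lebesgue_wrt B"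
abbreviation crd :: "'v \<Rightarrow> 'v \<Rightarrow> real" where "crd \<equiv> coord B"
abbreviation PL :: "('v \<Rightarrow> real) measure" where "PL \<equiv> Pi\<^sub>M B (\<lambda>_. lborel)"

lemma fin_B: "finite B"
  by (rule finite_independent[OF basis(1)])

sublocale PL: product_sigma_finite "\<lambda>_::'v. lborel :: real measure"
  by standard

lemma measurable_lincomb [measurable]: "(\<lambda>c. \<Sum>b\<in>B. c b *\<^sub>R b) \<in> PL \<rightarrow>\<^sub>M borel"
  by (intro borel_measurable_sum borel_measurable_scaleR borel_measurable_const) simp

lemma sets_L [simp, measurable_cong]: "sets L = sets borel"
  and space_L [simp]: "space L = UNIV"
  unfolding lebesgue_wrt_def by simp_all

lemma emeasure_L: "A \<in> sets borel \<Longrightarrow> emeasure L A = emeasure PL ((\<lambda>c. \<Sum>b\<in>B. c b *\<^sub>R b) -` A \<inter> space PL)"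
  unfolding lebesgue_wrt_def by (subst emeasure_distr) auto

lemma PL_translate: "distr PL PL (\<lambda>c. \<lambda>b\<in>B. c b + a b) = PL"
proof (rule PL.PiM_eqI[OF fin_B])
  fix A :: "'v \<Rightarrow> real set" assume A: "\<And>b. b \<in> B \<Longrightarrow> A b \<in> sets lborel"
  have m: "(\<lambda>c. \<lambda>b\<in>B. c b + a b) \<in> PL \<rightarrow>\<^sub>M PL" by measurable
  have sh: "(\<lambda>x. x + a b) -` A b \<in> sets lborel" if "b \<in> B" for b
    using measurable_sets[of "\<lambda>x. x + a b" borel borel "A b"] A[OF that] by simp
  have "(\<lambda>c. \<lambda>b\<in>B. c b + a b) -` Pi\<^sub>E B A \<inter> space PL = Pi\<^sub>E B (\<lambda>b. (\<lambda>x. x + a b) -` A b)"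
    by (auto simp: space_PiM PiE_iff)
  then have "emeasure (distr PL PL (\<lambda>c. \<lambda>b\<in>B. c b + a b)) (Pi\<^sub>E B A) = emeasure PL (Pi\<^sub>E B (\<lambda>b. (\<lambda>x. x + a b) -` A b))"
    using A fin_B by (subst emeasure_distr[OF m]) (auto intro!: sets_PiM_I_finite)
  also have "\<dots> = (\<Prod>b\<in>B. emeasure lborel ((\<lambda>x. x + a b) -` A b))"
    using sh fin_B by (subst PL.emeasure_PiM) auto
  also have "\<dots> = (\<Prod>b\<in>B. emeasure lborel (A b))"
  proof (rule prod.cong[OF refl])
    fix b assume b: "b \<in> B"
    have "emeasure lborel (A b) = emeasure (distr lborel borel ((+) (a b))) (A b)"
      by (simp add: lborel_distr_plus)
    also have "\<dots> = emeasure lborel ((+) (a b) -` A b)"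
      using A[OF b] by (subst emeasure_distr) auto
    also have "(+) (a b) -` A b = (\<lambda>x. x + a b) -` A b" by (auto simp: add.commute)
    finally show "emeasure lborel ((\<lambda>x. x + a b) -` A b) = emeasure lborel (A b)" by simp
  qed
  finally show "emeasure (distr PL PL (\<lambda>c. \<lambda>b\<in>B. c b + a b)) (Pi\<^sub>E B A) = (\<Prod>b\<in>B. emeasure lborel (A b))" .
qed simp

text \<open>Together with finiteness on bounded sets, translation invariance is what integration by
  parts rests on.\<close>

lemma L_translate: "distr L borel (\<lambda>x. x + v) = L"
proof -
  have m: "(\<lambda>c. \<lambda>b\<in>B. c b + crd b v) \<in> PL \<rightarrow>\<^sub>M PL" by measurable
  have eq: "(\<lambda>x. x + v) \<circ> (\<lambda>c. \<Sum>b\<in>B. c b *\<^sub>R b) = (\<lambda>c. \<Sum>b\<in>B. c b *\<^sub>R b) \<circ> (\<lambda>c. \<lambda>b\<in>B. c b + crd b v)"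
    by (auto simp: scaleR_left_distrib sum.distrib coord_sum[OF basis])
  have "distr L borel (\<lambda>x. x + v) = distr PL borel ((\<lambda>x. x + v) \<circ> (\<lambda>c. \<Sum>b\<in>B. c b *\<^sub>R b))"
    unfolding lebesgue_wrt_def by (subst distr_distr) auto
  also have "\<dots> = distr (distr PL PL (\<lambda>c. \<lambda>b\<in>B. c b + crd b v)) borel (\<lambda>c. \<Sum>b\<in>B. c b *\<^sub>R b)"
    unfolding eq by (subst distr_distr[OF _ m]) auto
  finally show ?thesis unfolding PL_translate lebesgue_wrt_def .
qed

lemma emeasure_L_bounded:
  assumes "bounded A"
  shows "emeasure L A < \<infinity>"
proof (cases "A \<in> sets borel")
  case True
  obtain R where R: "\<And>x. x \<in> A \<Longrightarrow> norm x \<le> R" using assms bounded_iff by blast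
  have "\<exists>K>0. \<forall>x. norm (crd b x) \<le> norm x * K" for b
    using bounded_linear.pos_bounded[OF bounded_linear_coord[OF basis]] .
  then obtain K where K: "\<And>b. K b > 0" "\<And>b x. \<bar>crd b x\<bar> \<le> norm x * K b" by (metis real_norm_def)
  have "(\<lambda>c. \<Sum>b\<in>B. c b *\<^sub>R b) -` A \<inter> space PL \<subseteq> Pi\<^sub>E B (\<lambda>b. {- (R * K b)..R * K b})"
  proof
    fix c assume "c \<in> (\<lambda>c. \<Sum>b\<in>B. c b *\<^sub>R b) -` A \<inter> space PL"
    then have c: "(\<Sum>b\<in>B. c b *\<^sub>R b) \<in> A" "c \<in> space PL" by auto
    have "\<bar>c b\<bar> \<le> R * K b" if "b \<in> B" for b
    proof -
      have "\<bar>c b\<bar> \<le> norm (\<Sum>b\<in>B. c b *\<^sub>R b) * K b"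
        using K(2)[of b "\<Sum>b\<in>B. c b *\<^sub>R b"] coord_lincomb[OF basis that] by simp
      also have "\<dots> \<le> R * K b" using R[OF c(1)] K(1)[of b] by (intro mult_right_mono) auto
      finally show ?thesis .
    qed
    then have "- (R * K b) \<le> c b" "c b \<le> R * K b" if "b \<in> B" for b
      using \<open>\<And>b. b \<in> B \<Longrightarrow> \<bar>c b\<bar> \<le> R * K b\<close>[OF that] by linarith+
    then show "c \<in> Pi\<^sub>E B (\<lambda>b. {- (R * K b)..R * K b})"
      using c(2) by (auto simp: space_PiM PiE_iff)
  qed
  then have "emeasure L A \<le> emeasure PL (Pi\<^sub>E B (\<lambda>b. {- (R * K b)..R * K b}))"
    unfolding emeasure_L[OF True] using fin_B by (intro emeasure_mono) (auto intro!: sets_PiM_I_finite)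
  also have "\<dots> = (\<Prod>b\<in>B. emeasure lborel {- (R * K b)..R * K b})"
    using fin_B by (subst PL.emeasure_PiM) auto
  also have "\<dots> < \<infinity>"
    using fin_B by (auto simp: less_top[symmetric] ennreal_prod_eq_top emeasure_lborel_Icc_eq)
  finally show ?thesis .
next
  case False
  then show ?thesis by (simp add: emeasure_notin_sets)
qed

lemma emeasure_L_open:
  assumes "open U" "U \<noteq> {}"
  shows "emeasure L U > 0"
proof -
  obtain x where "x \<in> U" using assms(2) by blast
  then obtain e where e: "e > 0" "ball x e \<subseteq> U" using assms(1) by (meson open_contains_ball)
  define s where "s = (\<Sum>b\<in>B. norm b) + 1"
  have s: "s > 0" unfolding s_def by (simp add: sum_nonneg add_nonneg_pos)
  define d where "d = e / (2 * s)"
  have d: "d > 0" unfolding d_def using e(1) s by simp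
  have "Pi\<^sub>E B (\<lambda>b. {crd b x - d..crd b x + d}) \<subseteq> (\<lambda>c. \<Sum>b\<in>B. c b *\<^sub>R b) -` U \<inter> space PL"
  proof
    fix c assume c: "c \<in> Pi\<^sub>E B (\<lambda>b. {crd b x - d..crd b x + d})"
    then have sp: "c \<in> space PL" by (auto simp: space_PiM PiE_iff)
    have "(\<Sum>b\<in>B. c b *\<^sub>R b) - x = (\<Sum>b\<in>B. (c b - crd b x) *\<^sub>R b)"
      by (simp add: scaleR_left_diff_distrib sum_subtractf coord_sum[OF basis])
    moreover have "norm ((c b - crd b x) *\<^sub>R b) \<le> d * norm b" if "b \<in> B" for b
      using c that by (auto simp: PiE_iff abs_le_iff intro!: mult_right_mono)
    ultimately have "norm ((\<Sum>b\<in>B. c b *\<^sub>R b) - x) \<le> (\<Sum>b\<in>B. d * norm b)"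
      by (metis (no_types, lifting) sum_norm_le)
    also have "\<dots> = d * (s - 1)" by (simp add: s_def sum_distrib_left)
    also have "\<dots> < e" using s e(1) by (simp add: d_def field_simps add_pos_pos)
    finally have "(\<Sum>b\<in>B. c b *\<^sub>R b) \<in> ball x e" by (simp add: dist_norm norm_minus_commute)
    then show "c \<in> (\<lambda>c. \<Sum>b\<in>B. c b *\<^sub>R b) -` U \<inter> space PL" using e(2) sp by blast
  qed
  then have le: "emeasure PL (Pi\<^sub>E B (\<lambda>b. {crd b x - d..crd b x + d})) \<le> emeasure L U"
    unfolding emeasure_L[OF borel_open[OF assms(1)]]
    by (rule emeasure_mono[OF _ measurable_sets[OF measurable_lincomb borel_open[OF assms(1)]]])
  have "emeasure PL (Pi\<^sub>E B (\<lambda>b. {crd b x - d..crd b x + d})) = (\<Prod>b\<in>B. emeasure lborel {crd b x - d..crd b x + d})"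
    using fin_B by (subst PL.emeasure_PiM) auto
  also have "\<dots> = (\<Prod>b\<in>B. ennreal (2 * d))"
  proof (rule prod.cong[OF refl])
    fix b
    have "crd b x + d - (crd b x - d) = 2 * d" by simp
    then show "emeasure lborel {crd b x - d..crd b x + d} = ennreal (2 * d)"
      using emeasure_lborel_Icc[of "crd b x - d" "crd b x + d"] d by simp
  qed
  finally have "ennreal (2 * d) ^ card B \<le> emeasure L U" using le by (simp only: prod_constant)
  moreover have "ennreal (2 * d) \<noteq> 0" using d by simp
  then have "ennreal (2 * d) ^ card B \<noteq> 0" by (rule power_not_zero)
  then have "0 < ennreal (2 * d) ^ card B" by (rule zero_less_iff_neq_zero[THEN iffD2])
  ultimately show ?thesis by (metis order_less_le_trans)
qed

sublocale L: sigma_finite_measure L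
proof
  show "\<exists>A. countable A \<and> A \<subseteq> sets L \<and> \<Union> A = space L \<and> (\<forall>a\<in>A. emeasure L a \<noteq> \<infinity>)"
  proof (intro exI conjI)
    show "countable (range (\<lambda>n::nat. cball (0::'v) (real n)))" by simp
    show "\<Union> (range (\<lambda>n::nat. cball (0::'v) (real n))) = space L"
      using real_arch_simple by auto
    show "\<forall>a\<in>range (\<lambda>n::nat. cball (0::'v) (real n)). emeasure L a \<noteq> \<infinity>"
      using emeasure_L_bounded[OF bounded_cball] by (auto simp: less_top)
  qed auto
qed

lemma integrable_compact_support:
  fixes f :: "'v \<Rightarrow> real"
  assumes [measurable]: "f \<in> borel_measurable borel" and "bounded K" "\<And>x. x \<notin> K \<Longrightarrow> f x = 0"
    and "\<And>x. \<bar>f x\<bar> \<le> C"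
  shows "integrable L f"
proof -
  obtain R where "\<forall>x\<in>K. norm x \<le> R" using assms(2) unfolding bounded_iff by blast
  then have R: "K \<subseteq> cball 0 R" by auto
  show ?thesis
  proof (rule integrableI_bounded_set)
    show "emeasure L (cball 0 R) < \<infinity>" by (rule emeasure_L_bounded[OF bounded_cball])
    show "AE x in L. x \<notin> cball 0 R \<longrightarrow> f x = 0"
      using R assms(3) by (intro AE_I2) blast
    show "AE x in L. x \<in> cball 0 R \<longrightarrow> norm (f x) \<le> C"
      using assms(4) by (intro AE_I2) auto
  qed auto
qed

lemma integrable_cont_test:
  assumes "continuous_on UNIV f" "\<psi> \<in> test_functions U"
  shows "integrable L (\<lambda>x. f x * \<psi> x)"
proof -
  let ?K = "tsupp \<psi>"
  have K: "compact ?K" using test_functionsD(2)[OF assms(2)] .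
  have cont: "continuous_on UNIV (\<lambda>x. f x * \<psi> x)"
    using assms smooth_continuous_on test_functionsD(1) by (intro continuous_intros) auto
  have "compact ((\<lambda>x. f x * \<psi> x) ` ?K)"
    using K cont continuous_on_subset by (intro compact_continuous_image) auto
  then have "bounded ((\<lambda>x. f x * \<psi> x) ` ?K)" by (rule compact_imp_bounded)
  then obtain C where "\<forall>y\<in>(\<lambda>x. f x * \<psi> x) ` ?K. norm y \<le> C" unfolding bounded_iff by blast
  then have C: "\<bar>f x * \<psi> x\<bar> \<le> C" if "x \<in> ?K" for x using that by simp
  have z: "f x * \<psi> x = 0" if "x \<notin> ?K" for x using tsupp_zero[OF that] by simp
  have "\<bar>f x * \<psi> x\<bar> \<le> \<bar>C\<bar>" for x using C[of x] z[of x] by fastforce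
  then show ?thesis
    using cont z K by (intro integrable_compact_support[where K="?K" and C="\<bar>C\<bar>"])
      (auto intro: borel_measurable_continuous_onI compact_imp_bounded)
qed

lemma integrable_test: "\<psi> \<in> test_functions U \<Longrightarrow> integrable L \<psi>"
  using integrable_cont_test[of "\<lambda>_. 1" \<psi> U] by simp

lemma integral_translate:
  fixes f :: "'v \<Rightarrow> real"
  assumes [measurable]: "f \<in> borel_measurable borel"
  shows "(LINT x|L. f (x + v)) = (LINT x|L. f x)"
proof -
  have "(LINT x|L. f x) = (LINT x|distr L borel (\<lambda>x. x + v). f x)" by (simp add: L_translate)
  also have "\<dots> = (LINT x|L. f (x + v))" by (subst integral_distr) auto
  finally show ?thesis by simp
qed

text \<open>The integral of a difference quotient vanishes by translation invariance, and dominated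
  convergence passes to the derivative.\<close>

lemma integral_dd_zero:
  assumes "\<psi> \<in> test_functions U"
  shows "(LINT x|L. dd v \<psi> x) = 0"
proof -
  have sm: "smooth \<psi>" by (rule test_functionsD(1)[OF assms])
  have [measurable]: "\<psi> \<in> borel_measurable borel"
    by (intro borel_measurable_continuous_onI smooth_continuous_on sm)
  have [measurable]: "dd v \<psi> \<in> borel_measurable borel"
    by (intro borel_measurable_continuous_onI smooth_continuous_on smooth_dd sm)
  obtain C where C: "C \<ge> 0" "\<And>x v. \<bar>dd v \<psi> x\<bar> \<le> C * norm v"
    using test_functions_dd_bound[OF assms] by blast
  obtain R where R: "\<And>x. x \<in> tsupp \<psi> \<Longrightarrow> norm x \<le> R"
    using compact_imp_bounded[OF test_functionsD(2)[OF assms]] unfolding bounded_iff by blast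
  have out: "\<psi> x = 0" if "norm x > R" for x
    using tsupp_zero[of x \<psi>] R[of x] that by force
  define t where "t = (\<lambda>n. 1 / real (Suc n))"
  have t0: "t n > 0" "t n \<le> 1" for n unfolding t_def by auto
  have tlim: "t \<longlonglongrightarrow> 0" unfolding t_def using LIMSEQ_inverse_real_of_nat by (simp add: inverse_eq_divide)
  define q where "q = (\<lambda>n x. (\<psi> (x + t n *\<^sub>R v) - \<psi> x) / t n)"
  \<comment> \<open>The step length \<open>t n\<close> is at most 1, so all difference quotients
    vanish outside the ball enlarged by \<open>norm v\<close>; inside, the mean value bound
    applies.\<close>
  define w where "w = (\<lambda>x. C * norm v * indicator (cball (0::'v) (R + norm v)) x :: real)"
  have "(\<lambda>n. LINT x|L. q n x) \<longlonglongrightarrow> (LINT x|L. dd v \<psi> x)"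
  proof (rule integral_dominated_convergence[where w=w])
    show "integrable L w" unfolding w_def
      using emeasure_L_bounded[OF bounded_cball] by (intro integrable_mult_right integrable_real_indicator) auto
    show "AE x in L. (\<lambda>n. q n x) \<longlonglongrightarrow> dd v \<psi> x"
    proof (rule AE_I2)
      fix x
      have "((\<lambda>t. \<psi> (x + t *\<^sub>R v)) has_real_derivative dd v \<psi> (x + 0 *\<^sub>R v)) (at 0)"
        by (rule DERIV_dd_line[OF smooth_differentiable[OF sm]])
      then have "((\<lambda>h. (\<psi> (x + h *\<^sub>R v) - \<psi> x) / h) \<longlongrightarrow> dd v \<psi> x) (at 0)"
        by (simp add: DERIV_def)
      moreover have "filterlim t (at 0) sequentially"
        using tlim t0 by (auto simp: filterlim_at intro!: always_eventually) (metis less_irrefl)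
      ultimately show "(\<lambda>n. q n x) \<longlonglongrightarrow> dd v \<psi> x"
        unfolding q_def by (rule filterlim_compose)
    qed
    show "AE x in L. norm (q n x) \<le> w x" for n
    proof (rule AE_I2)
      fix x
      show "norm (q n x) \<le> w x"
      proof (cases "norm x \<le> R + norm v")
        case True
        have "\<bar>\<psi> (x + t n *\<^sub>R v) - \<psi> x\<bar> \<le> C * norm (t n *\<^sub>R v)"
          by (rule mvt_line[OF smooth_differentiable[OF sm] C(2)])
        then have "\<bar>q n x\<bar> \<le> C * norm v" using t0(1)[of n] by (simp add: q_def abs_divide divide_le_eq mult_ac)
        then show ?thesis using True by (simp add: w_def)
      next
        case False
        have "norm x \<le> norm (x + t n *\<^sub>R v) + t n * norm v"
          using norm_triangle_ineq4[of "x + t n *\<^sub>R v" "t n *\<^sub>R v"] t0(1)[of n] by simp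
        moreover have "t n * norm v \<le> norm v" using t0[of n] by (simp add: mult_left_le_one_le)
        ultimately have "norm (x + t n *\<^sub>R v) > R" using False by linarith
        moreover have "norm x > R" using False norm_ge_zero[of v] by linarith
        ultimately have "q n x = 0" using out by (simp add: q_def)
        then show ?thesis by (simp add: w_def C(1))
      qed
    qed
  qed (auto simp: q_def)
  moreover have "(LINT x|L. q n x) = 0" for n
  proof -
    have i1: "integrable L \<psi>" by (rule integrable_test[OF assms])
    obtain M where M: "\<And>x. \<bar>\<psi> x\<bar> \<le> M" using test_functions_bounded[OF assms] by blast
    have i2: "integrable L (\<lambda>x. \<psi> (x + t n *\<^sub>R v))"
    proof (rule integrable_compact_support[where K="cball 0 (R + norm (t n *\<^sub>R v))" and C=M])
      show "\<psi> (x + t n *\<^sub>R v) = 0" if "x \<notin> cball 0 (R + norm (t n *\<^sub>R v))" for x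
        using that norm_triangle_ineq4[of "x + t n *\<^sub>R v" "t n *\<^sub>R v"] by (intro out) simp
    qed (use M in auto)
    have "(LINT x|L. q n x) = ((LINT x|L. \<psi> (x + t n *\<^sub>R v)) - (LINT x|L. \<psi> x)) / t n"
      unfolding q_def using i1 i2 by simp
    then show ?thesis by (simp add: integral_translate)
  qed
  ultimately have "(\<lambda>n. 0) \<longlonglongrightarrow> (LINT x|L. dd v \<psi> x)" by simp
  from LIMSEQ_unique[OF this tendsto_const] show ?thesis .
qed

lemma integral_by_parts:
  assumes "smooth f" "\<psi> \<in> test_functions U"
  shows "(LINT x|L. f x * dd v \<psi> x) = - (LINT x|L. dd v f x * \<psi> x)"
proof -
  have "(\<lambda>x. f x * \<psi> x) \<in> test_functions U"
    using test_functions_mult_right[OF assms(2,1)] by (simp add: mult.commute)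
  from integral_dd_zero[OF this, of v]
  have "0 = (LINT x|L. f x * dd v \<psi> x + dd v f x * \<psi> x)"
    using dd_mult[OF smooth_differentiable[OF assms(1)] smooth_differentiable[OF test_functionsD(1)[OF assms(2)]]]
    by (simp cong: Bochner_Integration.integral_cong)
  also have "\<dots> = (LINT x|L. f x * dd v \<psi> x) + (LINT x|L. dd v f x * \<psi> x)"
    by (intro Bochner_Integration.integral_add integrable_cont_test[OF _ assms(2)]
        integrable_cont_test[OF _ test_functions_dd[OF assms(2)]] smooth_continuous_on smooth_dd assms(1))
  finally show ?thesis by simp
qed

lemma integral_by_parts2:
  assumes "smooth f" "\<psi> \<in> test_functions U"
  shows "(LINT x|L. f x * dd u (dd v \<psi>) x) = (LINT x|L. dd v (dd u f) x * \<psi> x)"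
  using integral_by_parts[OF assms(1) test_functions_dd[OF assms(2)], of u v]
    integral_by_parts[OF smooth_dd[OF assms(1)] assms(2), of u v] by simp

lemma integral_test_pos:
  assumes "\<psi> \<in> test_functions U" "\<And>x. 0 \<le> \<psi> x" "open W" "W \<noteq> {}" "\<And>x. x \<in> W \<Longrightarrow> \<psi> x = 1"
  shows "(LINT x|L. \<psi> x) > 0"
proof -
  obtain y where "y \<in> W" using assms(4) by blast
  then obtain e where e: "e > 0" "ball y e \<subseteq> W" using assms(3) by (meson open_contains_ball)
  have fin: "emeasure L (ball y e) < \<infinity>" by (rule emeasure_L_bounded[OF bounded_ball])
  have "0 < measure L (ball y e)"
    using emeasure_L_open[of "ball y e"] e(1) fin by (simp add: measure_def enn2real_positive_iff)
  also have "measure L (ball y e) = (LINT x|L. indicator (ball y e) x)" by simp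
  also have "\<dots> \<le> (LINT x|L. \<psi> x)"
  proof (rule integral_mono[OF _ integrable_test[OF assms(1)]])
    show "integrable L (indicator (ball y e) :: 'v \<Rightarrow> real)"
      using fin by (intro integrable_real_indicator) auto
    show "indicator (ball y e) x \<le> \<psi> x" for x
      using e(2) assms(2,5) by (auto simp: indicator_def)
  qed
  finally show ?thesis .
qed

end

subsection \<open>Homogeneous separately concave functions\<close>

lemma mono_bounded_tendsto_at_top:
  fixes f :: "real \<Rightarrow> real"
  assumes mono: "\<And>s s'. s0 \<le> s \<Longrightarrow> s \<le> s' \<Longrightarrow> f s \<le> f s'" and bd: "\<And>s. s0 \<le> s \<Longrightarrow> f s \<le> C"
  shows "\<exists>l. (f \<longlongrightarrow> l) at_top"
proof -
  define l where "l = Sup (f ` {s0..})"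
  have bdd: "bdd_above (f ` {s0..})" using bd by (auto intro!: bdd_aboveI)
  have "(f \<longlongrightarrow> l) at_top"
  proof (rule order_tendstoI)
    fix a assume "a < l"
    then obtain s where s: "s0 \<le> s" "a < f s"
      unfolding l_def using less_cSup_iff[OF _ bdd] by auto
    show "\<forall>\<^sub>F x in at_top. a < f x"
      using eventually_ge_at_top[of s]
    proof eventually_elim
      case (elim x)
      then show ?case using mono[OF s(1)] s(2) by (meson less_le_trans)
    qed
  next
    fix a assume a: "l < a"
    show "\<forall>\<^sub>F x in at_top. f x < a"
      using eventually_ge_at_top[of s0]
    proof eventually_elim
      case (elim x)
      then have "f x \<le> l" unfolding l_def using bdd by (intro cSup_upper) auto
      then show ?case using a by simp
    qed
  qed
  then show ?thesis by blast
qed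

definition shift :: "'i \<Rightarrow> real \<Rightarrow> ('i \<Rightarrow> real) \<Rightarrow> 'i \<Rightarrow> real" where
  "shift k s x = x(k := x k + s)"

definition unit_vec :: "'i \<Rightarrow> 'i \<Rightarrow> real" where
  "unit_vec k = (\<lambda>i. if i = k then 1 else 0)"

text \<open>\<open>K\<close> is the domain, a cone given as a predicate. The last clause says that
  domain and values depend on the coordinates in \<open>I\<close> only; the index type may be
  larger.\<close>

definition hom_sep_concave :: "'i set \<Rightarrow> (('i \<Rightarrow> real) \<Rightarrow> bool) \<Rightarrow> (('i \<Rightarrow> real) \<Rightarrow> real) \<Rightarrow> bool" where
  "hom_sep_concave I K G \<longleftrightarrow>
     (\<forall>x t. K x \<and> 0 < t \<longrightarrow> K (\<lambda>i. t * x i) \<and> G (\<lambda>i. t * x i) = t * G x) \<and>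
     (\<forall>x i a b t. i \<in> I \<and> K (x(i := a)) \<and> K (x(i := b)) \<and> 0 \<le> t \<and> t \<le> 1 \<longrightarrow>
        (1 - t) * G (x(i := a)) + t * G (x(i := b)) \<le> G (x(i := (1 - t) * a + t * b))) \<and>
     (\<forall>x y. (\<forall>i\<in>I. x i = y i) \<longrightarrow> K x = K y \<and> G x = G y)"

text \<open>Blowing up at the interior point \<open>unit_vec k\<close> of the cone: since \<open>G\<close> is concave in the direction of
  \<open>unit_vec k\<close> with asymptotic slope \<open>G (unit_vec k)\<close>, the limit below is monotone.\<close>

lemma blow_up:
  fixes G :: "('i \<Rightarrow> real) \<Rightarrow> real"
  assumes fin: "finite I" and kI: "k \<in> I" and G: "hom_sep_concave I K G"
    and r: "0 < r" and int: "\<And>x. (\<And>i. i \<in> I \<Longrightarrow> \<bar>x i - unit_vec k i\<bar> \<le> r) \<Longrightarrow> K x"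
    and C: "\<And>x. K x \<Longrightarrow> (\<And>i. i \<in> I \<Longrightarrow> \<bar>x i\<bar> \<le> 2) \<Longrightarrow> \<bar>G x\<bar> \<le> C"
  shows "\<exists>h L. hom_sep_concave I (\<lambda>_. True) h \<and> (\<forall>x. \<bar>h x\<bar> \<le> L * (\<Sum>i\<in>I. \<bar>x i\<bar>)) \<and>
      (\<forall>x. K x \<longrightarrow> G x \<le> h x) \<and> (\<forall>x s. h (shift k s x) = h x + s * G (unit_vec k)) \<and>
      (\<forall>j \<sigma>. (\<forall>x s. K x \<and> K (shift j s x) \<longrightarrow> G (shift j s x) = G x + s * \<sigma>) \<longrightarrow>
         (\<forall>x s. h (shift j s x) = h x + s * \<sigma>))"
proof -
  have hom: "K (\<lambda>i. t * x i)" "G (\<lambda>i. t * x i) = t * G x" if "K x" "0 < t" for x t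
    using G that unfolding hom_sep_concave_def by blast+
  have conc: "(1 - t) * G (x(i := a)) + t * G (x(i := b)) \<le> G (x(i := (1 - t) * a + t * b))"
    if "i \<in> I" "K (x(i := a))" "K (x(i := b))" "0 \<le> t" "t \<le> 1" for x i a b t
    using G that unfolding hom_sep_concave_def by blast
  have loc: "K x = K y" "G x = G y" if "\<And>i. i \<in> I \<Longrightarrow> x i = y i" for x y
    using G that unfolding hom_sep_concave_def by blast+
  define e where "e = unit_vec k"
  \<comment> \<open>Halved so that the box of radius \<open>2 * r'\<close>, on which the Lipschitz
    estimate needs a bound for \<open>G\<close>, stays inside the domain and has coordinates at most
    2.\<close>
  define r' where "r' = min r 1 / 2"
  have r': "0 < r'" "2 * r' \<le> r" "2 * r' \<le> 1" unfolding r'_def using r by auto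
  have boxK: "K z" "\<bar>G z\<bar> \<le> C" if z: "z \<in> coord_box I e (2 * r')" for z
  proof -
    have d: "\<bar>z i - unit_vec k i\<bar> \<le> 2 * r'" if "i \<in> I" for i
      using z that unfolding coord_box_def e_def by blast
    show Kz: "K z" by (rule int) (use d r'(2) in fastforce)
    have "\<bar>z i\<bar> \<le> 2" if "i \<in> I" for i
      using d[OF that] r'(3) unfolding unit_vec_def by (auto split: if_splits)
    then show "\<bar>G z\<bar> \<le> C" using C[OF Kz] by blast
  qed
  have sep: "sep_convex_on I (coord_box I e (2 * r')) (\<lambda>x. - G x)"
    unfolding sep_convex_on_def
  proof (intro allI ballI impI, elim conjE)
    fix y i a b and t :: real
    assume *: "i \<in> I" "0 \<le> t" "t \<le> 1" "y(i := a) \<in> coord_box I e (2 * r')" "y(i := b) \<in> coord_box I e (2 * r')"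
    show "- G (y(i := (1 - t) * a + t * b)) \<le> (1 - t) * - G (y(i := a)) + t * - G (y(i := b))"
      using conc[OF *(1) boxK(1)[OF *(4)] boxK(1)[OF *(5)] *(2,3)] by simp
  qed
  define Lc where "Lc = 2 * C / r'"
  have eb: "e \<in> coord_box I e \<rho>" if "\<rho> \<ge> 0" for \<rho> using that unfolding coord_box_def by simp
  have Lc0: "0 \<le> Lc"
    unfolding Lc_def using boxK(2)[OF eb[of "2 * r'"]] r'(1) by simp
  have lip: "\<bar>G z - G e\<bar> \<le> Lc * (\<Sum>i\<in>I. \<bar>z i - e i\<bar>)" if "z \<in> coord_box I e r'" for z
  proof -
    have "\<bar>- G z - - G e\<bar> \<le> 2 * C / r' * (\<Sum>i\<in>I. \<bar>z i - e i\<bar>)"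
      using sep_convex_Lipschitz[OF fin r'(1) sep _ that eb] boxK(2) r'(1) by simp
    then show ?thesis unfolding Lc_def by (simp add: abs_minus_commute)
  qed
  define N where "N = (\<lambda>x. \<Sum>i\<in>I. \<bar>x i :: real\<bar>)"
  have N0: "0 \<le> N x" for x unfolding N_def by (simp add: sum_nonneg)
  \<comment> \<open>By homogeneity this equals \<open>s * (G z - G e)\<close> with
    \<open>z = e + x / s\<close>: its limit as \<open>s\<close> tends to infinity is the derivative
    of \<open>G\<close> at \<open>e\<close> in the direction \<open>x\<close>.\<close>
  define \<phi> where "\<phi> = (\<lambda>x s. G (shift k s x) - s * G e)"
  \<comment> \<open>Beyond \<open>s0 x\<close> the rescaled point \<open>e + x / s\<close> lies in
    the box of radius \<open>r'\<close>, where the Lipschitz estimate holds.\<close>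
  define s0 where "s0 = (\<lambda>x. N x / r' + 1)"
  have s0: "0 < s0 x" for x unfolding s0_def using N0[of x] r'(1) by (simp add: add_nonneg_pos)
  have far: "K (shift k s x)" "\<bar>\<phi> x s\<bar> \<le> Lc * N x" if s: "s0 x \<le> s" for x s
  proof -
    have spos: "s > 0" using s0[of x] s by linarith
    define z where "z = (\<lambda>i. if i \<in> I then x i / s + e i else e i)"
    have ns: "N x / r' \<le> s" using s unfolding s0_def by linarith
    have xi: "\<bar>x i\<bar> / s \<le> r'" if "i \<in> I" for i
    proof -
      have "\<bar>x i\<bar> \<le> N x" unfolding N_def using fin that by (intro member_le_sum) auto
      also have "\<dots> \<le> r' * s" using ns r'(1) by (simp add: divide_le_eq mult.commute)
      finally show ?thesis using spos by (simp add: divide_le_eq)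
    qed
    have zbox: "z \<in> coord_box I e r'"
      unfolding coord_box_def z_def using xi spos by (auto simp: abs_divide)
    then have zbox2: "z \<in> coord_box I e (2 * r')"
      unfolding coord_box_def using r'(1) by force
    have eqI: "shift k s x i = s * z i" if "i \<in> I" for i
      unfolding shift_def z_def e_def unit_vec_def using that spos by (auto simp: field_simps)
    show "K (shift k s x)"
      using loc(1)[of "shift k s x" "\<lambda>i. s * z i"] eqI hom(1)[OF boxK(1)[OF zbox2] spos] by blast
    have "G (shift k s x) = s * G z"
      using loc(2)[of "shift k s x" "\<lambda>i. s * z i"] eqI hom(2)[OF boxK(1)[OF zbox2] spos] by simp
    then have "\<phi> x s = s * (G z - G e)" unfolding \<phi>_def by (simp add: algebra_simps)
    then have "\<bar>\<phi> x s\<bar> = s * \<bar>G z - G e\<bar>" using spos by (simp add: abs_mult)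
    also have "\<dots> \<le> s * (Lc * (\<Sum>i\<in>I. \<bar>z i - e i\<bar>))"
      using lip[OF zbox] spos by (intro mult_left_mono) auto
    also have "(\<Sum>i\<in>I. \<bar>z i - e i\<bar>) = (\<Sum>i\<in>I. \<bar>x i\<bar> / s)"
      unfolding z_def using spos by (intro sum.cong) (auto simp: abs_divide)
    also have "s * (Lc * (\<Sum>i\<in>I. \<bar>x i\<bar> / s)) = Lc * N x"
      unfolding N_def using spos by (simp add: sum_divide_distrib[symmetric])
    finally show "\<bar>\<phi> x s\<bar> \<le> Lc * N x" .
  qed
  have sh0: "shift k 0 y = y" for y unfolding shift_def by simp
  have shsh: "shift k a (shift k b y) = shift k (a + b) y" for a b y
    unfolding shift_def by (auto simp: fun_eq_iff)
  \<comment> \<open>Concavity along \<open>k\<close> on the long segment from \<open>y\<close> to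
    \<open>shift k (s * R) y\<close>: the value at the far end is \<open>s * R * G e\<close> up to a
    bounded error, which is negligible after division by \<open>R\<close>.\<close>
  have super: "G y + s * G e \<le> G (shift k s y)" if K: "K y" and s: "0 \<le> s" for y s
  proof (cases "s = 0")
    case True
    then show ?thesis by (simp add: sh0)
  next
    case False
    then have spos: "s > 0" using s by simp
    define c where "c = G y + Lc * N y"
    have key: "(G y + s * G e - G (shift k s y)) * R \<le> c" if R: "R \<ge> 1" "s * R \<ge> s0 y" for R
    proof -
      have "(1 - 1/R) * G (y(k := y k)) + (1/R) * G (y(k := y k + s * R))
          \<le> G (y(k := (1 - 1/R) * y k + (1/R) * (y k + s * R)))"
        using far(1)[OF R(2)] K R(1) by (intro conc[OF kI]) (auto simp: shift_def)
      moreover have "y(k := (1 - 1/R) * y k + (1/R) * (y k + s * R)) = shift k s y"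
      proof -
        have "(1 - 1/R) * y k + (1/R) * (y k + s * R) = y k + s"
          using R(1) by (simp add: field_simps)
        then show ?thesis unfolding shift_def by simp
      qed
      moreover have "y(k := y k + s * R) = shift k (s * R) y" unfolding shift_def ..
      ultimately have "(1 - 1/R) * G y + (1/R) * G (shift k (s * R) y) \<le> G (shift k s y)" by simp
      then have "((1 - 1/R) * G y + (1/R) * G (shift k (s * R) y)) * R \<le> G (shift k s y) * R"
        using R(1) by (intro mult_right_mono) auto
      then have "(R - 1) * G y + G (shift k (s * R) y) \<le> G (shift k s y) * R"
        using R(1) by (simp add: algebra_simps)
      moreover have "G (shift k (s * R) y) \<ge> s * R * G e - Lc * N y"
        using far(2)[OF R(2)] unfolding \<phi>_def by linarith
      ultimately show ?thesis unfolding c_def by (simp add: algebra_simps)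
    qed
    show ?thesis
    proof (rule ccontr)
      define d where "d = G y + s * G e - G (shift k s y)"
      assume "\<not> ?thesis"
      then have d: "d > 0" unfolding d_def by simp
      \<comment> \<open>Large enough for the far end to be in the domain and for
        \<open>d * R\<close> to exceed \<open>c\<close>.\<close>
      define R where "R = max 1 (max (s0 y / s) (\<bar>c\<bar> / d + 1))"
      have R: "R \<ge> 1" "R \<ge> s0 y / s" "R \<ge> \<bar>c\<bar> / d + 1" unfolding R_def by auto
      have "s * R \<ge> s0 y" using R(2) spos by (simp add: divide_le_eq mult.commute)
      from key[OF R(1) this] have "d * R \<le> c" unfolding d_def .
      moreover have "d * R \<ge> \<bar>c\<bar> + d" using mult_left_mono[OF R(3), of d] d by (simp add: algebra_simps)
      ultimately show False using d by linarith
    qed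
  qed
  have mono: "\<phi> x s \<le> \<phi> x s'" if "K (shift k s x)" "s \<le> s'" for x s s'
    using super[OF that(1), of "s' - s"] that(2) unfolding \<phi>_def shsh by (simp add: algebra_simps)
  have "\<exists>l. (\<phi> x \<longlongrightarrow> l) at_top" for x
  proof (rule mono_bounded_tendsto_at_top)
    show "\<phi> x s \<le> \<phi> x s'" if "s0 x \<le> s" "s \<le> s'" for s s' using mono[OF far(1)] that by blast
    show "\<phi> x s \<le> Lc * N x" if "s0 x \<le> s" for s using far(2)[OF that] by linarith
  qed
  then obtain h where h: "\<And>x. (\<phi> x \<longlongrightarrow> h x) at_top" by metis
  have evK: "\<forall>\<^sub>F s in at_top. K (shift k s x)" for x
    using eventually_ge_at_top[of "s0 x"] by eventually_elim (rule far(1))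
  have ntr: "(at_top :: real filter) \<noteq> bot" by simp
  have h_ge: "G x \<le> h x" if "K x" for x
  proof (rule tendsto_lowerbound[OF h _ ntr])
    show "\<forall>\<^sub>F s in at_top. G x \<le> \<phi> x s"
      using eventually_ge_at_top[of 0]
    proof eventually_elim
      case (elim s)
      have "\<phi> x 0 \<le> \<phi> x s" by (rule mono) (use that elim in \<open>auto simp: sh0\<close>)
      then show ?case by (simp add: \<phi>_def sh0)
    qed
  qed
  have h_bd: "\<bar>h x\<bar> \<le> Lc * N x" for x
  proof (rule tendsto_upperbound[OF tendsto_rabs[OF h] _ ntr])
    show "\<forall>\<^sub>F s in at_top. \<bar>\<phi> x s\<bar> \<le> Lc * N x"
      using eventually_ge_at_top[of "s0 x"] by eventually_elim (rule far(2))
  qed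
  have h_hom: "h (\<lambda>i. t * x i) = t * h x" if t: "0 < t" for x t
  proof (rule tendsto_unique[OF ntr h])
    have lim: "filterlim (\<lambda>s. s / t) at_top at_top"
      using filterlim_tendsto_pos_mult_at_top[OF tendsto_const[of "1/t"] _ filterlim_ident] t by simp
    have l2: "((\<lambda>s. t * \<phi> x (s / t)) \<longlongrightarrow> t * h x) at_top"
      by (intro tendsto_mult tendsto_const filterlim_compose[OF h lim])
    have "\<forall>\<^sub>F s in at_top. K (shift k (s / t) x)"
      using lim evK[of x] by (rule eventually_compose_filterlim[rotated])
    then have "\<forall>\<^sub>F s in at_top. t * \<phi> x (s / t) = \<phi> (\<lambda>i. t * x i) s"
    proof eventually_elim
      case (elim s)
      have "shift k s (\<lambda>i. t * x i) = (\<lambda>i. t * shift k (s / t) x i)"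
        unfolding shift_def using t by (auto simp: fun_eq_iff field_simps)
      then show ?case using hom(2)[OF elim t] t unfolding \<phi>_def by (simp add: algebra_simps)
    qed
    then show "(\<phi> (\<lambda>i. t * x i) \<longlongrightarrow> t * h x) at_top" using l2 by (rule Lim_transform_eventually[rotated])
  qed
  have h_conc: "(1 - t) * h (x(i := a)) + t * h (x(i := b)) \<le> h (x(i := (1 - t) * a + t * b))"
    if i: "i \<in> I" and t: "0 \<le> t" "t \<le> 1" for x i a b t
  proof (rule tendsto_le[OF ntr h])
    show "((\<lambda>s. (1 - t) * \<phi> (x(i := a)) s + t * \<phi> (x(i := b)) s) \<longlongrightarrow> (1 - t) * h (x(i := a)) + t * h (x(i := b))) at_top"
      by (intro tendsto_intros h)
    show "\<forall>\<^sub>F s in at_top. (1 - t) * \<phi> (x(i := a)) s + t * \<phi> (x(i := b)) s \<le> \<phi> (x(i := (1 - t) * a + t * b)) s"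
      using evK[of "x(i := a)"] evK[of "x(i := b)"]
    proof eventually_elim
      case (elim s)
      \<comment> \<open>The shift along \<open>k\<close> is moved into the base point; when
        \<open>i = k\<close>, the varied coordinate overrides it and the two end values are shifted
        by \<open>d\<close> instead.\<close>
      define y where "y = shift k s x"
      define d where "d = (if i = k then s else 0)"
      have sh: "shift k s (x(i := v)) = y(i := v + d)" for v
        unfolding y_def d_def shift_def by auto
      have "(1 - t) * (a + d) + t * (b + d) = (1 - t) * a + t * b + d" by (simp add: algebra_simps)
      then have "(1 - t) * G (y(i := a + d)) + t * G (y(i := b + d)) \<le> G (y(i := (1 - t) * a + t * b + d))"
        using conc[OF i, of y "a + d" "b + d" t] elim t unfolding sh by simp
      then show ?case unfolding \<phi>_def sh by (simp add: algebra_simps)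
    qed
  qed
  have h_loc: "h x = h y" if "\<And>i. i \<in> I \<Longrightarrow> x i = y i" for x y
  proof -
    have "\<phi> x = \<phi> y"
      unfolding \<phi>_def using loc(2)[of "shift k _ x" "shift k _ y"] that kI
      by (auto simp: fun_eq_iff shift_def)
    then show ?thesis using tendsto_unique[OF ntr h[of x]] h[of y] by simp
  qed
  \<comment> \<open>Additivity of \<open>G\<close> along another coordinate is inherited because
    shifts commute; this keeps the earlier gains when the blow-up is iterated.\<close>
  have h_shift: "h (shift j s x) = h x + s * \<sigma>"
    if add: "\<And>x s. K x \<Longrightarrow> K (shift j s x) \<Longrightarrow> G (shift j s x) = G x + s * \<sigma>" for j \<sigma> x s
  proof (rule tendsto_unique[OF ntr h])
    have "\<forall>\<^sub>F u in at_top. \<phi> x u + s * \<sigma> = \<phi> (shift j s x) u"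
      using evK[of x] evK[of "shift j s x"]
    proof eventually_elim
      case (elim u)
      have "shift k u (shift j s x) = shift j s (shift k u x)"
        unfolding shift_def by (auto simp: fun_eq_iff)
      then show ?case using add[of "shift k u x" s] elim unfolding \<phi>_def by simp
    qed
    moreover have "((\<lambda>u. \<phi> x u + s * \<sigma>) \<longlongrightarrow> h x + s * \<sigma>) at_top" by (intro tendsto_intros h)
    ultimately show "(\<phi> (shift j s x) \<longlongrightarrow> h x + s * \<sigma>) at_top" by (rule Lim_transform_eventually[rotated])
  qed
  have h_shiftk: "h (shift k s x) = h x + s * G e" for s x
  proof (rule tendsto_unique[OF ntr h])
    have lim: "filterlim (\<lambda>u. s + u) at_top at_top"
      by (rule filterlim_tendsto_add_at_top[OF tendsto_const filterlim_ident])
    have "((\<lambda>u. \<phi> x (s + u) + s * G e) \<longlongrightarrow> h x + s * G e) at_top"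
      by (intro tendsto_add tendsto_const filterlim_compose[OF h lim])
    moreover have "\<phi> x (s + u) + s * G e = \<phi> (shift k s x) u" for u
      unfolding \<phi>_def shsh by (simp add: algebra_simps)
    ultimately show "(\<phi> (shift k s x) \<longlongrightarrow> h x + s * G e) at_top" by simp
  qed
  have H: "hom_sep_concave I (\<lambda>_. True) h"
    unfolding hom_sep_concave_def
  proof (intro conjI allI impI, goal_cases)
    case 1 then show ?case by simp
  next
    case (2 x t) then show ?case using h_hom by blast
  next
    case (3 x i a b t) then show ?case using h_conc by blast
  next
    case 4 then show ?case by simp
  next
    case (5 x y) then show ?case using h_loc by blast
  qed
  show ?thesis
  proof (rule exI[of _ h], rule exI[of _ Lc], intro conjI H)
    show "\<forall>x. \<bar>h x\<bar> \<le> Lc * (\<Sum>i\<in>I. \<bar>x i\<bar>)" using h_bd unfolding N_def by blast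
    show "\<forall>x. K x \<longrightarrow> G x \<le> h x" using h_ge by blast
    show "\<forall>x s. h (shift k s x) = h x + s * G (unit_vec k)" using h_shiftk unfolding e_def by blast
    show "\<forall>j \<sigma>. (\<forall>x s. K x \<and> K (shift j s x) \<longrightarrow> G (shift j s x) = G x + s * \<sigma>) \<longrightarrow>
         (\<forall>x s. h (shift j s x) = h x + s * \<sigma>)" using h_shift by blast
  qed
qed

text \<open>A first blow-up at \<open>unit_vec k\<close> gives a majorant defined everywhere, so
  that afterwards every \<open>unit_vec j\<close> is an interior point. Blowing up once at each of
  them makes the majorant additive along one more coordinate and keeps the earlier ones; when all
  coordinates are exhausted it is linear.\<close>

lemma hom_sep_concave_linear_bound:
  fixes G :: "('i \<Rightarrow> real) \<Rightarrow> real"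
  assumes fin: "finite I" and kI: "k \<in> I" and G: "hom_sep_concave I K G"
    and r: "0 < r" and int: "\<And>x. (\<And>i. i \<in> I \<Longrightarrow> \<bar>x i - unit_vec k i\<bar> \<le> r) \<Longrightarrow> K x"
    and C: "\<And>x. K x \<Longrightarrow> (\<And>i. i \<in> I \<Longrightarrow> \<bar>x i\<bar> \<le> 2) \<Longrightarrow> \<bar>G x\<bar> \<le> C"
  shows "\<exists>\<sigma>. \<forall>x. K x \<longrightarrow> G x \<le> (\<Sum>i\<in>I. \<sigma> i * x i)"
proof -
  obtain h0 L0 where h0: "hom_sep_concave I (\<lambda>_. True) h0"
      "\<And>x. \<bar>h0 x\<bar> \<le> L0 * (\<Sum>i\<in>I. \<bar>x i\<bar>)" "\<And>x. K x \<Longrightarrow> G x \<le> h0 x"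
    using blow_up[OF fin kI G r int C] by blast
  have "\<exists>h L. hom_sep_concave I (\<lambda>_. True) h \<and> (\<forall>x. \<bar>h x\<bar> \<le> L * (\<Sum>i\<in>I. \<bar>x i\<bar>)) \<and>
      (\<forall>x. h0 x \<le> h x) \<and> (\<forall>j\<in>J. \<exists>\<sigma>. \<forall>x s. h (shift j s x) = h x + s * \<sigma>)"
    if "finite J" "J \<subseteq> I" for J
    using that
  proof (induction J rule: finite_induct)
    case empty
    show ?case by (rule exI[of _ h0], rule exI[of _ L0]) (use h0 in auto)
  next
    case (insert j J)
    have sub: "J \<subseteq> I" and jI: "j \<in> I" using insert.prems by auto
    obtain h L where h: "hom_sep_concave I (\<lambda>_. True) h" "\<And>x. \<bar>h x\<bar> \<le> L * (\<Sum>i\<in>I. \<bar>x i\<bar>)"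
      "\<And>x. h0 x \<le> h x" "\<And>i. i \<in> J \<Longrightarrow> \<exists>\<sigma>. \<forall>x s. h (shift i s x) = h x + s * \<sigma>"
      using insert.IH[OF sub] by blast
    have bd: "\<bar>h x\<bar> \<le> \<bar>L\<bar> * (2 * card I)" if "\<And>i. i \<in> I \<Longrightarrow> \<bar>x i\<bar> \<le> 2" for x
    proof -
      have "(\<Sum>i\<in>I. \<bar>x i\<bar>) \<le> 2 * card I" using sum_bounded_above[of I "\<lambda>i. \<bar>x i\<bar>" 2] that by simp
      then have "L * (\<Sum>i\<in>I. \<bar>x i\<bar>) \<le> \<bar>L\<bar> * (2 * card I)"
        by (intro mult_mono) (auto simp: sum_nonneg)
      then show ?thesis using h(2)[of x] by linarith
    qed
    obtain h' L' where h': "hom_sep_concave I (\<lambda>_. True) h'" "\<And>x. \<bar>h' x\<bar> \<le> L' * (\<Sum>i\<in>I. \<bar>x i\<bar>)"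
      "\<And>x. h x \<le> h' x" "\<And>x s. h' (shift j s x) = h' x + s * h (unit_vec j)"
      "\<And>i \<sigma>. (\<forall>x s. h (shift i s x) = h x + s * \<sigma>) \<Longrightarrow> (\<forall>x s. h' (shift i s x) = h' x + s * \<sigma>)"
      using blow_up[OF fin jI h(1) zero_less_one _ bd] by auto
    have "\<exists>\<sigma>. \<forall>x s. h' (shift i s x) = h' x + s * \<sigma>" if i: "i \<in> insert j J" for i
    proof (cases "i = j")
      case True
      then show ?thesis using h'(4) by blast
    next
      case False
      then have "i \<in> J" using i by blast
      then show ?thesis using h(4) h'(5) by blast
    qed
    moreover have "h0 x \<le> h' x" for x using h(3) h'(3) by (rule order_trans)
    ultimately show ?case using h'(1,2) by blast
  qed
  from this[OF fin order_refl] obtain h L where h: "\<And>x. \<bar>h x\<bar> \<le> L * (\<Sum>i\<in>I. \<bar>x i :: real\<bar>)" "\<And>x. h0 x \<le> h x"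
    "\<forall>j\<in>I. \<exists>\<sigma>. \<forall>x s. h (shift j s x) = h x + s * \<sigma>" by blast
  from bchoice[OF h(3)] obtain \<sigma> where \<sigma>: "\<And>j x s. j \<in> I \<Longrightarrow> h (shift j s x) = h x + s * \<sigma> j" by blast
  have lin: "h x = h (\<lambda>i. if i \<in> J then 0 else x i) + (\<Sum>i\<in>J. \<sigma> i * x i)" if "finite J" "J \<subseteq> I" for J x
    using that
  proof (induction J rule: finite_induct)
    case (insert j J)
    let ?y = "\<lambda>i. if i \<in> J then 0 else x i"
    have "(\<lambda>i. if i \<in> insert j J then 0 else x i) = shift j (- x j) ?y"
      unfolding shift_def using insert.hyps by (auto simp: fun_eq_iff)
    then have "h (\<lambda>i. if i \<in> insert j J then 0 else x i) = h ?y - x j * \<sigma> j"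
      using \<sigma>[of j "- x j" ?y] insert.prems by simp
    then show ?case using insert by (simp add: algebra_simps)
  qed simp
  have "h x = (\<Sum>i\<in>I. \<sigma> i * x i)" for x
  proof -
    \<comment> \<open>At the origin of the \<open>I\<close>-coordinates the linear growth bound
      forces the value 0.\<close>
    have "\<bar>h (\<lambda>i. if i \<in> I then 0 else x i)\<bar> \<le> L * (\<Sum>i\<in>I. \<bar>if i \<in> I then 0 else x i\<bar>)" by (rule h(1))
    also have "(\<Sum>i\<in>I. \<bar>if i \<in> I then 0 else x i\<bar>) = 0" by (rule sum.neutral) simp
    finally show ?thesis using lin[OF fin order_refl, of x] by simp
  qed
  then show ?thesis using h0(3) h(2) order_trans by metis
qed

subsection \<open>The one-dimensional profile of a simple laminate\<close>

context
  fixes f :: "real \<Rightarrow> real" and r :: real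
  assumes r: "0 < r" and per: "\<And>s. \<bar>s\<bar> < r \<Longrightarrow> f (1 + s) = f s"
begin

text \<open>Away from the integers \<open>frac\<close> is locally a translation; at an integer the
  branch from the left is \<open>f (1 + s)\<close>, which \<open>per\<close> identifies with
  \<open>f s\<close>. Agreement of the two ends on a small interval is thus enough to continue
  \<open>f\<close> smoothly with period 1.\<close>

lemma periodize_local: "\<exists>\<delta>>0. \<forall>t. \<bar>t - x\<bar> < \<delta> \<longrightarrow> f (frac t) = f (t - of_int \<lfloor>x\<rfloor>)"
proof (cases "frac x = 0")
  case False
  have fr: "0 < frac x" "frac x < 1" using False frac_ge_0[of x] frac_lt_1[of x] by linarith+
  define \<delta> where "\<delta> = min (frac x) (1 - frac x)"
  have "f (frac t) = f (t - of_int \<lfloor>x\<rfloor>)" if "\<bar>t - x\<bar> < \<delta>" for t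
  proof -
    have "\<lfloor>t\<rfloor> = \<lfloor>x\<rfloor>"
      using that unfolding \<delta>_def frac_def by (intro floor_unique) (auto simp: abs_less_iff)
    then show ?thesis by (simp add: frac_def)
  qed
  moreover have "\<delta> > 0" unfolding \<delta>_def using fr by simp
  ultimately show ?thesis by blast
next
  case True
  then have x: "of_int \<lfloor>x\<rfloor> = x" by (simp add: frac_def)
  have "f (frac t) = f (t - of_int \<lfloor>x\<rfloor>)" if t: "\<bar>t - x\<bar> < min r 1" for t
  proof (cases "t \<ge> x")
    case True
    have "\<lfloor>t\<rfloor> = \<lfloor>x\<rfloor>" using t True x by (intro floor_unique) auto
    then show ?thesis by (simp add: frac_def)
  next
    case False
    have "\<lfloor>t\<rfloor> = \<lfloor>x\<rfloor> - 1" using t False x by (intro floor_unique) auto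
    then have "frac t = 1 + (t - of_int \<lfloor>x\<rfloor>)" by (simp add: frac_def)
    then show ?thesis using per[of "t - of_int \<lfloor>x\<rfloor>"] t unfolding x by simp
  qed
  then show ?thesis using r by (intro exI[of _ "min r 1"]) auto
qed

lemma smooth_periodize: "smooth f \<Longrightarrow> smooth (\<lambda>t. f (frac t))"
proof (rule smooth_local)
  fix x assume f: "smooth f"
  obtain \<delta> where \<delta>: "\<delta> > 0" "\<And>t. \<bar>t - x\<bar> < \<delta> \<Longrightarrow> f (frac t) = f (t - of_int \<lfloor>x\<rfloor>)"
    using periodize_local by blast
  show "\<exists>g U. open U \<and> x \<in> U \<and> smooth g \<and> (\<forall>y\<in>U. f (frac y) = g y)"
  proof (intro exI conjI ballI)
    show "smooth (\<lambda>t. f (t - of_int \<lfloor>x\<rfloor>))"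
      by (intro smooth_compose[OF f] smooth_diff smooth_ident_real smooth_const)
    show "f (frac y) = f (y - of_int \<lfloor>x\<rfloor>)" if "y \<in> ball x \<delta>" for y
      using that \<delta>(2) by (simp add: dist_real_def abs_minus_commute)
  qed (use \<delta> in auto)
qed

lemma DERIV_periodize:
  assumes "\<And>t. (f has_real_derivative f' t) (at t)"
  shows "((\<lambda>t. f (frac t)) has_real_derivative f' (frac x)) (at x)"
proof -
  obtain \<delta> where \<delta>: "\<delta> > 0" "\<And>t. \<bar>t - x\<bar> < \<delta> \<Longrightarrow> f (frac t) = f (t - of_int \<lfloor>x\<rfloor>)"
    using periodize_local by blast
  have "((\<lambda>t. t - of_int \<lfloor>x\<rfloor>) has_real_derivative 1) (at x)"
    using DERIV_diff[OF DERIV_ident DERIV_const] by simp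
  from DERIV_chain2[OF assms this]
  have "((\<lambda>t. f (t - of_int \<lfloor>x\<rfloor>)) has_real_derivative f' (frac x)) (at x)" by (simp add: frac_def)
  then show ?thesis
    by (rule has_field_derivative_transform_within_open[of _ _ _ "ball x \<delta>"])
      (use \<delta> in \<open>auto simp: dist_real_def abs_minus_commute\<close>)
qed

end

lemma periodize_bounded:
  assumes "continuous_on UNIV (f :: real \<Rightarrow> real)"
  shows "\<exists>C. \<forall>t. \<bar>f (frac t)\<bar> \<le> C"
proof -
  have "compact (f ` {0..1})"
    by (intro compact_continuous_image continuous_on_subset[OF assms]) auto
  then have "bounded (f ` {0..1})" by (rule compact_imp_bounded)
  then obtain C where "\<forall>y\<in>f ` {0..1}. norm y \<le> C" unfolding bounded_iff by blast
  moreover have "frac t \<in> {0..1}" for t :: real using frac_ge_0[of t] frac_lt_1[of t] by simp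
  ultimately have "\<bar>f (frac t)\<bar> \<le> C" for t by (metis imageI real_norm_def)
  then show ?thesis by blast
qed

lemma frac_near:
  fixes s t :: real
  assumes "\<bar>s - t\<bar> < r" "r \<le> frac t" "frac t \<le> 1 - r"
  shows "frac s = frac t + (s - t)"
proof -
  have "\<lfloor>s\<rfloor> = \<lfloor>t\<rfloor>" using assms unfolding frac_def by (intro floor_unique) linarith+
  then show ?thesis by (simp add: frac_def)
qed

text \<open>One period of the laminate. \<open>w2\<close> takes the values \<mu>1 and \<mu>2 except
  in thin transition layers, with mean 0, so that \<open>w1\<close> and \<open>w\<close> can be
  periodic and bounded. The cut-offs \<chi>1 and \<chi>2 select the two plateaus with a margin
  \<open>r\<close>, their means \<open>m1\<close> and \<open>m2\<close> are nearly the barycentric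
  weights of 0 between \<mu>1 and \<mu>2, and \<open>u1\<close>, \<open>u2\<close> are bounded
  antiderivatives of the cut-offs minus their means.\<close>

lemma lamination_profile:
  fixes \<mu>1 \<mu>2 \<epsilon> :: real
  assumes "\<mu>1 < 0" "0 < \<mu>2" "0 < \<epsilon>"
  obtains w w1 w2 \<chi>1 \<chi>2 u1 u2 :: "real \<Rightarrow> real" and m1 m2 C r :: real where
    "smooth w" "smooth \<chi>1" "smooth \<chi>2" "smooth u1" "smooth u2"
    "\<And>t. (w has_real_derivative w1 t) (at t)" "\<And>t. (w1 has_real_derivative w2 t) (at t)"
    "\<And>t. \<bar>w t\<bar> \<le> C" "\<And>t. \<bar>w1 t\<bar> \<le> C" "\<And>t. \<mu>1 \<le> w2 t" "\<And>t. w2 t \<le> \<mu>2"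
    "\<And>t. 0 \<le> \<chi>1 t" "\<And>t. \<chi>1 t \<le> 1" "\<And>t. 0 \<le> \<chi>2 t" "\<And>t. \<chi>2 t \<le> 1" "0 < r"
    "\<And>t s. \<chi>1 t \<noteq> 0 \<Longrightarrow> \<bar>s - t\<bar> < r \<Longrightarrow> w2 s = \<mu>1"
    "\<And>t s. \<chi>2 t \<noteq> 0 \<Longrightarrow> \<bar>s - t\<bar> < r \<Longrightarrow> w2 s = \<mu>2"
    "\<And>t. (u1 has_real_derivative \<chi>1 t - m1) (at t)" "\<And>t. (u2 has_real_derivative \<chi>2 t - m2) (at t)"
    "\<And>t. \<bar>u1 t\<bar> \<le> C" "\<And>t. \<bar>u2 t\<bar> \<le> C"
    "m1 \<ge> \<mu>2 / (\<mu>2 - \<mu>1) - \<epsilon>" "m2 \<ge> - \<mu>1 / (\<mu>2 - \<mu>1) - \<epsilon>"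
proof -
  \<comment> \<open>The share of the plateau \<mu>2 for which the mean
    \<open>(1 - \<theta>) * \<mu>1 + \<theta> * \<mu>2\<close> is 0.\<close>
  define \<theta> where "\<theta> = - \<mu>1 / (\<mu>2 - \<mu>1)"
  have pos: "0 < \<mu>2 - \<mu>1" using assms by simp
  have \<theta>: "0 < \<theta>" "\<theta> < 1"
  proof -
    show "0 < \<theta>" unfolding \<theta>_def using pos assms(1) by (intro divide_pos_pos) auto
    show "\<theta> < 1" unfolding \<theta>_def by (subst divide_less_eq_1_pos[OF pos]) (use assms in simp)
  qed
  have \<theta>1: "1 - \<theta> = \<mu>2 / (\<mu>2 - \<mu>1)" unfolding \<theta>_def using assms by (simp add: field_simps)
  have \<theta>\<mu>: "(\<mu>2 - \<mu>1) * \<theta> = - \<mu>1" unfolding \<theta>_def using assms by simp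
  \<comment> \<open>The plateau \<mu>2 is centred at 1/2 and reaches from \<alpha> to
    \<open>1 - \<alpha>\<close>.\<close>
  define \<alpha> where "\<alpha> = (1 - \<theta>) / 2"
  have \<alpha>: "0 < \<alpha>" "1 - 2 * \<alpha> = \<theta>" unfolding \<alpha>_def using \<theta> by (simp_all add: diff_divide_distrib)
  define r where "r = min (\<alpha> / 8) (min (\<theta> / 8) (\<epsilon> / 8))"
  have r: "0 < r" "8 * r \<le> \<alpha>" "8 * r \<le> \<theta>" "8 * r \<le> \<epsilon>" unfolding r_def using \<alpha> \<theta> assms(3) by auto
  obtain S :: "real \<Rightarrow> real" and S1 S2 c where S: "smooth S" "smooth S1" "smooth S2"
    "\<And>x. 0 \<le> S x \<and> S x \<le> 1" "mono S"
    "\<And>x. (S1 has_real_derivative S x) (at x)" "\<And>x. (S2 has_real_derivative S1 x) (at x)"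
    "\<And>x. x \<le> -r \<Longrightarrow> S x = 0 \<and> S1 x = 0 \<and> S2 x = 0"
    "\<And>x. x \<ge> r \<Longrightarrow> S x = 1 \<and> S1 x = x \<and> S2 x = x\<^sup>2 / 2 + c"
    using ex_step[OF r(1)] by metis
  have sm: "smooth (\<lambda>t. S (t - a))" "smooth (\<lambda>t. S1 (t - a))" "smooth (\<lambda>t. S2 (t - a))" for a
    by (intro smooth_compose[OF S(1)] smooth_compose[OF S(2)] smooth_compose[OF S(3)]
        smooth_diff smooth_ident_real smooth_const)+
  have dm: "((\<lambda>t. t - a) has_real_derivative 1) (at t)" for a t :: real
    using DERIV_diff[OF DERIV_ident DERIV_const] by simp
  have ds: "((\<lambda>t. S1 (t - a)) has_real_derivative S (t - a)) (at t)"
    "((\<lambda>t. S2 (t - a)) has_real_derivative S1 (t - a)) (at t)" for a t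
    using DERIV_chain2[OF S(6) dm] DERIV_chain2[OF S(7) dm] by simp_all
  define f2 where "f2 = (\<lambda>t. \<mu>1 + (\<mu>2 - \<mu>1) * (S (t - \<alpha>) - S (t - (1 - \<alpha>))))"
  define f1 where "f1 = (\<lambda>t. \<mu>1 * t + (\<mu>2 - \<mu>1) * (S1 (t - \<alpha>) - S1 (t - (1 - \<alpha>))))"
  define f0 where "f0 = (\<lambda>t. \<mu>1 * (t * t / 2) + (\<mu>2 - \<mu>1) * (S2 (t - \<alpha>) - S2 (t - (1 - \<alpha>))))"
  \<comment> \<open>The steps of \<open>g2\<close> lie \<open>3 * r\<close> inside those of
    \<open>f2\<close>, the steps of \<open>g1\<close> lie \<open>3 * r\<close> outside. With
    transition layers of half-width \<open>r\<close> this leaves a gap \<open>r\<close> between the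
    layers and costs each plateau \<open>6 * r\<close>.\<close>
  define m2 where "m2 = \<theta> - 6 * r"
  define m1 where "m1 = 1 - \<theta> - 6 * r"
  define g2 where "g2 = (\<lambda>t. S (t - (\<alpha> + 3 * r)) - S (t - (1 - \<alpha> - 3 * r)))"
  define g1 where "g1 = (\<lambda>t. 1 - (S (t - (\<alpha> - 3 * r)) - S (t - (1 - \<alpha> + 3 * r))))"
  define U2 where "U2 = (\<lambda>t. S1 (t - (\<alpha> + 3 * r)) - S1 (t - (1 - \<alpha> - 3 * r)) - m2 * t)"
  define U1 where "U1 = (\<lambda>t. t - (S1 (t - (\<alpha> - 3 * r)) - S1 (t - (1 - \<alpha> + 3 * r))) - m1 * t)"
  have df0: "(f0 has_real_derivative f1 t) (at t)" for t
    unfolding f0_def f1_def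
    by (rule DERIV_cong, (rule DERIV_add DERIV_cmult DERIV_diff ds DERIV_cdivide DERIV_mult DERIV_ident)+) simp
  have df1: "(f1 has_real_derivative f2 t) (at t)" for t
    unfolding f1_def f2_def
    by (rule DERIV_cong, (rule DERIV_add DERIV_cmult DERIV_diff ds DERIV_ident)+) simp
  have dU2: "(U2 has_real_derivative g2 t - m2) (at t)" for t
    unfolding U2_def g2_def by (rule DERIV_cong, (rule DERIV_cmult DERIV_diff ds DERIV_ident)+) simp
  have dU1: "(U1 has_real_derivative g1 t - m1) (at t)" for t
    unfolding U1_def g1_def by (rule DERIV_cong, (rule DERIV_cmult DERIV_diff ds DERIV_ident)+) simp
  have smf: "smooth f0" "smooth f1" "smooth g1" "smooth g2" "smooth U1" "smooth U2"
  proof -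
    have sq: "smooth (\<lambda>t::real. t * t / 2)"
      using smooth_cmult[OF smooth_mult[OF smooth_ident_real smooth_ident_real], of "1/2"] by simp
    show "smooth f0" unfolding f0_def by (intro smooth_add smooth_cmult smooth_diff sm sq)
    show "smooth f1" unfolding f1_def by (intro smooth_add smooth_cmult smooth_diff sm smooth_ident_real)
    show "smooth g1" unfolding g1_def by (intro smooth_diff sm smooth_const)
    show "smooth g2" unfolding g2_def by (intro smooth_diff sm smooth_const)
    show "smooth U1" unfolding U1_def by (intro smooth_diff sm smooth_cmult smooth_ident_real)
    show "smooth U2" unfolding U2_def by (intro smooth_diff sm smooth_cmult smooth_ident_real)
  qed
  have per: "f0 (1 + s) = f0 s" "f1 (1 + s) = f1 s" "g1 (1 + s) = g1 s" "g2 (1 + s) = g2 s"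
    "U1 (1 + s) = U1 s" "U2 (1 + s) = U2 s" if "\<bar>s\<bar> < r" for s
  proof -
    have s: "- r < s" "s < r" using that by auto
    have lo: "S (s - a) = 0" "S1 (s - a) = 0" "S2 (s - a) = 0" if "2 * r \<le> a" for a
      using S(8)[of "s - a"] that s by auto
    have hi: "S (1 + s - a) = 1" "S1 (1 + s - a) = 1 + s - a" "S2 (1 + s - a) = (1 + s - a)\<^sup>2 / 2 + c"
      if "a \<le> 1 - 2 * r" for a
      using S(9)[of "1 + s - a"] that s by auto
    have b: "2 * r \<le> \<alpha>" "2 * r \<le> 1 - \<alpha>" "\<alpha> \<le> 1 - 2 * r" "1 - \<alpha> \<le> 1 - 2 * r"
      "2 * r \<le> \<alpha> + 3 * r" "2 * r \<le> 1 - \<alpha> - 3 * r" "\<alpha> + 3 * r \<le> 1 - 2 * r" "1 - \<alpha> - 3 * r \<le> 1 - 2 * r"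
      "2 * r \<le> \<alpha> - 3 * r" "2 * r \<le> 1 - \<alpha> + 3 * r" "\<alpha> - 3 * r \<le> 1 - 2 * r" "1 - \<alpha> + 3 * r \<le> 1 - 2 * r"
      using r \<alpha> \<theta> by linarith+
    \<comment> \<open>The squares cancel and an affine function of \<open>s\<close> is left, whose
      size is matched by the choice of \<theta>; it is a multiple of \<open>1 + 2 * s\<close>
      because the plateau is symmetric about 1/2.\<close>
    have "(1 + s - \<alpha>)\<^sup>2 / 2 + c - ((1 + s - (1 - \<alpha>))\<^sup>2 / 2 + c) = (1 - 2 * \<alpha>) * (1 + 2 * s) / 2"
      by (simp add: power2_eq_square field_simps)
    then have "f0 (1 + s) = \<mu>1 * ((1 + s) * (1 + s) / 2) + ((\<mu>2 - \<mu>1) * \<theta>) * (1 + 2 * s) / 2"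
      unfolding f0_def hi[OF b(3)] hi[OF b(4)] \<alpha>(2) by simp
    also have "\<dots> = \<mu>1 * (s * s / 2)" unfolding \<theta>\<mu> by (simp add: field_simps)
    finally show "f0 (1 + s) = f0 s" unfolding f0_def lo[OF b(1)] lo[OF b(2)] by simp
    have "f1 (1 + s) = \<mu>1 * (1 + s) + (\<mu>2 - \<mu>1) * (1 - 2 * \<alpha>)"
      unfolding f1_def hi[OF b(3)] hi[OF b(4)] by simp
    then show "f1 (1 + s) = f1 s" unfolding f1_def lo[OF b(1)] lo[OF b(2)] \<alpha>(2) \<theta>\<mu> by (simp add: algebra_simps)
    show "g2 (1 + s) = g2 s" unfolding g2_def hi[OF b(7)] hi[OF b(8)] lo[OF b(5)] lo[OF b(6)] by simp
    show "g1 (1 + s) = g1 s" unfolding g1_def hi[OF b(11)] hi[OF b(12)] lo[OF b(9)] lo[OF b(10)] by simp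
    have m: "m2 = 1 - 2 * \<alpha> - 6 * r" "m1 = 2 * \<alpha> - 6 * r" unfolding m2_def m1_def using \<alpha>(2) by linarith+
    show "U2 (1 + s) = U2 s" unfolding U2_def hi[OF b(7)] hi[OF b(8)] lo[OF b(5)] lo[OF b(6)] m
      by (simp add: algebra_simps)
    show "U1 (1 + s) = U1 s" unfolding U1_def hi[OF b(11)] hi[OF b(12)] lo[OF b(9)] lo[OF b(10)] m
      by (simp add: algebra_simps)
  qed
  have J01: "0 \<le> S (t - x) - S (t - y) \<and> S (t - x) - S (t - y) \<le> 1" if "x \<le> y" for t x y
    using monoD[OF S(5), of "t - y" "t - x"] S(4)[of "t - x"] S(4)[of "t - y"] that by simp
  have f2b: "\<mu>1 \<le> f2 t" "f2 t \<le> \<mu>2" for t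
  proof -
    have j: "0 \<le> S (t - \<alpha>) - S (t - (1 - \<alpha>))" "S (t - \<alpha>) - S (t - (1 - \<alpha>)) \<le> 1"
      using J01[of \<alpha> "1 - \<alpha>" t] \<alpha> \<theta> by linarith+
    show "\<mu>1 \<le> f2 t" unfolding f2_def using j(1) assms by simp
    have "(\<mu>2 - \<mu>1) * (S (t - \<alpha>) - S (t - (1 - \<alpha>))) \<le> (\<mu>2 - \<mu>1) * 1"
      using j(2) assms by (intro mult_left_mono) auto
    then show "f2 t \<le> \<mu>2" unfolding f2_def by simp
  qed
  have g1b: "0 \<le> g1 t" "g1 t \<le> 1" for t
    unfolding g1_def using J01[of "\<alpha> - 3 * r" "1 - \<alpha> + 3 * r" t] \<alpha> \<theta> r by linarith+
  have g2b: "0 \<le> g2 t" "g2 t \<le> 1" for t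
    unfolding g2_def using J01[of "\<alpha> + 3 * r" "1 - \<alpha> - 3 * r" t] \<alpha> \<theta> r by linarith+
  have sup2: "f2 (frac s) = \<mu>2" if "g2 (frac t) \<noteq> 0" "\<bar>s - t\<bar> < r" for s t
  proof -
    have "\<alpha> + 2 * r < frac t"
    proof (rule ccontr)
      assume "\<not> ?thesis"
      then have "g2 (frac t) = 0"
        unfolding g2_def using S(8)[of "frac t - (\<alpha> + 3 * r)"] S(8)[of "frac t - (1 - \<alpha> - 3 * r)"] r \<alpha> by simp
      then show False using that(1) by blast
    qed
    moreover have "frac t < 1 - \<alpha> - 2 * r"
    proof (rule ccontr)
      assume "\<not> ?thesis"
      then have "g2 (frac t) = 0"
        unfolding g2_def using S(9)[of "frac t - (\<alpha> + 3 * r)"] S(9)[of "frac t - (1 - \<alpha> - 3 * r)"] r \<alpha> by simp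
      then show False using that(1) by blast
    qed
    moreover have "frac s = frac t + (s - t)"
      by (rule frac_near[OF that(2)]) (use calculation r \<alpha> in linarith)+
    ultimately have "frac s - \<alpha> \<ge> r" "frac s - (1 - \<alpha>) \<le> - r" using that(2) by linarith+
    then show ?thesis unfolding f2_def using S(8)[of "frac s - (1 - \<alpha>)"] S(9)[of "frac s - \<alpha>"] by simp
  qed
  have sup1: "f2 (frac s) = \<mu>1" if "g1 (frac t) \<noteq> 0" "\<bar>s - t\<bar> < r" for s t
  proof (rule ccontr)
    assume ne: "f2 (frac s) \<noteq> \<mu>1"
    have "\<alpha> - r < frac s"
    proof (rule ccontr)
      assume "\<not> ?thesis"
      then have "f2 (frac s) = \<mu>1"
        unfolding f2_def using S(8)[of "frac s - \<alpha>"] S(8)[of "frac s - (1 - \<alpha>)"] r \<alpha> \<theta> by simp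
      then show False using ne by blast
    qed
    moreover have "frac s < 1 - \<alpha> + r"
    proof (rule ccontr)
      assume "\<not> ?thesis"
      then have "f2 (frac s) = \<mu>1"
        unfolding f2_def using S(9)[of "frac s - \<alpha>"] S(9)[of "frac s - (1 - \<alpha>)"] r \<alpha> \<theta> by simp
      then show False using ne by blast
    qed
    moreover have "frac t = frac s + (t - s)"
      by (rule frac_near[of t s r]) (use calculation that(2) r \<alpha> in linarith)+
    ultimately have "frac t - (\<alpha> - 3 * r) \<ge> r" "frac t - (1 - \<alpha> + 3 * r) \<le> - r" using that(2) by linarith+
    then have "g1 (frac t) = 0"
      unfolding g1_def using S(8)[of "frac t - (1 - \<alpha> + 3 * r)"] S(9)[of "frac t - (\<alpha> - 3 * r)"] by simp
    then show False using that(1) by blast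
  qed
  obtain C1 where C1: "\<And>t. \<bar>f0 (frac t)\<bar> \<le> C1" using periodize_bounded[OF smooth_continuous_on[OF smf(1)]] by blast
  obtain C2 where C2: "\<And>t. \<bar>f1 (frac t)\<bar> \<le> C2" using periodize_bounded[OF smooth_continuous_on[OF smf(2)]] by blast
  obtain C3 where C3: "\<And>t. \<bar>U1 (frac t)\<bar> \<le> C3" using periodize_bounded[OF smooth_continuous_on[OF smf(5)]] by blast
  obtain C4 where C4: "\<And>t. \<bar>U2 (frac t)\<bar> \<le> C4" using periodize_bounded[OF smooth_continuous_on[OF smf(6)]] by blast
  define C where "C = max (max C1 C2) (max C3 C4)"
  have CC: "C1 \<le> C" "C2 \<le> C" "C3 \<le> C" "C4 \<le> C" unfolding C_def by auto
  show ?thesis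
  proof (rule that[of "\<lambda>t. f0 (frac t)" "\<lambda>t. g1 (frac t)" "\<lambda>t. g2 (frac t)" "\<lambda>t. U1 (frac t)"
        "\<lambda>t. U2 (frac t)" "\<lambda>t. f1 (frac t)" "\<lambda>t. f2 (frac t)" C r m1 m2])
    show "smooth (\<lambda>t. f0 (frac t))" by (rule smooth_periodize[OF r(1) per(1) smf(1)])
    show "smooth (\<lambda>t. g1 (frac t))" by (rule smooth_periodize[OF r(1) per(3) smf(3)])
    show "smooth (\<lambda>t. g2 (frac t))" by (rule smooth_periodize[OF r(1) per(4) smf(4)])
    show "smooth (\<lambda>t. U1 (frac t))" by (rule smooth_periodize[OF r(1) per(5) smf(5)])
    show "smooth (\<lambda>t. U2 (frac t))" by (rule smooth_periodize[OF r(1) per(6) smf(6)])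
    show "((\<lambda>t. f0 (frac t)) has_real_derivative f1 (frac t)) (at t)" for t
      by (rule DERIV_periodize[OF r(1) per(1) df0])
    show "((\<lambda>t. f1 (frac t)) has_real_derivative f2 (frac t)) (at t)" for t
      by (rule DERIV_periodize[OF r(1) per(2) df1])
    show "((\<lambda>t. U1 (frac t)) has_real_derivative g1 (frac t) - m1) (at t)" for t
      by (rule DERIV_periodize[OF r(1) per(5) dU1])
    show "((\<lambda>t. U2 (frac t)) has_real_derivative g2 (frac t) - m2) (at t)" for t
      by (rule DERIV_periodize[OF r(1) per(6) dU2])
    show "\<bar>f0 (frac t)\<bar> \<le> C" for t using C1 CC(1) by (rule order_trans)
    show "\<bar>f1 (frac t)\<bar> \<le> C" for t using C2 CC(2) by (rule order_trans)
    show "\<bar>U1 (frac t)\<bar> \<le> C" for t using C3 CC(3) by (rule order_trans)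
    show "\<bar>U2 (frac t)\<bar> \<le> C" for t using C4 CC(4) by (rule order_trans)
    show "m1 \<ge> \<mu>2 / (\<mu>2 - \<mu>1) - \<epsilon>" unfolding m1_def \<theta>1[symmetric] using r by linarith
    show "m2 \<ge> - \<mu>1 / (\<mu>2 - \<mu>1) - \<epsilon>" unfolding m2_def \<theta>_def[symmetric] using r by linarith
  qed (use f2b g1b g2b r(1) sup1 sup2 in blast)+
qed

subsection \<open>\<open>D\<close>-affine functions\<close>

lemma D_affine_line:
  assumes "D_affine D f" "cone_of_directions D" "d \<in> D"
  shows "f (x + t *\<^sub>R d) = f x + t * (f (x + d) - f x)"
proof -
  define g where "g = (\<lambda>t. f (x + t *\<^sub>R d))"
  have c1: "convex_on UNIV g" unfolding g_def using assms D_convex_line unfolding D_affine_def by blast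
  have c2: "convex_on UNIV (\<lambda>t. - g t)"
    unfolding g_def using assms D_convex_line[of D "\<lambda>x. - f x"] unfolding D_affine_def by blast
  have aff: "g ((1 - s) * a + s * b) = (1 - s) * g a + s * g b" if "0 \<le> s" "s \<le> 1" for s a b
    using convex_onD[OF c1 that, of a b] convex_onD[OF c2 that, of a b] by simp
  have "g t = g 0 + t * (g 1 - g 0)"
  proof -
    consider "0 \<le> t \<and> t \<le> 1" | "t > 1" | "t < 0" by linarith
    then show ?thesis
    proof cases
      case 1
      then show ?thesis using aff[of t 0 1] by (simp add: algebra_simps)
    next
      case 2
      then have "g 1 = (1 - 1/t) * g 0 + (1/t) * g t" using aff[of "1/t" 0 t] by simp
      then have "t * g 1 = t * ((1 - 1/t) * g 0 + (1/t) * g t)" by simp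
      also have "\<dots> = (t - 1) * g 0 + g t" using 2 by (simp add: field_simps)
      finally show ?thesis by (simp add: algebra_simps)
    next
      case 3
      define s where "s = 1 / (1 - t)"
      have s: "0 \<le> s" "s \<le> 1" "s * (1 - t) = 1" unfolding s_def using 3 by auto
      have "(1 - s) * 1 + s * t = 0" using s(3) by (simp add: algebra_simps)
      then have "g 0 = (1 - s) * g 1 + s * g t" using aff[OF s(1,2), of 1 t] by simp
      then have "(1 - t) * g 0 = (1 - t) * ((1 - s) * g 1 + s * g t)" by simp
      also have "\<dots> = (1 - t) * g 1 - (s * (1 - t)) * g 1 + (s * (1 - t)) * g t" by (simp add: algebra_simps)
      finally show ?thesis unfolding s(3) by (simp add: algebra_simps)
    qed
  qed
  then show ?thesis unfolding g_def by simp
qed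

text \<open>Each coordinate of a basis contained in D enters affinely. The base point
  \<open>x\<close> is kept free in the induction because adding the coordinate \<open>k\<close>
  evaluates the shorter expression at \<open>x\<close> and at \<open>x + k\<close>.\<close>

lemma D_affine_smooth:
  fixes f :: "'v::fin_dim_normed \<Rightarrow> real"
  assumes "D_affine D f" "cone_of_directions D"
  shows "smooth f"
proof -
  obtain C where C: "C \<subseteq> D" "finite C" "independent C" "span C = UNIV"
    using cone_basis[OF assms(2)] by blast
  have "smooth (\<lambda>y. f (x + (\<Sum>b\<in>F. coord C b y *\<^sub>R b)))" if "finite F" "F \<subseteq> C" for F x
    using that
  proof (induction F arbitrary: x rule: finite_induct)
    case (insert k F)
    have sub: "F \<subseteq> C" and kD: "k \<in> D" using insert.prems C(1) by auto
    let ?g = "\<lambda>x y. f (x + (\<Sum>b\<in>F. coord C b y *\<^sub>R b))"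
    have "f (x + (\<Sum>b\<in>insert k F. coord C b y *\<^sub>R b)) = ?g x y + coord C k y * (?g (x + k) y - ?g x y)" for y
    proof -
      have "x + (\<Sum>b\<in>insert k F. coord C b y *\<^sub>R b) = (x + (\<Sum>b\<in>F. coord C b y *\<^sub>R b)) + coord C k y *\<^sub>R k"
        using insert.hyps by (simp add: algebra_simps)
      moreover have "x + (\<Sum>b\<in>F. coord C b y *\<^sub>R b) + k = (x + k) + (\<Sum>b\<in>F. coord C b y *\<^sub>R b)" by simp
      ultimately show ?thesis
        using D_affine_line[OF assms kD, of "x + (\<Sum>b\<in>F. coord C b y *\<^sub>R b)" "coord C k y"]
        by (simp only:)
    qed
    moreover have "smooth (\<lambda>y. ?g x y + coord C k y * (?g (x + k) y - ?g x y))"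
      by (intro smooth_add smooth_mult smooth_diff insert.IH[OF sub] smooth_bounded_linear bounded_linear_coord[OF C(3,4)])
    ultimately show ?case by simp
  qed simp
  from this[OF C(2) order_refl, of 0] show ?thesis by (simp add: coord_sum[OF C(3,4)])
qed

lemma D_affine_Hessian_vanishes:
  fixes f :: "'v::fin_dim_normed \<Rightarrow> real"
  assumes "D_affine D f" "cone_of_directions D" "d \<in> D"
  shows "dd d (dd d f) x = 0"
proof -
  have sm: "smooth f" by (rule D_affine_smooth[OF assms(1,2)])
  define c where "c = f (x + d) - f x"
  have eq: "(\<lambda>t. f (x + t *\<^sub>R d)) = (\<lambda>t. f x + t * c)"
    unfolding c_def using D_affine_line[OF assms] by blast
  have "((\<lambda>t. f x + t * c) has_real_derivative c) (at t)" for t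
    by (rule DERIV_cong, (rule DERIV_add DERIV_cmult_right DERIV_const DERIV_ident)+) simp
  then have 1: "dd d f (x + t *\<^sub>R d) = c" for t
    using DERIV_unique[OF DERIV_dd_line[OF smooth_differentiable[OF sm], of x d t]] unfolding eq by blast
  have "((\<lambda>t. c) has_real_derivative dd d (dd d f) (x + 0 *\<^sub>R d)) (at 0)"
    using DERIV_dd_line[where f="dd d f" and x=x and v=d and t=0, OF smooth_differentiable[OF smooth_dd[OF sm]]]
    by (simp only: 1)
  from DERIV_unique[OF this DERIV_const] show ?thesis by simp
qed

lemma bilinear_polarization:
  fixes f :: "'v::fin_dim_normed \<Rightarrow> real"
  assumes "smooth f"
  shows "2 * dd u (dd v f) x = dd (u + v) (dd (u + v) f) x - dd u (dd u f) x - dd v (dd v f) x"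
proof -
  have d: "dd w f differentiable (at x)" for w by (rule smooth_differentiable[OF smooth_dd[OF assms]])
  have "dd w (dd (u + v) f) x = dd w (dd u f) x + dd w (dd v f) x" for w
    using dd_commute[OF assms, of w] dd_linear_arg(1)[OF d] by simp
  then have "dd (u + v) (dd (u + v) f) x = dd u (dd u f) x + dd u (dd v f) x + (dd v (dd u f) x + dd v (dd v f) x)"
    using dd_linear_arg(1)[OF d, of u v] by (simp add: dd_linear_arg(1)[OF d])
  then show ?thesis using dd_commute[OF assms, of u v] by simp
qed

lemma Hessian_zero_affine:
  fixes f :: "'v::fin_dim_normed \<Rightarrow> real"
  assumes "smooth f" "\<And>x u. dd u (dd u f) x = 0"
  shows "affine_function f"
proof -
  have z: "dd u (dd v f) x = 0" for u v x using bilinear_polarization[OF assms(1), of u v x] assms(2) by simp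
  have const: "g y = g 0" if "\<And>y. g differentiable (at y)" "\<And>v y. dd v g y = 0" for g :: "'v \<Rightarrow> real" and y
    using mvt_line[of g "y" 0 0] that by simp
  have c: "dd v f y = dd v f 0" for v y
    by (rule const[OF smooth_differentiable[OF smooth_dd[OF assms(1)]] z])
  define l where "l = (\<lambda>v. dd v f 0)"
  have l: "linear l" unfolding l_def by (rule linear_dd[OF assms(1)])
  have bl: "bounded_linear l" by (rule linear_imp_bounded_linear[OF l])
  have dl: "(l has_derivative l) (at x)" for x by (rule bounded_linear_imp_has_derivative[OF bl])
  have der: "((\<lambda>x. f x - l x) has_derivative (\<lambda>v. dd v f x - l v)) (at x)" for x
    by (intro has_derivative_diff has_derivative_dd smooth_differentiable assms(1) dl)
  have aff: "f y - l y = f 0 - l 0" for y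
  proof (rule const[of "\<lambda>x. f x - l x"])
    show "(\<lambda>x. f x - l x) differentiable (at y)" for y using der differentiable_def by blast
    show "dd v (\<lambda>x. f x - l x) y = 0" for v y
    proof -
      have "dd v (\<lambda>x. f x - l x) y = dd v f y - l v" by (rule dd_eqI[OF der])
      also have "\<dots> = 0" unfolding c[of v y] l_def by (rule diff_self)
      finally show ?thesis .
    qed
  qed
  have "f y = l y + f 0" for y using aff[of y] linear_0[OF l] by linarith
  then have "f = (\<lambda>x. l x + f 0)" by (rule ext)
  then show ?thesis unfolding affine_function_def using l by blast
qed

text \<open>The form is the Hessian of \<open>f\<close> at a point where it does not vanish. The
  identity x y = ((x + y)^2 - (x - y)^2) / 4 writes it as a combination of squares of functionals,
  indexed by pairs of basis vectors and a sign.\<close>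

lemma nonaffine_D_affine_form:
  fixes f :: "'v::fin_dim_normed \<Rightarrow> real"
  assumes "D_affine D f" "cone_of_directions D" "\<not> affine_function f"
  shows "\<exists>(I :: (('v \<times> 'v) \<times> bool) set) a c e. finite I \<and> (\<forall>i. bounded_linear (a i)) \<and> norm (e :: 'v) = 1 \<and>
     (\<forall>d\<in>D. (\<Sum>i\<in>I. c i * (a i d)\<^sup>2) = 0) \<and> (\<Sum>i\<in>I. c i * (a i e)\<^sup>2) \<noteq> (0 :: real)"
proof -
  have sm: "smooth f" by (rule D_affine_smooth[OF assms(1,2)])
  obtain x u where xu: "dd u (dd u f) x \<noteq> 0" using Hessian_zero_affine[OF sm] assms(3) by blast
  have d: "dd w f differentiable (at x)" for w by (rule smooth_differentiable[OF smooth_dd[OF sm]])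
  obtain B :: "'v set" where B: "finite B" "independent B" "span B = UNIV"
    using ex_finite_basis by blast
  define Q where "Q = (\<lambda>u v. dd u (dd v f) x)"
  have Q1: "linear (\<lambda>u. Q u v)" for v unfolding Q_def by (rule linear_dd[OF smooth_dd[OF sm]])
  have Qsym: "Q u v = Q v u" for u v unfolding Q_def by (rule dd_commute[OF sm])
  have Q2: "linear (\<lambda>v. Q u v)" for u using Q1[of u] unfolding Qsym[of u] .
  define I where "I = (B \<times> B) \<times> (UNIV :: bool set)"
  define a where "a = (\<lambda>((b, b'), s). \<lambda>x. if s then coord B b x + coord B b' x else coord B b x - coord B b' x)"
  define c where "c = (\<lambda>((b, b'), s). if s then Q b b' / 4 else - Q b b' / 4)"
  have form: "(\<Sum>i\<in>I. c i * (a i y)\<^sup>2) = Q y y" for y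
  proof -
    have "Q y y = Q (\<Sum>b\<in>B. coord B b y *\<^sub>R b) (\<Sum>b'\<in>B. coord B b' y *\<^sub>R b')"
      by (simp add: coord_sum[OF B(2,3)])
    also have "\<dots> = (\<Sum>b\<in>B. \<Sum>b'\<in>B. coord B b y * (coord B b' y * Q b b'))"
      by (simp add: linear_sum[OF Q1] linear_scale[OF Q1] linear_sum[OF Q2] linear_scale[OF Q2] sum_distrib_left)
        (intro sum.cong refl, simp add: Qsym)
    also have "\<dots> = (\<Sum>p\<in>B \<times> B. coord B (fst p) y * (coord B (snd p) y * Q (fst p) (snd p)))"
      by (simp add: sum.cartesian_product case_prod_beta)
    also have "\<dots> = (\<Sum>p\<in>B \<times> B. \<Sum>s\<in>(UNIV :: bool set). c (p, s) * (a (p, s) y)\<^sup>2)"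
    proof (rule sum.cong[OF refl])
      fix p assume "p \<in> B \<times> B"
      obtain b b' where p: "p = (b, b')" by (cases p)
      show "coord B (fst p) y * (coord B (snd p) y * Q (fst p) (snd p)) = (\<Sum>s\<in>(UNIV :: bool set). c (p, s) * (a (p, s) y)\<^sup>2)"
        unfolding p c_def a_def UNIV_bool by (simp add: power2_eq_square field_simps)
    qed
    also have "\<dots> = (\<Sum>i\<in>I. c i * (a i y)\<^sup>2)"
      unfolding I_def by (simp add: sum.cartesian_product case_prod_beta)
    finally show ?thesis by simp
  qed
  have u0: "u \<noteq> 0"
  proof
    assume "u = 0"
    then have "Q u u = 0" using linear_0[OF Q1] by simp
    then show False using xu unfolding Q_def by blast
  qed
  define e where "e = u /\<^sub>R norm u"
  have Qe: "Q e e = (inverse (norm u) * inverse (norm u)) * Q u u"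
    unfolding e_def by (simp add: linear_scale[OF Q1] linear_scale[OF Q2])
  show ?thesis
  proof (intro exI conjI allI ballI)
    show "finite I" unfolding I_def using B(1) by simp
    show "bounded_linear (a i)" for i
      unfolding a_def by (cases i; cases "snd i") (auto intro!: bounded_linear_add bounded_linear_sub bounded_linear_coord[OF B(2,3)])
    show "norm e = 1" unfolding e_def using u0 by simp
    show "(\<Sum>i\<in>I. c i * (a i d)\<^sup>2) = 0" if "d \<in> D" for d
      unfolding form unfolding Q_def by (rule D_affine_Hessian_vanishes[OF assms(1,2) that])
    show "(\<Sum>i\<in>I. c i * (a i e)\<^sup>2) \<noteq> 0"
      unfolding form Qe using xu u0 unfolding Q_def by simp
  qed
qed

subsection \<open>Laminates\<close>

lemma dd2_add:
  assumes "smooth f" "smooth g"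
  shows "dd u (dd v (\<lambda>x. f x + g x)) x = dd u (dd v f) x + dd u (dd v g) x"
proof -
  have "dd v (\<lambda>x. f x + g x) = (\<lambda>x. dd v f x + dd v g x)"
    by (rule ext, rule dd_add) (rule smooth_differentiable assms)+
  then show ?thesis by (simp add: dd_add smooth_differentiable smooth_dd assms)
qed

lemma dd2_mult:
  assumes "smooth f" "smooth g"
  shows "dd u (dd v (\<lambda>x. f x * g x)) x =
    f x * dd u (dd v g) x + dd u f x * dd v g x + (dd v f x * dd u g x + dd u (dd v f) x * g x)"
proof -
  have "dd v (\<lambda>x. f x * g x) = (\<lambda>x. f x * dd v g x + dd v f x * g x)"
    by (rule ext, rule dd_mult) (rule smooth_differentiable assms)+
  then have "dd u (dd v (\<lambda>x. f x * g x)) x = dd u (\<lambda>x. f x * dd v g x) x + dd u (\<lambda>x. dd v f x * g x) x"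
    by (simp add: dd_add smooth_differentiable smooth_dd smooth_mult assms)
  then show ?thesis by (simp add: dd_mult smooth_differentiable smooth_dd assms)
qed

lemma dd_cmult: "f differentiable (at x) \<Longrightarrow> dd v (\<lambda>x. c * f x) x = c * dd v f x"
  by (rule dd_eqI) (intro has_derivative_mult_right has_derivative_dd)

lemma dd2_cmult:
  assumes "smooth f"
  shows "dd u (dd v (\<lambda>x. c * f x)) x = c * dd u (dd v f) x"
proof -
  have "dd v (\<lambda>x. c * f x) = (\<lambda>x. c * dd v f x)"
    by (rule ext, rule dd_cmult) (rule smooth_differentiable assms)+
  then show ?thesis by (simp add: dd_cmult smooth_differentiable smooth_dd assms)
qed

lemma dd_plane_wave:
  fixes a :: "'v::real_normed_vector \<Rightarrow> real" and w :: "real \<Rightarrow> real"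
  assumes "bounded_linear a" "\<And>t. (w has_real_derivative w1 t) (at t)"
  shows "dd v (\<lambda>y. w (a y / \<delta>)) y = w1 (a y / \<delta>) * (a v / \<delta>)"
proof -
  have "((\<lambda>y. a y / \<delta>) has_derivative (\<lambda>v. a v / \<delta>)) (at y)"
    by (rule bounded_linear_imp_has_derivative)
      (use bounded_linear_const_mult[OF assms(1), of "1 / \<delta>"] in simp)
  from has_derivative_compose[OF this assms(2)[unfolded has_field_derivative_def]]
  show ?thesis by (rule dd_eqI)
qed

lemma smooth_plane_wave:
  fixes a :: "'v::real_normed_vector \<Rightarrow> real" and w :: "real \<Rightarrow> real"
  assumes "bounded_linear a" "smooth w"
  shows "smooth (\<lambda>y. w (a y / \<delta>))"
  by (rule smooth_compose[OF assms(2)], rule smooth_bounded_linear)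
    (use bounded_linear_const_mult[OF assms(1), of "1 / \<delta>"] in simp)

text \<open>Up to the factor \<delta>, the oscillating part
  \<open>\<xi> (a y / \<delta>) - m\<close> is the derivative in direction \<open>b\<close> of the
  bounded function \<open>u (a y / \<delta>)\<close>; integrating by parts moves this derivative to
  \<eta>.\<close>

lemma (in basis_space) plane_wave_average:
  fixes a :: "'v \<Rightarrow> real" and u \<xi> :: "real \<Rightarrow> real"
  assumes a: "bounded_linear a" "a b = 1" and u: "smooth u" "\<And>t. (u has_real_derivative \<xi> t - m) (at t)"
    and C: "\<And>t. \<bar>u t\<bar> \<le> C" and \<xi>: "smooth \<xi>" and \<eta>: "\<eta> \<in> test_functions U" and \<delta>: "0 < \<delta>"
  shows "\<bar>(LINT y|L. \<eta> y * \<xi> (a y / \<delta>)) - m * (LINT y|L. \<eta> y)\<bar> \<le> \<delta> * (C * (LINT y|L. \<bar>dd b \<eta> y\<bar>))"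
proof -
  define g where "g = (\<lambda>y. u (a y / \<delta>))"
  have gsm: "smooth g" unfolding g_def by (rule smooth_plane_wave[OF a(1) u(1)])
  have dg: "dd b g y = (\<xi> (a y / \<delta>) - m) / \<delta>" for y
    unfolding g_def dd_plane_wave[OF a(1) u(2)] a(2) by simp
  have \<xi>sm: "smooth (\<lambda>y. \<xi> (a y / \<delta>))" by (rule smooth_plane_wave[OF a(1) \<xi>])
  have i1: "integrable L (\<lambda>y. \<xi> (a y / \<delta>) * \<eta> y)"
    by (rule integrable_cont_test[OF smooth_continuous_on[OF \<xi>sm] \<eta>])
  have i2: "integrable L \<eta>" by (rule integrable_test[OF \<eta>])
  have i3: "integrable L (\<lambda>y. g y * dd b \<eta> y)"
    by (rule integrable_cont_test[OF smooth_continuous_on[OF gsm] test_functions_dd[OF \<eta>]])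
  have "(LINT y|L. \<eta> y * \<xi> (a y / \<delta>)) - m * (LINT y|L. \<eta> y) = (LINT y|L. \<xi> (a y / \<delta>) * \<eta> y - m * \<eta> y)"
    using i1 i2 by (simp add: mult.commute)
  also have "\<dots> = (LINT y|L. \<delta> * (dd b g y * \<eta> y))"
  proof (rule Bochner_Integration.integral_cong[OF refl])
    fix y
    have "\<delta> * (c / \<delta> * h) = c * h" for c h using \<delta> by simp
    from this[of "\<xi> (a y / \<delta>) - m" "\<eta> y"]
    show "\<xi> (a y / \<delta>) * \<eta> y - m * \<eta> y = \<delta> * (dd b g y * \<eta> y)"
      unfolding dg left_diff_distrib by (rule sym)
  qed
  also have "\<dots> = \<delta> * (LINT y|L. dd b g y * \<eta> y)" by simp
  also have "(LINT y|L. dd b g y * \<eta> y) = - (LINT y|L. g y * dd b \<eta> y)"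
    using integral_by_parts[OF gsm \<eta>, of b] by simp
  finally have eq: "(LINT y|L. \<eta> y * \<xi> (a y / \<delta>)) - m * (LINT y|L. \<eta> y) = - (\<delta> * (LINT y|L. g y * dd b \<eta> y))"
    by simp
  have "\<bar>LINT y|L. g y * dd b \<eta> y\<bar> \<le> (LINT y|L. \<bar>g y * dd b \<eta> y\<bar>)"
    using integral_norm_bound[of L "\<lambda>y. g y * dd b \<eta> y"] by simp
  also have "\<dots> \<le> (LINT y|L. C * \<bar>dd b \<eta> y\<bar>)"
  proof (rule integral_mono)
    show "integrable L (\<lambda>y. \<bar>g y * dd b \<eta> y\<bar>)" using i3 by (rule integrable_abs)
    show "integrable L (\<lambda>y. C * \<bar>dd b \<eta> y\<bar>)"
      by (intro integrable_mult_right integrable_abs integrable_test[OF test_functions_dd[OF \<eta>]])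
    show "\<bar>g y * dd b \<eta> y\<bar> \<le> C * \<bar>dd b \<eta> y\<bar>" for y
      unfolding abs_mult g_def by (intro mult_right_mono C) auto
  qed
  also have "\<dots> = C * (LINT y|L. \<bar>dd b \<eta> y\<bar>)" by simp
  finally show ?thesis unfolding eq using \<delta> by (simp add: abs_mult)
qed

section \<open>Perturbed quadratic forms and their achievable averages\<close>

locale quadratic_forms = basis_space B for B :: "'v::fin_dim_normed set" +
  fixes D :: "'v set" and I :: "'i set" and a :: "'i \<Rightarrow> 'v \<Rightarrow> real" and e :: 'v
  assumes finI: "finite I" and bl: "\<And>i. bounded_linear (a i)"
begin

definition Qf :: "('i \<Rightarrow> real) \<Rightarrow> 'v \<Rightarrow> real" where
  "Qf x d = (\<Sum>i\<in>I. x i * (a i d)\<^sup>2)"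

text \<open>Positivity is uniform: the margin \<kappa> absorbs the errors caused by cutting off a
  plane wave.\<close>

definition pos_on_D :: "('i \<Rightarrow> real) \<Rightarrow> bool" where
  "pos_on_D x \<longleftrightarrow> (\<exists>\<kappa>>0. \<forall>d\<in>D. \<kappa> * (norm d)\<^sup>2 \<le> Qf x d)"

text \<open>The bound \<open>M\<close> on second derivatives is a parameter separate from the
  smallness \<tau> of \<phi> and its gradient: plane waves of high frequency reduce \<tau> at a
  fixed \<open>M\<close>.\<close>

definition admissible :: "'v set \<Rightarrow> real \<Rightarrow> real \<Rightarrow> ('i \<Rightarrow> real) \<Rightarrow> ('v \<Rightarrow> real) \<Rightarrow> bool" where
  "admissible U \<tau> M x \<phi> \<longleftrightarrow> \<phi> \<in> test_functions U \<and>
     (\<forall>y. \<forall>d\<in>D. 0 \<le> Qf x d + dd d (dd d \<phi>) y) \<and> (\<forall>y. \<bar>\<phi> y\<bar> \<le> \<tau>) \<and>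
     (\<forall>y v. \<bar>dd v \<phi> y\<bar> \<le> \<tau> * norm v) \<and>
     (\<forall>y u v. \<bar>dd u (dd v \<phi>) y\<bar> \<le> M * norm u * norm v)"

text \<open>Optimizing over \<open>\<psi>\<close> turns the right-hand side into the \<open>\<eta>\<close>-weighted integral of
  \<open>\<bar>Qf x e + D\<^sup>2\<phi>(e,e)\<bar>\<close>. The weight \<open>\<eta>\<close> is arbitrary, so that competitors can be inserted into
  the strips of a laminate without any covering argument.\<close>

definition achieves :: "('i \<Rightarrow> real) \<Rightarrow> real \<Rightarrow> bool" where
  "achieves x t \<longleftrightarrow> (\<exists>M. \<forall>U \<eta> \<tau>. open U \<longrightarrow> \<eta> \<in> test_functions U \<longrightarrow> (\<forall>y. 0 \<le> \<eta> y \<and> \<eta> y \<le> 1) \<longrightarrow> 0 < \<tau> \<longrightarrow>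
     (\<exists>\<phi> \<psi>. admissible U \<tau> M x \<phi> \<and> \<psi> \<in> test_functions U \<and> (\<forall>y. \<bar>\<psi> y\<bar> \<le> \<eta> y) \<and>
        t * (LINT y|L. \<eta> y) \<le> (LINT y|L. \<psi> y * (Qf x e + dd e (dd e \<phi>) y))))"

lemma Qf_upd: "i \<in> I \<Longrightarrow> Qf (x(i := s)) d = Qf x d + (s - x i) * (a i d)\<^sup>2"
  unfolding Qf_def using finI by (simp add: sum.remove algebra_simps)

lemma Qf_scale: "Qf (\<lambda>i. r * x i) d = r * Qf x d"
  unfolding Qf_def by (simp add: sum_distrib_left mult_ac)

lemma Qf_add: "Qf (\<lambda>i. x i + y i) d = Qf x d + Qf y d"
  unfolding Qf_def by (simp add: sum.distrib algebra_simps)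

lemma Qf_cong: "(\<And>i. i \<in> I \<Longrightarrow> x i = y i) \<Longrightarrow> Qf x = Qf y"
  unfolding Qf_def by (intro ext sum.cong) auto

lemma admissible_zero:
  assumes "pos_on_D x" "0 < \<tau>"
  shows "admissible U \<tau> 0 x (\<lambda>_. 0)"
proof -
  have "0 \<le> Qf x d" if "d \<in> D" for d
    using assms(1) that unfolding pos_on_D_def
    by (meson less_imp_le mult_nonneg_nonneg order_trans zero_le_power2)
  then show ?thesis unfolding admissible_def using assms(2) by simp
qed

lemma integrable_value:
  assumes "smooth \<phi>" "\<psi> \<in> test_functions U"
  shows "integrable L (\<lambda>y. \<psi> y * (q + dd e (dd e \<phi>) y))"
proof -
  have "integrable L (\<lambda>y. (q + dd e (dd e \<phi>) y) * \<psi> y)"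
    by (rule integrable_cont_test[OF _ assms(2)])
      (intro continuous_on_add continuous_on_const smooth_continuous_on smooth_dd assms(1))
  then show ?thesis by (simp add: mult.commute)
qed

lemma achieves_trivial:
  assumes "pos_on_D x"
  shows "achieves x \<bar>Qf x e\<bar>"
  unfolding achieves_def
proof (intro exI[of _ 0] allI impI)
  fix U :: "'v set" and \<eta> :: "'v \<Rightarrow> real" and \<tau> :: real
  assume \<eta>: "\<eta> \<in> test_functions U" "\<forall>y. 0 \<le> \<eta> y \<and> \<eta> y \<le> 1" and \<tau>: "0 < \<tau>"
  define \<psi> where "\<psi> = (\<lambda>y. sgn (Qf x e) * \<eta> y)"
  have "\<psi> \<in> test_functions U" unfolding \<psi>_def by (rule test_functions_cmult[OF \<eta>(1)])
  moreover have "\<bar>\<psi> y\<bar> \<le> \<eta> y" for y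
    unfolding \<psi>_def abs_mult using \<eta>(2) by (simp add: abs_sgn_eq)
  moreover have "(LINT y|L. \<psi> y * (Qf x e + dd e (dd e (\<lambda>_. 0)) y)) = \<bar>Qf x e\<bar> * (LINT y|L. \<eta> y)"
  proof -
    have "(LINT y|L. \<psi> y * (Qf x e + dd e (dd e (\<lambda>_. 0)) y)) = (LINT y|L. \<bar>Qf x e\<bar> * \<eta> y)"
      unfolding \<psi>_def by (intro Bochner_Integration.integral_cong) (auto simp: abs_sgn mult_ac)
    then show ?thesis by simp
  qed
  ultimately show "\<exists>\<phi> \<psi>. admissible U \<tau> 0 x \<phi> \<and> \<psi> \<in> test_functions U \<and> (\<forall>y. \<bar>\<psi> y\<bar> \<le> \<eta> y) \<and>
        \<bar>Qf x e\<bar> * (LINT y|L. \<eta> y) \<le> (LINT y|L. \<psi> y * (Qf x e + dd e (dd e \<phi>) y))"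
    using admissible_zero[OF assms \<tau>] by (intro exI[of _ "\<lambda>_. 0"] exI[of _ \<psi>]) simp
qed

lemma integral_weight_nonneg:
  fixes \<eta> :: "'v \<Rightarrow> real"
  shows "(\<forall>y. 0 \<le> \<eta> y \<and> \<eta> y \<le> 1) \<Longrightarrow> 0 \<le> (LINT y|L. \<eta> y)"
  by (intro integral_nonneg_AE AE_I2) auto

lemma achieves_mono:
  assumes "achieves x t" "t' \<le> t"
  shows "achieves x t'"
proof -
  obtain M where M: "\<And>U \<eta> \<tau>. open U \<Longrightarrow> \<eta> \<in> test_functions U \<Longrightarrow> (\<forall>y. 0 \<le> \<eta> y \<and> \<eta> y \<le> 1) \<Longrightarrow> 0 < \<tau> \<Longrightarrow>
     (\<exists>\<phi> \<psi>. admissible U \<tau> M x \<phi> \<and> \<psi> \<in> test_functions U \<and> (\<forall>y. \<bar>\<psi> y\<bar> \<le> \<eta> y) \<and>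
        t * (LINT y|L. \<eta> y) \<le> (LINT y|L. \<psi> y * (Qf x e + dd e (dd e \<phi>) y)))"
    using assms(1) unfolding achieves_def by blast
  show ?thesis
    unfolding achieves_def
  proof (intro exI[of _ M] allI impI)
    fix U :: "'v set" and \<eta> :: "'v \<Rightarrow> real" and \<tau> :: real
    assume *: "open U" "\<eta> \<in> test_functions U" "\<forall>y. 0 \<le> \<eta> y \<and> \<eta> y \<le> 1" "0 < \<tau>"
    have "t' * (LINT y|L. \<eta> y) \<le> t * (LINT y|L. \<eta> y)"
      using assms(2) integral_weight_nonneg[OF *(3)] by (rule mult_right_mono)
    then show "\<exists>\<phi> \<psi>. admissible U \<tau> M x \<phi> \<and> \<psi> \<in> test_functions U \<and> (\<forall>y. \<bar>\<psi> y\<bar> \<le> \<eta> y) \<and>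
        t' * (LINT y|L. \<eta> y) \<le> (LINT y|L. \<psi> y * (Qf x e + dd e (dd e \<phi>) y))"
      using M[OF *] order_trans by blast
  qed
qed

lemma achieves_scale:
  assumes "achieves x t" "0 < r"
  shows "achieves (\<lambda>i. r * x i) (r * t)"
proof -
  obtain M where M: "\<And>U \<eta> \<tau>. open U \<Longrightarrow> \<eta> \<in> test_functions U \<Longrightarrow> (\<forall>y. 0 \<le> \<eta> y \<and> \<eta> y \<le> 1) \<Longrightarrow> 0 < \<tau> \<Longrightarrow>
     (\<exists>\<phi> \<psi>. admissible U \<tau> M x \<phi> \<and> \<psi> \<in> test_functions U \<and> (\<forall>y. \<bar>\<psi> y\<bar> \<le> \<eta> y) \<and>
        t * (LINT y|L. \<eta> y) \<le> (LINT y|L. \<psi> y * (Qf x e + dd e (dd e \<phi>) y)))"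
    using assms(1) unfolding achieves_def by blast
  show ?thesis
    unfolding achieves_def
  proof (intro exI[of _ "r * M"] allI impI)
    fix U :: "'v set" and \<eta> :: "'v \<Rightarrow> real" and \<tau> :: real
    assume *: "open U" "\<eta> \<in> test_functions U" "\<forall>y. 0 \<le> \<eta> y \<and> \<eta> y \<le> 1" "0 < \<tau>"
    have "0 < \<tau> / r" using *(4) assms(2) by simp
    from M[OF *(1-3) this] obtain \<phi> \<psi> where \<phi>: "admissible U (\<tau> / r) M x \<phi>" and \<psi>: "\<psi> \<in> test_functions U"
      "\<And>y. \<bar>\<psi> y\<bar> \<le> \<eta> y" "t * (LINT y|L. \<eta> y) \<le> (LINT y|L. \<psi> y * (Qf x e + dd e (dd e \<phi>) y))" by blast
    have \<phi>': "\<phi> \<in> test_functions U" "\<And>y d. d \<in> D \<Longrightarrow> 0 \<le> Qf x d + dd d (dd d \<phi>) y" "\<And>y. \<bar>\<phi> y\<bar> \<le> \<tau> / r"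
      "\<And>y v. \<bar>dd v \<phi> y\<bar> \<le> \<tau> / r * norm v" "\<And>y u v. \<bar>dd u (dd v \<phi>) y\<bar> \<le> M * norm u * norm v"
      using \<phi> unfolding admissible_def by blast+
    have sm: "smooth \<phi>" by (rule test_functionsD(1)[OF \<phi>'(1)])
    have d2: "dd u (dd v (\<lambda>y. r * \<phi> y)) y = r * dd u (dd v \<phi>) y" for u v y by (rule dd2_cmult[OF sm])
    have d1: "dd v (\<lambda>y. r * \<phi> y) y = r * dd v \<phi> y" for v y by (rule dd_cmult[OF smooth_differentiable[OF sm]])
    have "admissible U \<tau> (r * M) (\<lambda>i. r * x i) (\<lambda>y. r * \<phi> y)"
      unfolding admissible_def d1 d2 Qf_scale
    proof (intro conjI allI ballI)
      show "(\<lambda>y. r * \<phi> y) \<in> test_functions U" by (rule test_functions_cmult[OF \<phi>'(1)])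
      show "0 \<le> r * Qf x d + r * dd d (dd d \<phi>) y" if "d \<in> D" for y d
        using mult_nonneg_nonneg[OF less_imp_le[OF assms(2)] \<phi>'(2)[OF that, of y]] by (simp add: algebra_simps)
      show "\<bar>r * \<phi> y\<bar> \<le> \<tau>" for y using \<phi>'(3)[of y] assms(2) by (simp add: abs_mult field_simps)
      show "\<bar>r * dd v \<phi> y\<bar> \<le> \<tau> * norm v" for y v
        using mult_left_mono[OF \<phi>'(4)[of v y], of r] assms(2) by (simp add: abs_mult)
      show "\<bar>r * dd u (dd v \<phi>) y\<bar> \<le> r * M * norm u * norm v" for y u v
        using mult_left_mono[OF \<phi>'(5)[of u v y], of r] assms(2) by (simp add: abs_mult mult.assoc)
    qed
    moreover have "r * t * (LINT y|L. \<eta> y) \<le> (LINT y|L. \<psi> y * (Qf (\<lambda>i. r * x i) e + dd e (dd e (\<lambda>y. r * \<phi> y)) y))"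
    proof -
      have "(LINT y|L. \<psi> y * (Qf (\<lambda>i. r * x i) e + dd e (dd e (\<lambda>y. r * \<phi> y)) y))
          = (LINT y|L. r * (\<psi> y * (Qf x e + dd e (dd e \<phi>) y)))"
        unfolding d2 Qf_scale by (intro Bochner_Integration.integral_cong) (auto simp: algebra_simps)
      also have "\<dots> = r * (LINT y|L. \<psi> y * (Qf x e + dd e (dd e \<phi>) y))" by simp
      finally show ?thesis using mult_left_mono[OF \<psi>(3), of r] assms(2) by (simp add: mult.assoc)
    qed
    ultimately show "\<exists>\<phi> \<psi>. admissible U \<tau> (r * M) (\<lambda>i. r * x i) \<phi> \<and> \<psi> \<in> test_functions U \<and> (\<forall>y. \<bar>\<psi> y\<bar> \<le> \<eta> y) \<and>
        r * t * (LINT y|L. \<eta> y) \<le> (LINT y|L. \<psi> y * (Qf (\<lambda>i. r * x i) e + dd e (dd e \<phi>) y))"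
      using \<psi>(1,2) by blast
  qed
qed

text \<open>A perturbation admissible for \<open>x\<close> stays admissible for a form that is
  larger on D; only the value at \<open>e\<close> changes, by the difference of the forms. This
  bounds the averages of all bounded coefficient vectors by that of a single large form.\<close>

lemma achieves_compare:
  assumes "achieves x t" "\<And>d. d \<in> D \<Longrightarrow> Qf x d \<le> Qf z d"
  shows "achieves z (t - \<bar>Qf z e - Qf x e\<bar>)"
proof -
  obtain M where M: "\<And>U \<eta> \<tau>. open U \<Longrightarrow> \<eta> \<in> test_functions U \<Longrightarrow> (\<forall>y. 0 \<le> \<eta> y \<and> \<eta> y \<le> 1) \<Longrightarrow> 0 < \<tau> \<Longrightarrow>
     (\<exists>\<phi> \<psi>. admissible U \<tau> M x \<phi> \<and> \<psi> \<in> test_functions U \<and> (\<forall>y. \<bar>\<psi> y\<bar> \<le> \<eta> y) \<and>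
        t * (LINT y|L. \<eta> y) \<le> (LINT y|L. \<psi> y * (Qf x e + dd e (dd e \<phi>) y)))"
    using assms(1) unfolding achieves_def by blast
  show ?thesis
    unfolding achieves_def
  proof (intro exI[of _ M] allI impI)
    fix U :: "'v set" and \<eta> :: "'v \<Rightarrow> real" and \<tau> :: real
    assume *: "open U" "\<eta> \<in> test_functions U" "\<forall>y. 0 \<le> \<eta> y \<and> \<eta> y \<le> 1" "0 < \<tau>"
    from M[OF *] obtain \<phi> \<psi> where \<phi>: "admissible U \<tau> M x \<phi>" and \<psi>: "\<psi> \<in> test_functions U"
      "\<And>y. \<bar>\<psi> y\<bar> \<le> \<eta> y" "t * (LINT y|L. \<eta> y) \<le> (LINT y|L. \<psi> y * (Qf x e + dd e (dd e \<phi>) y))" by blast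
    have sm: "smooth \<phi>" using \<phi> test_functionsD(1) unfolding admissible_def by blast
    have "admissible U \<tau> M z \<phi>"
      using \<phi> assms(2) unfolding admissible_def by (meson add_right_mono order_trans)
    moreover have "(t - \<bar>Qf z e - Qf x e\<bar>) * (LINT y|L. \<eta> y) \<le> (LINT y|L. \<psi> y * (Qf z e + dd e (dd e \<phi>) y))"
    proof -
      define q where "q = Qf z e - Qf x e"
      have i1: "integrable L \<psi>" "integrable L \<eta>" by (rule integrable_test[OF \<psi>(1)], rule integrable_test[OF *(2)])
      have "(LINT y|L. \<psi> y * (Qf z e + dd e (dd e \<phi>) y)) = (LINT y|L. \<psi> y * (Qf x e + dd e (dd e \<phi>) y) + q * \<psi> y)"
        unfolding q_def by (intro Bochner_Integration.integral_cong) (auto simp: algebra_simps)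
      also have "\<dots> = (LINT y|L. \<psi> y * (Qf x e + dd e (dd e \<phi>) y)) + q * (LINT y|L. \<psi> y)"
        using integrable_value[OF sm \<psi>(1)] i1 by simp
      finally have eq: "(LINT y|L. \<psi> y * (Qf z e + dd e (dd e \<phi>) y)) =
          (LINT y|L. \<psi> y * (Qf x e + dd e (dd e \<phi>) y)) + q * (LINT y|L. \<psi> y)" .
      have "\<bar>LINT y|L. \<psi> y\<bar> \<le> (LINT y|L. \<bar>\<psi> y\<bar>)"
        using integral_norm_bound[of L \<psi>] by simp
      also have "\<dots> \<le> (LINT y|L. \<eta> y)" by (intro integral_mono integrable_abs i1 \<psi>(2))
      finally have "\<bar>q * (LINT y|L. \<psi> y)\<bar> \<le> \<bar>q\<bar> * (LINT y|L. \<eta> y)"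
        unfolding abs_mult by (rule mult_left_mono) simp
      then show ?thesis unfolding eq using \<psi>(3) unfolding q_def[symmetric] left_diff_distrib by linarith
    qed
    ultimately show "\<exists>\<phi> \<psi>. admissible U \<tau> M z \<phi> \<and> \<psi> \<in> test_functions U \<and> (\<forall>y. \<bar>\<psi> y\<bar> \<le> \<eta> y) \<and>
        (t - \<bar>Qf z e - Qf x e\<bar>) * (LINT y|L. \<eta> y) \<le> (LINT y|L. \<psi> y * (Qf z e + dd e (dd e \<phi>) y))"
      using \<psi>(1,2) by blast
  qed
qed

end

section \<open>Lamination: competitors inserted into the strips of a plane wave\<close>

context quadratic_forms
begin

text \<open>\<open>\<phi>0\<close> is a cut-off plane wave whose Hessian is \<mu>1 or \<mu>2 times
  the square of \<open>a i\<close> on the strips \<open>U1\<close> and \<open>U2\<close>, so that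
  the perturbed form there is exactly one of the two given forms. Their competitors are inserted in
  these strips, with the weights \<open>\<eta>1\<close> and \<open>\<eta>2\<close> in place of
  \<eta>. The strips carry nearly the weights of the convex combination, whence the value; elsewhere
  the margin \<kappa> keeps the form nonnegative on D.\<close>

lemma achieves_lamination_aux:
  assumes i: "i \<in> I" and \<mu>: "\<mu>1 < 0" "0 < \<mu>2" and b: "a i b = 1"
    and K1: "pos_on_D (x(i := x i + \<mu>1))" and K2: "pos_on_D (x(i := x i + \<mu>2))"
    and A1: "achieves (x(i := x i + \<mu>1)) t1" and A2: "achieves (x(i := x i + \<mu>2)) t2"
    and t0: "0 \<le> t1" "0 \<le> t2"
    and t: "t < \<mu>2 / (\<mu>2 - \<mu>1) * t1 + - \<mu>1 / (\<mu>2 - \<mu>1) * t2"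
  shows "achieves x t"
proof -
  let ?x1 = "x(i := x i + \<mu>1)" and ?x2 = "x(i := x i + \<mu>2)"
  have Q1: "Qf ?x1 d = Qf x d + \<mu>1 * (a i d)\<^sup>2" and Q2: "Qf ?x2 d = Qf x d + \<mu>2 * (a i d)\<^sup>2" for d
    using Qf_upd[OF i, of x _ d] by simp_all
  obtain M1 where M1: "\<And>U \<eta> \<tau>. open U \<Longrightarrow> \<eta> \<in> test_functions U \<Longrightarrow> (\<forall>y. 0 \<le> \<eta> y \<and> \<eta> y \<le> 1) \<Longrightarrow> 0 < \<tau> \<Longrightarrow>
     (\<exists>\<phi> \<psi>. admissible U \<tau> M1 ?x1 \<phi> \<and> \<psi> \<in> test_functions U \<and> (\<forall>y. \<bar>\<psi> y\<bar> \<le> \<eta> y) \<and>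
        t1 * (LINT y|L. \<eta> y) \<le> (LINT y|L. \<psi> y * (Qf ?x1 e + dd e (dd e \<phi>) y)))"
    using A1 unfolding achieves_def by blast
  obtain M2 where M2: "\<And>U \<eta> \<tau>. open U \<Longrightarrow> \<eta> \<in> test_functions U \<Longrightarrow> (\<forall>y. 0 \<le> \<eta> y \<and> \<eta> y \<le> 1) \<Longrightarrow> 0 < \<tau> \<Longrightarrow>
     (\<exists>\<phi> \<psi>. admissible U \<tau> M2 ?x2 \<phi> \<and> \<psi> \<in> test_functions U \<and> (\<forall>y. \<bar>\<psi> y\<bar> \<le> \<eta> y) \<and>
        t2 * (LINT y|L. \<eta> y) \<le> (LINT y|L. \<psi> y * (Qf ?x2 e + dd e (dd e \<phi>) y)))"
    using A2 unfolding achieves_def by blast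
  obtain \<kappa>1 where \<kappa>1: "\<kappa>1 > 0" "\<And>d. d \<in> D \<Longrightarrow> \<kappa>1 * (norm d)\<^sup>2 \<le> Qf x d + \<mu>1 * (a i d)\<^sup>2"
    using K1 unfolding pos_on_D_def Q1 by blast
  obtain \<kappa>2 where \<kappa>2: "\<kappa>2 > 0" "\<And>d. d \<in> D \<Longrightarrow> \<kappa>2 * (norm d)\<^sup>2 \<le> Qf x d + \<mu>2 * (a i d)\<^sup>2"
    using K2 unfolding pos_on_D_def Q2 by blast
  define \<kappa> where "\<kappa> = min \<kappa>1 \<kappa>2"
  have \<kappa>: "\<kappa> > 0" "\<kappa> \<le> \<kappa>1" "\<kappa> \<le> \<kappa>2" unfolding \<kappa>_def using \<kappa>1 \<kappa>2 by auto
  \<comment> \<open>Raising the coefficient of a square only increases the form, so the margin at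
    \<mu>1 serves every larger \<rho>.\<close>
  have seg: "\<kappa> * (norm d)\<^sup>2 \<le> Qf x d + \<rho> * (a i d)\<^sup>2" if d: "d \<in> D" and \<rho>: "\<mu>1 \<le> \<rho>" for d \<rho>
  proof -
    have "\<kappa> * (norm d)\<^sup>2 \<le> \<kappa>1 * (norm d)\<^sup>2" using \<kappa> by (intro mult_right_mono) auto
    moreover have "\<mu>1 * (a i d)\<^sup>2 \<le> \<rho> * (a i d)\<^sup>2" using \<rho> by (intro mult_right_mono) auto
    ultimately show ?thesis using \<kappa>1(2)[OF d] by linarith
  qed
  have K: "pos_on_D x" unfolding pos_on_D_def using \<kappa>(1) seg[of _ 0] \<mu> by auto
  define gap where "gap = \<mu>2 / (\<mu>2 - \<mu>1) * t1 + - \<mu>1 / (\<mu>2 - \<mu>1) * t2 - t"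
  have gap: "gap > 0" unfolding gap_def using t by simp
  \<comment> \<open>The profile may lose half of the gap; the other half is left for the averaging
    error of order \<delta>.\<close>
  define \<epsilon> where "\<epsilon> = gap / (2 * (t1 + t2 + 1))"
  have \<epsilon>: "\<epsilon> > 0" "\<epsilon> * (t1 + t2) \<le> gap / 2"
  proof -
    show "\<epsilon> > 0" unfolding \<epsilon>_def using gap t0 by simp
    have "\<epsilon> * (t1 + t2) \<le> \<epsilon> * (t1 + t2 + 1)" using \<open>\<epsilon> > 0\<close> by (intro mult_left_mono) auto
    also have "\<dots> = gap / 2"
    proof -
      have "gap / (2 * X) * X = gap / 2" if "X \<noteq> 0" for X using that by simp
      from this[of "t1 + t2 + 1"] show ?thesis unfolding \<epsilon>_def using t0 by linarith
    qed
    finally show "\<epsilon> * (t1 + t2) \<le> gap / 2" .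
  qed
  obtain w w1 w2 \<chi>1 \<chi>2 u1 u2 :: "real \<Rightarrow> real" and m1 m2 C r :: real where
    sm: "smooth w" "smooth \<chi>1" "smooth \<chi>2" "smooth u1" "smooth u2"
    and dw: "\<And>t. (w has_real_derivative w1 t) (at t)" "\<And>t. (w1 has_real_derivative w2 t) (at t)"
    and wC: "\<And>t. \<bar>w t\<bar> \<le> C" "\<And>t. \<bar>w1 t\<bar> \<le> C" and w2b: "\<And>t. \<mu>1 \<le> w2 t" "\<And>t. w2 t \<le> \<mu>2"
    and \<chi>b: "\<And>t. 0 \<le> \<chi>1 t" "\<And>t. \<chi>1 t \<le> 1" "\<And>t. 0 \<le> \<chi>2 t" "\<And>t. \<chi>2 t \<le> 1" and r: "0 < r"
    and supp: "\<And>t s. \<chi>1 t \<noteq> 0 \<Longrightarrow> \<bar>s - t\<bar> < r \<Longrightarrow> w2 s = \<mu>1"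
      "\<And>t s. \<chi>2 t \<noteq> 0 \<Longrightarrow> \<bar>s - t\<bar> < r \<Longrightarrow> w2 s = \<mu>2"
    and du: "\<And>t. (u1 has_real_derivative \<chi>1 t - m1) (at t)" "\<And>t. (u2 has_real_derivative \<chi>2 t - m2) (at t)"
    and uC: "\<And>t. \<bar>u1 t\<bar> \<le> C" "\<And>t. \<bar>u2 t\<bar> \<le> C"
    and m: "m1 \<ge> \<mu>2 / (\<mu>2 - \<mu>1) - \<epsilon>" "m2 \<ge> - \<mu>1 / (\<mu>2 - \<mu>1) - \<epsilon>"
  proof (rule lamination_profile[OF \<mu> \<epsilon>(1)], goal_cases)
    case (1 w w1 w2 \<chi>1 \<chi>2 u1 u2 m1 m2 C r)
    from 1(2-) show ?case by (rule 1(1)[of w \<chi>1 \<chi>2 u1 u2 w1 w2 C r m1 m2])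
  qed
  have C0: "0 \<le> C" using wC(1)[of 0] by linarith
  have mt: "t + gap / 2 \<le> m1 * t1 + m2 * t2"
  proof -
    have "(\<mu>2 / (\<mu>2 - \<mu>1) - \<epsilon>) * t1 \<le> m1 * t1" "(- \<mu>1 / (\<mu>2 - \<mu>1) - \<epsilon>) * t2 \<le> m2 * t2"
      using m t0 by (intro mult_right_mono; simp)+
    moreover have "(\<mu>2 / (\<mu>2 - \<mu>1) - \<epsilon>) * t1 + (- \<mu>1 / (\<mu>2 - \<mu>1) - \<epsilon>) * t2 = t + gap - \<epsilon> * (t1 + t2)"
      unfolding gap_def by (simp add: algebra_simps)
    ultimately show ?thesis using \<epsilon>(2) by linarith
  qed
  obtain A where A': "A > 0" "\<forall>v. norm (a i v) \<le> norm v * A"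
    using bounded_linear.pos_bounded[OF bl[of i]] by blast
  then have A: "A > 0" "\<bar>a i v\<bar> \<le> A * norm v" for v by (simp_all add: mult.commute)
  \<comment> \<open>First term: the plane wave; 1: the errors of the cut-off; the rest: the two
    competitors. Neither \<tau> nor \<open>U\<close> nor \<eta> enters.\<close>
  define M where "M = (\<bar>\<mu>1\<bar> + \<bar>\<mu>2\<bar>) * A * A + 1 + \<bar>M1\<bar> + \<bar>M2\<bar>"
  have M0: "0 \<le> M" unfolding M_def using A by simp
  show ?thesis
    unfolding achieves_def
  proof (intro exI[of _ M] allI impI)
    fix U :: "'v set" and \<eta> :: "'v \<Rightarrow> real" and \<tau> :: real
    assume U: "open U" and \<eta>: "\<eta> \<in> test_functions U" and \<eta>01: "\<forall>y. 0 \<le> \<eta> y \<and> \<eta> y \<le> 1" and \<tau>: "0 < \<tau>"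
    define J where "J = (LINT y|L. \<eta> y)"
    have J0: "0 \<le> J" unfolding J_def by (rule integral_weight_nonneg[OF \<eta>01])
    show "\<exists>\<phi> \<psi>. admissible U \<tau> M x \<phi> \<and> \<psi> \<in> test_functions U \<and> (\<forall>y. \<bar>\<psi> y\<bar> \<le> \<eta> y) \<and>
        t * (LINT y|L. \<eta> y) \<le> (LINT y|L. \<psi> y * (Qf x e + dd e (dd e \<phi>) y))"
    proof (cases "J = 0")
      \<comment> \<open>The weight may integrate to 0, and then the bound on \<rho> below would
        leave no positive choice; the zero perturbation is enough.\<close>
      case True
      have "admissible U \<tau> M x (\<lambda>_. 0)"
        using admissible_zero[OF K \<tau>] M0 unfolding admissible_def by simp
      then show ?thesis
        using True \<eta>01 unfolding J_def by (intro exI[of _ "\<lambda>_. 0"]) simp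
    next
      case False
      then have Jpos: "J > 0" using J0 by simp
      obtain \<zeta> W0 where \<zeta>: "\<zeta> \<in> test_functions U" "\<And>y. 0 \<le> \<zeta> y" "\<And>y. \<zeta> y \<le> 1"
        and W0: "open W0" "tsupp \<eta> \<subseteq> W0" "\<And>y. y \<in> W0 \<Longrightarrow> \<zeta> y = 1"
        using smooth_Urysohn[OF test_functionsD(2)[OF \<eta>] U test_functionsD(3)[OF \<eta>]] by blast
      define W where "W = W0 \<inter> U"
      have W: "open W" "tsupp \<eta> \<subseteq> W" "W \<subseteq> U" "\<And>y. y \<in> W \<Longrightarrow> \<zeta> y = 1"
        unfolding W_def using W0 U test_functionsD(3)[OF \<eta>] by auto
      have \<zeta>sm: "smooth \<zeta>" by (rule test_functionsD(1)[OF \<zeta>(1)])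
      have \<zeta>W1: "dd v \<zeta> y = 0" if "y \<in> W" for v y using dd_vanish[OF W(1) that W(4)] .
      have \<zeta>W2: "dd u (dd v \<zeta>) y = 0" if "y \<in> W" for u v y using dd_vanish[OF W(1) that \<zeta>W1] .
      obtain C1 where C1: "C1 \<ge> 0" "\<And>y v. \<bar>dd v \<zeta> y\<bar> \<le> C1 * norm v"
        using test_functions_dd_bound[OF \<zeta>(1)] by blast
      obtain C2 where C2: "C2 \<ge> 0" "\<And>y u v. \<bar>dd u (dd v \<zeta>) y\<bar> \<le> C2 * norm u * norm v"
        using test_functions_dd2_bound[OF \<zeta>(1)] by blast
      define N where "N = (LINT y|L. \<bar>dd b \<eta> y\<bar>)"
      have N0: "0 \<le> N" unfolding N_def by (intro integral_nonneg_AE AE_I2) auto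
      \<comment> \<open>\<open>P\<close> collects the constants of the four error estimates
        \<open>s1\<close> to \<open>s4\<close>, so that one choice of \<delta> settles all of
        them.\<close>
      define P where "P = C + (C1 * C + C * A) + (C2 * C + 2 * C1 * C * A) + C * N * (t1 + t2) + 1"
      have Pparts: "0 \<le> C1 * C" "0 \<le> C * A" "0 \<le> C2 * C" "0 \<le> 2 * C1 * C * A" "0 \<le> C * N * (t1 + t2)"
        using C0 C1(1) C2(1) A(1) N0 t0 by auto
      have P: "1 \<le> P" unfolding P_def using Pparts C0 by linarith
      \<comment> \<open>Errors below \<tau>/3 leave room for the two competitors, below 1 they fit
        into \<open>M\<close>, below \<kappa> they keep the form nonnegative, and the last entry
        protects the average.\<close>
      define \<rho> where "\<rho> = min (\<tau> / 3) (min (min 1 \<kappa>) (gap / 2 * J))"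
      have \<rho>: "0 < \<rho>" "\<rho> \<le> \<tau> / 3" "\<rho> \<le> 1" "\<rho> \<le> \<kappa>" "\<rho> \<le> gap / 2 * J"
        unfolding \<rho>_def using \<tau> \<kappa> gap Jpos by auto
      define \<delta> where "\<delta> = min 1 (\<rho> / P)"
      have \<delta>: "0 < \<delta>" "\<delta> \<le> 1" unfolding \<delta>_def using \<rho>(1) P by auto
      have \<delta>P: "\<delta> * P \<le> \<rho>"
      proof -
        have "\<delta> \<le> \<rho> / P" unfolding \<delta>_def by simp
        then show ?thesis using P by (simp add: pos_le_divide_eq)
      qed
      have small: "\<delta> * c \<le> \<rho>" if "c \<le> P" for c
        using mult_left_mono[OF that, of \<delta>] \<delta>(1) \<delta>P by linarith
      have \<delta>sq: "\<delta> * \<delta> * c \<le> \<delta> * c" if "0 \<le> c" for c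
        using mult_right_mono[OF mult_left_le_one_le[of \<delta> \<delta>] that] \<delta> by simp
      have s1: "\<delta> * \<delta> * C \<le> \<rho>"
        using \<delta>sq[OF C0] small[of C] Pparts unfolding P_def by linarith
      have s2: "\<delta> * \<delta> * (C1 * C) + \<delta> * (C * A) \<le> \<rho>"
        using \<delta>sq[OF Pparts(1)] small[of "C1 * C + C * A"] Pparts C0 unfolding P_def by (simp add: distrib_left)
      have s3: "\<delta> * \<delta> * (C2 * C) + \<delta> * (2 * C1 * C * A) \<le> \<rho>"
        using \<delta>sq[OF Pparts(3)] small[of "C2 * C + 2 * C1 * C * A"] Pparts C0 unfolding P_def by (simp add: distrib_left)
      have s4: "\<delta> * (C * N * (t1 + t2)) \<le> gap / 2 * J"
        using small[of "C * N * (t1 + t2)"] Pparts C0 \<rho>(5) unfolding P_def by linarith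
      define g where "g = (\<lambda>y. w (a i y / \<delta>))"
      have gsm: "smooth g" unfolding g_def by (rule smooth_plane_wave[OF bl sm(1)])
      have dg: "dd v g y = w1 (a i y / \<delta>) * (a i v / \<delta>)" for v y
        unfolding g_def by (rule dd_plane_wave[OF bl dw(1)])
      have ddg: "dd u (dd v g) y = w2 (a i y / \<delta>) * (a i u / \<delta>) * (a i v / \<delta>)" for u v y
      proof -
        have w1d: "(\<lambda>y. w1 (a i y / \<delta>)) differentiable (at y)"
        proof -
          have "((\<lambda>y. a i y / \<delta>) has_derivative (\<lambda>v. a i v / \<delta>)) (at y)"
            by (rule bounded_linear_imp_has_derivative)
              (use bounded_linear_const_mult[OF bl[of i], of "1 / \<delta>"] in simp)
          from has_derivative_compose[OF this dw(2)[unfolded has_field_derivative_def]]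
          show ?thesis unfolding differentiable_def by blast
        qed
        have "dd v g = (\<lambda>y. (a i v / \<delta>) * w1 (a i y / \<delta>))" using dg by (auto simp: mult.commute)
        then have "dd u (dd v g) y = (a i v / \<delta>) * dd u (\<lambda>y. w1 (a i y / \<delta>)) y"
          using dd_cmult[OF w1d, of u "a i v / \<delta>"] by simp
        also have "dd u (\<lambda>y. w1 (a i y / \<delta>)) y = w2 (a i y / \<delta>) * (a i u / \<delta>)"
          by (rule dd_plane_wave[OF bl dw(2)])
        finally show ?thesis by simp
      qed
      \<comment> \<open>With \<delta>^2 in front the function is O(\<delta>^2), its gradient
        O(\<delta>) and its Hessian of order 1.\<close>
      define \<phi>0 where "\<phi>0 = (\<lambda>y. \<delta> * \<delta> * (\<zeta> y * g y))"
      have \<phi>0: "\<phi>0 \<in> test_functions U"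
        unfolding \<phi>0_def by (intro test_functions_cmult test_functions_mult_right[OF \<zeta>(1) gsm])
      have d\<phi>0: "dd v \<phi>0 y = \<delta> * \<delta> * (dd v \<zeta> y * g y) + \<delta> * (\<zeta> y * w1 (a i y / \<delta>) * a i v)" for v y
      proof -
        have "dd v \<phi>0 y = \<delta> * \<delta> * (\<zeta> y * dd v g y + dd v \<zeta> y * g y)"
          unfolding \<phi>0_def
          by (simp add: dd_cmult dd_mult smooth_differentiable smooth_mult gsm \<zeta>sm)
        moreover have "\<delta> * \<delta> * (z * (W * (c / \<delta>))) = \<delta> * (z * W * c)" for z W c
          using \<delta>(1) by (simp add: field_simps)
        ultimately show ?thesis unfolding dg distrib_left by simp
      qed
      have dd\<phi>0: "dd u (dd v \<phi>0) y = \<zeta> y * w2 (a i y / \<delta>) * (a i u * a i v) +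
          (\<delta> * \<delta> * (dd u (dd v \<zeta>) y * g y) + \<delta> * (w1 (a i y / \<delta>) * (dd u \<zeta> y * a i v + dd v \<zeta> y * a i u)))" for u v y
      proof -
        have "dd u (dd v \<phi>0) y = \<delta> * \<delta> * (\<zeta> y * dd u (dd v g) y + dd u \<zeta> y * dd v g y + (dd v \<zeta> y * dd u g y + dd u (dd v \<zeta>) y * g y))"
          unfolding \<phi>0_def using dd2_cmult[OF smooth_mult[OF \<zeta>sm gsm], of u v "\<delta> * \<delta>" y] dd2_mult[OF \<zeta>sm gsm, of u v y] by simp
        moreover have "\<delta> * \<delta> * (z * (W * (p / \<delta>))) = \<delta> * (W * (z * p))"
          "\<delta> * \<delta> * (z * (W * (p / \<delta>) * (q / \<delta>))) = z * W * (p * q)" for z W p q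
          using \<delta>(1) by (simp_all add: field_simps)
        ultimately show ?thesis unfolding dg ddg distrib_left by simp
      qed
      have err: "\<bar>\<delta> * \<delta> * (dd u (dd v \<zeta>) y * g y) + \<delta> * (w1 (a i y / \<delta>) * (dd u \<zeta> y * a i v + dd v \<zeta> y * a i u))\<bar>
          \<le> \<rho> * (norm u * norm v)" for u v y
      proof -
        have e1: "\<bar>dd u (dd v \<zeta>) y * g y\<bar> \<le> (C2 * norm u * norm v) * C"
          unfolding abs_mult g_def using C2 wC(1) by (intro mult_mono) auto
        have "\<bar>dd u \<zeta> y * a i v\<bar> \<le> (C1 * norm u) * (A * norm v)" "\<bar>dd v \<zeta> y * a i u\<bar> \<le> (C1 * norm v) * (A * norm u)"
          unfolding abs_mult using C1 A by (intro mult_mono; simp)+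
        then have "\<bar>dd u \<zeta> y * a i v + dd v \<zeta> y * a i u\<bar> \<le> 2 * C1 * A * (norm u * norm v)"
          using abs_triangle_ineq[of "dd u \<zeta> y * a i v" "dd v \<zeta> y * a i u"] by (simp add: algebra_simps)
        then have e2: "\<bar>w1 (a i y / \<delta>) * (dd u \<zeta> y * a i v + dd v \<zeta> y * a i u)\<bar> \<le> C * (2 * C1 * A * (norm u * norm v))"
          unfolding abs_mult[of "w1 _"] using wC(2) C0 by (intro mult_mono) auto
        have "\<bar>\<delta> * \<delta> * (dd u (dd v \<zeta>) y * g y) + \<delta> * (w1 (a i y / \<delta>) * (dd u \<zeta> y * a i v + dd v \<zeta> y * a i u))\<bar>
          \<le> \<delta> * \<delta> * \<bar>dd u (dd v \<zeta>) y * g y\<bar> + \<delta> * \<bar>w1 (a i y / \<delta>) * (dd u \<zeta> y * a i v + dd v \<zeta> y * a i u)\<bar>"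
          using abs_triangle_ineq[of "\<delta> * \<delta> * (dd u (dd v \<zeta>) y * g y)" "\<delta> * (w1 (a i y / \<delta>) * (dd u \<zeta> y * a i v + dd v \<zeta> y * a i u))"] \<delta>(1)
          by (simp add: abs_mult)
        also have "\<dots> \<le> \<delta> * \<delta> * ((C2 * norm u * norm v) * C) + \<delta> * (C * (2 * C1 * A * (norm u * norm v)))"
          using e1 e2 \<delta>(1) by (intro add_mono mult_left_mono) auto
        also have "\<dots> = (\<delta> * \<delta> * (C2 * C) + \<delta> * (2 * C1 * C * A)) * (norm u * norm v)"
          by (simp add: algebra_simps)
        also have "\<dots> \<le> \<rho> * (norm u * norm v)" by (rule mult_right_mono[OF s3]) simp
        finally show ?thesis .
      qed
      \<comment> \<open>The points whose phase is within \<open>r\<close> of a phase where \<chi>1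
        is nonzero: an open union of strips on which \<open>w2\<close> is still constant.\<close>
      define O1 where "O1 = (\<Union>z\<in>{z. \<chi>1 z \<noteq> 0}. {y. \<bar>a i y / \<delta> - z\<bar> < r})"
      define O2 where "O2 = (\<Union>z\<in>{z. \<chi>2 z \<noteq> 0}. {y. \<bar>a i y / \<delta> - z\<bar> < r})"
      have cont_a: "continuous_on UNIV (\<lambda>y. \<bar>a i y / \<delta> - z\<bar>)" for z
        using linear_continuous_on[OF bl[of i]] \<delta>(1) by (intro continuous_intros) auto
      have opz: "open {y. \<bar>a i y / \<delta> - z\<bar> < r}" for z
        by (rule open_Collect_less[OF cont_a continuous_on_const])
      have O12: "open O1" "open O2" unfolding O1_def O2_def by (intro open_UN ballI opz)+
      have w2O: "y \<in> O1 \<Longrightarrow> w2 (a i y / \<delta>) = \<mu>1" "y \<in> O2 \<Longrightarrow> w2 (a i y / \<delta>) = \<mu>2" for y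
        unfolding O1_def O2_def using supp by blast+
      define U1 where "U1 = W \<inter> O1"
      define U2 where "U2 = W \<inter> O2"
      have opU: "open U1" "open U2" unfolding U1_def U2_def using W(1) O12 by auto
      have U12U: "U1 \<subseteq> U" "U2 \<subseteq> U" unfolding U1_def U2_def using W(3) by auto
      have disj: "y \<in> U1 \<Longrightarrow> y \<notin> U2" for y
        using w2O \<mu> unfolding U1_def U2_def by force
      \<comment> \<open>The closed support of the new weight must lie in the open strips. The margin
        \<open>r\<close> gives this, since in phase a limit of points with \<xi> nonzero is within
        \<open>r\<close> of one of them.\<close>
      have test_j: "(\<lambda>y. \<eta> y * \<xi> (a i y / \<delta>)) \<in> test_functions (W \<inter> (\<Union>z\<in>{z. \<xi> z \<noteq> 0}. {y. \<bar>a i y / \<delta> - z\<bar> < r}))"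
        if \<xi>: "smooth \<xi>" for \<xi> :: "real \<Rightarrow> real"
      proof (rule test_functionsI)
        let ?S = "{y. \<xi> (a i y / \<delta>) \<noteq> 0}"
        show "smooth (\<lambda>y. \<eta> y * \<xi> (a i y / \<delta>))"
          by (intro smooth_mult test_functionsD(1)[OF \<eta>] smooth_plane_wave[OF bl \<xi>])
        show "compact (tsupp \<eta> \<inter> closure ?S)"
          by (intro compact_Int_closed test_functionsD(2)[OF \<eta>] closed_closure)
        show "tsupp \<eta> \<inter> closure ?S \<subseteq> W \<inter> (\<Union>z\<in>{z. \<xi> z \<noteq> 0}. {y. \<bar>a i y / \<delta> - z\<bar> < r})"
        proof
          fix y assume y: "y \<in> tsupp \<eta> \<inter> closure ?S"
          have "y \<in> {y'. \<bar>a i y' / \<delta> - a i y / \<delta>\<bar> < r}" using r by simp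
          then have "{y'. \<bar>a i y' / \<delta> - a i y / \<delta>\<bar> < r} \<inter> closure ?S \<noteq> {}" using y by blast
          then have "{y'. \<bar>a i y' / \<delta> - a i y / \<delta>\<bar> < r} \<inter> ?S \<noteq> {}"
            using open_Int_closure_eq_empty[OF opz] by blast
          then obtain y' where y': "\<bar>a i y' / \<delta> - a i y / \<delta>\<bar> < r" "\<xi> (a i y' / \<delta>) \<noteq> 0" by blast
          then have "\<bar>a i y / \<delta> - a i y' / \<delta>\<bar> < r" by (simp add: abs_minus_commute)
          then show "y \<in> W \<inter> (\<Union>z\<in>{z. \<xi> z \<noteq> 0}. {y. \<bar>a i y / \<delta> - z\<bar> < r})"
            using y y'(2) W(2) by blast
        qed
        show "\<eta> y * \<xi> (a i y / \<delta>) = 0" if "y \<notin> tsupp \<eta> \<inter> closure ?S" for y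
        proof (cases "y \<in> tsupp \<eta>")
          case True
          then have "y \<notin> ?S" using that closure_subset[of ?S] by blast
          then show ?thesis by simp
        next
          case False
          then show ?thesis by (simp add: tsupp_zero)
        qed
      qed
      define \<eta>1 where "\<eta>1 = (\<lambda>y. \<eta> y * \<chi>1 (a i y / \<delta>))"
      define \<eta>2 where "\<eta>2 = (\<lambda>y. \<eta> y * \<chi>2 (a i y / \<delta>))"
      have t\<eta>: "\<eta>1 \<in> test_functions U1" "\<eta>2 \<in> test_functions U2"
        unfolding \<eta>1_def \<eta>2_def U1_def U2_def O1_def O2_def using test_j sm by blast+
      have \<eta>j01: "0 \<le> \<eta>1 y \<and> \<eta>1 y \<le> \<eta> y" "0 \<le> \<eta>2 y \<and> \<eta>2 y \<le> \<eta> y" for y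
        unfolding \<eta>1_def \<eta>2_def using \<eta>01 \<chi>b by (auto intro: mult_left_le)
      have \<eta>j1: "\<forall>y. 0 \<le> \<eta>1 y \<and> \<eta>1 y \<le> 1" "\<forall>y. 0 \<le> \<eta>2 y \<and> \<eta>2 y \<le> 1"
        using \<eta>j01 \<eta>01 order_trans by blast+
      have av1: "\<bar>(LINT y|L. \<eta>1 y) - m1 * J\<bar> \<le> \<delta> * (C * N)" "\<bar>(LINT y|L. \<eta>2 y) - m2 * J\<bar> \<le> \<delta> * (C * N)"
        unfolding \<eta>1_def \<eta>2_def J_def N_def
        by (rule plane_wave_average[OF bl b sm(4) du(1) uC(1) sm(2) \<eta> \<delta>(1)],
            rule plane_wave_average[OF bl b sm(5) du(2) uC(2) sm(3) \<eta> \<delta>(1)])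
      have \<tau>3: "0 < \<tau> / 3" using \<tau> by simp
      obtain \<phi>1 \<psi>1 where \<phi>1: "admissible U1 (\<tau> / 3) M1 ?x1 \<phi>1" and \<psi>1: "\<psi>1 \<in> test_functions U1"
        "\<And>y. \<bar>\<psi>1 y\<bar> \<le> \<eta>1 y" "t1 * (LINT y|L. \<eta>1 y) \<le> (LINT y|L. \<psi>1 y * (Qf ?x1 e + dd e (dd e \<phi>1) y))"
        using M1[OF opU(1) t\<eta>(1) \<eta>j1(1) \<tau>3] by blast
      obtain \<phi>2 \<psi>2 where \<phi>2: "admissible U2 (\<tau> / 3) M2 ?x2 \<phi>2" and \<psi>2: "\<psi>2 \<in> test_functions U2"
        "\<And>y. \<bar>\<psi>2 y\<bar> \<le> \<eta>2 y" "t2 * (LINT y|L. \<eta>2 y) \<le> (LINT y|L. \<psi>2 y * (Qf ?x2 e + dd e (dd e \<phi>2) y))"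
        using M2[OF opU(2) t\<eta>(2) \<eta>j1(2) \<tau>3] by blast
      have p1: "\<phi>1 \<in> test_functions U1" "\<And>y d. d \<in> D \<Longrightarrow> 0 \<le> Qf ?x1 d + dd d (dd d \<phi>1) y" "\<And>y. \<bar>\<phi>1 y\<bar> \<le> \<tau> / 3"
        "\<And>y v. \<bar>dd v \<phi>1 y\<bar> \<le> \<tau> / 3 * norm v" "\<And>y u v. \<bar>dd u (dd v \<phi>1) y\<bar> \<le> M1 * norm u * norm v"
        using \<phi>1 unfolding admissible_def by blast+
      have p2: "\<phi>2 \<in> test_functions U2" "\<And>y d. d \<in> D \<Longrightarrow> 0 \<le> Qf ?x2 d + dd d (dd d \<phi>2) y" "\<And>y. \<bar>\<phi>2 y\<bar> \<le> \<tau> / 3"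
        "\<And>y v. \<bar>dd v \<phi>2 y\<bar> \<le> \<tau> / 3 * norm v" "\<And>y u v. \<bar>dd u (dd v \<phi>2) y\<bar> \<le> M2 * norm u * norm v"
        using \<phi>2 unfolding admissible_def by blast+
      have sm012: "smooth \<phi>0" "smooth \<phi>1" "smooth \<phi>2"
        using test_functionsD(1) \<phi>0 p1(1) p2(1) by blast+
      define \<phi> where "\<phi> = (\<lambda>y. \<phi>0 y + (\<phi>1 y + \<phi>2 y))"
      define \<psi> where "\<psi> = (\<lambda>y. \<psi>1 y + \<psi>2 y)"
      have \<phi>t: "\<phi> \<in> test_functions U"
        unfolding \<phi>_def
        by (intro test_functions_add \<phi>0 test_functions_mono[OF p1(1) U12U(1)] test_functions_mono[OF p2(1) U12U(2)])
      have \<psi>t: "\<psi> \<in> test_functions U"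
        unfolding \<psi>_def
        by (intro test_functions_add test_functions_mono[OF \<psi>1(1) U12U(1)] test_functions_mono[OF \<psi>2(1) U12U(2)])
      have d\<phi>: "dd v \<phi> y = dd v \<phi>0 y + (dd v \<phi>1 y + dd v \<phi>2 y)" for v y
        unfolding \<phi>_def by (simp add: dd_add smooth_differentiable smooth_add sm012)
      have dd\<phi>: "dd u (dd v \<phi>) y = dd u (dd v \<phi>0) y + (dd u (dd v \<phi>1) y + dd u (dd v \<phi>2) y)" for u v y
        unfolding \<phi>_def using dd2_add[OF sm012(1) smooth_add[OF sm012(2,3)], of u v y] dd2_add[OF sm012(2,3), of u v y] by simp
      have out1: "dd u (dd v \<phi>1) y = 0" if "y \<notin> U1" for u v y
        using test_functionsD(4)[OF test_functions_dd[OF test_functions_dd[OF p1(1)]] that] .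
      have out2: "dd u (dd v \<phi>2) y = 0" if "y \<notin> U2" for u v y
        using test_functionsD(4)[OF test_functions_dd[OF test_functions_dd[OF p2(1)]] that] .
      \<comment> \<open>Here the cut-off equals 1 in a neighbourhood and \<open>w2\<close> is
        constant, so that no error term occurs, and the other competitor vanishes.\<close>
      have in1: "Qf x d + dd d (dd d \<phi>) y = Qf ?x1 d + dd d (dd d \<phi>1) y" if y: "y \<in> U1" for y d
      proof -
        have yW: "y \<in> W" and w2y: "w2 (a i y / \<delta>) = \<mu>1" using y w2O(1) unfolding U1_def by blast+
        have "dd d (dd d \<phi>0) y = \<mu>1 * (a i d)\<^sup>2"
          unfolding dd\<phi>0 w2y \<zeta>W1[OF yW] \<zeta>W2[OF yW] W(4)[OF yW] by (simp add: power2_eq_square)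
        then show ?thesis unfolding dd\<phi> Q1 using out2[OF disj[OF y]] by simp
      qed
      have in2: "Qf x d + dd d (dd d \<phi>) y = Qf ?x2 d + dd d (dd d \<phi>2) y" if y: "y \<in> U2" for y d
      proof -
        have yW: "y \<in> W" and w2y: "w2 (a i y / \<delta>) = \<mu>2" using y w2O(2) unfolding U2_def by blast+
        have y1: "y \<notin> U1" using disj y by blast
        have "dd d (dd d \<phi>0) y = \<mu>2 * (a i d)\<^sup>2"
          unfolding dd\<phi>0 w2y \<zeta>W1[OF yW] \<zeta>W2[OF yW] W(4)[OF yW] by (simp add: power2_eq_square)
        then show ?thesis unfolding dd\<phi> Q2 using out1[OF y1] by simp
      qed
      have pos: "0 \<le> Qf x d + dd d (dd d \<phi>) y" if d: "d \<in> D" for y d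
      proof -
        consider "y \<in> U1" | "y \<in> U2" | "y \<notin> U1" "y \<notin> U2" by blast
        then show ?thesis
        proof cases
          case 1
          show ?thesis unfolding in1[OF 1] by (rule p1(2)[OF d])
        next
          case 2
          show ?thesis unfolding in2[OF 2] by (rule p2(2)[OF d])
        next
          case 3
          \<comment> \<open>Since \<zeta> has values between 0 and 1 and \<mu>1 is negative, the
            effective coefficient never drops below \<mu>1.\<close>
          define c where "c = \<zeta> y * w2 (a i y / \<delta>)"
          have "\<mu>1 \<le> c"
          proof -
            have "\<zeta> y * \<mu>1 \<le> c" unfolding c_def by (intro mult_left_mono w2b \<zeta>(2))
            moreover have "\<mu>1 \<le> \<zeta> y * \<mu>1" using mult_right_mono_neg[OF \<zeta>(3)[of y], of \<mu>1] \<mu>(1) by simp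
            ultimately show ?thesis by linarith
          qed
          from seg[OF d this] have "\<kappa> * (norm d)\<^sup>2 \<le> Qf x d + c * (a i d)\<^sup>2" .
          moreover have "dd d (dd d \<phi>) y \<ge> c * (a i d)\<^sup>2 - \<rho> * (norm d)\<^sup>2"
            using err[of d d y] out1[OF 3(1), of d d] out2[OF 3(2), of d d]
            unfolding dd\<phi> dd\<phi>0 c_def power2_eq_square abs_le_iff by linarith
          moreover have "\<rho> * (norm d)\<^sup>2 \<le> \<kappa> * (norm d)\<^sup>2" by (rule mult_right_mono[OF \<rho>(4)]) simp
          ultimately show ?thesis by linarith
        qed
      qed
      have b0: "\<bar>\<phi>0 y\<bar> \<le> \<tau> / 3" for y
      proof -
        have "\<bar>\<zeta> y * g y\<bar> \<le> 1 * C"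
          unfolding abs_mult g_def using \<zeta>(2,3)[of y] wC(1) by (intro mult_mono) auto
        then have "\<bar>\<phi>0 y\<bar> \<le> \<delta> * \<delta> * C"
          unfolding \<phi>0_def using \<delta>(1) by (simp add: abs_mult)
        then show ?thesis using s1 \<rho>(2) by linarith
      qed
      have b1: "\<bar>dd v \<phi>0 y\<bar> \<le> \<tau> / 3 * norm v" for v y
      proof -
        have "\<bar>dd v \<zeta> y * g y\<bar> \<le> (C1 * norm v) * C"
          unfolding abs_mult g_def using C1 wC(1) by (intro mult_mono) auto
        moreover have "\<bar>\<zeta> y * w1 (a i y / \<delta>) * a i v\<bar> \<le> (1 * C) * (A * norm v)"
          unfolding abs_mult using \<zeta>(2,3)[of y] wC(2) A C0 by (intro mult_mono) auto
        ultimately have "\<delta> * \<delta> * \<bar>dd v \<zeta> y * g y\<bar> + \<delta> * \<bar>\<zeta> y * w1 (a i y / \<delta>) * a i v\<bar>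
            \<le> \<delta> * \<delta> * ((C1 * norm v) * C) + \<delta> * ((1 * C) * (A * norm v))"
          using \<delta>(1) by (intro add_mono mult_left_mono) auto
        also have "\<dots> = (\<delta> * \<delta> * (C1 * C) + \<delta> * (C * A)) * norm v" by (simp add: algebra_simps)
        also have "\<dots> \<le> \<tau> / 3 * norm v" using s2 \<rho>(2) by (intro mult_right_mono) auto
        finally have *: "\<delta> * \<delta> * \<bar>dd v \<zeta> y * g y\<bar> + \<delta> * \<bar>\<zeta> y * w1 (a i y / \<delta>) * a i v\<bar> \<le> \<tau> / 3 * norm v" .
        have "\<bar>dd v \<phi>0 y\<bar> \<le> \<bar>\<delta> * \<delta> * (dd v \<zeta> y * g y)\<bar> + \<bar>\<delta> * (\<zeta> y * w1 (a i y / \<delta>) * a i v)\<bar>"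
          unfolding d\<phi>0 by (rule abs_triangle_ineq)
        also have "\<dots> = \<delta> * \<delta> * \<bar>dd v \<zeta> y * g y\<bar> + \<delta> * \<bar>\<zeta> y * w1 (a i y / \<delta>) * a i v\<bar>"
          using \<delta>(1) abs_mult[of "\<delta> * \<delta>" "dd v \<zeta> y * g y"] abs_mult[of \<delta> "\<zeta> y * w1 (a i y / \<delta>) * a i v"] by simp
        finally show ?thesis using * by linarith
      qed
      have b2: "\<bar>dd u (dd v \<phi>0) y\<bar> \<le> ((\<bar>\<mu>1\<bar> + \<bar>\<mu>2\<bar>) * A * A + 1) * (norm u * norm v)" for u v y
      proof -
        have "\<bar>w2 (a i y / \<delta>)\<bar> \<le> \<bar>\<mu>1\<bar> + \<bar>\<mu>2\<bar>"
          using w2b(1)[of "a i y / \<delta>"] w2b(2)[of "a i y / \<delta>"] by linarith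
        then have "\<bar>\<zeta> y * w2 (a i y / \<delta>) * (a i u * a i v)\<bar> \<le> (1 * (\<bar>\<mu>1\<bar> + \<bar>\<mu>2\<bar>)) * ((A * norm u) * (A * norm v))"
          unfolding abs_mult using \<zeta>(2,3)[of y] A by (intro mult_mono) auto
        moreover have "\<rho> * (norm u * norm v) \<le> 1 * (norm u * norm v)" by (rule mult_right_mono[OF \<rho>(3)]) simp
        moreover have "\<bar>dd u (dd v \<phi>0) y\<bar> \<le> \<bar>\<zeta> y * w2 (a i y / \<delta>) * (a i u * a i v)\<bar> +
          \<bar>\<delta> * \<delta> * (dd u (dd v \<zeta>) y * g y) + \<delta> * (w1 (a i y / \<delta>) * (dd u \<zeta> y * a i v + dd v \<zeta> y * a i u))\<bar>"
          unfolding dd\<phi>0 by (rule abs_triangle_ineq)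
        ultimately have "\<bar>dd u (dd v \<phi>0) y\<bar> \<le> (1 * (\<bar>\<mu>1\<bar> + \<bar>\<mu>2\<bar>)) * ((A * norm u) * (A * norm v)) + norm u * norm v"
          using err[of u v y] by linarith
        then show ?thesis by (simp add: algebra_simps)
      qed
      have adm: "admissible U \<tau> M x \<phi>"
        unfolding admissible_def
      proof (intro conjI allI ballI \<phi>t)
        show "0 \<le> Qf x d + dd d (dd d \<phi>) y" if "d \<in> D" for y d by (rule pos[OF that])
        show "\<bar>\<phi> y\<bar> \<le> \<tau>" for y unfolding \<phi>_def using b0[of y] p1(3)[of y] p2(3)[of y] by linarith
        show "\<bar>dd v \<phi> y\<bar> \<le> \<tau> * norm v" for y v
          unfolding d\<phi> using b1[of v y] p1(4)[of v y] p2(4)[of v y] by linarith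
        show "\<bar>dd u (dd v \<phi>) y\<bar> \<le> M * norm u * norm v" for y u v
        proof -
          have "M1 * norm u * norm v \<le> \<bar>M1\<bar> * (norm u * norm v)" "M2 * norm u * norm v \<le> \<bar>M2\<bar> * (norm u * norm v)"
            unfolding mult.assoc by (intro mult_right_mono; simp)+
          then have "\<bar>dd u (dd v \<phi>) y\<bar> \<le> ((\<bar>\<mu>1\<bar> + \<bar>\<mu>2\<bar>) * A * A + 1) * (norm u * norm v) + (\<bar>M1\<bar> * (norm u * norm v) + \<bar>M2\<bar> * (norm u * norm v))"
            unfolding dd\<phi> using b2[of u v y] p1(5)[of u v y] p2(5)[of u v y] by linarith
          then show ?thesis unfolding M_def by (simp add: algebra_simps)
        qed
      qed
      have \<psi>le: "\<bar>\<psi> y\<bar> \<le> \<eta> y" for y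
      proof (cases "y \<in> U1")
        case True
        then have "\<psi>2 y = 0" using test_functionsD(4)[OF \<psi>2(1)] disj by blast
        then show ?thesis unfolding \<psi>_def using \<psi>1(2)[of y] \<eta>j01(1)[of y] by linarith
      next
        case False
        then have "\<psi>1 y = 0" using test_functionsD(4)[OF \<psi>1(1)] by blast
        then show ?thesis unfolding \<psi>_def using \<psi>2(2)[of y] \<eta>j01(2)[of y] by linarith
      qed
      have val: "t * J \<le> (LINT y|L. \<psi> y * (Qf x e + dd e (dd e \<phi>) y))"
      proof -
        \<comment> \<open>\<psi>1 and \<psi>2 vanish off their own strips, so each product may be
          computed with the form that holds there.\<close>
        have pt: "\<psi> y * (Qf x e + dd e (dd e \<phi>) y) =
            \<psi>1 y * (Qf ?x1 e + dd e (dd e \<phi>1) y) + \<psi>2 y * (Qf ?x2 e + dd e (dd e \<phi>2) y)" for y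
        proof -
          have "\<psi>1 y * (Qf x e + dd e (dd e \<phi>) y) = \<psi>1 y * (Qf ?x1 e + dd e (dd e \<phi>1) y)"
            using in1[of y e] test_functionsD(4)[OF \<psi>1(1), of y] by (cases "y \<in> U1") auto
          moreover have "\<psi>2 y * (Qf x e + dd e (dd e \<phi>) y) = \<psi>2 y * (Qf ?x2 e + dd e (dd e \<phi>2) y)"
            using in2[of y e] test_functionsD(4)[OF \<psi>2(1), of y] by (cases "y \<in> U2") auto
          ultimately show ?thesis unfolding \<psi>_def distrib_right[of "\<psi>1 y"] by (simp only:)
        qed
        have "(LINT y|L. \<psi> y * (Qf x e + dd e (dd e \<phi>) y)) =
            (LINT y|L. \<psi>1 y * (Qf ?x1 e + dd e (dd e \<phi>1) y)) + (LINT y|L. \<psi>2 y * (Qf ?x2 e + dd e (dd e \<phi>2) y))"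
          unfolding pt by (intro Bochner_Integration.integral_add integrable_value[OF sm012(2) \<psi>1(1)] integrable_value[OF sm012(3) \<psi>2(1)])
        moreover have "t1 * (LINT y|L. \<eta>1 y) \<ge> t1 * (m1 * J - \<delta> * (C * N))" "t2 * (LINT y|L. \<eta>2 y) \<ge> t2 * (m2 * J - \<delta> * (C * N))"
          using av1 t0 by (intro mult_left_mono; simp add: abs_le_iff)+
        moreover have "t1 * (m1 * J - \<delta> * (C * N)) + t2 * (m2 * J - \<delta> * (C * N)) = (m1 * t1 + m2 * t2) * J - \<delta> * (C * N * (t1 + t2))"
          by (simp add: algebra_simps)
        moreover have "(t + gap / 2) * J \<le> (m1 * t1 + m2 * t2) * J" by (rule mult_right_mono[OF mt J0])
        moreover have "(t + gap / 2) * J = t * J + gap / 2 * J" by (simp add: algebra_simps)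
        ultimately show ?thesis using s4 \<psi>1(3) \<psi>2(3) by linarith
      qed
      show ?thesis using adm \<psi>t \<psi>le val unfolding J_def by blast
    qed
  qed
qed

lemma achieves_cong: "Qf x = Qf z \<Longrightarrow> achieves x t = achieves z t"
  by (simp add: achieves_def admissible_def)

text \<open>With the combination \<open>s\<close> as base point, the increments
  \<open>s1 - s\<close> and \<open>s2 - s\<close> have opposite signs and the barycentric weights of
  0 between them are \<open>1 - \<theta>\<close> and \<theta>.\<close>

lemma achieves_lamination:
  assumes i: "i \<in> I" and s: "s1 < s2" "0 < \<theta>" "\<theta> < 1"
    and K: "pos_on_D (x(i := s1))" "pos_on_D (x(i := s2))"
    and A: "achieves (x(i := s1)) t1" "achieves (x(i := s2)) t2"
    and t0: "0 \<le> t1" "0 \<le> t2" and t: "t < (1 - \<theta>) * t1 + \<theta> * t2"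
  shows "achieves (x(i := (1 - \<theta>) * s1 + \<theta> * s2)) t"
proof -
  define s where "s = (1 - \<theta>) * s1 + \<theta> * s2"
  have d1: "s1 - s = - (\<theta> * (s2 - s1))" and d2: "s2 - s = (1 - \<theta>) * (s2 - s1)"
    unfolding s_def by (simp_all add: algebra_simps)
  have \<mu>: "s1 - s < 0" "0 < s2 - s" unfolding d1 d2 using s by simp_all
  show ?thesis
  proof (cases "\<exists>v. a i v \<noteq> 0")
    case True
    then obtain v where v: "a i v \<noteq> 0" by blast
    have b: "a i (v /\<^sub>R a i v) = 1"
      using linear_scale[OF bounded_linear.linear[OF bl[of i]], of "inverse (a i v)" v] v by simp
    let ?y = "x(i := s)"
    have e: "?y(i := ?y i + (s1 - s)) = x(i := s1)" "?y(i := ?y i + (s2 - s)) = x(i := s2)" by simp_all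
    have w: "(s2 - s) / ((s2 - s) - (s1 - s)) = 1 - \<theta>" "- (s1 - s) / ((s2 - s) - (s1 - s)) = \<theta>"
      unfolding d1 d2 using s(1) by (simp_all add: field_simps)
    have K': "pos_on_D (?y(i := ?y i + (s1 - s)))" "pos_on_D (?y(i := ?y i + (s2 - s)))"
      unfolding e using K by blast+
    have A': "achieves (?y(i := ?y i + (s1 - s))) t1" "achieves (?y(i := ?y i + (s2 - s))) t2"
      unfolding e using A by blast+
    have t': "t < (s2 - s) / ((s2 - s) - (s1 - s)) * t1 + - (s1 - s) / ((s2 - s) - (s1 - s)) * t2"
      unfolding w by (rule t)
    have "achieves ?y t"
      by (rule achieves_lamination_aux[OF i \<mu> b K' A' t0 t'])
    then show ?thesis unfolding s_def .
  next
    \<comment> \<open>A vanishing functional admits no plane wave, but then the coordinate does not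
      affect the form and the better of the two values is achieved directly.\<close>
    case False
    then have a0: "a i d = 0" for d by blast
    have "Qf (x(i := v)) = Qf x" for v by (rule ext) (simp add: Qf_upd[OF i] a0)
    then have Q: "Qf (x(i := v)) = Qf (x(i := s))" for v by simp
    have "achieves (x(i := s)) t1" "achieves (x(i := s)) t2"
      using A achieves_cong[OF Q[of s1]] achieves_cong[OF Q[of s2]] by blast+
    moreover have "t \<le> max t1 t2"
    proof -
      have "(1 - \<theta>) * t1 + \<theta> * t2 \<le> (1 - \<theta>) * max t1 t2 + \<theta> * max t1 t2"
        using s by (intro add_mono mult_left_mono) auto
      then show ?thesis using t by (simp add: algebra_simps)
    qed
    ultimately show ?thesis
      unfolding s_def[symmetric] using achieves_mono by (metis max_def)
  qed
qed

end

section \<open>Unboundedness of the achievable averages\<close>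

context quadratic_forms
begin

text \<open>The largest achievable average is a homogeneous separately concave function of the coefficients. If it
  were finite, it would be bounded by a linear functional, which is incompatible with its
  being positive at both \<open>c\<close> and \<open>-c\<close>.\<close>

lemma unbounded_average:
  assumes k: "k \<in> I" "c0 > 0" "\<And>d. d \<in> D \<Longrightarrow> c0 * norm d \<le> \<bar>a k d\<bar>"
    and c: "\<And>d. d \<in> D \<Longrightarrow> Qf c d = 0" "Qf c e \<noteq> 0"
  shows "\<exists>x. pos_on_D x \<and> (\<forall>t. achieves x t)"
proof (rule ccontr)
  assume "\<not> ?thesis"
  then have neg: "\<exists>t. \<not> achieves x t" if "pos_on_D x" for x using that by blast
  define G where "G = (\<lambda>x. Sup {t. achieves x t})"
  have bdd: "bdd_above {t. achieves x t}" if x: "pos_on_D x" for x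
  proof -
    obtain t where t: "\<not> achieves x t" using neg[OF x] by blast
    have "s \<le> t" if "achieves x s" for s
      using achieves_mono[OF that, of t] t by (meson linear)
    then show ?thesis by (auto intro!: bdd_aboveI)
  qed
  have le_G: "t \<le> G x" if "pos_on_D x" "achieves x t" for x t
    unfolding G_def using that bdd by (intro cSup_upper) auto
  have G_triv: "\<bar>Qf x e\<bar> \<le> G x" if "pos_on_D x" for x
    by (rule le_G[OF that achieves_trivial[OF that]])
  have G0: "0 \<le> G x" if "pos_on_D x" for x using G_triv[OF that] by linarith
  have ach0: "achieves x 0" if "pos_on_D x" for x
    by (rule achieves_mono[OF achieves_trivial[OF that]]) simp
  have G_le: "G x \<le> u" if "pos_on_D x" "\<And>t. achieves x t \<Longrightarrow> t \<le> u" for x u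
    unfolding G_def using that ach0 by (intro cSup_least) auto
  have near_G: "\<exists>t\<ge>0. achieves x t \<and> G x - \<epsilon> < t" if "pos_on_D x" "\<epsilon> > 0" for x \<epsilon>
  proof -
    have eps: "G x - \<epsilon> < G x" using that(2) by simp
    have "{t. achieves x t} \<noteq> {}" using ach0[OF that(1)] by blast
    from less_cSup_iff[OF this bdd[OF that(1)], of "G x - \<epsilon>"]
    have "(G x - \<epsilon> < G x) = (\<exists>t\<in>{t. achieves x t}. G x - \<epsilon> < t)" by (simp only: G_def)
    then obtain t where t: "achieves x t" "G x - \<epsilon> < t" using eps by auto
    have "achieves x (max 0 t)" using t(1) ach0[OF that(1)] by (simp add: max_def)
    then show ?thesis using t(2) by (intro exI[of _ "max 0 t"]) auto
  qed
  have pos_scale: "pos_on_D (\<lambda>i. r * x i)" if "pos_on_D x" "0 < r" for x r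
  proof -
    obtain \<kappa> where \<kappa>: "\<kappa> > 0" "\<And>d. d \<in> D \<Longrightarrow> \<kappa> * (norm d)\<^sup>2 \<le> Qf x d"
      using \<open>pos_on_D x\<close> unfolding pos_on_D_def by blast
    show ?thesis
      unfolding pos_on_D_def Qf_scale
      by (rule exI[of _ "r * \<kappa>"]) (use \<kappa> that(2) in \<open>auto simp: mult.assoc\<close>)
  qed
  have G_hom_le: "r * G x \<le> G (\<lambda>i. r * x i)" if "pos_on_D x" "0 < r" for x r
  proof -
    have "G x \<le> G (\<lambda>i. r * x i) / r"
    proof (rule G_le[OF that(1)])
      fix t assume "achieves x t"
      from le_G[OF pos_scale[OF that] achieves_scale[OF this that(2)]]
      show "t \<le> G (\<lambda>i. r * x i) / r" using that(2) by (simp add: le_divide_eq mult.commute)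
    qed
    then show ?thesis using that(2) by (simp add: le_divide_eq mult.commute)
  qed
  have G_hom: "G (\<lambda>i. r * x i) = r * G x" if "pos_on_D x" "0 < r" for x r
  proof (rule antisym)
    have "(1 / r) * G (\<lambda>i. r * x i) \<le> G (\<lambda>i. (1 / r) * (r * x i))"
      by (rule G_hom_le[OF pos_scale[OF that]]) (use that in simp)
    also have "(\<lambda>i. (1 / r) * (r * x i)) = x" using that(2) by auto
    finally show "G (\<lambda>i. r * x i) \<le> r * G x" using that(2) by (simp add: divide_le_eq mult.commute)
  qed (rule G_hom_le[OF that])
  \<comment> \<open>Near-optimal values are laminated: near-optimality costs
    \<open>\<epsilon> / 2\<close>, and the strict inequality in \<open>achieves_lamination\<close>
    another \<open>\<epsilon> / 2\<close>.\<close>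
  have G_conc_aux: "(1 - t) * G (x(i := u)) + t * G (x(i := v)) \<le> G (x(i := (1 - t) * u + t * v))"
    if i: "i \<in> I" and K: "pos_on_D (x(i := u))" "pos_on_D (x(i := v))" and t: "0 < t" "t < 1" and uv: "u < v" for x i u v t
  proof (rule field_le_epsilon)
    fix \<epsilon> :: real assume \<epsilon>: "0 < \<epsilon>"
    have \<epsilon>2: "\<epsilon> / 2 > 0" using \<epsilon> by simp
    obtain t1 where t1: "t1 \<ge> 0" "achieves (x(i := u)) t1" "G (x(i := u)) - \<epsilon> / 2 < t1"
      using near_G[OF K(1) \<epsilon>2] by blast
    obtain t2 where t2: "t2 \<ge> 0" "achieves (x(i := v)) t2" "G (x(i := v)) - \<epsilon> / 2 < t2"
      using near_G[OF K(2) \<epsilon>2] by blast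
    have Kmid: "pos_on_D (x(i := (1 - t) * u + t * v))"
    proof -
      obtain \<kappa>1 where \<kappa>1: "\<kappa>1 > 0" "\<And>d. d \<in> D \<Longrightarrow> \<kappa>1 * (norm d)\<^sup>2 \<le> Qf (x(i := u)) d"
        using K(1) unfolding pos_on_D_def by blast
      obtain \<kappa>2 where \<kappa>2: "\<kappa>2 > 0" "\<And>d. d \<in> D \<Longrightarrow> \<kappa>2 * (norm d)\<^sup>2 \<le> Qf (x(i := v)) d"
        using K(2) unfolding pos_on_D_def by blast
      have "((1 - t) * \<kappa>1 + t * \<kappa>2) * (norm d)\<^sup>2 \<le> Qf (x(i := (1 - t) * u + t * v)) d" if d: "d \<in> D" for d
      proof -
        have "Qf (x(i := (1 - t) * u + t * v)) d = (1 - t) * Qf (x(i := u)) d + t * Qf (x(i := v)) d"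
          unfolding Qf_upd[OF i] by (simp add: algebra_simps)
        moreover have "(1 - t) * (\<kappa>1 * (norm d)\<^sup>2) \<le> (1 - t) * Qf (x(i := u)) d"
          using \<kappa>1(2)[OF d] t by (intro mult_left_mono) auto
        moreover have "t * (\<kappa>2 * (norm d)\<^sup>2) \<le> t * Qf (x(i := v)) d"
          using \<kappa>2(2)[OF d] t by (intro mult_left_mono) auto
        ultimately show ?thesis by (simp add: algebra_simps)
      qed
      moreover have "(1 - t) * \<kappa>1 + t * \<kappa>2 > 0" using \<kappa>1(1) \<kappa>2(1) t by (simp add: add_pos_pos)
      ultimately show ?thesis unfolding pos_on_D_def by blast
    qed
    have "achieves (x(i := (1 - t) * u + t * v)) ((1 - t) * t1 + t * t2 - \<epsilon> / 2)"
      by (rule achieves_lamination[OF i uv t K t1(2) t2(2) t1(1) t2(1)]) (use \<epsilon> in simp)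
    from le_G[OF Kmid this] have "(1 - t) * t1 + t * t2 - \<epsilon> / 2 \<le> G (x(i := (1 - t) * u + t * v))" .
    moreover have "(1 - t) * (G (x(i := u)) - \<epsilon> / 2) \<le> (1 - t) * t1" "t * (G (x(i := v)) - \<epsilon> / 2) \<le> t * t2"
      using t1(3) t2(3) t by (intro mult_left_mono; simp)+
    moreover have "(1 - t) * (p - \<epsilon> / 2) + t * (q - \<epsilon> / 2) = (1 - t) * p + t * q - \<epsilon> / 2" for p q
      by (simp add: field_simps)
    note this[of "G (x(i := u))" "G (x(i := v))"]
    ultimately show "(1 - t) * G (x(i := u)) + t * G (x(i := v)) \<le> G (x(i := (1 - t) * u + t * v)) + \<epsilon>"
      by linarith
  qed
  have G_conc: "(1 - t) * G (x(i := u)) + t * G (x(i := v)) \<le> G (x(i := (1 - t) * u + t * v))"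
    if i: "i \<in> I" and K: "pos_on_D (x(i := u))" "pos_on_D (x(i := v))" and t: "0 \<le> t" "t \<le> 1" for x i u v t
  proof -
    consider "t = 0" | "t = 1" | "u = v" | "0 < t" "t < 1" "u < v" | "0 < t" "t < 1" "v < u"
      using t by linarith
    then show ?thesis
    proof cases
      case 3
      have "(1 - t) * v + t * v = v" by (simp add: algebra_simps)
      then show ?thesis using 3 by (simp add: algebra_simps)
    next
      case 4
      then show ?thesis by (intro G_conc_aux[OF i K])
    next
      case 5
      then show ?thesis using G_conc_aux[OF i K(2,1), of "1 - t"] by (simp add: add.commute)
    qed simp_all
  qed
  have H: "hom_sep_concave I pos_on_D G"
    unfolding hom_sep_concave_def
  proof (intro conjI allI impI, goal_cases)
    case (1 x t) then show ?case using pos_scale by blast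
  next
    case (2 x t) then show ?case using G_hom by blast
  next
    case (3 x i u v t) then show ?case using G_conc by blast
  next
    case (4 x y) then show ?case using Qf_cong[of x y] unfolding pos_on_D_def by simp
  next
    case (5 x y)
    then have Q: "Qf x = Qf y" by (intro Qf_cong) blast
    have "achieves x = achieves y" by (rule ext, rule achieves_cong[OF Q])
    then show ?case unfolding G_def by simp
  qed
  have "\<exists>K>0. \<forall>d. norm (a i d) \<le> norm d * K" for i
    using bounded_linear.pos_bounded[OF bl[of i]] .
  then obtain A where A: "\<And>i. A i > 0" "\<And>i d. norm (a i d) \<le> norm d * A i" by metis
  define S where "S = (\<Sum>i\<in>I. (A i)\<^sup>2) + 1"
  have S: "S > 0" unfolding S_def by (intro add_nonneg_pos sum_nonneg) auto
  have Q_upper: "\<bar>Qf x d\<bar> \<le> \<rho> * S * (norm d)\<^sup>2" if "0 \<le> \<rho>" "\<And>i. i \<in> I \<Longrightarrow> \<bar>x i\<bar> \<le> \<rho>" for x \<rho> d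
  proof -
    have "\<bar>Qf x d\<bar> \<le> (\<Sum>i\<in>I. \<bar>x i * (a i d)\<^sup>2\<bar>)" unfolding Qf_def by (rule sum_abs)
    also have "\<dots> \<le> (\<Sum>i\<in>I. \<rho> * ((norm d)\<^sup>2 * (A i)\<^sup>2))"
    proof (rule sum_mono)
      fix i assume i: "i \<in> I"
      have "\<bar>a i d\<bar>\<^sup>2 \<le> (norm d * A i)\<^sup>2" using A(2)[of i d] by (intro power_mono) auto
      then have "(a i d)\<^sup>2 \<le> (norm d)\<^sup>2 * (A i)\<^sup>2" by (simp add: power_mult_distrib)
      then show "\<bar>x i * (a i d)\<^sup>2\<bar> \<le> \<rho> * ((norm d)\<^sup>2 * (A i)\<^sup>2)"
        unfolding abs_mult using that(1) that(2)[OF i] by (intro mult_mono) auto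
    qed
    also have "\<dots> = \<rho> * (S - 1) * (norm d)\<^sup>2"
      unfolding S_def by (simp add: sum_distrib_left sum_distrib_right mult_ac)
    also have "\<dots> \<le> \<rho> * S * (norm d)\<^sup>2" using that(1) by (intro mult_right_mono mult_left_mono) auto
    finally show ?thesis .
  qed
  have Q_unit: "Qf (unit_vec k) d = (a k d)\<^sup>2" for d
  proof -
    have "Qf (unit_vec k) d = (\<Sum>i\<in>I. if i = k then (a i d)\<^sup>2 else 0)"
      unfolding Qf_def unit_vec_def by (intro sum.cong) auto
    then show ?thesis using finI k(1) by simp
  qed
  have k2: "c0\<^sup>2 * (norm d)\<^sup>2 \<le> (a k d)\<^sup>2" if "d \<in> D" for d
  proof -
    have "(c0 * norm d)\<^sup>2 \<le> \<bar>a k d\<bar>\<^sup>2" using k(2) k(3)[OF that] by (intro power_mono) auto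
    then show ?thesis by (simp add: power_mult_distrib)
  qed
  \<comment> \<open>Coefficients within \<rho> of \<open>unit_vec k\<close> change the form by at
    most half of \<open>c0\<^sup>2 * (norm d)\<^sup>2\<close>, the lower bound of the square of
    \<open>a k\<close> on D.\<close>
  define \<rho> where "\<rho> = c0\<^sup>2 / (2 * S)"
  have \<rho>: "\<rho> > 0" "\<rho> * S = c0\<^sup>2 / 2" unfolding \<rho>_def using S k(2) by auto
  have int: "pos_on_D x" if x: "\<And>i. i \<in> I \<Longrightarrow> \<bar>x i - unit_vec k i\<bar> \<le> \<rho>" for x
    unfolding pos_on_D_def
  proof (intro exI conjI ballI)
    show "c0\<^sup>2 / 2 > 0" using k(2) by simp
    fix d assume d: "d \<in> D"
    have "Qf x d = Qf (\<lambda>i. unit_vec k i + (x i - unit_vec k i)) d" by simp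
    also have "\<dots> = (a k d)\<^sup>2 + Qf (\<lambda>i. x i - unit_vec k i) d"
      using Qf_add[of "unit_vec k" "\<lambda>i. x i - unit_vec k i" d] Q_unit by simp
    finally have "Qf x d \<ge> (a k d)\<^sup>2 - \<rho> * S * (norm d)\<^sup>2"
      using Q_upper[of \<rho> "\<lambda>i. x i - unit_vec k i" d] x \<rho>(1) by auto
    then show "c0\<^sup>2 / 2 * (norm d)\<^sup>2 \<le> Qf x d" using k2[OF d] unfolding \<rho>(2) by simp
  qed
  \<comment> \<open>So large that \<open>R\<close> times the square of \<open>a k\<close> dominates
    on D every form with coefficients bounded by 2.\<close>
  define R where "R = 2 * S / c0\<^sup>2"
  have R: "R > 0" unfolding R_def using S k(2) by simp
  define z where "z = (\<lambda>i. R * unit_vec k i)"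
  have z: "pos_on_D z"
    unfolding z_def by (rule pos_scale[OF _ R], rule int) (use \<rho>(1) in simp)
  define C where "C = G z + \<bar>Qf z e\<bar> + 2 * S * (norm e)\<^sup>2"
  have bd: "\<bar>G x\<bar> \<le> C" if x: "pos_on_D x" "\<And>i. i \<in> I \<Longrightarrow> \<bar>x i\<bar> \<le> 2" for x
  proof -
    have cmp: "Qf x d \<le> Qf z d" if d: "d \<in> D" for d
    proof -
      have "Qf x d \<le> 2 * S * (norm d)\<^sup>2" using Q_upper[of 2 x d] x(2) by auto
      also have "\<dots> = R * (c0\<^sup>2 * (norm d)\<^sup>2)" unfolding R_def using k(2) by simp
      also have "\<dots> \<le> R * (a k d)\<^sup>2" using k2[OF d] R by (intro mult_left_mono) auto
      also have "\<dots> = Qf z d" unfolding z_def Qf_scale Q_unit ..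
      finally show ?thesis .
    qed
    have "G x \<le> C"
    proof (rule G_le[OF x(1)])
      fix t assume "achieves x t"
      from le_G[OF z achieves_compare[OF this cmp]]
      have "t \<le> G z + \<bar>Qf z e - Qf x e\<bar>" by simp
      moreover have "\<bar>Qf x e\<bar> \<le> 2 * S * (norm e)\<^sup>2" using Q_upper[of 2 x e] x(2) by auto
      ultimately show "t \<le> C" unfolding C_def by linarith
    qed
    then show ?thesis using G0[OF x(1)] by simp
  qed
  obtain \<sigma> where \<sigma>: "\<And>x. pos_on_D x \<Longrightarrow> G x \<le> (\<Sum>i\<in>I. \<sigma> i * x i)"
    using hom_sep_concave_linear_bound[OF finI k(1) H \<rho>(1) int bd] by blast
  define q where "q = Qf c e"
  define p where "p = (a k e)\<^sup>2"
  \<comment> \<open>The forms \<open>c\<close> and \<open>-c\<close> vanish on D, so \<epsilon>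
    times the square of \<open>a k\<close> is added to bring them into the cone. The size of
    \<epsilon> makes the resulting term \<open>\<epsilon> * \<sigma> k\<close> at most half of
    \<open>\<bar>q\<bar>\<close>.\<close>
  define \<epsilon> where "\<epsilon> = \<bar>q\<bar> / (2 * (\<bar>\<sigma> k\<bar> + 1))"
  have \<epsilon>: "\<epsilon> > 0" unfolding \<epsilon>_def q_def using c(2) by simp
  have K: "pos_on_D (\<lambda>i. s * c i + \<epsilon> * unit_vec k i)" and Q: "Qf (\<lambda>i. s * c i + \<epsilon> * unit_vec k i) e = s * q + \<epsilon> * p" for s
  proof -
    have eq: "Qf (\<lambda>i. s * c i + \<epsilon> * unit_vec k i) d = s * Qf c d + \<epsilon> * (a k d)\<^sup>2" for d
      using Qf_add[of "\<lambda>i. s * c i" "\<lambda>i. \<epsilon> * unit_vec k i" d] by (simp add: Qf_scale Q_unit)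
    show "pos_on_D (\<lambda>i. s * c i + \<epsilon> * unit_vec k i)"
      unfolding pos_on_D_def
    proof (intro exI conjI ballI)
      show "\<epsilon> * c0\<^sup>2 > 0" using \<epsilon> k(2) by simp
      show "\<epsilon> * c0\<^sup>2 * (norm d)\<^sup>2 \<le> Qf (\<lambda>i. s * c i + \<epsilon> * unit_vec k i) d" if "d \<in> D" for d
        unfolding eq c(1)[OF that] using mult_left_mono[OF k2[OF that] less_imp_le[OF \<epsilon>]] by (simp add: mult.assoc)
    qed
    show "Qf (\<lambda>i. s * c i + \<epsilon> * unit_vec k i) e = s * q + \<epsilon> * p" unfolding eq q_def p_def ..
  qed
  have up: "\<bar>s * q + \<epsilon> * p\<bar> \<le> s * (\<Sum>i\<in>I. \<sigma> i * c i) + \<epsilon> * \<sigma> k" for s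
  proof -
    have "\<bar>s * q + \<epsilon> * p\<bar> \<le> (\<Sum>i\<in>I. \<sigma> i * (s * c i + \<epsilon> * unit_vec k i))"
      using G_triv[OF K[of s]] \<sigma>[OF K[of s]] unfolding Q by (rule order_trans)
    also have "\<dots> = s * (\<Sum>i\<in>I. \<sigma> i * c i) + \<epsilon> * (\<Sum>i\<in>I. \<sigma> i * unit_vec k i)"
      by (simp add: sum.distrib sum_distrib_left algebra_simps)
    also have "(\<Sum>i\<in>I. \<sigma> i * unit_vec k i) = (\<Sum>i\<in>I. if i = k then \<sigma> i else 0)"
      unfolding unit_vec_def by (intro sum.cong) auto
    also have "\<dots> = \<sigma> k" using finI k(1) by simp
    finally show ?thesis .
  qed
  \<comment> \<open>Adding the estimates for \<open>s = 1\<close> and \<open>s = -1\<close> cancels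
    the sum over \<open>c\<close> on the right, while the left sides add up to at least
    \<open>2 * \<bar>q\<bar>\<close>.\<close>
  have "2 * \<bar>q\<bar> \<le> 2 * (\<epsilon> * \<sigma> k)" using up[of 1] up[of "-1"] by (simp add: abs_if split: if_splits)
  also have "\<dots> \<le> 2 * (\<epsilon> * (\<bar>\<sigma> k\<bar> + 1))" using \<epsilon> by (intro mult_left_mono) auto
  also have "\<epsilon> * (\<bar>\<sigma> k\<bar> + 1) = \<bar>q\<bar> / 2"
  proof -
    have "\<bar>q\<bar> / (2 * X) * X = \<bar>q\<bar> / 2" if "X \<noteq> 0" for X using that by simp
    from this[of "\<bar>\<sigma> k\<bar> + 1"] show ?thesis unfolding \<epsilon>_def by linarith
  qed
  finally show False using c(2) unfolding q_def by simp
qed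

end

subsection \<open>The gliding hump\<close>

text \<open>Balls around a dense sequence with radii \<open>1 / Suc j\<close>, enumerated by pairs.
  Arbitrarily late members must lie in \<open>U\<close> because the hump on \<open>W n\<close> only
  guarantees an integral of size \<open>n\<close>.\<close>

lemma ex_shrinking_balls:
  "\<exists>W :: nat \<Rightarrow> 'v::fin_dim_normed set. (\<forall>n. open (W n) \<and> W n \<noteq> {} \<and> bounded (W n)) \<and>
     (\<forall>U n0. open U \<and> U \<noteq> {} \<longrightarrow> (\<exists>n\<ge>n0. W n \<subseteq> U))"
proof -
  obtain Q :: "'v set" where Q: "countable Q" "\<And>X. open X \<Longrightarrow> X \<noteq> {} \<Longrightarrow> \<exists>d\<in>Q. d \<in> X"
    using countable_dense_exists by blast
  have "Q \<noteq> {}" using Q(2)[of UNIV] by auto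
  then obtain q :: "nat \<Rightarrow> 'v" where q: "range q = Q" using Q(1) uncountable_def by blast
  define W where "W = (\<lambda>n. ball (q (fst (prod_decode n))) (1 / Suc (snd (prod_decode n))))"
  have "\<exists>n\<ge>n0. W n \<subseteq> U" if U: "open U" "U \<noteq> {}" for U n0
  proof -
    obtain i where i: "q i \<in> U" using Q(2)[OF U] q by blast
    obtain r where r: "r > 0" "ball (q i) r \<subseteq> U" using U(1) i by (meson open_contains_ball)
    obtain j0 where j0: "1 / Suc j0 < r" using r(1) nat_approx_posE[of r] by auto
    define j where "j = max j0 n0"
    have "1 / Suc j \<le> 1 / Suc j0" unfolding j_def by (simp add: frac_le)
    then have "ball (q i) (1 / Suc j) \<subseteq> ball (q i) r" using j0 by (intro subset_ball) linarith
    then have "W (prod_encode (i, j)) \<subseteq> U" unfolding W_def using r(2) by simp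
    moreover have "prod_encode (i, j) \<ge> n0"
      using le_prod_encode_2[of j i] unfolding j_def by simp
    ultimately show ?thesis by blast
  qed
  moreover have "open (W n) \<and> W n \<noteq> {} \<and> bounded (W n)" for n unfolding W_def by simp
  ultimately show ?thesis by blast
qed

text \<open>Two integrations by parts put the derivatives on \<open>S\<close>. The bound
  \<open>V\<close> measures how much a smooth partial sum can take away from the next hump.\<close>

lemma (in basis_space) Hessian_bounded_on_bounded:
  assumes S: "smooth S" and U: "bounded U"
  shows "\<exists>V. \<forall>\<psi>\<in>test_functions U. (\<forall>y. \<bar>\<psi> y\<bar> \<le> 1) \<longrightarrow> \<bar>LINT y|L. S y * dd e (dd e \<psi>) y\<bar> \<le> V"
proof -
  let ?K = "closure U"
  have K: "compact ?K" using U by (simp add: compact_closure)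
  have cont: "continuous_on UNIV (dd e (dd e S))" by (intro smooth_continuous_on smooth_dd S)
  have "compact ((\<lambda>y. dd e (dd e S) y) ` ?K)"
    by (rule compact_continuous_image[OF continuous_on_subset[OF cont] K]) simp
  then have "bounded ((\<lambda>y. dd e (dd e S) y) ` ?K)" by (rule compact_imp_bounded)
  then obtain c where "\<forall>z\<in>(\<lambda>y. dd e (dd e S) y) ` ?K. norm z \<le> c" unfolding bounded_iff by blast
  then have c: "\<bar>dd e (dd e S) y\<bar> \<le> c" if "y \<in> ?K" for y using that by simp
  have fin: "emeasure L ?K < \<infinity>" by (rule emeasure_L_bounded[OF bounded_closure[OF U]])
  have intK: "integrable L (indicator ?K :: 'v \<Rightarrow> real)"
    using fin by (intro integrable_real_indicator) auto
  have "\<bar>LINT y|L. S y * dd e (dd e \<psi>) y\<bar> \<le> \<bar>c\<bar> * measure L ?K"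
    if \<psi>: "\<psi> \<in> test_functions U" "\<And>y. \<bar>\<psi> y\<bar> \<le> 1" for \<psi>
  proof -
    have i: "integrable L (\<lambda>y. dd e (dd e S) y * \<psi> y)" by (rule integrable_cont_test[OF cont \<psi>(1)])
    have "\<bar>LINT y|L. S y * dd e (dd e \<psi>) y\<bar> = \<bar>LINT y|L. dd e (dd e S) y * \<psi> y\<bar>"
      by (simp only: integral_by_parts2[OF S \<psi>(1)])
    also have "\<dots> \<le> (LINT y|L. \<bar>dd e (dd e S) y * \<psi> y\<bar>)"
      using integral_norm_bound[of L "\<lambda>y. dd e (dd e S) y * \<psi> y"] by simp
    also have "\<dots> \<le> (LINT y|L. \<bar>c\<bar> * indicator ?K y)"
    proof (rule integral_mono)
      show "integrable L (\<lambda>y. \<bar>dd e (dd e S) y * \<psi> y\<bar>)" using i by (rule integrable_abs)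
      show "integrable L (\<lambda>y. \<bar>c\<bar> * indicator ?K y)" using intK by (rule integrable_mult_right)
      show "\<bar>dd e (dd e S) y * \<psi> y\<bar> \<le> \<bar>c\<bar> * indicator ?K y" for y
      proof (cases "y \<in> ?K")
        case True
        have "\<bar>dd e (dd e S) y\<bar> * \<bar>\<psi> y\<bar> \<le> \<bar>c\<bar> * 1"
          using c[OF True] \<psi>(2)[of y] by (intro mult_mono) auto
        then show ?thesis using True by (simp add: abs_mult)
      next
        case False
        then have "y \<notin> U" using closure_subset[of U] by blast
        then have "\<psi> y = 0" by (rule test_functionsD(4)[OF \<psi>(1)])
        then show ?thesis by simp
      qed
    qed
    also have "\<dots> = \<bar>c\<bar> * measure L ?K" by simp
    finally show ?thesis .
  qed
  then show ?thesis by blast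
qed

text \<open>Interpolation: s is the product of its powers with exponents 1 - \<alpha> and \<alpha>;
  the first is bounded by size, the second by the Lipschitz constant. \<open>M + 1\<close> replaces
  \<open>M\<close> so that its negative powers are at most 1.\<close>

lemma powr_min_bound:
  fixes \<tau> M r \<alpha> s :: real
  assumes "0 \<le> s" "s \<le> 2 * \<tau>" "s \<le> M * r" "0 < \<tau>" "0 \<le> M" "0 \<le> r" "0 < \<alpha>" "\<alpha> < 1"
  shows "s \<le> ((2 * \<tau>) powr (1 - \<alpha>) * (M + 1) powr \<alpha>) * r powr \<alpha>"
proof (cases "s = 0")
  case False
  then have s: "s > 0" using assms by simp
  have "s = s powr (1 - \<alpha>) * s powr \<alpha>" using s by (simp add: powr_add[symmetric])
  also have "\<dots> \<le> (2 * \<tau>) powr (1 - \<alpha>) * ((M + 1) * r) powr \<alpha>"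
  proof (intro mult_mono powr_mono2)
    show "s \<le> (M + 1) * r" using assms by (simp add: distrib_right)
  qed (use assms s in auto)
  also have "\<dots> = ((2 * \<tau>) powr (1 - \<alpha>) * (M + 1) powr \<alpha>) * r powr \<alpha>"
    using assms by (simp add: powr_mult)
  finally show ?thesis .
qed simp

text \<open>The exponent of \<open>M + 1\<close> becomes
  \<open>\<alpha> - n * (1 - \<alpha>)\<close>, which is nonpositive for large \<open>n\<close>. One
  choice of \<tau> at each stage thus serves every \<alpha> below 1 from some stage on.\<close>

lemma powr_Holder_const_le_1:
  fixes \<tau> M \<alpha> :: real
  assumes "0 < \<tau>" "2 * \<tau> \<le> 1 / (M + 1) ^ n" "0 \<le> M" "0 < \<alpha>" "\<alpha> < 1" "\<alpha> / (1 - \<alpha>) \<le> real n"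
  shows "(2 * \<tau>) powr (1 - \<alpha>) * (M + 1) powr \<alpha> \<le> 1"
proof -
  have "(2 * \<tau>) powr (1 - \<alpha>) \<le> (1 / (M + 1) ^ n) powr (1 - \<alpha>)"
    using assms by (intro powr_mono2) auto
  also have "1 / (M + 1) ^ n = (M + 1) powr (- real n)"
    using assms(3) by (simp add: powr_minus powr_realpow inverse_eq_divide)
  also have "((M + 1) powr (- real n)) powr (1 - \<alpha>) = (M + 1) powr (- real n * (1 - \<alpha>))"
    by (rule powr_powr)
  finally have "(2 * \<tau>) powr (1 - \<alpha>) * (M + 1) powr \<alpha> \<le> (M + 1) powr (- real n * (1 - \<alpha>)) * (M + 1) powr \<alpha>"
    by (intro mult_right_mono) auto
  also have "\<dots> = (M + 1) powr (- real n * (1 - \<alpha>) + \<alpha>)" by (rule powr_add[symmetric])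
  also have "\<dots> \<le> (M + 1) powr 0"
  proof (rule powr_mono)
    have "\<alpha> \<le> real n * (1 - \<alpha>)" using assms(5,6) by (simp add: divide_le_eq)
    then show "- real n * (1 - \<alpha>) + \<alpha> \<le> 0" by simp
  qed (use assms in auto)
  finally show ?thesis using assms(3) by simp
qed

text \<open>What a single hump supplies: along D it loses at most \<open>C * (l d)\<^sup>2\<close>
  of convexity, and \<psi> certifies that the total variation of its Hessian in direction
  \<open>e\<close> is at least \<open>t\<close>.\<close>

definition (in basis_space) rough_pair ::
  "('v \<Rightarrow> real) \<Rightarrow> real \<Rightarrow> 'v set \<Rightarrow> 'v \<Rightarrow> 'v set \<Rightarrow> real \<Rightarrow> real \<Rightarrow> real \<Rightarrow> ('v \<Rightarrow> real) \<Rightarrow> ('v \<Rightarrow> real) \<Rightarrow> bool" where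
  "rough_pair l C D e U M \<tau> t \<phi> \<psi> \<longleftrightarrow> \<phi> \<in> test_functions U \<and> \<psi> \<in> test_functions U \<and>
     (\<forall>y. \<forall>d\<in>D. - (C * (l d)\<^sup>2) \<le> dd d (dd d \<phi>) y) \<and> (\<forall>y. \<bar>\<phi> y\<bar> \<le> \<tau>) \<and>
     (\<forall>y v. \<bar>dd v \<phi> y\<bar> \<le> \<tau> * norm v) \<and> (\<forall>y u v. \<bar>dd u (dd v \<phi>) y\<bar> \<le> M * norm u * norm v) \<and>
     (\<forall>y. \<bar>\<psi> y\<bar> \<le> 1) \<and> t \<le> (LINT y|L. \<phi> y * dd e (dd e \<psi>) y)"

context quadratic_forms
begin

text \<open>A form \<open>x\<close> with unbounded average is at most \<open>C\<close> times the
  square of \<open>a k\<close> on D, which converts admissibility for \<open>x\<close> into the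
  lower Hessian bound. \<open>C\<close> is fixed together with \<open>x\<close>; \<open>M\<close>
  may depend on \<open>U\<close> and \<open>t\<close>, but is chosen before \<tau>.\<close>

lemma large_Hessian_test:
  assumes k: "c0 > 0" "\<And>d. d \<in> D \<Longrightarrow> c0 * norm d \<le> \<bar>a k d\<bar>" "k \<in> I"
    and c: "\<And>d. d \<in> D \<Longrightarrow> Qf c d = 0" "Qf c e \<noteq> 0"
  shows "\<exists>C\<ge>0. \<forall>U t. open U \<and> U \<noteq> {} \<longrightarrow> (\<exists>M\<ge>0. \<forall>\<tau>>0. \<exists>\<phi> \<psi>. rough_pair (a k) C D e U M \<tau> t \<phi> \<psi>)"
proof -
  obtain x where x: "pos_on_D x" "\<And>t. achieves x t"
    using unbounded_average[OF k(3,1,2) c] by blast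
  have "\<exists>K>0. \<forall>d. norm (a i d) \<le> norm d * K" for i
    using bounded_linear.pos_bounded[OF bl[of i]] .
  then obtain A where A: "\<And>i. A i > 0" "\<And>i d. norm (a i d) \<le> norm d * A i" by metis
  define S where "S = (\<Sum>i\<in>I. \<bar>x i\<bar> * (A i)\<^sup>2)"
  have S0: "0 \<le> S" unfolding S_def by (intro sum_nonneg) auto
  define C where "C = S / c0\<^sup>2"
  have C0: "0 \<le> C" unfolding C_def using S0 by simp
  have upper: "Qf x d \<le> C * (a k d)\<^sup>2" if d: "d \<in> D" for d
  proof -
    have "Qf x d \<le> (\<Sum>i\<in>I. \<bar>x i\<bar> * ((norm d)\<^sup>2 * (A i)\<^sup>2))"
      unfolding Qf_def
    proof (rule sum_mono)
      fix i
      have "\<bar>a i d\<bar>\<^sup>2 \<le> (norm d * A i)\<^sup>2" using A(2)[of i d] by (intro power_mono) auto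
      then have "(a i d)\<^sup>2 \<le> (norm d)\<^sup>2 * (A i)\<^sup>2" by (simp add: power_mult_distrib)
      then show "x i * (a i d)\<^sup>2 \<le> \<bar>x i\<bar> * ((norm d)\<^sup>2 * (A i)\<^sup>2)" by (intro mult_mono) auto
    qed
    also have "\<dots> = S * (norm d)\<^sup>2" unfolding S_def by (simp add: sum_distrib_left sum_distrib_right mult_ac)
    also have "\<dots> = C * (c0 * norm d)\<^sup>2" unfolding C_def using k(1) by (simp add: power_mult_distrib)
    also have "\<dots> \<le> C * \<bar>a k d\<bar>\<^sup>2"
      using k(1) k(2)[OF d] C0 by (intro mult_left_mono power_mono) auto
    finally show ?thesis by simp
  qed
  have "\<exists>M\<ge>0. \<forall>\<tau>>0. \<exists>\<phi> \<psi>. rough_pair (a k) C D e U M \<tau> t \<phi> \<psi>"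
    if U: "open U" "U \<noteq> {}" for U t
  proof -
    obtain z where z: "z \<in> U" using U(2) by blast
    have Kz: "compact {z}" "{z} \<subseteq> U" using z by auto
    obtain \<eta> W where \<eta>: "\<eta> \<in> test_functions U" "\<forall>y. 0 \<le> \<eta> y \<and> \<eta> y \<le> 1"
      and W: "open W" "{z} \<subseteq> W" "\<And>y. y \<in> W \<Longrightarrow> \<eta> y = 1"
      using smooth_Urysohn[OF Kz(1) U(1) Kz(2)] by blast
    define J where "J = (LINT y|L. \<eta> y)"
    have Wne: "W \<noteq> {}" using W(2) by blast
    have J: "J > 0" unfolding J_def
      by (rule integral_test_pos[OF \<eta>(1) _ W(1) Wne W(3)]) (use \<eta>(2) in blast)
    \<comment> \<open>The first term pays for the constant part \<open>Qf x e\<close> of the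
      Hessian; \<open>t\<close> is divided by \<open>J\<close> because averages are weighted by
      \<eta>.\<close>
    define T where "T = \<bar>Qf x e\<bar> + t / J"
    obtain M where M: "\<And>U \<eta> \<tau>. open U \<Longrightarrow> \<eta> \<in> test_functions U \<Longrightarrow> (\<forall>y. 0 \<le> \<eta> y \<and> \<eta> y \<le> 1) \<Longrightarrow> 0 < \<tau> \<Longrightarrow>
     (\<exists>\<phi> \<psi>. admissible U \<tau> M x \<phi> \<and> \<psi> \<in> test_functions U \<and> (\<forall>y. \<bar>\<psi> y\<bar> \<le> \<eta> y) \<and>
        T * (LINT y|L. \<eta> y) \<le> (LINT y|L. \<psi> y * (Qf x e + dd e (dd e \<phi>) y)))"
      using x(2)[of T] unfolding achieves_def by blast
    have "\<exists>\<phi> \<psi>. rough_pair (a k) C D e U \<bar>M\<bar> \<tau> t \<phi> \<psi>" if \<tau>: "\<tau> > 0" for \<tau>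
    proof -
      obtain \<phi> \<psi> where \<phi>: "admissible U \<tau> M x \<phi>" and \<psi>: "\<psi> \<in> test_functions U" "\<And>y. \<bar>\<psi> y\<bar> \<le> \<eta> y"
        "T * J \<le> (LINT y|L. \<psi> y * (Qf x e + dd e (dd e \<phi>) y))"
        using M[OF U(1) \<eta> \<tau>] unfolding J_def by blast
      have p: "\<phi> \<in> test_functions U" "\<And>y d. d \<in> D \<Longrightarrow> 0 \<le> Qf x d + dd d (dd d \<phi>) y" "\<And>y. \<bar>\<phi> y\<bar> \<le> \<tau>"
        "\<And>y v. \<bar>dd v \<phi> y\<bar> \<le> \<tau> * norm v" "\<And>y u v. \<bar>dd u (dd v \<phi>) y\<bar> \<le> M * norm u * norm v"
        using \<phi> unfolding admissible_def by blast+
      have sm: "smooth \<phi>" by (rule test_functionsD(1)[OF p(1)])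
      have i1: "integrable L \<psi>" "integrable L \<eta>" by (rule integrable_test[OF \<psi>(1)], rule integrable_test[OF \<eta>(1)])
      have i2: "integrable L (\<lambda>y. dd e (dd e \<phi>) y * \<psi> y)"
        by (rule integrable_cont_test[OF smooth_continuous_on[OF smooth_dd[OF smooth_dd[OF sm]]] \<psi>(1)])
      have "(LINT y|L. \<psi> y * (Qf x e + dd e (dd e \<phi>) y)) = (LINT y|L. Qf x e * \<psi> y + dd e (dd e \<phi>) y * \<psi> y)"
        by (intro Bochner_Integration.integral_cong) (auto simp: algebra_simps)
      also have "\<dots> = Qf x e * (LINT y|L. \<psi> y) + (LINT y|L. dd e (dd e \<phi>) y * \<psi> y)"
        using i1 i2 by simp
      also have "(LINT y|L. dd e (dd e \<phi>) y * \<psi> y) = (LINT y|L. \<phi> y * dd e (dd e \<psi>) y)"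
        by (simp only: integral_by_parts2[OF sm \<psi>(1)])
      finally have v: "T * J \<le> Qf x e * (LINT y|L. \<psi> y) + (LINT y|L. \<phi> y * dd e (dd e \<psi>) y)"
        using \<psi>(3) by simp
      have "\<bar>LINT y|L. \<psi> y\<bar> \<le> (LINT y|L. \<bar>\<psi> y\<bar>)" using integral_norm_bound[of L \<psi>] by simp
      also have "\<dots> \<le> J" unfolding J_def by (intro integral_mono integrable_abs i1 \<psi>(2))
      finally have "\<bar>Qf x e * (LINT y|L. \<psi> y)\<bar> \<le> \<bar>Qf x e\<bar> * J"
        unfolding abs_mult by (rule mult_left_mono) simp
      moreover have "T * J = \<bar>Qf x e\<bar> * J + t" unfolding T_def using J by (simp add: distrib_right)
      ultimately have "t \<le> (LINT y|L. \<phi> y * dd e (dd e \<psi>) y)" using v by linarith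
      moreover have "- (C * (a k d)\<^sup>2) \<le> dd d (dd d \<phi>) y" if "d \<in> D" for y d
        using p(2)[OF that, of y] upper[OF that] by linarith
      moreover have "\<bar>dd u (dd v \<phi>) y\<bar> \<le> \<bar>M\<bar> * norm u * norm v" for y u v
        using p(5)[of u v y] mult_right_mono[OF abs_ge_self[of M], of "norm u * norm v"] by (simp add: mult.assoc)
      moreover have "\<bar>\<psi> y\<bar> \<le> 1" for y using \<psi>(2)[of y] \<eta>(2) order_trans by blast
      ultimately have "rough_pair (a k) C D e U \<bar>M\<bar> \<tau> t \<phi> \<psi>"
        unfolding rough_pair_def using p(1,3,4) \<psi>(1) by blast
      then show ?thesis by blast
    qed
    then show ?thesis by (intro exI[of _ "\<bar>M\<bar>"]) simp
  qed
  then show ?thesis using C0 by blast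
qed

end

lemma mono_tail_bound:
  fixes X :: "nat \<Rightarrow> 'a::real_normed_vector"
  assumes step: "\<And>i. n \<le> i \<Longrightarrow> norm (X (Suc i) - X i) \<le> c / 2 ^ Suc i" and lim: "X \<longlonglongrightarrow> l" and c: "0 \<le> c"
  shows "norm (l - X n) \<le> c / 2 ^ n"
proof -
  have "norm (X (n + j) - X n) \<le> c / 2 ^ n * (1 - 1 / 2 ^ j)" for j
  proof (induction j)
    case (Suc j)
    have "norm (X (n + Suc j) - X n) \<le> norm (X (Suc (n + j)) - X (n + j)) + norm (X (n + j) - X n)"
      using norm_triangle_ineq[of "X (Suc (n + j)) - X (n + j)" "X (n + j) - X n"] by simp
    also have "\<dots> \<le> c / 2 ^ Suc (n + j) + c / 2 ^ n * (1 - 1 / 2 ^ j)"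
      using step[of "n + j"] Suc by (intro add_mono) auto
    also have "\<dots> = c / 2 ^ n * (1 - 1 / 2 ^ Suc j)" by (simp add: power_add field_simps)
    finally show ?case .
  qed simp
  moreover have "c / 2 ^ n * (1 - 1 / 2 ^ j) \<le> c / 2 ^ n * 1" for j
    using c by (intro mult_left_mono) auto
  ultimately have b: "norm (X (n + j) - X n) \<le> c / 2 ^ n" for j using order_trans by fastforce
  have "(\<lambda>j. norm (X (n + j) - X n)) \<longlonglongrightarrow> norm (l - X n)"
    using LIMSEQ_ignore_initial_segment[OF lim, of n] by (intro tendsto_intros) (simp add: add.commute)
  then show ?thesis using b by (intro LIMSEQ_le_const2) auto
qed

lemma sum_geometric_half: "(\<Sum>i<n. 1 / 2 ^ Suc i) = 1 - 1 / (2 :: real) ^ n"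
  by (induction n) (auto simp: field_simps)

lemma summable_half: "summable (\<lambda>i. 1 / (2 :: real) ^ Suc i)"
  using power_half_series by (simp add: sums_iff power_one_over)

context basis_space
begin

text \<open>\<theta> bounds the amplitude of all later humps. By the last condition, changing the
  sum by at most \<open>\<theta>'\<close> changes its integral against the second derivative of
  \<psi> by at most 1, which is why \<open>real n + 1\<close> is demanded. The power in the bound on
  \<tau> prepares the Hoelder estimate.\<close>

definition hump_step ::
  "'v \<Rightarrow> (nat \<Rightarrow> 'v set) \<Rightarrow> nat \<Rightarrow> ('v \<Rightarrow> real) \<Rightarrow> real \<Rightarrow> ('v \<Rightarrow> real) \<Rightarrow> real \<Rightarrow> ('v \<Rightarrow> real) \<Rightarrow> ('v \<Rightarrow> real) \<Rightarrow> real \<Rightarrow> real \<Rightarrow> bool" where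
  "hump_step e W n S \<theta> S' \<theta>' \<phi> \<psi> M \<tau> \<longleftrightarrow>
      \<phi> \<in> test_functions (W n) \<and> \<psi> \<in> test_functions (W n) \<and> (\<forall>y. \<bar>\<psi> y\<bar> \<le> 1) \<and>
      (\<forall>y. \<bar>\<phi> y\<bar> \<le> \<tau>) \<and> (\<forall>y v. \<bar>dd v \<phi> y\<bar> \<le> \<tau> * norm v) \<and>
      (\<forall>y u v. \<bar>dd u (dd v \<phi>) y\<bar> \<le> M * norm u * norm v) \<and>
      0 \<le> M \<and> 0 < \<tau> \<and> \<tau> \<le> \<theta> \<and> \<tau> \<le> 1/2 \<and> 2 * \<tau> \<le> 1 / (M + 1) ^ n \<and>
      S' = (\<lambda>y. S y + 1 / 2 ^ Suc n * \<phi> y) \<and>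
      real n + 1 \<le> (LINT y|L. S' y * dd e (dd e \<psi>) y) \<and>
      0 < \<theta>' \<and> \<theta>' \<le> \<theta> \<and> \<theta>' * (LINT y|L. \<bar>dd e (dd e \<psi>) y\<bar>) \<le> 1"

text \<open>The order of choices is essential: the bound \<open>V\<close> for the partial sum, then
  \<open>t\<close>, then \<open>M\<close>, then \<tau> depending on \<open>M\<close>, and only after
  \<psi> the remaining amplitude \<open>\<theta>'\<close>.\<close>

lemma gliding_hump:
  fixes l :: "'v \<Rightarrow> real" and D :: "'v set" and W :: "nat \<Rightarrow> 'v set"
  assumes l: "bounded_linear l" and C: "0 \<le> C"
    and H: "\<And>U t. open U \<Longrightarrow> U \<noteq> {} \<Longrightarrow> \<exists>M\<ge>0. \<forall>\<tau>>0. \<exists>\<phi> \<psi>. rough_pair l C D e U M \<tau> t \<phi> \<psi>"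
    and W: "\<And>n. open (W n)" "\<And>n. W n \<noteq> {}" "\<And>n. bounded (W n)"
  shows "\<exists>S \<theta> \<phi> \<psi> M \<tau>. S 0 = (\<lambda>y. C * (l y * l y)) \<and> (\<forall>n.
      smooth (S n) \<and> (\<forall>y. \<forall>d\<in>D. 0 \<le> dd d (dd d (S n)) y) \<and>
      hump_step e W n (S n) (\<theta> n) (S (Suc n)) (\<theta> (Suc n)) (\<phi> n) (\<psi> n) (M n) (\<tau> n))"
proof -
  \<comment> \<open>The convexity reserve along D: the initial function has twice
    \<open>C * (l d)\<^sup>2\<close>, and the hump of weight \<open>1 / 2 ^ Suc n\<close> uses up at
    most that share of it, so the limit keeps a nonnegative Hessian along D.\<close>
  define ok where "ok = (\<lambda>n (p :: ('v \<Rightarrow> real) \<times> real). smooth (fst p) \<and> 0 < snd p \<and>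
      (\<forall>y. \<forall>d\<in>D. (1 + 1 / 2 ^ n) * (C * (l d)\<^sup>2) \<le> dd d (dd d (fst p)) y) \<and>
      (n = 0 \<longrightarrow> fst p = (\<lambda>y. C * (l y * l y))))"
  define F0 where "F0 = (\<lambda>y. C * (l y * l y))"
  have lsm: "smooth l" by (rule smooth_bounded_linear[OF l])
  have F0sm: "smooth F0" unfolding F0_def by (intro smooth_cmult smooth_mult lsm)
  have dl: "dd v l y = l v" for v y by (rule dd_eqI[OF bounded_linear_imp_has_derivative[OF l]])
  have ddl: "dd u (dd v l) y = 0" for u v y
  proof -
    have "dd v l = (\<lambda>y. l v)" using dl by blast
    then show ?thesis by simp
  qed
  have ddF0: "dd d (dd d F0) y = 2 * (C * (l d)\<^sup>2)" for d y
    unfolding F0_def using dd2_cmult[OF smooth_mult[OF lsm lsm], of d d C y] dd2_mult[OF lsm lsm, of d d y]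
    by (simp add: dl ddl power2_eq_square)
  have "\<exists>f. \<forall>n. ok n (f n) \<and> (\<exists>\<phi> \<psi> M \<tau>. hump_step e W n (fst (f n)) (snd (f n)) (fst (f (Suc n))) (snd (f (Suc n))) \<phi> \<psi> M \<tau>)"
  proof (rule dependent_nat_choice)
    show "\<exists>p. ok 0 p"
      by (rule exI[of _ "(F0, 1)"]) (use F0sm ddF0 in \<open>simp add: ok_def, simp add: F0_def\<close>)
  next
    fix p n assume p: "ok n p"
    obtain S \<theta> where pS: "p = (S, \<theta>)" by (cases p)
    have S: "smooth S" "0 < \<theta>" "\<And>y d. d \<in> D \<Longrightarrow> (1 + 1 / 2 ^ n) * (C * (l d)\<^sup>2) \<le> dd d (dd d S) y"
      using p unfolding ok_def pS by auto
    obtain V where V: "\<And>\<psi>. \<psi> \<in> test_functions (W n) \<Longrightarrow> (\<forall>y. \<bar>\<psi> y\<bar> \<le> 1) \<Longrightarrow> \<bar>LINT y|L. S y * dd e (dd e \<psi>) y\<bar> \<le> V"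
      using Hessian_bounded_on_bounded[OF S(1) W(3)[of n], where e=e] by blast
    \<comment> \<open>Compensates the partial sum, which contributes at most \<open>V\<close> in
      absolute value, and the weight \<open>1 / 2 ^ Suc n\<close> of the hump.\<close>
    define t where "t = (real n + 1 + V) * 2 ^ Suc n"
    obtain M where M: "M \<ge> 0" "\<And>\<tau>. \<tau> > 0 \<Longrightarrow> \<exists>\<phi> \<psi>. rough_pair l C D e (W n) M \<tau> t \<phi> \<psi>"
      using H[OF W(1)[of n] W(2)[of n], of t] by blast
    define \<tau> where "\<tau> = min \<theta> (min (1/2) (1 / (2 * (M + 1) ^ n)))"
    have M1: "(M + 1) ^ n > 0" using M(1) by simp
    have \<tau>: "0 < \<tau>" "\<tau> \<le> \<theta>" "\<tau> \<le> 1/2" "\<tau> \<le> 1 / (2 * (M + 1) ^ n)"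
      unfolding \<tau>_def using S(2) M1 by auto
    have \<tau>2: "2 * \<tau> \<le> 1 / (M + 1) ^ n"
      using mult_left_mono[OF \<tau>(4), of 2] M1 by simp
    obtain \<phi> \<psi> where pair: "rough_pair l C D e (W n) M \<tau> t \<phi> \<psi>"
      using M(2)[OF \<tau>(1)] by blast
    have \<phi>: "\<phi> \<in> test_functions (W n)" and \<psi>: "\<psi> \<in> test_functions (W n)"
      and \<phi>1: "\<And>y d. d \<in> D \<Longrightarrow> - (C * (l d)\<^sup>2) \<le> dd d (dd d \<phi>) y"
      and \<phi>2: "\<forall>y. \<bar>\<phi> y\<bar> \<le> \<tau>" "\<forall>y v. \<bar>dd v \<phi> y\<bar> \<le> \<tau> * norm v" "\<forall>y u v. \<bar>dd u (dd v \<phi>) y\<bar> \<le> M * norm u * norm v"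
      and \<psi>1: "\<forall>y. \<bar>\<psi> y\<bar> \<le> 1" and val: "t \<le> (LINT y|L. \<phi> y * dd e (dd e \<psi>) y)"
      using pair unfolding rough_pair_def by blast+
    have \<phi>sm: "smooth \<phi>" by (rule test_functionsD(1)[OF \<phi>])
    have dd\<psi>: "dd e (dd e \<psi>) \<in> test_functions (W n)" by (intro test_functions_dd \<psi>)
    define S' where "S' = (\<lambda>y. S y + 1 / 2 ^ Suc n * \<phi> y)"
    have S'sm: "smooth S'" unfolding S'_def by (intro smooth_add smooth_cmult S(1) \<phi>sm)
    define In where "In = (LINT y|L. \<bar>dd e (dd e \<psi>) y\<bar>)"
    have In0: "0 \<le> In" unfolding In_def by (intro integral_nonneg_AE AE_I2) auto
    define \<theta>' where "\<theta>' = min \<theta> (1 / (In + 1))"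
    have \<theta>': "0 < \<theta>'" "\<theta>' \<le> \<theta>" "\<theta>' \<le> 1 / (In + 1)" unfolding \<theta>'_def using S(2) In0 by auto
    have \<theta>In: "\<theta>' * In \<le> 1"
    proof -
      have "\<theta>' * In \<le> \<theta>' * (In + 1)" using \<theta>'(1) by (intro mult_left_mono) auto
      also have "\<dots> \<le> 1" using \<theta>'(3) In0 by (simp add: pos_le_divide_eq)
      finally show ?thesis .
    qed
    have hval: "real n + 1 \<le> (LINT y|L. S' y * dd e (dd e \<psi>) y)"
    proof -
      have i: "integrable L (\<lambda>y. S y * dd e (dd e \<psi>) y)" "integrable L (\<lambda>y. \<phi> y * dd e (dd e \<psi>) y)"
        by (intro integrable_cont_test[OF _ dd\<psi>] smooth_continuous_on S(1) \<phi>sm)+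
      have "(LINT y|L. S' y * dd e (dd e \<psi>) y) = (LINT y|L. S y * dd e (dd e \<psi>) y + 1 / 2 ^ Suc n * (\<phi> y * dd e (dd e \<psi>) y))"
        unfolding S'_def by (intro Bochner_Integration.integral_cong) (auto simp: algebra_simps)
      also have "\<dots> = (LINT y|L. S y * dd e (dd e \<psi>) y) + 1 / 2 ^ Suc n * (LINT y|L. \<phi> y * dd e (dd e \<psi>) y)"
        using i(1) integrable_mult_right[OF i(2), of "1 / 2 ^ Suc n"] by (subst Bochner_Integration.integral_add) auto
      finally have eq: "(LINT y|L. S' y * dd e (dd e \<psi>) y) = (LINT y|L. S y * dd e (dd e \<psi>) y) + 1 / 2 ^ Suc n * (LINT y|L. \<phi> y * dd e (dd e \<psi>) y)" .
      have "1 / 2 ^ Suc n * t \<le> 1 / 2 ^ Suc n * (LINT y|L. \<phi> y * dd e (dd e \<psi>) y)"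
        using val by (intro mult_left_mono) auto
      moreover have "1 / 2 ^ Suc n * t = real n + 1 + V" unfolding t_def by simp
      moreover have "- V \<le> (LINT y|L. S y * dd e (dd e \<psi>) y)" using V[OF \<psi> \<psi>1] by linarith
      ultimately show ?thesis unfolding eq by linarith
    qed
    have Hess: "(1 + 1 / 2 ^ Suc n) * (C * (l d)\<^sup>2) \<le> dd d (dd d S') y" if d: "d \<in> D" for y d
    proof -
      have "dd d (dd d S') y = dd d (dd d S) y + 1 / 2 ^ Suc n * dd d (dd d \<phi>) y"
        unfolding S'_def using dd2_add[OF S(1) smooth_cmult[OF \<phi>sm], of d d "1 / 2 ^ Suc n" y]
          dd2_cmult[OF \<phi>sm, of d d "1 / 2 ^ Suc n" y] by simp
      moreover have "1 / 2 ^ Suc n * (- (C * (l d)\<^sup>2)) \<le> 1 / 2 ^ Suc n * dd d (dd d \<phi>) y"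
        by (rule mult_left_mono[OF \<phi>1[OF d]]) simp
      moreover have "(1 + 1 / 2 ^ Suc n) * z = (1 + 1 / 2 ^ n) * z + 1 / 2 ^ Suc n * (- z)" for z :: real
        by (simp add: field_simps)
      ultimately show ?thesis using S(3)[OF d, of y] by (metis add_mono)
    qed
    have "hump_step e W n S \<theta> S' \<theta>' \<phi> \<psi> M \<tau>"
      unfolding hump_step_def by (intro conjI \<phi> \<psi> \<psi>1 \<phi>2 M(1) \<tau>(1-3) \<tau>2 hval \<theta>'(1,2))
        (use S'_def \<theta>In In_def in simp_all)
    moreover have "ok (Suc n) (S', \<theta>')" unfolding ok_def using S'sm \<theta>'(1) Hess by simp
    ultimately show "\<exists>p'. ok (Suc n) p' \<and> (\<exists>\<phi> \<psi> M \<tau>. hump_step e W n (fst p) (snd p) (fst p') (snd p') \<phi> \<psi> M \<tau>)"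
      unfolding pS by (intro exI[of _ "(S', \<theta>')"]) auto
  qed
  then obtain f where f: "\<And>n. ok n (f n)"
    "\<forall>n. \<exists>\<phi> \<psi> M \<tau>. hump_step e W n (fst (f n)) (snd (f n)) (fst (f (Suc n))) (snd (f (Suc n))) \<phi> \<psi> M \<tau>" by blast
  obtain \<phi> where "\<forall>n. \<exists>\<psi> M \<tau>. hump_step e W n (fst (f n)) (snd (f n)) (fst (f (Suc n))) (snd (f (Suc n))) (\<phi> n) \<psi> M \<tau>"
    using choice[OF f(2)] by blast
  from choice[OF this] obtain \<psi> where
    "\<forall>n. \<exists>M \<tau>. hump_step e W n (fst (f n)) (snd (f n)) (fst (f (Suc n))) (snd (f (Suc n))) (\<phi> n) (\<psi> n) M \<tau>" by blast
  from choice[OF this] obtain M where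
    "\<forall>n. \<exists>\<tau>. hump_step e W n (fst (f n)) (snd (f n)) (fst (f (Suc n))) (snd (f (Suc n))) (\<phi> n) (\<psi> n) (M n) \<tau>" by blast
  from choice[OF this] obtain \<tau> where
    g: "\<And>n. hump_step e W n (fst (f n)) (snd (f n)) (fst (f (Suc n))) (snd (f (Suc n))) (\<phi> n) (\<psi> n) (M n) (\<tau> n)" by blast
  have S0: "fst (f 0) = (\<lambda>y. C * (l y * l y))" using f(1)[of 0] unfolding ok_def by simp
  have okn: "smooth (fst (f n)) \<and> (\<forall>y. \<forall>d\<in>D. 0 \<le> dd d (dd d (fst (f n))) y)" for n
  proof -
    have "0 \<le> (1 + 1 / 2 ^ n) * (C * (l d)\<^sup>2)" for d using C by simp
    then show ?thesis using f(1)[of n] unfolding ok_def by (meson order_trans)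
  qed
  show ?thesis
    by (rule exI[of _ "\<lambda>n. fst (f n)"], rule exI[of _ "\<lambda>n. snd (f n)"], rule exI[of _ \<phi>], rule exI[of _ \<psi>],
        rule exI[of _ M], rule exI[of _ \<tau>], intro conjI allI S0)
      (use okn g in blast)+
qed

end

section \<open>Convergence and regularity of the sum of the humps\<close>

definition grad :: "('v::real_normed_vector \<Rightarrow> real) \<Rightarrow> 'v \<Rightarrow> ('v \<Rightarrow>\<^sub>L real)" where
  "grad f x = Blinfun (\<lambda>v. dd v f x)"

lemma grad_apply: "smooth f \<Longrightarrow> blinfun_apply (grad f x) v = dd v f x"
  unfolding grad_def by (simp add: bounded_linear_Blinfun_apply bounded_linear_dd smooth_differentiable)

lemma norm_grad_le:
  assumes "smooth f" "0 \<le> c" "\<And>v. \<bar>dd v f x\<bar> \<le> c * norm v"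
  shows "norm (grad f x) \<le> c"
  using assms by (intro norm_blinfun_bound) (auto simp: grad_apply)

lemma norm_grad_diff_le:
  fixes f :: "'v::fin_dim_normed \<Rightarrow> real"
  assumes "smooth f" "0 \<le> M" "\<And>z u v. \<bar>dd u (dd v f) z\<bar> \<le> M * norm u * norm v"
  shows "norm (grad f x - grad f y) \<le> M * norm (x - y)"
proof (rule norm_blinfun_bound)
  show "0 \<le> M * norm (x - y)" using assms(2) by simp
  fix v
  have "\<bar>dd v f (y + (x - y)) - dd v f y\<bar> \<le> M * norm (x - y) * norm v"
    by (rule mvt_line[OF smooth_differentiable[OF smooth_dd[OF assms(1)]] assms(3)])
  then show "norm (blinfun_apply (grad f x - grad f y) v) \<le> M * norm (x - y) * norm v"
    by (simp add: blinfun.diff_left grad_apply[OF assms(1)])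
qed

lemma D_convex_limit:
  assumes "\<And>n. D_convex D (S n)" "cone_of_directions D" "\<And>y. (\<lambda>n. S n y) \<longlonglongrightarrow> f y"
  shows "D_convex D f"
proof (rule D_convexI)
  fix x d assume d: "d \<in> D"
  show "convex_on UNIV (\<lambda>t. f (x + t *\<^sub>R d))"
  proof (rule convex_onI)
    fix t a b :: real assume t: "0 < t" "t < 1"
    show "f (x + ((1 - t) *\<^sub>R a + t *\<^sub>R b) *\<^sub>R d) \<le> (1 - t) * f (x + a *\<^sub>R d) + t * f (x + b *\<^sub>R d)"
    proof (rule LIMSEQ_le)
      show "(\<lambda>n. S n (x + ((1 - t) *\<^sub>R a + t *\<^sub>R b) *\<^sub>R d)) \<longlonglongrightarrow> f (x + ((1 - t) *\<^sub>R a + t *\<^sub>R b) *\<^sub>R d)"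
        by (rule assms(3))
      show "(\<lambda>n. (1 - t) * S n (x + a *\<^sub>R d) + t * S n (x + b *\<^sub>R d)) \<longlonglongrightarrow> (1 - t) * f (x + a *\<^sub>R d) + t * f (x + b *\<^sub>R d)"
        by (intro tendsto_intros assms(3))
      show "\<exists>N. \<forall>n\<ge>N. S n (x + ((1 - t) *\<^sub>R a + t *\<^sub>R b) *\<^sub>R d) \<le> (1 - t) * S n (x + a *\<^sub>R d) + t * S n (x + b *\<^sub>R d)"
        using convex_onD[OF D_convex_line[OF assms(1,2) d], of t a b] t by auto
    qed
  qed simp
qed

text \<open>For the background function, whose gradient is Lipschitz: on a bounded set a Lipschitz
  bound implies a Hoelder bound for every exponent below 1.\<close>

lemma powr_split_bound:
  fixes r R \<alpha> :: real
  assumes "0 \<le> r" "r \<le> R" "0 < \<alpha>" "\<alpha> < 1"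
  shows "r \<le> (R + 1) * r powr \<alpha>"
proof (cases "r = 0")
  case False
  then have r: "r > 0" using assms(1) by simp
  have "r = r powr (1 - \<alpha>) * r powr \<alpha>" using r by (simp add: powr_add[symmetric])
  also have "\<dots> \<le> (R + 1) * r powr \<alpha>"
  proof (rule mult_right_mono)
    have "r powr (1 - \<alpha>) \<le> (R + 1) powr (1 - \<alpha>)" using assms r by (intro powr_mono2) auto
    also have "\<dots> \<le> (R + 1) powr 1" using assms by (intro powr_mono) auto
    finally show "r powr (1 - \<alpha>) \<le> R + 1" using assms by simp
  qed simp
  finally show ?thesis .
qed (use assms in simp)

context basis_space
begin

text \<open>The gradient of the \<open>n\<close>-th hump is at most \<open>(M n + 1) ^ - n\<close>, up to a constant, and its Hessian at
  most \<open>M n\<close>; by interpolation its Hoelder constant for any exponent is at most \<open>1\<close> for large \<open>n\<close>.\<close>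

lemma rough_D_convex_function:
  fixes l :: "'v \<Rightarrow> real" and D :: "'v set"
  assumes D: "cone_of_directions D" and l: "bounded_linear l" and C: "0 \<le> C"
    and H: "\<And>U t. open U \<Longrightarrow> U \<noteq> {} \<Longrightarrow> \<exists>M\<ge>0. \<forall>\<tau>>0. \<exists>\<phi> \<psi>. rough_pair l C D e U M \<tau> t \<phi> \<psi>"
  shows "\<exists>(f :: 'v \<Rightarrow> real) Df. D_convex D f \<and> (\<forall>x. (f has_derivative blinfun_apply (Df x)) (at x)) \<and>
      continuous_on UNIV Df \<and> locally_Holder Df \<and>
      (\<forall>U. open U \<and> U \<noteq> {} \<longrightarrow> (\<forall>n::nat. \<exists>\<psi>\<in>test_functions U. (\<forall>y. \<bar>\<psi> y\<bar> \<le> 1) \<and>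
         real n \<le> (LINT y|L. f y * dd e (dd e \<psi>) y)))"
proof -
  obtain W :: "nat \<Rightarrow> 'v set" where W: "\<And>n. open (W n)" "\<And>n. W n \<noteq> {}" "\<And>n. bounded (W n)"
    "\<And>U n0. open U \<Longrightarrow> U \<noteq> {} \<Longrightarrow> \<exists>n\<ge>n0. W n \<subseteq> U"
    using ex_shrinking_balls by metis
  obtain S \<theta> \<phi> \<psi> M \<tau> where S0: "S 0 = (\<lambda>y. C * (l y * l y))"
    and S1: "\<And>n. smooth (S n) \<and> (\<forall>y. \<forall>d\<in>D. 0 \<le> dd d (dd d (S n)) y)"
    and step: "\<And>n. hump_step e W n (S n) (\<theta> n) (S (Suc n)) (\<theta> (Suc n)) (\<phi> n) (\<psi> n) (M n) (\<tau> n)"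
  proof -
    have "\<exists>S \<theta> \<phi> \<psi> M \<tau>. S 0 = (\<lambda>y. C * (l y * l y)) \<and> (\<forall>n.
      smooth (S n) \<and> (\<forall>y. \<forall>d\<in>D. 0 \<le> dd d (dd d (S n)) y) \<and>
      hump_step e W n (S n) (\<theta> n) (S (Suc n)) (\<theta> (Suc n)) (\<phi> n) (\<psi> n) (M n) (\<tau> n))"
      by (rule gliding_hump[OF l C _ W(1) W(2) W(3)]) (rule H)
    then show thesis using that by blast
  qed
  have sS: "smooth (S n)" and HS: "\<And>y d. d \<in> D \<Longrightarrow> 0 \<le> dd d (dd d (S n)) y" for n
    using S1[of n] by blast+
  have t\<phi>: "\<phi> n \<in> test_functions (W n)" and t\<psi>: "\<psi> n \<in> test_functions (W n)" and \<psi>1: "\<forall>y. \<bar>\<psi> n y\<bar> \<le> 1"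
    and \<phi>0: "\<And>y. \<bar>\<phi> n y\<bar> \<le> \<tau> n" and \<phi>1: "\<And>y v. \<bar>dd v (\<phi> n) y\<bar> \<le> \<tau> n * norm v"
    and \<phi>2: "\<And>y u v. \<bar>dd u (dd v (\<phi> n)) y\<bar> \<le> M n * norm u * norm v"
    and M0: "0 \<le> M n" and \<tau>0: "0 < \<tau> n" and \<tau>\<theta>: "\<tau> n \<le> \<theta> n" and \<tau>h: "\<tau> n \<le> 1/2"
    and \<tau>M: "2 * \<tau> n \<le> 1 / (M n + 1) ^ n" and SS: "S (Suc n) = (\<lambda>y. S n y + 1 / 2 ^ Suc n * \<phi> n y)"
    and val: "real n + 1 \<le> (LINT y|L. S (Suc n) y * dd e (dd e (\<psi> n)) y)"
    and \<theta>0: "0 < \<theta> (Suc n)" and \<theta>S: "\<theta> (Suc n) \<le> \<theta> n" and \<theta>I: "\<theta> (Suc n) * (LINT y|L. \<bar>dd e (dd e (\<psi> n)) y\<bar>) \<le> 1" for n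
    using step[of n] unfolding hump_step_def by blast+
  have \<phi>0': "\<bar>\<phi> n y\<bar> \<le> \<tau> n" for n y by (rule \<phi>0)
  have \<phi>sm: "smooth (\<phi> n)" for n by (rule test_functionsD(1)[OF t\<phi>])
  have \<theta>mono: "\<theta> i \<le> \<theta> n" if "n \<le> i" for n i
    using lift_Suc_antimono_le[of \<theta>, OF \<theta>S that] .
  define F0 where "F0 = S 0"
  have F0sm: "smooth F0" unfolding F0_def by (rule sS)
  define w where "w = (\<lambda>n. 1 / (2::real) ^ Suc n)"
  have w0: "0 \<le> w n" for n unfolding w_def by simp
  have wsum: "(\<Sum>i<n. w i) \<le> 1" for n unfolding w_def sum_geometric_half by simp
  have wsummable: "summable w" unfolding w_def by (rule summable_half)
  have Sn: "S n y = F0 y + (\<Sum>i<n. w i * \<phi> i y)" for n y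
    by (induction n) (auto simp: F0_def SS w_def)
  define f where "f = (\<lambda>y. F0 y + (\<Sum>n. w n * \<phi> n y))"
  have sumf: "summable (\<lambda>n. w n * \<phi> n y)" for y
  proof (rule summable_comparison_test'[OF wsummable, of 0])
    fix n
    have "\<bar>\<phi> n y\<bar> \<le> 1" using \<phi>0'[of n y] \<tau>h[of n] by linarith
    then show "norm (w n * \<phi> n y) \<le> w n" using w0[of n] by (simp add: abs_mult mult_left_le)
  qed
  have Slim: "(\<lambda>n. S n y) \<longlonglongrightarrow> f y" for y
    unfolding Sn f_def using summable_LIMSEQ[OF sumf[of y]] by (intro tendsto_intros) simp
  have conv: "D_convex D f"
    by (rule D_convex_limit[OF D_convex_of_Hessian[OF sS HS] D Slim])
  define P where "P = (\<lambda>y. \<lambda>n. \<Sum>i<n. w i *\<^sub>R grad (\<phi> i) y)"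
  have ng: "norm (grad (\<phi> n) y) \<le> \<tau> n" for n y
    by (rule norm_grad_le[OF \<phi>sm less_imp_le[OF \<tau>0] \<phi>1])
  have sumD: "summable (\<lambda>n. w n *\<^sub>R grad (\<phi> n) y)" for y
  proof (rule summable_comparison_test'[OF wsummable, of 0])
    fix n
    have "norm (grad (\<phi> n) y) \<le> 1" using ng[of n y] \<tau>h[of n] by linarith
    then show "norm (w n *\<^sub>R grad (\<phi> n) y) \<le> w n" using w0[of n] by (simp add: mult_left_le)
  qed
  define E where "E = (\<lambda>y. \<Sum>n. w n *\<^sub>R grad (\<phi> n) y)"
  have Plim: "P y \<longlonglongrightarrow> E y" for y
    unfolding P_def E_def by (rule summable_LIMSEQ[OF sumD])
  define Df where "Df = (\<lambda>y. grad F0 y + E y)"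
  \<comment> \<open>The gradients of the partial sums converge uniformly at a geometric rate, which
    is what term-by-term differentiation requires.\<close>
  have tail: "norm (E y - P y n) \<le> 1 / 2 ^ n" for y n
  proof (rule mono_tail_bound[OF _ Plim])
    fix i
    have "norm (grad (\<phi> i) y) \<le> 1" using ng[of i y] \<tau>h[of i] by linarith
    then have "w i * norm (grad (\<phi> i) y) \<le> w i" using w0[of i] by (simp add: mult_left_le)
    then show "norm (P y (Suc i) - P y i) \<le> 1 / 2 ^ Suc i"
      unfolding P_def using w0[of i] by (simp add: w_def)
  qed simp
  have Papply: "blinfun_apply (P y n) v = (\<Sum>i<n. w i * dd v (\<phi> i) y)" for y n v
    unfolding P_def by (simp add: blinfun.sum_left blinfun.scaleR_left grad_apply[OF \<phi>sm])
  have der: "(f has_derivative blinfun_apply (Df x)) (at x)" for x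
  proof -
    have "\<exists>h. \<forall>x\<in>UNIV. (\<lambda>n. w n * \<phi> n x) sums (h x) \<and> (h has_derivative (\<lambda>v. blinfun_apply (E x) v)) (at x within UNIV)"
    proof (rule has_derivative_series[where f'="\<lambda>n x v. w n * dd v (\<phi> n) x" and x=0])
      show "((\<lambda>x. w n * \<phi> n x) has_derivative (\<lambda>v. w n * dd v (\<phi> n) x)) (at x within UNIV)" for n x
        by (intro has_derivative_mult_right has_derivative_dd smooth_differentiable \<phi>sm)
      show "\<forall>\<^sub>F n in sequentially. \<forall>x\<in>UNIV. \<forall>v. norm ((\<Sum>i<n. w i * dd v (\<phi> i) x) - blinfun_apply (E x) v) \<le> \<epsilon> * norm v"
        if \<epsilon>: "0 < \<epsilon>" for \<epsilon>
      proof -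
        have "(\<lambda>n. (1 / 2 :: real) ^ n) \<longlonglongrightarrow> 0" by (rule LIMSEQ_realpow_zero) auto
        then have "\<forall>\<^sub>F n in sequentially. (1 / 2 :: real) ^ n < \<epsilon>" using \<epsilon> by (rule order_tendstoD(2))
        then show ?thesis
        proof eventually_elim
          case (elim n)
          show ?case
          proof (intro ballI allI)
            fix x v
            have "norm (blinfun_apply (E x - P x n) v) \<le> norm (E x - P x n) * norm v" by (rule norm_blinfun)
            also have "\<dots> \<le> \<epsilon> * norm v"
              using tail[of x n] elim by (intro mult_right_mono) (auto simp: power_one_over)
            finally show "norm ((\<Sum>i<n. w i * dd v (\<phi> i) x) - blinfun_apply (E x) v) \<le> \<epsilon> * norm v"
              by (simp add: blinfun.diff_left Papply abs_minus_commute)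
          qed
        qed
      qed
      show "(\<lambda>n. w n * \<phi> n 0) sums (\<Sum>n. w n * \<phi> n 0)" by (rule summable_sums[OF sumf])
    qed auto
    then obtain h where h: "\<And>x. (\<lambda>n. w n * \<phi> n x) sums (h x)" "\<And>x. (h has_derivative blinfun_apply (E x)) (at x)"
      by auto
    have "h = (\<lambda>x. \<Sum>n. w n * \<phi> n x)" using h(1) by (auto simp: sums_iff)
    then have "f = (\<lambda>x. F0 x + h x)" unfolding f_def by simp
    moreover have "((\<lambda>x. F0 x + h x) has_derivative (\<lambda>v. dd v F0 x + blinfun_apply (E x) v)) (at x)"
      by (intro has_derivative_add has_derivative_dd smooth_differentiable F0sm h(2))
    moreover have "(\<lambda>v. dd v F0 x + blinfun_apply (E x) v) = blinfun_apply (Df x)"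
      unfolding Df_def by (auto simp: blinfun.add_left grad_apply[OF F0sm])
    ultimately show ?thesis by simp
  qed
  obtain A where A: "A > 0" "\<And>v. \<bar>l v\<bar> \<le> norm v * A"
    using bounded_linear.pos_bounded[OF l] by auto
  have F0grad: "norm (grad F0 x - grad F0 y) \<le> 2 * C * A * A * norm (x - y)" for x y
  proof (rule norm_grad_diff_le[OF F0sm])
    show "0 \<le> 2 * C * A * A" using A(1) C by simp
    fix z u v
    have lsm: "smooth l" by (rule smooth_bounded_linear[OF l])
    have dl: "dd v l y = l v" for v y by (rule dd_eqI[OF bounded_linear_imp_has_derivative[OF l]])
    have ddl: "dd u (dd v l) z = 0"
    proof -
      have "dd v l = (\<lambda>y. l v)" using dl by blast
      then show ?thesis by simp
    qed
    have "dd u (dd v F0) z = 2 * C * (l u * l v)"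
      unfolding F0_def S0 using dd2_cmult[OF smooth_mult[OF lsm lsm], of u v C z] dd2_mult[OF lsm lsm, of u v z]
      by (simp add: dl ddl)
    moreover have "\<bar>l u * l v\<bar> \<le> (norm u * A) * (norm v * A)"
      unfolding abs_mult using A by (intro mult_mono) auto
    then have "2 * C * \<bar>l u * l v\<bar> \<le> 2 * C * ((norm u * A) * (norm v * A))" using C by (intro mult_left_mono) auto
    ultimately show "\<bar>dd u (dd v F0) z\<bar> \<le> 2 * C * A * A * norm u * norm v"
      using C by (simp add: abs_mult mult_ac)
  qed
  have holder: "locally_Holder Df"
    unfolding locally_Holder_def
  proof (intro allI impI)
    fix K :: "'v set" and \<alpha> :: real assume K: "compact K" and \<alpha>: "0 < \<alpha> \<and> \<alpha> < 1"
    define c where "c = (\<lambda>n. (2 * \<tau> n) powr (1 - \<alpha>) * (M n + 1) powr \<alpha>)"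
    \<comment> \<open>From stage \<open>N\<close> on the interpolation constants are at most 1; the
      finitely many earlier ones are added up in \<open>Bc\<close>.\<close>
    define N where "N = nat \<lceil>\<alpha> / (1 - \<alpha>)\<rceil>"
    have c0: "0 \<le> c n" for n unfolding c_def by simp
    define Bc where "Bc = 1 + (\<Sum>n<N. c n)"
    have cB: "c n \<le> Bc" for n
    proof (cases "n < N")
      case True
      then have "c n \<le> (\<Sum>n<N. c n)" using c0 by (intro member_le_sum) auto
      then show ?thesis unfolding Bc_def by simp
    next
      case False
      then have "\<alpha> / (1 - \<alpha>) \<le> real n" unfolding N_def by linarith
      then have "c n \<le> 1" unfolding c_def using \<alpha> by (intro powr_Holder_const_le_1[OF \<tau>0 \<tau>M M0]) auto
      moreover have "0 \<le> (\<Sum>n<N. c n)" by (intro sum_nonneg c0)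
      ultimately show ?thesis unfolding Bc_def by simp
    qed
    have Bc0: "0 \<le> Bc" unfolding Bc_def using sum_nonneg[of "{..<N}" c] c0 by simp
    have Ediff: "norm (E x - E y) \<le> Bc * norm (x - y) powr \<alpha>" for x y
    proof -
      have "norm (P x n - P y n) \<le> Bc * norm (x - y) powr \<alpha>" for n
      proof -
        have "norm (P x n - P y n) = norm (\<Sum>i<n. w i *\<^sub>R (grad (\<phi> i) x - grad (\<phi> i) y))"
          unfolding P_def by (simp add: sum_subtractf scaleR_right_diff_distrib)
        also have "\<dots> \<le> (\<Sum>i<n. w i * (Bc * norm (x - y) powr \<alpha>))"
        proof (rule sum_norm_le)
          fix i
          have "norm (grad (\<phi> i) x - grad (\<phi> i) y) \<le> c i * norm (x - y) powr \<alpha>"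
            unfolding c_def
          proof (rule powr_min_bound)
            show "norm (grad (\<phi> i) x - grad (\<phi> i) y) \<le> 2 * \<tau> i"
              using norm_triangle_ineq4[of "grad (\<phi> i) x" "grad (\<phi> i) y"] ng[of i x] ng[of i y] by linarith
            show "norm (grad (\<phi> i) x - grad (\<phi> i) y) \<le> M i * norm (x - y)"
              by (rule norm_grad_diff_le[OF \<phi>sm M0 \<phi>2])
          qed (use \<tau>0 M0 \<alpha> in auto)
          also have "\<dots> \<le> Bc * norm (x - y) powr \<alpha>" by (intro mult_right_mono cB) simp
          finally show "norm (w i *\<^sub>R (grad (\<phi> i) x - grad (\<phi> i) y)) \<le> w i * (Bc * norm (x - y) powr \<alpha>)"
            using w0[of i] by (simp add: mult_left_mono)
        qed
        also have "\<dots> = (\<Sum>i<n. w i) * (Bc * norm (x - y) powr \<alpha>)" by (simp add: sum_distrib_right)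
        also have "\<dots> \<le> 1 * (Bc * norm (x - y) powr \<alpha>)" using Bc0 by (intro mult_right_mono wsum) auto
        finally show ?thesis by simp
      qed
      moreover have "(\<lambda>n. norm (P x n - P y n)) \<longlonglongrightarrow> norm (E x - E y)" by (intro tendsto_intros Plim)
      ultimately show ?thesis by (intro LIMSEQ_le_const2) auto
    qed
    obtain R0 where R0: "\<And>x. x \<in> K \<Longrightarrow> norm x \<le> R0"
      using compact_imp_bounded[OF K] unfolding bounded_iff by blast
    define R where "R = 2 * \<bar>R0\<bar>"
    define cc where "cc = 2 * C * A * A * (R + 1) + Bc + 1"
    have "cc > 0" unfolding cc_def R_def using C A(1) Bc0 by (intro add_nonneg_pos add_nonneg_nonneg) auto
    moreover have "norm (Df x - Df y) \<le> cc * norm (x - y) powr \<alpha>" if "x \<in> K" "y \<in> K" for x y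
    proof -
      have "norm (x - y) \<le> R"
        unfolding R_def using norm_triangle_ineq4[of x y] R0[OF that(1)] R0[OF that(2)] by linarith
      then have "norm (x - y) \<le> (R + 1) * norm (x - y) powr \<alpha>" using \<alpha> by (intro powr_split_bound) auto
      then have "2 * C * A * A * norm (x - y) \<le> 2 * C * A * A * ((R + 1) * norm (x - y) powr \<alpha>)"
        using C A(1) by (intro mult_left_mono) auto
      moreover have "norm (Df x - Df y) \<le> norm (grad F0 x - grad F0 y) + norm (E x - E y)"
        unfolding Df_def using norm_triangle_ineq[of "grad F0 x - grad F0 y" "E x - E y"] by (simp add: algebra_simps)
      ultimately have "norm (Df x - Df y) \<le> 2 * C * A * A * ((R + 1) * norm (x - y) powr \<alpha>) + Bc * norm (x - y) powr \<alpha>"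
        using F0grad[of x y] Ediff[of x y] by linarith
      also have "\<dots> = (cc - 1) * norm (x - y) powr \<alpha>" unfolding cc_def by (simp add: algebra_simps)
      also have "\<dots> \<le> cc * norm (x - y) powr \<alpha>" by (intro mult_right_mono) auto
      finally show ?thesis .
    qed
    ultimately show "\<exists>c>0. \<forall>x\<in>K. \<forall>y\<in>K. norm (Df x - Df y) \<le> c * norm (x - y) powr \<alpha>" by blast
  qed
  have contDf: "continuous_on UNIV Df"
  proof -
    have "isCont Df x" for x
    proof -
      have "compact (cball x 1)" by (simp add: compact_eq_bounded_closed)
      moreover have "0 < (1/2 :: real) \<and> 1/2 < (1 :: real)" by simp
      ultimately obtain c where c: "\<forall>y\<in>cball x 1. \<forall>z\<in>cball x 1. norm (Df y - Df z) \<le> c * norm (y - z) powr (1/2)"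
        using holder unfolding locally_Holder_def by blast
      have ev: "\<forall>\<^sub>F y in at x. y \<in> ball x 1" using eventually_at_ball[of 1 x UNIV] by simp
      have "((\<lambda>y. norm (y - x)) \<longlongrightarrow> norm (x - x)) (at x)" by (intro tendsto_intros)
      then have "((\<lambda>y. norm (y - x)) \<longlongrightarrow> 0) (at x)" by simp
      then have "((\<lambda>y. norm (y - x) powr (1/2)) \<longlongrightarrow> 0 powr (1/2)) (at x)"
        by (intro tendsto_powr') auto
      then have lim: "((\<lambda>y. c * norm (y - x) powr (1/2)) \<longlongrightarrow> c * 0) (at x)" by (intro tendsto_intros) simp
      have "\<forall>\<^sub>F y in at x. norm (Df y - Df x) \<le> c * norm (y - x) powr (1/2)"
        using ev by eventually_elim (use c in auto)
      from Lim_null_comparison[OF this] lim have "((\<lambda>y. Df y - Df x) \<longlongrightarrow> 0) (at x)" by simp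
      then show ?thesis unfolding isCont_def by (simp add: LIM_zero_iff)
    qed
    then show ?thesis by (simp add: continuous_on_eq_continuous_at)
  qed
  have fcont: "continuous_on UNIV f"
    using has_derivative_continuous[OF der] by (simp add: continuous_on_eq_continuous_at)
  have big: "\<exists>\<psi>\<in>test_functions U. (\<forall>y. \<bar>\<psi> y\<bar> \<le> 1) \<and> real n0 \<le> (LINT y|L. f y * dd e (dd e \<psi>) y)"
    if U: "open U" "U \<noteq> {}" for U and n0 :: nat
  proof -
    obtain n where n: "n \<ge> n0" "W n \<subseteq> U" using W(4)[OF U] by blast
    have dd\<psi>: "dd e (dd e (\<psi> n)) \<in> test_functions (W n)" by (intro test_functions_dd t\<psi>)
    \<comment> \<open>All humps after stage \<open>n\<close> have amplitude at most
      \<open>\<theta> (Suc n)\<close>, since \<theta> decreases, and their weights are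
      summable.\<close>
    have diff: "\<bar>f y - S (Suc n) y\<bar> \<le> \<theta> (Suc n)" for y
    proof -
      have "norm (f y - S (Suc n) y) \<le> \<theta> (Suc n) / 2 ^ Suc n"
      proof (rule mono_tail_bound[OF _ Slim less_imp_le[OF \<theta>0]])
        fix i assume i: "Suc n \<le> i"
        have "\<bar>\<phi> i y\<bar> \<le> \<theta> (Suc n)"
          using \<phi>0'[of i y] \<tau>\<theta>[of i] \<theta>mono[OF i] by linarith
        then show "norm (S (Suc i) y - S i y) \<le> \<theta> (Suc n) / 2 ^ Suc i"
          by (simp add: SS abs_mult divide_right_mono)
      qed
      also have "(1::real) \<le> 2 ^ Suc n" by (rule one_le_power) simp
      then have "\<theta> (Suc n) / 2 ^ Suc n \<le> \<theta> (Suc n) / 1" using \<theta>0[of n] by (intro divide_left_mono) auto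
      finally show ?thesis by simp
    qed
    have i1: "integrable L (\<lambda>y. f y * dd e (dd e (\<psi> n)) y)" "integrable L (\<lambda>y. S (Suc n) y * dd e (dd e (\<psi> n)) y)"
      by (intro integrable_cont_test[OF _ dd\<psi>] fcont smooth_continuous_on sS)+
    have i2: "integrable L (\<lambda>y. \<theta> (Suc n) * \<bar>dd e (dd e (\<psi> n)) y\<bar>)"
      by (intro integrable_mult_right integrable_abs integrable_test[OF dd\<psi>])
    have "(LINT y|L. S (Suc n) y * dd e (dd e (\<psi> n)) y) - (LINT y|L. f y * dd e (dd e (\<psi> n)) y)
        = (LINT y|L. S (Suc n) y * dd e (dd e (\<psi> n)) y - f y * dd e (dd e (\<psi> n)) y)"
      using i1 by simp
    also have "\<dots> \<le> (LINT y|L. \<theta> (Suc n) * \<bar>dd e (dd e (\<psi> n)) y\<bar>)"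
    proof (rule integral_mono)
      show "integrable L (\<lambda>y. S (Suc n) y * dd e (dd e (\<psi> n)) y - f y * dd e (dd e (\<psi> n)) y)" using i1 by simp
      fix y
      have "\<bar>(S (Suc n) y - f y) * dd e (dd e (\<psi> n)) y\<bar> \<le> \<theta> (Suc n) * \<bar>dd e (dd e (\<psi> n)) y\<bar>"
        unfolding abs_mult using diff[of y] by (intro mult_right_mono) (auto simp: abs_minus_commute)
      then show "S (Suc n) y * dd e (dd e (\<psi> n)) y - f y * dd e (dd e (\<psi> n)) y \<le> \<theta> (Suc n) * \<bar>dd e (dd e (\<psi> n)) y\<bar>"
        by (simp add: left_diff_distrib abs_le_iff)
    qed (rule i2)
    \<comment> \<open>The reserve 1 in \<open>real n + 1\<close> is spent here on the later
      humps.\<close>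
    also have "\<dots> \<le> 1" using \<theta>I[of n] by simp
    finally have "real n \<le> (LINT y|L. f y * dd e (dd e (\<psi> n)) y)" using val[of n] by linarith
    then have "real n0 \<le> (LINT y|L. f y * dd e (dd e (\<psi> n)) y)" using n(1) by linarith
    moreover have "\<psi> n \<in> test_functions U" by (rule test_functions_mono[OF t\<psi> n(2)])
    ultimately show ?thesis using \<psi>1 by blast
  qed
  show ?thesis
    by (rule exI[of _ f], rule exI[of _ Df], intro conjI conv allI der contDf holder impI big) auto
qed

end

subsection \<open>Decomposition of the Hessian\<close>

lemma span_image_explicit:
  fixes f :: "'a \<Rightarrow> 'b::real_vector"
  assumes "x \<in> span (f ` D)"
  shows "\<exists>F r. finite F \<and> F \<subseteq> D \<and> x = (\<Sum>d\<in>F. r d *\<^sub>R f d)"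
proof -
  obtain t r where t: "finite t" "t \<subseteq> f ` D" "x = (\<Sum>y\<in>t. r y *\<^sub>R y)"
    using assms unfolding span_explicit by blast
  obtain F where F: "F \<subseteq> D" "inj_on f F" "t = f ` F" using t(2) subset_image_inj by metis
  have "x = (\<Sum>d\<in>F. r (f d) *\<^sub>R f d)" unfolding t(3) F(3) by (simp add: sum.reindex[OF F(2)])
  moreover have "finite F" using t(1) F(2,3) finite_imageD by blast
  ultimately show ?thesis using F(1) by (intro exI[of _ F] exI[of _ "\<lambda>d. r (f d)"] conjI)
qed

text \<open>Purely algebraic: \<open>x\<close> together with a maximal independent subset of
  \<open>S\<close> is independent, and the values of a functional may be prescribed on it.\<close>

lemma ex_functional_not_in_span:
  fixes x :: "'a::real_vector"
  assumes "x \<notin> span S"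
  shows "\<exists>g :: 'a \<Rightarrow> real. linear g \<and> (\<forall>y\<in>S. g y = 0) \<and> g x = 1"
proof -
  obtain T where T: "T \<subseteq> S" "independent T" "S \<subseteq> span T"
    using maximal_independent_subset by blast
  have "span T = span S" using T by (metis span_mono span_span subset_antisym)
  then have "x \<notin> span T" using assms by simp
  then have ind: "independent (insert x T)" using T(2) by (simp add: independent_insert)
  obtain g where g: "linear g" "\<forall>y\<in>insert x T. g y = (if y = x then 1 else 0 :: real)"
    using linear_independent_extend[OF ind, of "\<lambda>y. if y = x then 1 else 0 :: real"] by blast
  have xT: "x \<notin> T" using \<open>x \<notin> span T\<close> span_base by blast
  have "g y = 0" if "y \<in> S" for y
    by (rule linear_eq_0_on_span[OF g(1), of T]) (use g(2) xT T(3) that in auto)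
  then show ?thesis using g by auto
qed

text \<open>The dual form of the statement that the squares of the elements of D span the symmetric
  tensors; it is the link from the rigidity of D-affine functions to the decomposition of the
  Hessian.\<close>

definition determines_forms :: "'v::real_normed_vector set \<Rightarrow> bool" where
  "determines_forms D \<longleftrightarrow> (\<forall>S :: 'v \<Rightarrow> 'v \<Rightarrow> real. (\<forall>u. linear (S u)) \<and> (\<forall>u v. S u v = S v u) \<and>
     (\<forall>d\<in>D. S d d = 0) \<longrightarrow> (\<forall>u v. S u v = 0))"

context basis_space
begin

text \<open>The tensor of \<open>u\<close> and \<open>v\<close> as a rank-one operator, with the
  inner product for which \<open>B\<close> is orthonormal. This provides a concrete vector space in
  which spans can be formed.\<close>

definition tens :: "'v \<Rightarrow> 'v \<Rightarrow> 'v \<Rightarrow>\<^sub>L 'v" where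
  "tens u v = Blinfun (\<lambda>x. (\<Sum>b\<in>B. crd b u * crd b x) *\<^sub>R v)"

lemma bl_crd: "bounded_linear (crd b)"
  by (rule bounded_linear_coord[OF basis])

lemma tens_apply: "blinfun_apply (tens u v) x = (\<Sum>b\<in>B. crd b u * crd b x) *\<^sub>R v"
  unfolding tens_def
  by (intro fun_cong[OF bounded_linear_Blinfun_apply] bounded_linear_scaleR_const bounded_linear_sum
      bounded_linear_const_mult bl_crd)

lemma linear_tens: "linear (\<lambda>u. tens u v)" "linear (\<lambda>v. tens u v)"
proof -
  have c: "crd b (x + y) = crd b x + crd b y" "crd b (r *\<^sub>R x) = r * crd b x" for b x y r
    using linear_add[OF bounded_linear.linear[OF bl_crd]] linear_scale[OF bounded_linear.linear[OF bl_crd]] by simp_all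
  show "linear (\<lambda>u. tens u v)"
    by (intro linearI blinfun_eqI)
      (simp_all add: tens_apply c blinfun.add_left blinfun.scaleR_left distrib_right sum.distrib
        scaleR_left_distrib sum_distrib_left mult.assoc)
  show "linear (\<lambda>v. tens u v)"
    by (intro linearI blinfun_eqI)
      (simp_all add: tens_apply blinfun.add_left blinfun.scaleR_left scaleR_right_distrib mult.commute)
qed

text \<open>Otherwise a functional vanishes on all squares from D but not on this tensor; applied to
  symmetrized tensors it is a symmetric form that contradicts the assumption.\<close>

lemma sym_tensor_in_span:
  fixes D :: "'v set"
  assumes "determines_forms D"
  shows "tens u v + tens v u \<in> span ((\<lambda>d. tens d d) ` D)"
proof (rule ccontr)
  assume "\<not> ?thesis"
  then obtain g where g: "linear g" "\<forall>y\<in>(\<lambda>d. tens d d) ` D. g y = 0" "g (tens u v + tens v u) = (1 :: real)"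
    using ex_functional_not_in_span by blast
  define S where "S = (\<lambda>x y. g (tens x y) + g (tens y x))"
  have "linear (S x)" for x
    unfolding S_def
    by (intro linear_compose_add linear_compose[OF linear_tens(1) g(1), unfolded o_def]
        linear_compose[OF linear_tens(2) g(1), unfolded o_def])
  moreover have "S x y = S y x" for x y unfolding S_def by (rule add.commute)
  moreover have "S d d = 0" if "d \<in> D" for d using g(2) that unfolding S_def by auto
  ultimately have "S u v = 0" using assms unfolding determines_forms_def by blast
  then show False using g(3) linear_add[OF g(1)] unfolding S_def by simp
qed

lemma sym_bilinear_form_via_tens:
  fixes q :: "'v \<Rightarrow> 'v \<Rightarrow> real"
  assumes q: "\<And>u. linear (q u)" "\<And>u v. q u v = q v u"
    and eq: "tens u v + tens v u = (\<Sum>d\<in>F. r d *\<^sub>R tens d d)"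
  shows "2 * q u v = (\<Sum>d\<in>F. r d * q d d)"
proof -
  \<comment> \<open>The linear functional that evaluates \<open>q\<close> on tensors: a trace over
    the basis \<open>B\<close>.\<close>
  define T where "T = (\<lambda>A :: 'v \<Rightarrow>\<^sub>L 'v. \<Sum>b\<in>B. q b (blinfun_apply A b))"
  have T: "linear T"
    unfolding T_def
    by (intro linearI)
      (simp_all add: blinfun.add_left blinfun.scaleR_left linear_add[OF q(1)] linear_scale[OF q(1)]
        sum.distrib sum_distrib_left)
  have Tt: "T (tens x y) = q x y" for x y
  proof -
    have "(\<Sum>b'\<in>B. crd b' x * crd b' b) = crd b x" if b: "b \<in> B" for b
    proof -
      have "(\<Sum>b'\<in>B. crd b' x * crd b' b) = (\<Sum>b'\<in>B. if b' = b then crd b' x else 0)"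
        by (intro sum.cong) (auto simp: coord_base[OF basis _ b])
      then show ?thesis using b fin_B by simp
    qed
    then have "T (tens x y) = (\<Sum>b\<in>B. crd b x * q b y)"
      unfolding T_def tens_apply by (simp add: linear_scale[OF q(1)])
    also have "\<dots> = (\<Sum>b\<in>B. q y (crd b x *\<^sub>R b))"
      by (simp add: linear_scale[OF q(1)] q(2)[of _ y])
    also have "\<dots> = q y x" by (simp add: linear_sum[OF q(1), symmetric] coord_sum[OF basis])
    finally show ?thesis using q(2) by simp
  qed
  have "2 * q u v = T (tens u v + tens v u)"
    using q(2)[of u v] by (simp add: linear_add[OF T] Tt)
  also have "\<dots> = (\<Sum>d\<in>F. r d * q d d)"
    unfolding eq by (simp add: linear_sum[OF T] linear_scale[OF T] Tt)
  finally show ?thesis .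
qed

text \<open>The tensor identities for pairs of basis vectors are brought to a common finite subset
  of D, with coefficients extended by 0. The coefficients are symmetrized by hand, since an
  expansion in a spanning set is not unique and could spoil the symmetry of
  \<open>k d\<close>.\<close>

lemma Hessian_decomposition:
  fixes D :: "'v set"
  assumes "determines_forms D"
  shows "\<exists>F k. finite F \<and> F \<subseteq> D \<and> (\<forall>d. k d \<in> sym_bilinear) \<and>
     (\<forall>\<phi> x u v. smooth \<phi> \<longrightarrow> dd u (dd v \<phi>) x = (\<Sum>d\<in>F. blinfun_apply (blinfun_apply (k d) u) v * dd d (dd d \<phi>) x))"
proof -
  have "\<exists>(F :: 'v set) r. finite F \<and> F \<subseteq> D \<and> tens b b' + tens b' b = (\<Sum>d\<in>F. r d *\<^sub>R tens d d)" for b b'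
    by (rule span_image_explicit[OF sym_tensor_in_span[OF assms]])
  then have "\<forall>b b'. \<exists>(F :: 'v set) r. finite F \<and> F \<subseteq> D \<and> tens b b' + tens b' b = (\<Sum>d\<in>F. r d *\<^sub>R tens d d)"
    by (intro allI)
  then obtain G r0 where G0: "\<forall>b b'. finite (G b b') \<and> G b b' \<subseteq> D \<and> tens b b' + tens b' b = (\<Sum>d\<in>G b b'. r0 b b' d *\<^sub>R tens d d)"
    unfolding choice_iff by (elim exE)
  have G: "finite (G b b')" "G b b' \<subseteq> D" "tens b b' + tens b' b = (\<Sum>d\<in>G b b'. r0 b b' d *\<^sub>R tens d d)" for b b'
    using G0[THEN spec, THEN spec, of b b'] by blast+
  define F where "F = (\<Union>b\<in>B. \<Union>b'\<in>B. G b b')"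
  have F: "finite F" "F \<subseteq> D" unfolding F_def
    by (intro finite_UN_I fin_B G(1), intro UN_least G(2))
  define r1 where "r1 = (\<lambda>b b' d. if d \<in> G b b' then r0 b b' d else 0)"
  have r1: "tens b b' + tens b' b = (\<Sum>d\<in>F. r1 b b' d *\<^sub>R tens d d)" if "b \<in> B" "b' \<in> B" for b b'
  proof -
    have "(\<Sum>d\<in>F. r1 b b' d *\<^sub>R tens d d) = (\<Sum>d\<in>G b b'. r1 b b' d *\<^sub>R tens d d)"
      using that F(1) by (intro sum.mono_neutral_right) (auto simp: F_def r1_def)
    then show ?thesis unfolding G(3) r1_def by simp
  qed
  \<comment> \<open>One factor 1/2 symmetrizes, the other removes the 2 in
    \<open>2 * q b b'\<close>.\<close>
  define r where "r = (\<lambda>b b' d. (r1 b b' d + r1 b' b d) / 4)"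
  have rsym: "r b b' d = r b' b d" for b b' d unfolding r_def by simp
  define cb where "cb = (\<lambda>b. Blinfun (crd b))"
  have cb: "blinfun_apply (cb b) v = crd b v" for b v
    unfolding cb_def by (simp add: bounded_linear_Blinfun_apply[OF bl_crd])
  define k where "k = (\<lambda>d. \<Sum>b\<in>B. \<Sum>b'\<in>B. r b b' d *\<^sub>R Blinfun (\<lambda>u. crd b u *\<^sub>R cb b'))"
  have kapp: "blinfun_apply (blinfun_apply (k d) u) v = (\<Sum>b\<in>B. \<Sum>b'\<in>B. r b b' d * (crd b u * crd b' v))" for d u v
    unfolding k_def
    by (simp add: blinfun.sum_left blinfun.scaleR_left bounded_linear_Blinfun_apply bounded_linear_scaleR_const bl_crd cb mult.assoc)
  have ksym: "k d \<in> sym_bilinear" for d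
  proof -
    have "(\<Sum>b\<in>B. \<Sum>b'\<in>B. r b b' d * (crd b u * crd b' v)) = (\<Sum>b\<in>B. \<Sum>b'\<in>B. r b b' d * (crd b v * crd b' u))" for u v
      by (subst sum.swap) (simp add: rsym mult.commute)
    then show ?thesis unfolding sym_bilinear_def mem_Collect_eq kapp by blast
  qed
  have "dd u (dd v \<phi>) x = (\<Sum>d\<in>F. blinfun_apply (blinfun_apply (k d) u) v * dd d (dd d \<phi>) x)" if sm: "smooth \<phi>" for \<phi> x u v
  proof -
    define q where "q = (\<lambda>u v. dd u (dd v \<phi>) x)"
    have qsym: "q u v = q v u" for u v unfolding q_def by (rule dd_commute[OF sm])
    have qlin1: "linear (\<lambda>u. q u v)" for v unfolding q_def by (rule linear_dd[OF smooth_dd[OF sm]])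
    have qlin: "linear (q u)" for u using qlin1[of u] unfolding qsym[of _ u] .
    have qb: "q b b' = (\<Sum>d\<in>F. r b b' d * q d d)" if b: "b \<in> B" "b' \<in> B" for b b'
    proof -
      have "2 * q b b' = (\<Sum>d\<in>F. r1 b b' d * q d d)" "2 * q b' b = (\<Sum>d\<in>F. r1 b' b d * q d d)"
        using sym_bilinear_form_via_tens[OF qlin qsym r1[OF b]] sym_bilinear_form_via_tens[OF qlin qsym r1[OF b(2,1)]] .
      then have "4 * q b b' = (\<Sum>d\<in>F. r1 b b' d * q d d) + (\<Sum>d\<in>F. r1 b' b d * q d d)"
        using qsym[of b b'] by simp
      also have "\<dots> = (\<Sum>d\<in>F. 4 * (r b b' d * q d d))"
        unfolding r_def sum.distrib[symmetric] by (intro sum.cong) (auto simp: algebra_simps)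
      also have "\<dots> = 4 * (\<Sum>d\<in>F. r b b' d * q d d)" by (simp only: sum_distrib_left)
      finally show ?thesis by simp
    qed
    have "q u v = q (\<Sum>b\<in>B. crd b u *\<^sub>R b) (\<Sum>b'\<in>B. crd b' v *\<^sub>R b')" by (simp add: coord_sum[OF basis])
    also have "\<dots> = (\<Sum>b\<in>B. crd b u * q b (\<Sum>b'\<in>B. crd b' v *\<^sub>R b'))"
      by (simp add: linear_sum[OF qlin1] linear_scale[OF qlin1])
    also have "\<dots> = (\<Sum>b\<in>B. \<Sum>b'\<in>B. (crd b u * crd b' v) * q b b')"
      by (simp add: linear_sum[OF qlin] linear_scale[OF qlin] sum_distrib_left mult.assoc)
    also have "\<dots> = (\<Sum>b\<in>B. \<Sum>b'\<in>B. \<Sum>d\<in>F. r b b' d * (crd b u * crd b' v) * q d d)"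
      by (intro sum.cong refl) (simp add: qb sum_distrib_left mult_ac)
    also have "\<dots> = (\<Sum>b\<in>B. \<Sum>d\<in>F. \<Sum>b'\<in>B. r b b' d * (crd b u * crd b' v) * q d d)"
      by (intro sum.cong refl sum.swap)
    also have "\<dots> = (\<Sum>d\<in>F. \<Sum>b\<in>B. \<Sum>b'\<in>B. r b b' d * (crd b u * crd b' v) * q d d)"
      by (rule sum.swap)
    also have "\<dots> = (\<Sum>d\<in>F. blinfun_apply (blinfun_apply (k d) u) v * q d d)"
      unfolding kapp by (simp add: sum_distrib_right)
    finally show ?thesis unfolding q_def .
  qed
  then show ?thesis using F ksym by blast
qed

end

subsection \<open>The second derivative of a convex function as a measure\<close>

text \<open>Both \<open>s + h\<close> and \<open>t\<close> lie between \<open>s\<close> and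
  \<open>t + h\<close>, with complementary weights; the two convexity inequalities are
  added.\<close>

lemma convex_increment_mono:
  fixes F :: "real \<Rightarrow> real"
  assumes "convex_on UNIV F" "s \<le> t" "0 < h"
  shows "F (s + h) - F s \<le> F (t + h) - F t"
proof -
  define T where "T = t + h - s"
  have T: "T > 0" unfolding T_def using assms by simp
  define \<theta> where "\<theta> = h / T"
  have \<theta>: "0 \<le> \<theta>" "\<theta> \<le> 1" "\<theta> * T = h" unfolding \<theta>_def using T assms by (auto simp: T_def)
  have e: "(1 - \<theta>) * s + \<theta> * (t + h) = s + \<theta> * T" "(1 - (1 - \<theta>)) * s + (1 - \<theta>) * (t + h) = t + h - \<theta> * T"
    unfolding T_def by (simp_all add: algebra_simps)
  have "F ((1 - \<theta>) * s + \<theta> * (t + h)) \<le> (1 - \<theta>) * F s + \<theta> * F (t + h)"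
    "F ((1 - (1 - \<theta>)) * s + (1 - \<theta>) * (t + h)) \<le> (1 - (1 - \<theta>)) * F s + (1 - \<theta>) * F (t + h)"
    using convex_onD[OF assms(1), of \<theta> s "t + h"] convex_onD[OF assms(1), of "1 - \<theta>" s "t + h"] \<theta>(1,2) by auto
  then have "F (s + h) \<le> (1 - \<theta>) * F s + \<theta> * F (t + h)" "F t \<le> \<theta> * F s + (1 - \<theta>) * F (t + h)"
    unfolding e \<theta>(3) by simp_all
  then show ?thesis by (simp add: algebra_simps)
qed

text \<open>Together the two estimates give the right derivative at 0: the quotients decrease as
  \<open>h\<close> decreases, and stay bounded below.\<close>

lemma convex_difference_quotient:
  fixes F :: "real \<Rightarrow> real"
  assumes "convex_on UNIV F" "0 < h"
  shows "h \<le> h' \<Longrightarrow> (F h - F 0) / h \<le> (F h' - F 0) / h'" and "F 0 - F (-1) \<le> (F h - F 0) / h"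
proof -
  assume hh: "h \<le> h'"
  define \<theta> where "\<theta> = h / h'"
  have \<theta>: "0 \<le> \<theta>" "\<theta> \<le> 1" "\<theta> * h' = h" unfolding \<theta>_def using assms(2) hh by auto
  have "F ((1 - \<theta>) * 0 + \<theta> * h') \<le> (1 - \<theta>) * F 0 + \<theta> * F h'"
    using convex_onD[OF assms(1), of \<theta> 0 h'] \<theta>(1,2) by auto
  then have "F h - F 0 \<le> \<theta> * (F h' - F 0)" using \<theta>(3) by (simp add: algebra_simps)
  then have "F h - F 0 \<le> h * ((F h' - F 0) / h')" unfolding \<theta>_def by simp
  then show "(F h - F 0) / h \<le> (F h' - F 0) / h'" using assms(2) by (simp add: divide_le_eq mult.commute)
next
  define \<theta> where "\<theta> = 1 / (1 + h)"
  have \<theta>: "0 \<le> \<theta>" "\<theta> \<le> 1" "\<theta> * (1 + h) = 1" unfolding \<theta>_def using assms(2) by auto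
  have "(1 - \<theta>) * (-1) + \<theta> * h = 0" using \<theta>(3) by (simp add: algebra_simps)
  then have "F 0 \<le> (1 - \<theta>) * F (-1) + \<theta> * F h"
    using convex_onD[OF assms(1), of \<theta> "-1" h] \<theta>(1,2) by auto
  then have "(1 + h) * F 0 \<le> (1 + h) * ((1 - \<theta>) * F (-1) + \<theta> * F h)" using assms(2) by (intro mult_left_mono) auto
  also have "\<dots> = (1 + h) * F (-1) - (\<theta> * (1 + h)) * F (-1) + (\<theta> * (1 + h)) * F h" by (simp add: algebra_simps)
  finally have "h * (F 0 - F (-1)) \<le> F h - F 0" unfolding \<theta>(3) by (simp add: algebra_simps)
  then show "F 0 - F (-1) \<le> (F h - F 0) / h" using assms(2) by (simp add: le_divide_eq mult.commute)
qed

text \<open>The Stieltjes measure of \<open>g\<close> appears as the image of Lebesgue measure under the generalized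
  inverse \<open>\<tau>\<close> of \<open>g\<close>.\<close>

lemma Stieltjes_integration_by_parts:
  fixes g \<Phi> \<Phi>' \<tau> :: "real \<Rightarrow> real"
  assumes g [measurable]: "g \<in> borel_measurable borel" and mono: "\<And>s t. s \<le> t \<Longrightarrow> g s \<le> g t"
    and d: "\<And>t. (\<Phi> has_real_derivative \<Phi>' t) (at t)" and c: "continuous_on UNIV \<Phi>'"
    and \<tau>: "\<And>s. 0 \<le> \<tau> s" "\<And>s. \<tau> s \<le> 1"
    and \<tau>1: "\<And>s t. 0 \<le> t \<Longrightarrow> t < \<tau> s \<Longrightarrow> g t < s" and \<tau>2: "\<And>s t. 0 \<le> t \<Longrightarrow> t \<le> 1 \<Longrightarrow> g t < s \<Longrightarrow> t \<le> \<tau> s"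
  shows "(LINT s|lborel. indicator {g 0<..g 1} s * \<Phi> (\<tau> s)) =
     \<Phi> 1 * g 1 - \<Phi> 0 * g 0 - (LINT t|lborel. indicator {0..1} t * (\<Phi>' t * g t))"
proof -
  have [measurable]: "\<Phi>' \<in> borel_measurable borel" by (rule borel_measurable_continuous_onI[OF c])
  have cI: "continuous_on S \<Phi>'" for S by (rule continuous_on_subset[OF c]) simp
  have "compact (\<Phi>' ` {0..1})" by (rule compact_continuous_image[OF cI]) auto
  then have "bounded (\<Phi>' ` {0..1})" by (rule compact_imp_bounded)
  then obtain C where "\<forall>y\<in>\<Phi>' ` {0..1}. norm y \<le> C" unfolding bounded_iff by blast
  then have C: "\<bar>\<Phi>' t\<bar> \<le> C" if "0 \<le> t" "t \<le> 1" for t using that by simp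
  have C0: "0 \<le> C" using C[of 0] by simp
  have g01: "g 0 \<le> g 1" by (rule mono) simp
  have FTC: "(LINT t|lborel. indicator {0..b} t *\<^sub>R \<Phi>' t) = \<Phi> b - \<Phi> 0" if "0 \<le> b" for b
    using d by (intro integral_FTC_Icc that cI)
      (auto simp: has_real_derivative_iff_has_vector_derivative[symmetric] intro: has_field_derivative_at_within)
  \<comment> \<open>The integrand is \<Phi>' on the region \<open>g t < s\<close>. Integrating in
    \<open>t\<close> first produces \<Phi> at the generalized inverse, integrating in
    \<open>s\<close> first the factor \<open>g 1 - g t\<close>.\<close>
  define H where "H = (\<lambda>s t. indicator {g 0<..g 1} s * (indicator {0..1} t * ((if g t < s then 1 else 0) * \<Phi>' t)) :: real)"
  have Hm: "(\<lambda>(s, t). H s t) \<in> borel_measurable (lborel \<Otimes>\<^sub>M lborel)" unfolding H_def by measurable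
  have Hint: "integrable (lborel \<Otimes>\<^sub>M lborel) (\<lambda>(s, t). H s t)"
  proof (rule integrableI_bounded_set)
    show "{g 0..g 1} \<times> {0..1::real} \<in> sets (lborel \<Otimes>\<^sub>M lborel)" by simp
    show "emeasure (lborel \<Otimes>\<^sub>M lborel) ({g 0..g 1} \<times> {0..1::real}) < \<infinity>"
      using g01 by (simp add: lborel.emeasure_pair_measure_Times ennreal_mult_less_top)
    show "AE p in lborel \<Otimes>\<^sub>M lborel. p \<in> {g 0..g 1} \<times> {0..1} \<longrightarrow> norm (case p of (s, t) \<Rightarrow> H s t) \<le> C"
      using C C0 by (intro AE_I2) (auto simp: H_def indicator_def)
    show "AE p in lborel \<Otimes>\<^sub>M lborel. p \<notin> {g 0..g 1} \<times> {0..1} \<longrightarrow> (case p of (s, t) \<Rightarrow> H s t) = 0"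
      by (intro AE_I2) (auto simp: H_def indicator_def)
  qed (rule Hm)
  have inner_t: "(LINT t|lborel. H s t) = indicator {g 0<..g 1} s * (\<Phi> (\<tau> s) - \<Phi> 0)" for s
  proof -
    have "(LINT t|lborel. H s t) = indicator {g 0<..g 1} s * (LINT t|lborel. indicator {0..1} t * ((if g t < s then 1 else 0) * \<Phi>' t))"
      unfolding H_def by simp
    also have "(LINT t|lborel. indicator {0..1} t * ((if g t < s then 1 else 0) * \<Phi>' t)) = (LINT t|lborel. indicator {0..\<tau> s} t *\<^sub>R \<Phi>' t)"
    proof (rule integral_cong_AE)
      \<comment> \<open>At the single point \<open>t = \<tau> s\<close> the two conditions on \<tau>
        do not decide whether \<open>g t < s\<close>.\<close>
      have "AE t in lborel. t \<noteq> \<tau> s" by (rule AE_lborel_singleton)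
      then show "AE t in lborel. indicator {0..1} t * ((if g t < s then 1 else 0) * \<Phi>' t) = indicator {0..\<tau> s} t *\<^sub>R \<Phi>' t"
      proof eventually_elim
        case (elim t)
        show ?case
        proof (cases "0 \<le> t \<and> t \<le> 1")
          case True
          then have "g t < s \<longleftrightarrow> t \<le> \<tau> s" using \<tau>1[of t s] \<tau>2[of t s] elim by fastforce
          then show ?thesis using True by (simp add: indicator_def)
        next
          case False
          then have "\<not> (0 \<le> t \<and> t \<le> \<tau> s)" using \<tau>(2)[of s] by linarith
          then show ?thesis using False by (auto simp: indicator_def)
        qed
      qed
    qed measurable
    finally show ?thesis unfolding FTC[OF \<tau>(1)] .
  qed
  have inner_s: "(LINT s|lborel. H s t) = indicator {0..1} t * (\<Phi>' t * (g 1 - g t))" for t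
  proof (cases "0 \<le> t \<and> t \<le> 1")
    case True
    then have gt: "g 0 \<le> g t" "g t \<le> g 1" using mono by auto
    have "(LINT s|lborel. H s t) = (LINT s|lborel. \<Phi>' t * indicator {g t<..g 1} s)"
      using True gt by (intro Bochner_Integration.integral_cong) (auto simp: H_def indicator_def)
    also have "\<dots> = \<Phi>' t * (g 1 - g t)" using gt by simp
    finally show ?thesis using True by simp
  next
    case False
    then show ?thesis by (simp add: H_def)
  qed
  have fub: "(LINT t|lborel. LINT s|lborel. H s t) = (LINT s|lborel. LINT t|lborel. H s t)"
    by (rule lborel_pair.Fubini_integral[OF Hint])
  have bd: "integrable lborel (\<lambda>t. indicator {0..1} t * h t)" if [measurable]: "h \<in> borel_measurable borel" and "\<And>t. 0 \<le> t \<Longrightarrow> t \<le> 1 \<Longrightarrow> \<bar>h t\<bar> \<le> K" for h :: "real \<Rightarrow> real" and K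
    by (rule integrableI_bounded_set[where A="{0..1}" and B=K]) (use that(2) in \<open>auto intro!: AE_I2 simp: indicator_def\<close>)
  have bs: "integrable lborel (\<lambda>s. indicator {g 0<..g 1} s * c)" for c :: real
    by (intro integrable_mult_left integrable_real_indicator) (use g01 in auto)
  have i2: "integrable lborel (\<lambda>s. indicator {g 0<..g 1} s * (\<Phi> (\<tau> s) - \<Phi> 0))"
    using lborel_pair.integrable_fst'[OF Hint] by (simp only: prod.case inner_t)
  have "(LINT s|lborel. indicator {g 0<..g 1} s * \<Phi> (\<tau> s))
      = (LINT s|lborel. indicator {g 0<..g 1} s * (\<Phi> (\<tau> s) - \<Phi> 0) + indicator {g 0<..g 1} s * \<Phi> 0)"
    by (simp add: algebra_simps)
  also have "\<dots> = (LINT s|lborel. indicator {g 0<..g 1} s * (\<Phi> (\<tau> s) - \<Phi> 0)) + (g 1 - g 0) * \<Phi> 0"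
    using i2 bs g01 by simp
  also have "(LINT s|lborel. indicator {g 0<..g 1} s * (\<Phi> (\<tau> s) - \<Phi> 0)) = (LINT t|lborel. indicator {0..1} t * (\<Phi>' t * (g 1 - g t)))"
    using fub unfolding inner_t inner_s by simp
  also have "\<dots> = (LINT t|lborel. g 1 * (indicator {0..1} t *\<^sub>R \<Phi>' t) - indicator {0..1} t * (\<Phi>' t * g t))"
    by (intro Bochner_Integration.integral_cong) (auto simp: algebra_simps)
  also have "\<dots> = g 1 * (LINT t|lborel. indicator {0..1} t *\<^sub>R \<Phi>' t) - (LINT t|lborel. indicator {0..1} t * (\<Phi>' t * g t))"
  proof -
    have "integrable lborel (\<lambda>t. indicator {0..1} t * \<Phi>' t)" by (rule bd[OF _ C]) auto
    moreover have "integrable lborel (\<lambda>t. indicator {0..1} t * (\<Phi>' t * g t))"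
    proof (rule bd)
      fix t :: real assume t: "0 \<le> t" "t \<le> 1"
      have "\<bar>g t\<bar> \<le> \<bar>g 0\<bar> + \<bar>g 1\<bar>" using mono[OF t(1)] mono[OF t(2)] by linarith
      then show "\<bar>\<Phi>' t * g t\<bar> \<le> C * (\<bar>g 0\<bar> + \<bar>g 1\<bar>)"
        unfolding abs_mult using C[OF t] C0 by (intro mult_mono) auto
    qed auto
    ultimately show ?thesis by simp
  qed
  also have "(LINT t|lborel. indicator {0..1} t *\<^sub>R \<Phi>' t) = \<Phi> 1 - \<Phi> 0" by (rule FTC) simp
  finally show ?thesis by (simp add: algebra_simps)
qed

context basis_space
begin

lemma integrable_translate:
  fixes f :: "'v \<Rightarrow> real"
  assumes "integrable L f"
  shows "integrable L (\<lambda>x. f (x + v))"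
proof -
  have "integrable (distr L borel (\<lambda>x. x + v)) f" using assms by (simp add: L_translate)
  then show ?thesis by (rule integrable_distr[rotated]) simp
qed

text \<open>The Stieltjes measures on the segments from \<open>x\<close> to \<open>x + d\<close> are
  averaged over all \<open>x\<close>; by translation invariance every piece of a line is counted
  with total weight 1, and no complement of the direction \<open>d\<close> has to be chosen.
  Concretely, the pairs \<open>(x, s)\<close> with \<open>g x < s \<and> s \<le> g (x + d)\<close>
  are mapped to \<open>x + \<tau> x s *\<^sub>R d\<close>.\<close>

lemma D_convex_second_derivative_measure:
  assumes D: "cone_of_directions D" and f: "D_convex D f" and d: "d \<in> D"
  shows "\<exists>P. pos_Radon_measure P \<and>
     (\<forall>\<phi>\<in>test_functions UNIV. (LINT x|L. f x * dd d (dd d \<phi>) x) = (LINT x|P. \<phi> x))"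
proof -
  have fcont: "continuous_on S f" for S
    using D_convex_continuous[OF D f] continuous_on_subset by blast
  have fm [measurable]: "f \<in> borel_measurable borel" by (rule borel_measurable_continuous_onI[OF fcont])
  define F where "F = (\<lambda>x t. f (x + t *\<^sub>R d))"
  have conv: "convex_on UNIV (F x)" for x unfolding F_def by (rule D_convex_line[OF f D d])
  define h where "h = (\<lambda>n. 1 / real (Suc n))"
  have h: "0 < h n" "h n \<le> 1" "h (Suc n) \<le> h n" for n unfolding h_def by (auto simp: frac_le)
  have hlim: "h \<longlonglongrightarrow> 0" unfolding h_def using LIMSEQ_inverse_real_of_nat by (simp add: inverse_eq_divide)
  define q where "q = (\<lambda>n x. (f (x + h n *\<^sub>R d) - f x) / h n)"
  have qF: "q n x = (F x (h n) - F x 0) / h n" for n x unfolding q_def F_def by simp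
  \<comment> \<open>The right derivative of \<open>f\<close> in direction \<open>d\<close>; by
    convexity the quotients decrease along \<open>h\<close>, so the limit exists everywhere.\<close>
  define g where "g = (\<lambda>x. lim (\<lambda>n. q n x))"
  have qlim: "(\<lambda>n. q n x) \<longlonglongrightarrow> g x" for x
  proof -
    have "decseq (\<lambda>n. q n x)"
      unfolding qF by (intro decseq_SucI convex_difference_quotient(1)[OF conv h(1)] h(3))
    moreover have "F x 0 - F x (-1) \<le> q n x" for n
      unfolding qF by (rule convex_difference_quotient(2)[OF conv h(1)])
    ultimately obtain l where "(\<lambda>n. q n x) \<longlonglongrightarrow> l" using decseq_convergent by metis
    then show ?thesis unfolding g_def by (simp add: limI)
  qed
  have qm [measurable]: "q n \<in> borel_measurable borel" for n unfolding q_def by measurable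
  have gm [measurable]: "g \<in> borel_measurable borel" by (rule borel_measurable_LIMSEQ_real[OF qlim qm])
  have gmono: "g (x + s *\<^sub>R d) \<le> g (x + t *\<^sub>R d)" if "s \<le> t" for x s t
  proof (rule LIMSEQ_le[OF qlim qlim], intro exI allI impI)
    fix n
    have "F x (s + h n) - F x s \<le> F x (t + h n) - F x t" by (rule convex_increment_mono[OF conv that h(1)])
    moreover have s: "x + r *\<^sub>R d + h n *\<^sub>R d = x + (r + h n) *\<^sub>R d" for r by (simp add: algebra_simps)
    ultimately show "q n (x + s *\<^sub>R d) \<le> q n (x + t *\<^sub>R d)"
      unfolding q_def F_def s using h(1)[of n] by (intro divide_right_mono) auto
  qed
  have bound: "\<exists>G\<ge>0. \<forall>x. norm x \<le> R \<longrightarrow> (\<forall>n. \<bar>q n x\<bar> \<le> G) \<and> \<bar>g x\<bar> \<le> G" for R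
  proof -
    obtain Lc where Lc: "Lc > 0" "\<And>x y. x \<in> cball 0 (R + norm d) \<Longrightarrow> y \<in> cball 0 (R + norm d) \<Longrightarrow> \<bar>f x - f y\<bar> \<le> Lc * norm (x - y)"
      using D_convex_Lipschitz_on_bounded[OF D f bounded_cball] by blast
    have qb: "\<bar>q n x\<bar> \<le> Lc * norm d" if "norm x \<le> R" for x n
    proof -
      have "norm (h n *\<^sub>R d) \<le> norm d" using h[of n] by (simp add: mult_left_le_one_le)
      then have "norm (x + h n *\<^sub>R d) \<le> R + norm d" using norm_triangle_ineq[of x "h n *\<^sub>R d"] that by linarith
      then have "\<bar>f (x + h n *\<^sub>R d) - f x\<bar> \<le> Lc * norm (h n *\<^sub>R d)"
        using Lc(2)[of "x + h n *\<^sub>R d" x] that norm_ge_zero[of d] by simp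
      then show ?thesis using h(1)[of n] by (simp add: q_def abs_divide divide_le_eq mult_ac)
    qed
    have "\<bar>g x\<bar> \<le> Lc * norm d" if "norm x \<le> R" for x
      by (rule LIMSEQ_le_const2[OF tendsto_rabs[OF qlim[of x]]]) (use qb[OF that] in blast)
    then show ?thesis using qb Lc(1) by (intro exI[of _ "Lc * norm d"]) simp
  qed
  have tbound: "\<exists>R\<ge>0. \<forall>x. R < norm x \<longrightarrow> \<psi> x = 0" if \<psi>: "\<psi> \<in> test_functions UNIV" for \<psi> :: "'v \<Rightarrow> real"
  proof -
    obtain R where R: "\<And>x. x \<in> tsupp \<psi> \<Longrightarrow> norm x \<le> R"
      using compact_imp_bounded[OF test_functionsD(2)[OF \<psi>]] unfolding bounded_iff by blast
    have "\<psi> x = 0" if "\<bar>R\<bar> < norm x" for x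
      using tsupp_zero[of x \<psi>] R[of x] that by fastforce
    then show ?thesis by (intro exI[of _ "\<bar>R\<bar>"]) simp
  qed
  \<comment> \<open>\<open>g\<close> is also the distributional derivative: translation moves the
    difference quotient from \<open>f\<close> to \<psi>, and dominated convergence applies on both
    sides.\<close>
  have ibp: "(LINT x|L. f x * dd d \<psi> x) = - (LINT x|L. g x * \<psi> x)" if \<psi>: "\<psi> \<in> test_functions UNIV" for \<psi>
  proof -
    have sm: "smooth \<psi>" by (rule test_functionsD(1)[OF \<psi>])
    have [measurable]: "\<psi> \<in> borel_measurable borel" "dd d \<psi> \<in> borel_measurable borel"
      by (intro borel_measurable_continuous_onI smooth_continuous_on smooth_dd sm)+
    obtain R where R: "R \<ge> 0" "\<And>x. R < norm x \<Longrightarrow> \<psi> x = 0" using tbound[OF \<psi>] by blast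
    obtain G where G: "G \<ge> 0" "\<And>x n. norm x \<le> R \<Longrightarrow> \<bar>q n x\<bar> \<le> G" using bound[of R] by blast
    have lim1: "(\<lambda>n. LINT x|L. q n x * \<psi> x) \<longlonglongrightarrow> (LINT x|L. g x * \<psi> x)"
    proof (rule integral_dominated_convergence[where w="\<lambda>x. G * \<bar>\<psi> x\<bar>"])
      show "integrable L (\<lambda>x. G * \<bar>\<psi> x\<bar>)" by (intro integrable_mult_right integrable_abs integrable_test[OF \<psi>])
      show "AE x in L. (\<lambda>n. q n x * \<psi> x) \<longlonglongrightarrow> g x * \<psi> x" by (intro AE_I2 tendsto_mult qlim tendsto_const)
      show "AE x in L. norm (q n x * \<psi> x) \<le> G * \<bar>\<psi> x\<bar>" for n
      proof (rule AE_I2)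
        fix x
        show "norm (q n x * \<psi> x) \<le> G * \<bar>\<psi> x\<bar>"
          using G(2)[of x n] R(2)[of x] by (cases "norm x \<le> R") (auto simp: abs_mult mult_right_mono)
      qed
    qed auto
    have eq: "(LINT x|L. q n x * \<psi> x) = (LINT x|L. f x * ((\<psi> (x + h n *\<^sub>R (- d)) - \<psi> x) / h n))" for n
    proof -
      have c1: "continuous_on UNIV (\<lambda>x. f (x + h n *\<^sub>R d))"
        by (intro continuous_on_compose2[OF fcont[of UNIV]] continuous_intros) auto
      have i1: "integrable L (\<lambda>x. f (x + h n *\<^sub>R d) * \<psi> x)" by (rule integrable_cont_test[OF c1 \<psi>])
      have i2: "integrable L (\<lambda>x. f x * \<psi> x)" by (rule integrable_cont_test[OF fcont \<psi>])
      have i3: "integrable L (\<lambda>x. f x * \<psi> (x + h n *\<^sub>R (- d)))"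
        using integrable_translate[OF i1, of "h n *\<^sub>R (- d)"] by (simp add: add.assoc)
      have e1: "(LINT x|L. f (x + h n *\<^sub>R d) * \<psi> x) = (LINT x|L. f x * \<psi> (x + h n *\<^sub>R (- d)))"
        using integral_translate[of "\<lambda>x. f (x + h n *\<^sub>R d) * \<psi> x" "h n *\<^sub>R (- d)"] by (simp add: add.assoc)
      have "(LINT x|L. q n x * \<psi> x) = (LINT x|L. (f (x + h n *\<^sub>R d) * \<psi> x - f x * \<psi> x) / h n)"
        unfolding q_def by (intro Bochner_Integration.integral_cong) (auto simp: algebra_simps diff_divide_distrib)
      also have "\<dots> = ((LINT x|L. f (x + h n *\<^sub>R d) * \<psi> x) - (LINT x|L. f x * \<psi> x)) / h n"
        using i1 i2 by simp
      also have "\<dots> = ((LINT x|L. f x * \<psi> (x + h n *\<^sub>R (- d))) - (LINT x|L. f x * \<psi> x)) / h n" unfolding e1 ..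
      also have "\<dots> = (LINT x|L. (f x * \<psi> (x + h n *\<^sub>R (- d)) - f x * \<psi> x) / h n)"
        using i3 i2 by simp
      also have "\<dots> = (LINT x|L. f x * ((\<psi> (x + h n *\<^sub>R (- d)) - \<psi> x) / h n))"
        by (intro Bochner_Integration.integral_cong) (auto simp: algebra_simps diff_divide_distrib)
      finally show ?thesis .
    qed
    obtain C where C: "C \<ge> 0" "\<And>x v. \<bar>dd v \<psi> x\<bar> \<le> C * norm v" using test_functions_dd_bound[OF \<psi>] by blast
    have "compact (f ` cball 0 (R + norm d))"
      by (intro compact_continuous_image fcont) (simp add: compact_eq_bounded_closed)
    then have "bounded (f ` cball 0 (R + norm d))" by (rule compact_imp_bounded)
    then obtain Fb where "\<forall>y\<in>f ` cball 0 (R + norm d). norm y \<le> Fb" unfolding bounded_iff by blast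
    then have Fb: "\<bar>f x\<bar> \<le> Fb" if "norm x \<le> R + norm d" for x using that by simp
    have "(0::'v) \<in> cball 0 (R + norm d)" using R(1) by simp
    then have Fb0: "0 \<le> Fb" using Fb[of 0] R(1) by simp
    define w where "w = (\<lambda>x. Fb * (C * norm d) * indicator (cball (0::'v) (R + norm d)) x :: real)"
    have lim2: "(\<lambda>n. LINT x|L. f x * ((\<psi> (x + h n *\<^sub>R (- d)) - \<psi> x) / h n)) \<longlonglongrightarrow> (LINT x|L. f x * dd (- d) \<psi> x)"
    proof (rule integral_dominated_convergence[where w=w])
      show "integrable L w" unfolding w_def
        using emeasure_L_bounded[OF bounded_cball] by (intro integrable_mult_right integrable_real_indicator) auto
      show "(\<lambda>x. f x * dd (- d) \<psi> x) \<in> borel_measurable L"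
        using borel_measurable_continuous_onI[OF smooth_continuous_on[OF smooth_dd[OF sm, of "- d"]]] by measurable
      show "AE x in L. (\<lambda>n. f x * ((\<psi> (x + h n *\<^sub>R (- d)) - \<psi> x) / h n)) \<longlonglongrightarrow> f x * dd (- d) \<psi> x"
      proof (intro AE_I2 tendsto_mult tendsto_const)
        fix x
        have "((\<lambda>t. \<psi> (x + t *\<^sub>R (- d))) has_real_derivative dd (- d) \<psi> (x + 0 *\<^sub>R (- d))) (at 0)"
          by (rule DERIV_dd_line[OF smooth_differentiable[OF sm]])
        then have "((\<lambda>t. (\<psi> (x + t *\<^sub>R (- d)) - \<psi> x) / t) \<longlongrightarrow> dd (- d) \<psi> x) (at 0)"
          by (simp add: DERIV_def)
        moreover have "filterlim h (at 0) sequentially"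
          using hlim h(1) by (auto simp: filterlim_at intro!: always_eventually) (metis less_irrefl)
        ultimately show "(\<lambda>n. (\<psi> (x + h n *\<^sub>R (- d)) - \<psi> x) / h n) \<longlonglongrightarrow> dd (- d) \<psi> x"
          by (rule filterlim_compose)
      qed
      show "AE x in L. norm (f x * ((\<psi> (x + h n *\<^sub>R (- d)) - \<psi> x) / h n)) \<le> w x" for n
      proof (rule AE_I2)
        fix x
        have nh: "norm (h n *\<^sub>R (- d)) \<le> norm d" using h[of n] by (simp add: mult_left_le_one_le)
        show "norm (f x * ((\<psi> (x + h n *\<^sub>R (- d)) - \<psi> x) / h n)) \<le> w x"
        proof (cases "norm x \<le> R + norm d")
          case True
          have "\<bar>\<psi> (x + h n *\<^sub>R (- d)) - \<psi> x\<bar> \<le> C * norm (h n *\<^sub>R (- d))"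
            by (rule mvt_line[OF smooth_differentiable[OF sm] C(2)])
          then have "\<bar>(\<psi> (x + h n *\<^sub>R (- d)) - \<psi> x) / h n\<bar> \<le> C * norm d"
            using h(1)[of n] by (simp add: abs_divide divide_le_eq mult_ac)
          then have "\<bar>f x\<bar> * \<bar>(\<psi> (x + h n *\<^sub>R (- d)) - \<psi> x) / h n\<bar> \<le> Fb * (C * norm d)"
            using Fb[OF True] Fb0 by (intro mult_mono) auto
          then show ?thesis using True by (simp add: w_def abs_mult)
        next
          case False
          have "norm x \<le> norm (x + h n *\<^sub>R (- d)) + norm (h n *\<^sub>R (- d))"
            using norm_triangle_ineq4[of "x + h n *\<^sub>R (- d)" "h n *\<^sub>R (- d)"] by simp
          then have "R < norm (x + h n *\<^sub>R (- d))" "R < norm x"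
            using False nh norm_ge_zero[of d] by linarith+
          then have "\<psi> (x + h n *\<^sub>R (- d)) = 0" "\<psi> x = 0" using R(2) by blast+
          then show ?thesis using False by (simp add: w_def)
        qed
      qed
    qed auto
    have "(LINT x|L. f x * dd (- d) \<psi> x) = - (LINT x|L. f x * dd d \<psi> x)"
    proof -
      have "dd (- d) \<psi> x = - dd d \<psi> x" for x
        using dd_linear_arg(2)[OF smooth_differentiable[OF sm], of "-1" d x] by simp
      then show ?thesis by simp
    qed
    then show ?thesis using LIMSEQ_unique[OF lim1] lim2 unfolding eq by fastforce
  qed
  \<comment> \<open>Rational parameters make \<tau> a countable supremum, hence measurable; since
    \<open>g\<close> is monotone along lines nothing is lost.\<close>
  define T where "T = {0..1::real} \<inter> \<rat>"
  have T0: "0 \<in> T" unfolding T_def by simp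
  have T: "countable T" "\<And>t. t \<in> T \<Longrightarrow> 0 \<le> t \<and> t \<le> 1"
    unfolding T_def using countable_rat by auto
  have Tne: "T \<noteq> {}" using T0 by blast
  note T = T(1) Tne T(2) T0
  \<comment> \<open>Parameters that fail the condition contribute 0; as all of \<open>T\<close> is
    nonnegative, this default never raises the supremum above its true value.\<close>
  define \<tau> where "\<tau> = (\<lambda>x s. SUP t\<in>T. if g (x + t *\<^sub>R d) < s then t else 0)"
  have bdd: "bdd_above ((\<lambda>t. if g (x + t *\<^sub>R d) < s then t else 0) ` T)" for x s
    using T(3) by (intro bdd_aboveI[of _ 1]) (auto split: if_splits)
  have \<tau>0: "0 \<le> \<tau> x s" for x s
    unfolding \<tau>_def by (rule cSUP_upper2[OF bdd T(4)]) simp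
  have \<tau>1: "\<tau> x s \<le> 1" for x s
    unfolding \<tau>_def by (rule cSUP_least[OF T(2)]) (use T(3) in auto)
  have \<tau>lt: "g (x + t *\<^sub>R d) < s" if t: "0 \<le> t" "t < \<tau> x s" for x s t
  proof -
    obtain r where r: "r \<in> T" "t < (if g (x + r *\<^sub>R d) < s then r else 0)"
      using t(2) less_cSUP_iff[OF T(2) bdd] unfolding \<tau>_def by blast
    then have "g (x + r *\<^sub>R d) < s" "t < r" using t(1) by (auto split: if_splits)
    then show ?thesis using gmono[of t r x] by simp
  qed
  have \<tau>ge: "t \<le> \<tau> x s" if t: "0 \<le> t" "t \<le> 1" "g (x + t *\<^sub>R d) < s" for x s t
  proof (rule ccontr)
    assume "\<not> ?thesis"
    then obtain r where r: "r \<in> \<rat>" "\<tau> x s < r" "r < t" using Rats_dense_in_real[of "\<tau> x s" t] by auto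
    have rT: "r \<in> T" unfolding T_def using r t \<tau>0[of x s] by auto
    have "g (x + r *\<^sub>R d) < s" using gmono[of r t x] r(3) t(3) by simp
    then have "r \<le> \<tau> x s" unfolding \<tau>_def by (intro cSUP_upper2[OF bdd rT]) simp
    then show False using r(2) by simp
  qed
  define N where "N = L \<Otimes>\<^sub>M (lborel :: real measure)"
  have sN [measurable_cong]: "sets N = sets (borel \<Otimes>\<^sub>M borel)" unfolding N_def by (intro sets_pair_measure_cong) auto
  have spN: "space N = UNIV" unfolding N_def by (simp add: space_pair_measure)
  have \<tau>m [measurable]: "(\<lambda>p. \<tau> (fst p) (snd p)) \<in> borel_measurable N"
    unfolding \<tau>_def
  proof (rule borel_measurable_cSUP[OF T(1)])
    fix t
    have [measurable]: "fst \<in> N \<rightarrow>\<^sub>M borel" "snd \<in> N \<rightarrow>\<^sub>M borel" by measurable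
    have [measurable]: "(\<lambda>p. fst p + t *\<^sub>R d) \<in> N \<rightarrow>\<^sub>M borel" by measurable
    have "(\<lambda>p. g (fst p + t *\<^sub>R d)) \<in> N \<rightarrow>\<^sub>M borel" by measurable
    then show "(\<lambda>p. if g (fst p + t *\<^sub>R d) < snd p then t else 0) \<in> borel_measurable N" by measurable
  qed (rule bdd)
  define E where "E = {p :: 'v \<times> real. g (fst p) < snd p \<and> snd p \<le> g (fst p + d)}"
  have Em [measurable]: "E \<in> sets N"
  proof -
    have "{p \<in> space N. g (fst p) < snd p \<and> snd p \<le> g (fst p + d)} \<in> sets N" by measurable
    then show ?thesis unfolding E_def spN by simp
  qed
  define m where "m = (\<lambda>p. fst p + \<tau> (fst p) (snd p) *\<^sub>R d)"
  have mm [measurable]: "m \<in> N \<rightarrow>\<^sub>M borel" unfolding m_def by measurable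
  define P where "P = distr (density N (\<lambda>p. ennreal (indicator E p))) borel m"
  have supp: "norm (fst p) \<le> R + norm d" if "norm (m p) \<le> R" for p R
  proof -
    have "norm (fst p) \<le> norm (m p) + norm (\<tau> (fst p) (snd p) *\<^sub>R d)"
      unfolding m_def using norm_triangle_ineq4[of "fst p + \<tau> (fst p) (snd p) *\<^sub>R d" "\<tau> (fst p) (snd p) *\<^sub>R d"] by simp
    moreover have "norm (\<tau> (fst p) (snd p) *\<^sub>R d) \<le> norm d"
      using \<tau>0 \<tau>1 by (simp add: mult_left_le_one_le)
    ultimately show ?thesis using that by linarith
  qed
  \<comment> \<open>Points mapped into a bounded set come from a bounded set of \<open>x\<close>, on
    which \<open>g\<close> is bounded. This gives both finiteness on compact sets and integrability
    for Fubini.\<close>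
  have box: "\<exists>Z\<in>sets N. emeasure N Z < \<infinity> \<and> (\<forall>p\<in>E. norm (m p) \<le> R \<longrightarrow> p \<in> Z)" for R
  proof -
    obtain G where G: "G \<ge> 0" "\<And>x. norm x \<le> R + 2 * norm d \<Longrightarrow> \<bar>g x\<bar> \<le> G" using bound[of "R + 2 * norm d"] by blast
    let ?Z = "cball (0::'v) (R + norm d) \<times> {-G..G}"
    have "?Z \<in> sets N" unfolding N_def by simp
    moreover have "emeasure N ?Z < \<infinity>"
      unfolding N_def using emeasure_L_bounded[OF bounded_cball, of 0 "R + norm d"] G(1)
      by (simp add: lborel.emeasure_pair_measure_Times ennreal_mult_less_top)
    moreover have "p \<in> ?Z" if p: "p \<in> E" "norm (m p) \<le> R" for p
    proof -
      have n: "norm (fst p) \<le> R + norm d" by (rule supp[OF p(2)])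
      then have "norm (fst p + d) \<le> R + 2 * norm d" using norm_triangle_ineq[of "fst p" d] by linarith
      then have "\<bar>g (fst p)\<bar> \<le> G" "\<bar>g (fst p + d)\<bar> \<le> G" using G(2)[of "fst p"] G(2)[of "fst p + d"] n norm_ge_zero[of d] by linarith+
      then have "snd p \<in> {-G..G}" using p(1) unfolding E_def by auto
      then show ?thesis using n by (cases p) auto
    qed
    ultimately show ?thesis by blast
  qed
  have Radon: "pos_Radon_measure P"
    unfolding pos_Radon_measure_def
  proof (intro conjI allI impI)
    show "sets P = sets borel" unfolding P_def by simp
    fix K :: "'v set" assume K: "compact K"
    obtain R where R: "\<And>x. x \<in> K \<Longrightarrow> norm x \<le> R" using compact_imp_bounded[OF K] unfolding bounded_iff by blast
    obtain Z where Z: "Z \<in> sets N" "emeasure N Z < \<infinity>" "\<And>p. p \<in> E \<Longrightarrow> norm (m p) \<le> R \<Longrightarrow> p \<in> Z" using box[of R] by blast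
    have Kb: "K \<in> sets borel" using K by (simp add: compact_imp_closed)
    have "emeasure P K = emeasure (density N (\<lambda>p. ennreal (indicator E p))) (m -` K \<inter> space N)"
      unfolding P_def using Kb by (subst emeasure_distr) auto
    also have "\<dots> = (\<integral>\<^sup>+p. ennreal (indicator E p) * indicator (m -` K \<inter> space N) p \<partial>N)"
      using measurable_sets[OF mm Kb] by (subst emeasure_density) auto
    also have "\<dots> \<le> (\<integral>\<^sup>+p. indicator Z p \<partial>N)"
      using R Z(3) by (intro nn_integral_mono) (auto simp: indicator_def)
    also have "\<dots> < \<infinity>" using Z(1,2) by simp
    finally show "emeasure P K < \<infinity>" .
  qed
  have "(LINT x|L. f x * dd d (dd d \<phi>) x) = (LINT x|P. \<phi> x)" if \<phi>: "\<phi> \<in> test_functions UNIV" for \<phi>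
  proof -
    have sm: "smooth \<phi>" by (rule test_functionsD(1)[OF \<phi>])
    have [measurable]: "\<phi> \<in> borel_measurable borel" "dd d \<phi> \<in> borel_measurable borel"
      by (intro borel_measurable_continuous_onI smooth_continuous_on smooth_dd sm)+
    have d\<phi>: "dd d \<phi> \<in> test_functions UNIV" by (rule test_functions_dd[OF \<phi>])
    obtain R where R: "R \<ge> 0" "\<And>x. R < norm x \<Longrightarrow> \<phi> x = 0" using tbound[OF \<phi>] by blast
    obtain R' where R': "R' \<ge> 0" "\<And>x. R' < norm x \<Longrightarrow> dd d \<phi> x = 0" using tbound[OF d\<phi>] by blast
    obtain C where C: "\<And>x. \<bar>\<phi> x\<bar> \<le> C" using test_functions_bounded[OF \<phi>] by blast
    obtain C' where C': "\<And>x. \<bar>dd d \<phi> x\<bar> \<le> C'" using test_functions_bounded[OF d\<phi>] by blast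
    have prodint: "integrable L (\<lambda>x. \<psi> x * g x)"
      if \<psi>: "\<psi> \<in> test_functions UNIV" for \<psi>
    proof -
      obtain S where S: "S \<ge> 0" "\<And>x. S < norm x \<Longrightarrow> \<psi> x = 0" using tbound[OF \<psi>] by blast
      obtain A where A: "\<And>x. \<bar>\<psi> x\<bar> \<le> A" using test_functions_bounded[OF \<psi>] by blast
      obtain G where G: "G \<ge> 0" "\<And>x. norm x \<le> S \<Longrightarrow> \<bar>g x\<bar> \<le> G" using bound[of S] by blast
      have A0: "0 \<le> A" using A[of 0] by linarith
      have [measurable]: "\<psi> \<in> borel_measurable borel"
        by (intro borel_measurable_continuous_onI smooth_continuous_on test_functionsD(1)[OF \<psi>])
      show ?thesis
      proof (rule integrable_compact_support[where K="cball 0 S" and C="A * G"])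
        show "\<bar>\<psi> x * g x\<bar> \<le> A * G" for x
        proof (cases "norm x \<le> S")
          case True
          then show ?thesis unfolding abs_mult using A[of x] G(2)[OF True] A0 by (intro mult_mono) auto
        next
          case False
          then show ?thesis using S(2)[of x] A0 G(1) by simp
        qed
        show "\<psi> x * g x = 0" if "x \<notin> cball 0 S" for x using that S(2)[of x] by simp
      qed auto
    qed
    interpret p: pair_sigma_finite L "lborel :: real measure" by standard
    have "(LINT x|P. \<phi> x) = (LINT p|density N (\<lambda>p. ennreal (indicator E p)). \<phi> (m p))"
      unfolding P_def by (subst integral_distr) auto
    also have "\<dots> = (LINT p|N. indicator E p *\<^sub>R \<phi> (m p))"
      by (rule integral_density) auto
    also have "\<dots> = (LINT p|(L \<Otimes>\<^sub>M lborel). indicator E p * \<phi> (m p))" unfolding N_def by simp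
    also have "\<dots> = (LINT x|L. LINT s|lborel. indicator E (x, s) * \<phi> (m (x, s)))"
    proof (rule p.integral_fst'[symmetric])
      obtain Z where Z: "Z \<in> sets N" "emeasure N Z < \<infinity>" "\<And>p. p \<in> E \<Longrightarrow> norm (m p) \<le> R \<Longrightarrow> p \<in> Z" using box[of R] by blast
      have "integrable N (\<lambda>p. indicator E p * \<phi> (m p))"
      proof (rule integrableI_bounded_set[OF Z(1) _ Z(2), where B=C])
        show "AE p in N. p \<in> Z \<longrightarrow> norm (indicator E p * \<phi> (m p)) \<le> C"
        proof (intro AE_I2 impI)
          fix p show "norm (indicator E p * \<phi> (m p)) \<le> C"
            using C[of "m p"] by (auto simp: indicator_def)
        qed
        show "AE p in N. p \<notin> Z \<longrightarrow> indicator E p * \<phi> (m p) = 0"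
        proof (intro AE_I2 impI)
          fix p assume "p \<notin> Z"
          then have "p \<notin> E \<or> R < norm (m p)" using Z(3)[of p] by (meson not_le)
          then show "indicator E p * \<phi> (m p) = 0" using R(2) by auto
        qed
      qed measurable
      then show "integrable (L \<Otimes>\<^sub>M lborel) (\<lambda>p. indicator E p * \<phi> (m p))" unfolding N_def .
    qed
    also have "\<dots> = (LINT x|L. \<phi> (x + d) * g (x + d) - \<phi> x * g x - (LINT t|lborel. indicator {0..1} t * (dd d \<phi> (x + t *\<^sub>R d) * g (x + t *\<^sub>R d))))"
    proof (rule Bochner_Integration.integral_cong[OF refl])
      fix x
      have "(LINT s|lborel. indicator {g (x + 0 *\<^sub>R d)<..g (x + 1 *\<^sub>R d)} s * \<phi> (x + \<tau> x s *\<^sub>R d)) =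
         \<phi> (x + 1 *\<^sub>R d) * g (x + 1 *\<^sub>R d) - \<phi> (x + 0 *\<^sub>R d) * g (x + 0 *\<^sub>R d) -
         (LINT t|lborel. indicator {0..1} t * (dd d \<phi> (x + t *\<^sub>R d) * g (x + t *\<^sub>R d)))"
      proof (rule Stieltjes_integration_by_parts[where g="\<lambda>t. g (x + t *\<^sub>R d)" and \<Phi>="\<lambda>t. \<phi> (x + t *\<^sub>R d)"
            and \<Phi>'="\<lambda>t. dd d \<phi> (x + t *\<^sub>R d)" and \<tau>="\<tau> x"])
        show "continuous_on UNIV (\<lambda>t. dd d \<phi> (x + t *\<^sub>R d))"
          by (intro continuous_on_compose2[OF smooth_continuous_on[OF smooth_dd[OF sm], of UNIV]] continuous_intros) auto
        show "((\<lambda>t. \<phi> (x + t *\<^sub>R d)) has_real_derivative dd d \<phi> (x + t *\<^sub>R d)) (at t)" for t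
          by (rule DERIV_dd_line[OF smooth_differentiable[OF sm]])
        show "(\<lambda>t. g (x + t *\<^sub>R d)) \<in> borel_measurable borel" by measurable
        show "g (x + s *\<^sub>R d) \<le> g (x + t *\<^sub>R d)" if "s \<le> t" for s t by (rule gmono[OF that])
        show "0 \<le> \<tau> x s" "\<tau> x s \<le> 1" for s by (rule \<tau>0, rule \<tau>1)
        show "g (x + t *\<^sub>R d) < s" if "0 \<le> t" "t < \<tau> x s" for s t by (rule \<tau>lt[OF that])
        show "t \<le> \<tau> x s" if "0 \<le> t" "t \<le> 1" "g (x + t *\<^sub>R d) < s" for s t by (rule \<tau>ge[OF that])
      qed
      moreover have "indicator E (x, s) * \<phi> (m (x, s)) = indicator {g (x + 0 *\<^sub>R d)<..g (x + 1 *\<^sub>R d)} s * \<phi> (x + \<tau> x s *\<^sub>R d)" for s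
        unfolding E_def m_def by (auto simp: indicator_def)
      ultimately show "(LINT s|lborel. indicator E (x, s) * \<phi> (m (x, s))) = \<phi> (x + d) * g (x + d) - \<phi> x * g x -
          (LINT t|lborel. indicator {0..1} t * (dd d \<phi> (x + t *\<^sub>R d) * g (x + t *\<^sub>R d)))" by simp
    qed
    \<comment> \<open>The two boundary terms have equal integrals by translation; in the double
      integral every \<open>t\<close> contributes the same integral over \<open>x\<close>, again by
      translation.\<close>
    also have "\<dots> = - (LINT x|L. dd d \<phi> x * g x)"
    proof -
      define H where "H = (\<lambda>x t. indicator {0..1} t * (dd d \<phi> (x + t *\<^sub>R d) * g (x + t *\<^sub>R d)) :: real)"
      have [measurable]: "(\<lambda>(x, t). H x t) \<in> borel_measurable (L \<Otimes>\<^sub>M lborel)" unfolding H_def by measurable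
      obtain G where G: "G \<ge> 0" "\<And>x. norm x \<le> R' \<Longrightarrow> \<bar>g x\<bar> \<le> G" using bound[of R'] by blast
      have C'0: "0 \<le> C'" using C'[of 0] by linarith
      have Hint: "integrable (L \<Otimes>\<^sub>M lborel) (\<lambda>(x, t). H x t)"
      proof (rule integrableI_bounded_set[where A="cball (0::'v) (R' + norm d) \<times> {0..1}" and B="C' * G"])
        show "emeasure (L \<Otimes>\<^sub>M lborel) (cball (0::'v) (R' + norm d) \<times> {0..1::real}) < \<infinity>"
          using emeasure_L_bounded[OF bounded_cball, of 0 "R' + norm d"]
          by (simp add: lborel.emeasure_pair_measure_Times ennreal_mult_less_top)
        have Hb: "\<bar>H x t\<bar> \<le> C' * G" for x t
        proof (cases "norm (x + t *\<^sub>R d) \<le> R'")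
          case True
          have "\<bar>dd d \<phi> (x + t *\<^sub>R d) * g (x + t *\<^sub>R d)\<bar> \<le> C' * G"
            unfolding abs_mult using C' G(2)[OF True] C'0 by (intro mult_mono) auto
          then show ?thesis using C'0 G(1) by (simp add: H_def indicator_def)
        next
          case False
          then show ?thesis using R'(2)[of "x + t *\<^sub>R d"] C'0 G(1) by (simp add: H_def)
        qed
        then show "AE p in L \<Otimes>\<^sub>M lborel. p \<in> cball 0 (R' + norm d) \<times> {0..1} \<longrightarrow> norm (case p of (x, t) \<Rightarrow> H x t) \<le> C' * G"
          by (intro AE_I2) auto
        show "AE p in L \<Otimes>\<^sub>M lborel. p \<notin> cball 0 (R' + norm d) \<times> {0..1} \<longrightarrow> (case p of (x, t) \<Rightarrow> H x t) = 0"
        proof (intro AE_I2 impI)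
          fix p assume p: "p \<notin> cball (0::'v) (R' + norm d) \<times> {0..1::real}"
          obtain x t where xt: "p = (x, t)" by (cases p)
          have "H x t = 0"
          proof (cases "0 \<le> t \<and> t \<le> 1")
            case True
            then have nx: "R' + norm d < norm x" using p xt by auto
            have "norm x \<le> norm (x + t *\<^sub>R d) + norm (t *\<^sub>R d)"
              using norm_triangle_ineq4[of "x + t *\<^sub>R d" "t *\<^sub>R d"] by simp
            moreover have "norm (t *\<^sub>R d) \<le> norm d" using True by (simp add: mult_left_le_one_le)
            ultimately have "R' < norm (x + t *\<^sub>R d)" using nx by linarith
            then show ?thesis using R'(2) by (simp add: H_def)
          qed (simp add: H_def)
          then show "(case p of (x, t) \<Rightarrow> H x t) = 0" unfolding xt by simp
        qed
      qed auto
      have i3: "integrable L (\<lambda>x. LINT t|lborel. H x t)" using p.integrable_fst'[OF Hint] by simp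
      have "(LINT x|L. LINT t|lborel. H x t) = (LINT t|lborel. LINT x|L. H x t)"
        by (rule p.Fubini_integral[OF Hint, symmetric])
      also have "\<dots> = (LINT t|lborel. indicator {0..1::real} t * (LINT x|L. dd d \<phi> x * g x))"
      proof (rule Bochner_Integration.integral_cong[OF refl])
        fix t :: real
        have "(LINT x|L. dd d \<phi> (x + t *\<^sub>R d) * g (x + t *\<^sub>R d)) = (LINT x|L. dd d \<phi> x * g x)"
          by (rule integral_translate) measurable
        then show "(LINT x|L. H x t) = indicator {0..1} t * (LINT x|L. dd d \<phi> x * g x)"
          unfolding H_def by simp
      qed
      also have "\<dots> = (LINT x|L. dd d \<phi> x * g x)" by simp
      finally have e3: "(LINT x|L. LINT t|lborel. H x t) = (LINT x|L. dd d \<phi> x * g x)" .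
      have i1: "integrable L (\<lambda>x. \<phi> x * g x)" by (rule prodint[OF \<phi>])
      have i2: "integrable L (\<lambda>x. \<phi> (x + d) * g (x + d))" by (rule integrable_translate[OF i1])
      have e1: "(LINT x|L. \<phi> (x + d) * g (x + d)) = (LINT x|L. \<phi> x * g x)"
        by (rule integral_translate) measurable
      have Hr: "indicator {0..1} t * (dd d \<phi> (x + t *\<^sub>R d) * g (x + t *\<^sub>R d)) = H x t" for x t
        by (simp add: H_def)
      show ?thesis unfolding Hr using i1 i2 i3 e1 e3 by simp
    qed
    also have "\<dots> = (LINT x|L. f x * dd d (dd d \<phi>) x)"
      using ibp[OF d\<phi>] by (simp add: mult.commute)
    finally show ?thesis by simp
  qed
  then show ?thesis using Radon by blast
qed

end

section \<open>Nonnegative combinations of Radon measures and the Hessian measure\<close>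

lemma pos_Radon_integrable_test:
  fixes P :: "'v::fin_dim_normed measure"
  assumes P: "pos_Radon_measure P" and \<phi>: "\<phi> \<in> test_functions UNIV"
  shows "integrable P \<phi>"
proof -
  obtain C where C: "\<And>x. \<bar>\<phi> x\<bar> \<le> C" using test_functions_bounded[OF \<phi>] by blast
  have s [measurable_cong]: "sets P = sets borel" using P unfolding pos_Radon_measure_def by blast
  have K: "compact (tsupp \<phi>)" by (rule test_functionsD(2)[OF \<phi>])
  show ?thesis
  proof (rule integrableI_bounded_set[where A="tsupp \<phi>" and B=C])
    show "tsupp \<phi> \<in> sets P" unfolding s by simp
    show "\<phi> \<in> borel_measurable P"
      using borel_measurable_continuous_onI[OF smooth_continuous_on[OF test_functionsD(1)[OF \<phi>]]] by measurable
    show "emeasure P (tsupp \<phi>) < \<infinity>" using P K unfolding pos_Radon_measure_def by blast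
    show "AE x in P. x \<in> tsupp \<phi> \<longrightarrow> norm (\<phi> x) \<le> C" using C by (intro AE_I2) simp
    show "AE x in P. x \<notin> tsupp \<phi> \<longrightarrow> \<phi> x = 0" using tsupp_zero by (intro AE_I2) blast
  qed
qed

lemma pos_Radon_emeasure_finite:
  fixes P :: "'v::real_normed_vector measure"
  assumes "pos_Radon_measure P" "A \<in> rel_compact_borel"
  shows "emeasure P A < \<infinity>"
proof -
  have s: "sets P = sets borel" and f: "emeasure P (closure A) < \<infinity>"
    using assms unfolding pos_Radon_measure_def rel_compact_borel_def by auto
  have "emeasure P A \<le> emeasure P (closure A)"
    by (rule emeasure_mono) (auto simp: s closure_subset)
  then show ?thesis using f by (rule le_less_trans)
qed

text \<open>The sum is built from its values on Borel sets. Its integrals are identified for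
  nonnegative Borel functions first, then for the positive and negative parts of a test
  function.\<close>

lemma pos_Radon_add:
  fixes P Q :: "'v::fin_dim_normed measure"
  assumes P: "pos_Radon_measure P" and Q: "pos_Radon_measure Q" and c: "0 \<le> c"
  shows "\<exists>R. pos_Radon_measure R \<and> (\<forall>A\<in>rel_compact_borel. measure R A = measure Q A + c * measure P A) \<and>
     (\<forall>\<phi>\<in>test_functions UNIV. (LINT x|R. \<phi> x) = (LINT x|Q. \<phi> x) + c * (LINT x|P. \<phi> x))"
proof -
  have sP: "sets P = sets borel" and sQ: "sets Q = sets borel"
    using P Q unfolding pos_Radon_measure_def by blast+
  define \<mu> where "\<mu> = (\<lambda>A. emeasure Q A + ennreal c * emeasure P A)"
  define R where "R = measure_of UNIV (sets borel) \<mu>"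
  have sR: "sets R = sets borel" unfolding R_def
    using sets.sigma_sets_eq[of "borel :: 'v measure"] by (simp add: sets_measure_of_conv)
  have spR: "space R = UNIV" unfolding R_def by (simp add: space_measure_of_conv)
  have eR: "emeasure R A = \<mu> A" if A: "A \<in> sets borel" for A
  proof (rule emeasure_measure_of[OF R_def])
    show "sets borel \<subseteq> Pow (UNIV :: 'v set)" by simp
    show "A \<in> sets R" using A sR by simp
    show "positive (sets R) \<mu>" unfolding positive_def \<mu>_def by simp
    show "countably_additive (sets R) \<mu>"
      unfolding countably_additive_def sR
    proof (intro allI impI)
      fix X :: "nat \<Rightarrow> 'v set" assume X: "range X \<subseteq> sets borel" "disjoint_family X"
      have "(\<Sum>i. \<mu> (X i)) = (\<Sum>i. emeasure Q (X i)) + (\<Sum>i. ennreal c * emeasure P (X i))"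
        unfolding \<mu>_def by (rule suminf_add[symmetric]) auto
      also have "\<dots> = emeasure Q (\<Union> (range X)) + ennreal c * emeasure P (\<Union> (range X))"
        using X by (simp add: suminf_emeasure sQ sP)
      finally show "(\<Sum>i. \<mu> (X i)) = \<mu> (\<Union> (range X))" unfolding \<mu>_def .
    qed
  qed
  have mR: "borel_measurable R = borel_measurable borel" and mP: "borel_measurable P = borel_measurable borel"
    and mQ: "borel_measurable Q = borel_measurable borel"
    by (intro measurable_cong_sets sR sP sQ refl)+
  have nn: "(\<integral>\<^sup>+x. f x \<partial>R) = (\<integral>\<^sup>+x. f x \<partial>Q) + ennreal c * (\<integral>\<^sup>+x. f x \<partial>P)"
    if "f \<in> borel_measurable borel" for f :: "'v \<Rightarrow> ennreal"
    using that
  proof (induction f rule: borel_measurable_induct)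
    case (cong f g)
    then have "f = g" by (auto simp: fun_eq_iff)
    then show ?case using cong by simp
  next
    case (set A)
    then show ?case using eR[OF set] by (simp add: \<mu>_def sR sP sQ)
  next
    case (mult u k)
    then show ?case by (simp add: nn_integral_cmult mR mP mQ distrib_left mult_ac)
  next
    case (add u v)
    then show ?case by (simp add: nn_integral_add mR mP mQ distrib_left add_ac)
  next
    case (seq U)
    have inc: "incseq U" by (rule seq(3))
    have "(\<integral>\<^sup>+x. (SUP i. U i) x \<partial>M) = (SUP i. \<integral>\<^sup>+x. U i x \<partial>M)" if "borel_measurable M = (borel_measurable borel :: ('v \<Rightarrow> ennreal) set)" for M :: "'v measure"
      unfolding SUP_apply using seq(1) inc by (intro nn_integral_monotone_convergence_SUP) (simp_all add: that)
    note e = this[OF mR] this[OF mP] this[OF mQ]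
    have incQ: "incseq (\<lambda>i. \<integral>\<^sup>+x. U i x \<partial>M)" for M :: "'v measure"
      using inc by (auto simp: incseq_def le_fun_def intro!: nn_integral_mono)
    have "(SUP i. \<integral>\<^sup>+x. U i x \<partial>R) = (SUP i. (\<integral>\<^sup>+x. U i x \<partial>Q) + ennreal c * (\<integral>\<^sup>+x. U i x \<partial>P))"
      using seq.IH by simp
    also have "\<dots> = (SUP i. \<integral>\<^sup>+x. U i x \<partial>Q) + (SUP i. ennreal c * (\<integral>\<^sup>+x. U i x \<partial>P))"
      by (rule ennreal_SUP_add) (use incQ[of Q] incQ[of P] in \<open>auto simp: incseq_def intro!: mult_left_mono\<close>)
    also have "(SUP i. ennreal c * (\<integral>\<^sup>+x. U i x \<partial>P)) = ennreal c * (SUP i. \<integral>\<^sup>+x. U i x \<partial>P)"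
      by (rule SUP_mult_left_ennreal[symmetric])
    finally show ?case unfolding e .
  qed
  have Radon: "pos_Radon_measure R"
    unfolding pos_Radon_measure_def
  proof (intro conjI allI impI sR)
    fix K :: "'v set" assume K: "compact K"
    then have "emeasure P K < \<infinity>" "emeasure Q K < \<infinity>" using P Q unfolding pos_Radon_measure_def by blast+
    then show "emeasure R K < \<infinity>"
      using eR[of K] K by (simp add: \<mu>_def compact_imp_closed ennreal_mult_less_top)
  qed
  have "measure R A = measure Q A + c * measure P A" if A: "A \<in> rel_compact_borel" for A
  proof -
    have "emeasure P A < \<infinity>" "emeasure Q A < \<infinity>" by (rule pos_Radon_emeasure_finite[OF P A], rule pos_Radon_emeasure_finite[OF Q A])
    moreover have "A \<in> sets borel" using A unfolding rel_compact_borel_def by blast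
    ultimately show ?thesis
      unfolding measure_def eR[OF \<open>A \<in> sets borel\<close>] \<mu>_def using c
      by (simp add: enn2real_plus enn2real_mult ennreal_mult_less_top)
  qed
  moreover have "(LINT x|R. \<phi> x) = (LINT x|Q. \<phi> x) + c * (LINT x|P. \<phi> x)" if \<phi>: "\<phi> \<in> test_functions UNIV" for \<phi>
  proof -
    have \<phi>m: "\<phi> \<in> borel_measurable borel"
      by (rule borel_measurable_continuous_onI[OF smooth_continuous_on[OF test_functionsD(1)[OF \<phi>]]])
    have iP: "integrable P \<phi>" and iQ: "integrable Q \<phi>" and iR: "integrable R \<phi>"
      by (rule pos_Radon_integrable_test[OF P \<phi>], rule pos_Radon_integrable_test[OF Q \<phi>],
          rule pos_Radon_integrable_test[OF Radon \<phi>])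
    have fin: "(\<integral>\<^sup>+x. ennreal (\<phi> x) \<partial>M) < \<infinity>" "(\<integral>\<^sup>+x. ennreal (- \<phi> x) \<partial>M) < \<infinity>" if "integrable M \<phi>" for M
      using real_integrable_def[THEN iffD1, OF that] by (auto simp: less_top)
    have n1: "(\<integral>\<^sup>+x. ennreal (\<phi> x) \<partial>R) = (\<integral>\<^sup>+x. ennreal (\<phi> x) \<partial>Q) + ennreal c * (\<integral>\<^sup>+x. ennreal (\<phi> x) \<partial>P)"
      "(\<integral>\<^sup>+x. ennreal (- \<phi> x) \<partial>R) = (\<integral>\<^sup>+x. ennreal (- \<phi> x) \<partial>Q) + ennreal c * (\<integral>\<^sup>+x. ennreal (- \<phi> x) \<partial>P)"
      by (intro nn; use \<phi>m in measurable)+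
    show ?thesis
      unfolding real_lebesgue_integral_def[OF iR] real_lebesgue_integral_def[OF iP] real_lebesgue_integral_def[OF iQ] n1
      using fin[OF iP] fin[OF iQ] c
      by (simp add: enn2real_plus enn2real_mult ennreal_mult_less_top algebra_simps)
  qed
  ultimately show ?thesis using Radon by blast
qed

text \<open>Total masses may be infinite, and \<open>measure\<close> then returns 0; hence values
  are compared on relatively compact sets only.\<close>

definition is_Radon_combination :: "'v::real_normed_vector measure \<Rightarrow> ('i \<Rightarrow> real) \<Rightarrow> ('i \<Rightarrow> 'v measure) \<Rightarrow> 'i set \<Rightarrow> bool" where
  "is_Radon_combination R c P F \<longleftrightarrow> pos_Radon_measure R \<and>
     (\<forall>A\<in>rel_compact_borel. measure R A = (\<Sum>d\<in>F. c d * measure (P d) A)) \<and>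
     (\<forall>\<phi>\<in>test_functions UNIV. (LINT x|R. \<phi> x) = (\<Sum>d\<in>F. c d * (LINT x|P d. \<phi> x)))"

lemma is_Radon_combinationD:
  assumes "is_Radon_combination R c P F"
  shows "pos_Radon_measure R"
    and "A \<in> rel_compact_borel \<Longrightarrow> measure R A = (\<Sum>d\<in>F. c d * measure (P d) A)"
    and "\<phi> \<in> test_functions UNIV \<Longrightarrow> (LINT x|R. \<phi> x) = (\<Sum>d\<in>F. c d * (LINT x|P d. \<phi> x))"
  using assms unfolding is_Radon_combination_def by blast+

lemma pos_Radon_combination:
  fixes P :: "'i \<Rightarrow> 'v::fin_dim_normed measure"
  assumes "finite F" "\<And>d. d \<in> F \<Longrightarrow> pos_Radon_measure (P d)" and c: "\<And>d. 0 \<le> c d"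
  shows "\<exists>R. is_Radon_combination R c P F"
  using assms(1,2)
proof (induction F rule: finite_induct)
  case empty
  have "pos_Radon_measure (null_measure (borel :: 'v measure))" unfolding pos_Radon_measure_def by simp
  then have "is_Radon_combination (null_measure borel) c P {}"
    unfolding is_Radon_combination_def by (simp add: measure_def)
  then show ?case by (rule exI)
next
  case (insert k F)
  have "\<exists>Q. is_Radon_combination Q c P F" by (rule insert.IH) (rule insert.prems, simp)
  then obtain Q where Q: "is_Radon_combination Q c P F" by (rule exE)
  have Pk: "pos_Radon_measure (P k)" by (rule insert.prems) simp
  obtain R where R: "pos_Radon_measure R \<and> (\<forall>A\<in>rel_compact_borel. measure R A = measure Q A + c k * measure (P k) A) \<and>
     (\<forall>\<phi>\<in>test_functions UNIV. (LINT x|R. \<phi> x) = (LINT x|Q. \<phi> x) + c k * (LINT x|P k. \<phi> x))"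
    using pos_Radon_add[OF Pk is_Radon_combinationD(1)[OF Q] c[of k]] by (rule exE)
  have s: "(\<Sum>d\<in>insert k F. c d * z d) = (\<Sum>d\<in>F. c d * z d) + c k * z k" for z :: "'i \<Rightarrow> real"
    using insert.hyps by simp
  have "is_Radon_combination R c P (insert k F)"
    unfolding is_Radon_combination_def s
  proof (intro conjI ballI)
    show "pos_Radon_measure R" using R by (rule conjunct1)
    show "measure R A = (\<Sum>d\<in>F. c d * measure (P d) A) + c k * measure (P k) A" if A: "A \<in> rel_compact_borel" for A
      using bspec[OF conjunct1[OF conjunct2[OF R]] A] is_Radon_combinationD(2)[OF Q A] by (rule trans[OF _ arg_cong2[where f="(+)", OF _ refl]])
    show "(LINT x|R. \<phi> x) = (\<Sum>d\<in>F. c d * (LINT x|P d. \<phi> x)) + c k * (LINT x|P k. \<phi> x)" if A: "\<phi> \<in> test_functions UNIV" for \<phi>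
      using bspec[OF conjunct2[OF conjunct2[OF R]] A] is_Radon_combinationD(3)[OF Q A] by (rule trans[OF _ arg_cong2[where f="(+)", OF _ refl]])
  qed
  then show ?case by (rule exI)
qed

context basis_space
begin

text \<open>The form valued measure is the sum of the positive measures \<open>P d\<close> with
  constant coefficients \<open>k d\<close>. For fixed \<open>u\<close> and \<open>v\<close> these
  coefficients are scalars, and their positive and negative parts give the decomposition into two
  positive measures.\<close>

lemma Hessian_Radon_of_determining:
  assumes D: "cone_of_directions D" "determines_forms D" and f: "D_convex D f"
  shows "Hessian_is_Radon_measure B f"
proof -
  obtain F k where Fk: "finite F \<and> F \<subseteq> D \<and> (\<forall>d. k d \<in> sym_bilinear) \<and>
      (\<forall>\<phi> x u v. smooth \<phi> \<longrightarrow> dd u (dd v \<phi>) x = (\<Sum>d\<in>F. blinfun_apply (blinfun_apply (k d) u) v * dd d (dd d \<phi>) x))"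
    using Hessian_decomposition[OF D(2)] by (elim exE)
  note F = conjunct1[OF Fk] conjunct1[OF conjunct2[OF Fk]]
  have ks: "k d \<in> sym_bilinear" for d using Fk by (elim conjE, elim allE)
  have dec: "dd u (dd v \<phi>) x = (\<Sum>d\<in>F. blinfun_apply (blinfun_apply (k d) u) v * dd d (dd d \<phi>) x)"
    if "smooth \<phi>" for \<phi> x u v
    using Fk[THEN conjunct2, THEN conjunct2, THEN conjunct2, THEN spec, THEN spec, THEN spec, THEN spec, THEN mp, OF that] .
  have "\<forall>d\<in>F. \<exists>P. pos_Radon_measure P \<and> (\<forall>\<phi>\<in>test_functions UNIV. (LINT x|L. f x * dd d (dd d \<phi>) x) = (LINT x|P. \<phi> x))"
    using D_convex_second_derivative_measure[OF D(1) f] F(2) by blast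
  from bchoice[OF this] obtain P where P: "\<And>d. d \<in> F \<Longrightarrow> pos_Radon_measure (P d)"
    "\<And>d \<phi>. d \<in> F \<Longrightarrow> \<phi> \<in> test_functions UNIV \<Longrightarrow> (LINT x|L. f x * dd d (dd d \<phi>) x) = (LINT x|P d. \<phi> x)" by blast
  define M where "M = (\<lambda>A. \<Sum>d\<in>F. measure (P d) A *\<^sub>R k d)"
  have Mapp: "blinfun_apply (blinfun_apply (M A) u) v = (\<Sum>d\<in>F. measure (P d) A * blinfun_apply (blinfun_apply (k d) u) v)" for A u v
    unfolding M_def by (simp add: blinfun.sum_left blinfun.scaleR_left)
  have vec: "vector_Radon_measure M"
    unfolding vector_Radon_measure_def
  proof (intro allI impI)
    fix A :: "nat \<Rightarrow> 'v set" assume A: "disjoint_family A" "range A \<subseteq> rel_compact_borel" "(\<Union>n. A n) \<in> rel_compact_borel"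
    have "(\<lambda>n. measure (P d) (A n)) sums measure (P d) (\<Union>n. A n)" if d: "d \<in> F" for d
    proof (rule measure_UNION)
      have "sets (P d) = sets borel" using P(1)[OF d] unfolding pos_Radon_measure_def by blast
      then show "range A \<subseteq> sets (P d)" using A(2) unfolding rel_compact_borel_def by auto
      show "emeasure (P d) (\<Union>n. A n) \<noteq> \<infinity>" using pos_Radon_emeasure_finite[OF P(1)[OF d] A(3)] by simp
    qed (rule A(1))
    then show "(\<lambda>n. M (A n)) sums M (\<Union>n. A n)"
      unfolding M_def by (intro sums_sum bounded_linear.sums[OF bounded_linear_scaleR_left])
  qed
  have sym: "M A \<in> sym_bilinear" for A
  proof -
    have "blinfun_apply (blinfun_apply (k d) u) v = blinfun_apply (blinfun_apply (k d) v) u" for d u v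
      using ks[of d] unfolding sym_bilinear_def by blast
    then have "blinfun_apply (blinfun_apply (M A) u) v = blinfun_apply (blinfun_apply (M A) v) u" for u v
      unfolding Mapp by (rule arg_cong2[where f=times, OF refl, THEN sum.cong[OF refl]])
    then show ?thesis unfolding sym_bilinear_def by blast
  qed
  have "\<exists>Q N. Radon_decomposition (\<lambda>A. blinfun_apply (blinfun_apply (M A) u) v) Q N \<and>
      (\<forall>\<phi>\<in>test_functions UNIV. distr_Hessian B f \<phi> u v = (LINT x|Q. \<phi> x) - (LINT x|N. \<phi> x))" for u v
  proof -
    define c where "c = (\<lambda>d. blinfun_apply (blinfun_apply (k d) u) v)"
    obtain Q where Q: "is_Radon_combination Q (\<lambda>d. max 0 (c d)) P F"
      using pos_Radon_combination[of F P "\<lambda>d. max 0 (c d)", OF F(1) P(1)] by (metis max.cobounded1)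
    obtain N where N: "is_Radon_combination N (\<lambda>d. max 0 (- c d)) P F"
      using pos_Radon_combination[of F P "\<lambda>d. max 0 (- c d)", OF F(1) P(1)] by (metis max.cobounded1)
    note Q' = is_Radon_combinationD[OF Q] and N' = is_Radon_combinationD[OF N]
    have split: "max 0 (c d) * z - max 0 (- c d) * z = c d * z" for d z
      by (simp add: left_diff_distrib[symmetric] max_def)
    have "Radon_decomposition (\<lambda>A. blinfun_apply (blinfun_apply (M A) u) v) Q N"
      unfolding Radon_decomposition_def Mapp
      by (intro conjI Q'(1) N'(1) ballI)
        (simp add: Q'(2) N'(2) sum_subtractf[symmetric] split, simp add: c_def mult.commute)
    moreover have "distr_Hessian B f \<phi> u v = (LINT x|Q. \<phi> x) - (LINT x|N. \<phi> x)" if \<phi>: "\<phi> \<in> test_functions UNIV" for \<phi>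
    proof -
      have sm: "smooth \<phi>" by (rule test_functionsD(1)[OF \<phi>])
      have int: "integrable L (\<lambda>x. f x * dd d (dd d \<phi>) x)" for d
        by (rule integrable_cont_test[OF D_convex_continuous[OF D(1) f] test_functions_dd[OF test_functions_dd[OF \<phi>]]])
      \<comment> \<open>\<open>second_deriv\<close> differentiates first along \<open>u\<close>, the
        decomposition first along \<open>v\<close>; symmetry of second derivatives reconciles
        them.\<close>
      have sd: "second_deriv \<phi> x u v = (\<Sum>d\<in>F. c d * dd d (dd d \<phi>) x)" for x
        unfolding second_deriv_dd c_def by (rule trans[OF dd_commute[OF sm] dec[OF sm]])
      have "distr_Hessian B f \<phi> u v = (LINT x|L. (\<Sum>d\<in>F. c d * (f x * dd d (dd d \<phi>) x)))"
        unfolding distr_Hessian_def sd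
        by (simp add: sum_distrib_left mult_ac)
      also have "\<dots> = (\<Sum>d\<in>F. c d * (LINT x|L. f x * dd d (dd d \<phi>) x))"
        using int by (subst Bochner_Integration.integral_sum) auto
      also have "\<dots> = (\<Sum>d\<in>F. c d * (LINT x|P d. \<phi> x))"
        using P(2)[OF _ \<phi>] by (intro sum.cong) auto
      finally show ?thesis using \<phi> by (simp add: Q'(3) N'(3) sum_subtractf[symmetric] split)
    qed
    ultimately show ?thesis by blast
  qed
  then show ?thesis unfolding Hessian_is_Radon_measure_def using vec sym by blast
qed

end

subsection \<open>The equivalence\<close>

lemma affine_function_imp_D_affine:
  assumes "affine_function f"
  shows "D_affine D f"
proof -
  obtain l c where l: "linear l" and f: "f = (\<lambda>x. l x + c)" using assms unfolding affine_function_def by blast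
  have e: "f ((1 - t) *\<^sub>R x + t *\<^sub>R y) = (1 - t) * f x + t * f y" for t x y
    unfolding f linear_add[OF l] linear_scale[OF l] by (simp add: algebra_simps)
  have "convex_on (closed_segment x y) f" for x y
    by (rule convex_onI; (simp only: e)?; simp)
  moreover have "convex_on (closed_segment x y) (\<lambda>x. - f x)" for x y
    by (rule convex_onI; (simp only: e)?; simp)
  ultimately show ?thesis unfolding D_affine_def D_convex_def by blast
qed

text \<open>On a line with direction in D the function \<open>S x x\<close> has no quadratic term,
  so it is D-affine and hence affine. An affine function that is homogeneous of degree 2 is 0, and
  polarization recovers \<open>S\<close>.\<close>

lemma determines_forms_if_D_affine_imp_affine:
  fixes D :: "'v::real_normed_vector set"
  assumes aff: "\<And>f :: 'v \<Rightarrow> real. D_affine D f \<Longrightarrow> affine_function f"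
  shows "determines_forms D"
  unfolding determines_forms_def
proof (intro allI impI, elim conjE)
  fix S :: "'v \<Rightarrow> 'v \<Rightarrow> real" and u v
  assume "\<forall>u. linear (S u)" and sym: "\<forall>u v. S u v = S v u" and z: "\<forall>d\<in>D. S d d = 0"
  then have lin: "linear (S u)" for u by blast
  have add: "S (x + y) (x + y) = S x x + 2 * S x y + S y y" for x y
    using sym[rule_format, of "x + y" x] sym[rule_format, of "x + y" y] sym[rule_format, of y x]
    by (simp add: linear_add[OF lin])
  have scale: "S (t *\<^sub>R x) (t *\<^sub>R x) = t * (t * S x x)" for t x
    using sym[rule_format, of "t *\<^sub>R x" x] by (simp add: linear_scale[OF lin])
  have line: "S (x + t *\<^sub>R d) (x + t *\<^sub>R d) = S x x + 2 * t * S x d" if "d \<in> D" for x t d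
    unfolding add scale using z[rule_format, OF that] by (simp add: linear_scale[OF lin])
  have "D_affine D (\<lambda>x. S x x)"
    unfolding D_affine_def
  proof (intro conjI D_convexI)
    fix x d assume d: "d \<in> D"
    show "convex_on UNIV (\<lambda>t. S (x + t *\<^sub>R d) (x + t *\<^sub>R d))"
      "convex_on UNIV (\<lambda>t. - S (x + t *\<^sub>R d) (x + t *\<^sub>R d))"
      unfolding line[OF d] by (rule convex_onI; simp add: algebra_simps)+
  qed
  then obtain l c where l: "linear l" and q: "\<And>x. S x x = l x + c"
    using aff unfolding affine_function_def by (metis (no_types, lifting))
  \<comment> \<open>Evaluation at \<open>x\<close>, \<open>- x\<close> and 0: an even affine
    function is constant, and its value at 0 is 0.\<close>
  have S0: "S x x = 0" for x
    using q[of x] q[of "- x"] q[of 0] scale[of "-1" x] scale[of 0 0] linear_0[OF l] linear_neg[OF l, of x] by simp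
  show "S u v = 0" using add[of u v] by (simp add: S0)
qed

text \<open>On the compact intersection of \<open>closure D\<close> with the unit sphere the
  functional has no zero, so its absolute value attains a positive minimum; homogeneity does the
  rest. If the intersection is empty, D contains at most 0.\<close>

lemma cone_functional_lower_bound:
  fixes D :: "'v::fin_dim_normed set" and l :: "'v \<Rightarrow>\<^sub>L real"
  assumes cone: "\<And>x t. x \<in> D \<Longrightarrow> t *\<^sub>R x \<in> D" and ker: "closure D \<inter> {x. blinfun_apply l x = 0} \<subseteq> {0}"
  shows "\<exists>c>0. \<forall>d\<in>D. c * norm d \<le> \<bar>blinfun_apply l d\<bar>"
proof (cases "closure D \<inter> sphere 0 1 = {}")
  case True
  have "d = 0" if "d \<in> D" for d
  proof (rule ccontr)
    assume "d \<noteq> 0"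
    then have "inverse (norm d) *\<^sub>R d \<in> closure D \<inter> sphere 0 1"
      using cone[OF that] closure_subset by auto
    then show False using True by blast
  qed
  then show ?thesis by (intro exI[of _ 1]) fastforce
next
  case False
  have K: "compact (closure D \<inter> sphere 0 1)"
    by (intro closed_Int_compact closed_closure) (auto simp: compact_eq_bounded_closed bounded_iff sphere_def intro!: exI[of _ 1] closed_Collect_eq continuous_intros)
  obtain m where m: "m \<in> closure D \<inter> sphere 0 1"
    "\<And>y. y \<in> closure D \<inter> sphere 0 1 \<Longrightarrow> \<bar>blinfun_apply l m\<bar> \<le> \<bar>blinfun_apply l y\<bar>"
    using continuous_attains_inf[OF K False, of "\<lambda>x. \<bar>blinfun_apply l x\<bar>", OF continuous_on_rabs[OF
        linear_continuous_on[OF blinfun.bounded_linear_right]]] by blast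
  have "blinfun_apply l m \<noteq> 0" using m(1) ker by auto
  moreover have "\<bar>blinfun_apply l m\<bar> * norm d \<le> \<bar>blinfun_apply l d\<bar>" if d: "d \<in> D" for d
  proof (cases "d = 0")
    case False
    have "inverse (norm d) *\<^sub>R d \<in> closure D \<inter> sphere 0 1"
      using cone[OF d] closure_subset False by auto
    from m(2)[OF this] show ?thesis
      using False by (simp add: blinfun.scaleR_right abs_mult field_simps)
  qed (simp add: blinfun.zero_right)
  ultimately show ?thesis by (intro exI[of _ "\<bar>blinfun_apply l m\<bar>"]) auto
qed

section \<open>The rough function and the conclusion\<close>

context basis_space
begin

lemma ex_rough_D_convex_function:
  fixes D :: "'v set" and l :: "'v \<Rightarrow>\<^sub>L real" and g :: "'v \<Rightarrow> real"
  assumes cone: "cone_of_directions D" and ker: "closure D \<inter> {x. blinfun_apply l x = 0} = {0}"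
    and g: "D_affine D g" "\<not> affine_function g"
  shows "\<exists>e. norm e = 1 \<and> (\<exists>(f :: 'v \<Rightarrow> real) Df. D_convex D f \<and>
      (\<forall>x. (f has_derivative blinfun_apply (Df x)) (at x)) \<and> continuous_on UNIV Df \<and> locally_Holder Df \<and>
      (\<forall>U. open U \<and> U \<noteq> {} \<longrightarrow> (\<forall>n::nat. \<exists>\<psi>\<in>test_functions U. (\<forall>y. \<bar>\<psi> y\<bar> \<le> 1) \<and>
         real n \<le> (LINT y|L. f y * dd e (dd e \<psi>) y))))"
proof -
  obtain I :: "(('v \<times> 'v) \<times> bool) set" and a c e where I: "finite I" and a: "\<forall>i. bounded_linear (a i)"
    and e: "norm (e :: 'v) = 1" and cD: "\<forall>d\<in>D. (\<Sum>i\<in>I. c i * (a i d)\<^sup>2) = 0"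
    and ce: "(\<Sum>i\<in>I. c i * (a i e)\<^sup>2) \<noteq> (0 :: real)"
    using nonaffine_D_affine_form[OF g(1) cone g(2)] by (elim exE conjE)
  obtain c0 where c0: "c0 > 0" "\<And>d. d \<in> D \<Longrightarrow> c0 * norm d \<le> \<bar>blinfun_apply l d\<bar>"
    using cone_functional_lower_bound[of D l] cone ker unfolding cone_of_directions_def by auto
  \<comment> \<open>The functional l is adjoined as index \<open>None\<close> with coefficient 0:
    the form is unchanged, but the square of l becomes one of the lamination directions and supplies
    the interior point of the cone.\<close>
  define I' where "I' = insert None (Some ` I)"
  define a' where "a' = case_option (blinfun_apply l) a"
  define c' where "c' = case_option 0 c"
  have sum': "(\<Sum>i\<in>I'. c' i * (a' i d)\<^sup>2) = (\<Sum>i\<in>I. c i * (a i d)\<^sup>2)" for d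
    unfolding I'_def a'_def c'_def using I by (subst sum.insert) (auto simp: sum.reindex)
  have a': "bounded_linear (a' i)" for i
    unfolding a'_def using a by (cases i) (auto simp: blinfun.bounded_linear_right)
  interpret q: quadratic_forms B D I' a' e
  proof (intro quadratic_forms.intro basis_space_axioms quadratic_forms_axioms.intro)
    show "finite I'" using I by (simp add: I'_def)
  qed (rule a')
  have "\<exists>C\<ge>0. \<forall>U t. open U \<and> U \<noteq> {} \<longrightarrow> (\<exists>M\<ge>0. \<forall>\<tau>>0. \<exists>\<phi> \<psi>. rough_pair (a' None) C D e U M \<tau> t \<phi> \<psi>)"
  proof (rule q.large_Hessian_test[of c0 None c', OF c0(1)])
    show "c0 * norm d \<le> \<bar>a' None d\<bar>" if "d \<in> D" for d using c0(2)[OF that] by (simp add: a'_def)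
    show "None \<in> I'" by (simp add: I'_def)
    show "q.Qf c' d = 0" if "d \<in> D" for d using cD that unfolding q.Qf_def sum' by blast
    show "q.Qf c' e \<noteq> 0" using ce unfolding q.Qf_def sum' .
  qed
  then obtain C where C: "0 \<le> C"
    and H: "\<forall>U t. open U \<and> U \<noteq> {} \<longrightarrow> (\<exists>M\<ge>0. \<forall>\<tau>>0. \<exists>\<phi> \<psi>. rough_pair (a' None) C D e U M \<tau> t \<phi> \<psi>)"
    by (elim exE conjE)
  have "\<exists>M\<ge>0. \<forall>\<tau>>0. \<exists>\<phi> \<psi>. rough_pair (a' None) C D e U M \<tau> t \<phi> \<psi>" if "open U" "U \<noteq> {}" for U t
    by (rule H[THEN spec, THEN spec, THEN mp, OF conjI[OF that]])
  from rough_D_convex_function[OF cone a' C this] e show ?thesis by (intro exI[of _ e] conjI)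
qed

lemma set_integral_second_deriv:
  assumes "\<psi> \<in> test_functions U"
  shows "(LINT x:U|L. f x * second_deriv \<psi> x u v) = (LINT x|L. f x * dd v (dd u \<psi>) x)"
  unfolding set_lebesgue_integral_def second_deriv_dd
  by (intro Bochner_Integration.integral_cong refl)
    (auto simp: indicator_def test_functionsD(4)[OF test_functions_dd[OF test_functions_dd[OF assms]]])

lemma integral_test_bound:
  fixes P :: "'v measure"
  assumes P: "pos_Radon_measure P" and \<phi>: "\<phi> \<in> test_functions UNIV"
    and K: "compact K" "\<And>x. x \<notin> K \<Longrightarrow> \<phi> x = 0" and b: "\<And>x. \<bar>\<phi> x\<bar> \<le> 1"
  shows "\<bar>LINT x|P. \<phi> x\<bar> \<le> measure P K"
proof -
  have s: "K \<in> sets P" using P K(1) unfolding pos_Radon_measure_def by (simp add: compact_imp_closed)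
  have fin: "emeasure P K < \<infinity>" using P K(1) unfolding pos_Radon_measure_def by blast
  have i: "integrable P \<phi>" by (rule pos_Radon_integrable_test[OF P \<phi>])
  have "\<bar>LINT x|P. \<phi> x\<bar> \<le> (LINT x|P. \<bar>\<phi> x\<bar>)" using integral_norm_bound[of P \<phi>] by simp
  also have "\<dots> \<le> (LINT x|P. indicator K x)"
    using K(2) b by (intro integral_mono integrable_abs i integrable_real_indicator s fin)
      (auto simp: indicator_def)
  also have "\<dots> = measure P K" using s fin by simp
  finally show ?thesis .
qed

text \<open>A Radon measure has finite mass on the closed unit ball, which bounds all integrals of
  test functions supported in the open ball with values between -1 and 1. The rough function
  violates this bound for its own \<open>e\<close>.\<close>

lemma Hessian_Radon_imp_bounded:
  assumes "Hessian_is_Radon_measure B f"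
  shows "\<exists>C. \<forall>\<psi>\<in>test_functions (ball 0 1). (\<forall>y. \<bar>\<psi> y\<bar> \<le> 1) \<longrightarrow> (LINT y|L. f y * dd e (dd e \<psi>) y) \<le> C"
proof -
  obtain M where "\<forall>u v. \<exists>P N. Radon_decomposition (\<lambda>A. blinfun_apply (blinfun_apply (M A) u) v) P N \<and>
           (\<forall>\<phi>\<in>test_functions UNIV. distr_Hessian B f \<phi> u v = (LINT x|P. \<phi> x) - (LINT x|N. \<phi> x))"
    using assms unfolding Hessian_is_Radon_measure_def by blast
  then obtain P N where PN: "Radon_decomposition (\<lambda>A. blinfun_apply (blinfun_apply (M A) e) e) P N"
    and eq: "\<forall>\<phi>\<in>test_functions UNIV. distr_Hessian B f \<phi> e e = (LINT x|P. \<phi> x) - (LINT x|N. \<phi> x)"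
    by blast
  have P: "pos_Radon_measure P" and N: "pos_Radon_measure N" using PN unfolding Radon_decomposition_def by blast+
  have "(LINT y|L. f y * dd e (dd e \<psi>) y) \<le> measure P (cball 0 1) + measure N (cball 0 1)"
    if \<psi>: "\<psi> \<in> test_functions (ball 0 1)" "\<forall>y. \<bar>\<psi> y\<bar> \<le> 1" for \<psi>
  proof -
    have u: "\<psi> \<in> test_functions UNIV" by (rule test_functions_mono[OF \<psi>(1)]) simp
    have K: "compact (cball (0::'v) 1)" by (simp add: compact_eq_bounded_closed)
    have z: "\<psi> x = 0" if "x \<notin> cball 0 1" for x by (rule test_functionsD(4)[OF \<psi>(1)]) (use that in auto)
    have "(LINT y|L. f y * dd e (dd e \<psi>) y) = (LINT x|P. \<psi> x) - (LINT x|N. \<psi> x)"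
      using eq u unfolding distr_Hessian_def second_deriv_dd by blast
    moreover have "\<bar>LINT x|P. \<psi> x\<bar> \<le> measure P (cball 0 1)" "\<bar>LINT x|N. \<psi> x\<bar> \<le> measure N (cball 0 1)"
      by (rule integral_test_bound[OF P u K z], simp, rule \<psi>(2)[rule_format],
          rule integral_test_bound[OF N u K z], simp, rule \<psi>(2)[rule_format])
    ultimately show ?thesis by linarith
  qed
  then show ?thesis by blast
qed

end

theorem theorem1p4:
  fixes D :: "'v::fin_dim_normed set" and B :: "'v set"
  assumes cone: "cone_of_directions D"
    and ker: "\<exists>l :: 'v \<Rightarrow>\<^sub>L real. closure D \<inter> {x. blinfun_apply l x = 0} = {0}"
    and basis: "independent B" "span B = UNIV"
  shows "((\<forall>f. D_convex D f \<longrightarrow> Hessian_is_Radon_measure B f) \<longleftrightarrow>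
            (\<forall>f. D_affine D f \<longleftrightarrow> affine_function f)) \<and>
         ((\<exists>f. D_affine D f \<and> \<not> affine_function f) \<longrightarrow>
            (\<exists>(f :: 'v \<Rightarrow> real) (Df :: 'v \<Rightarrow> ('v \<Rightarrow>\<^sub>L real)).
               D_convex D f \<and>
               (\<forall>x. (f has_derivative blinfun_apply (Df x)) (at x)) \<and>
               continuous_on UNIV Df \<and>
               locally_Holder Df \<and>
               (\<forall>U. open U \<and> U \<noteq> {} \<longrightarrow>
                  (\<exists>e. norm e = 1 \<and>
                     (SUP \<phi>\<in>{\<phi> \<in> test_functions U. \<forall>x. \<bar>\<phi> x\<bar> \<le> 1}.
                        ereal (LINT x:U|lebesgue_wrt B. f x * second_deriv \<phi> x e e)) = \<infinity>))))"
proof -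
  interpret basis_space B by unfold_locales (rule basis)+
  obtain l :: "'v \<Rightarrow>\<^sub>L real" where l: "closure D \<inter> {x. blinfun_apply l x = 0} = {0}" using ker by (elim exE)
  note rough = ex_rough_D_convex_function[OF cone l]
  have "D_affine D g \<longleftrightarrow> affine_function g" if Radon: "\<forall>f. D_convex D f \<longrightarrow> Hessian_is_Radon_measure B f" for g
  proof
    assume g: "D_affine D g"
    show "affine_function g"
    proof (rule ccontr)
      assume na: "\<not> ?thesis"
      obtain e f where "D_convex D f"
        and f: "\<forall>U. open U \<and> U \<noteq> {} \<longrightarrow> (\<forall>n::nat. \<exists>\<psi>\<in>test_functions U. (\<forall>y. \<bar>\<psi> y\<bar> \<le> 1) \<and>
         real n \<le> (LINT y|L. f y * dd e (dd e \<psi>) y))"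
        using rough[OF g na] by (elim exE conjE)
      then have "Hessian_is_Radon_measure B f" using Radon by blast
      from Hessian_Radon_imp_bounded[OF this, of e] obtain C where
        C: "\<And>\<psi>. \<psi> \<in> test_functions (ball 0 1) \<Longrightarrow> \<forall>y. \<bar>\<psi> y\<bar> \<le> 1 \<Longrightarrow> (LINT y|L. f y * dd e (dd e \<psi>) y) \<le> C"
        by blast
      obtain n :: nat where n: "C < real n" using reals_Archimedean2 by blast
      have "open (ball (0::'v) 1) \<and> ball (0::'v) 1 \<noteq> {}" by simp
      from f[THEN spec, THEN mp, OF this, THEN spec, of n] obtain \<psi>
        where "\<psi> \<in> test_functions (ball 0 1)" "\<forall>y. \<bar>\<psi> y\<bar> \<le> 1" "real n \<le> (LINT y|L. f y * dd e (dd e \<psi>) y)"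
        by (elim bexE conjE)
      then show False using C[of \<psi>] n by fastforce
    qed
  qed (rule affine_function_imp_D_affine)
  moreover have "Hessian_is_Radon_measure B f"
    if "\<forall>f. D_affine D f \<longleftrightarrow> affine_function f" "D_convex D f" for f
    by (rule Hessian_Radon_of_determining[OF cone determines_forms_if_D_affine_imp_affine that(2)])
      (rule that(1)[THEN spec, THEN iffD1])
  moreover have "\<exists>(f :: 'v \<Rightarrow> real) Df. D_convex D f \<and> (\<forall>x. (f has_derivative blinfun_apply (Df x)) (at x)) \<and>
      continuous_on UNIV Df \<and> locally_Holder Df \<and>
      (\<forall>U. open U \<and> U \<noteq> {} \<longrightarrow> (\<exists>e. norm e = 1 \<and>
         (SUP \<phi>\<in>{\<phi> \<in> test_functions U. \<forall>x. \<bar>\<phi> x\<bar> \<le> 1}. ereal (LINT x:U|L. f x * second_deriv \<phi> x e e)) = \<infinity>))"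
    if ex: "\<exists>g. D_affine D g \<and> \<not> affine_function g"
  proof -
    obtain g where g: "D_affine D g" "\<not> affine_function g" using ex by (elim exE conjE)
    from rough[OF g] obtain e f Df where e: "norm e = 1" and f: "D_convex D f"
      "\<forall>x. (f has_derivative blinfun_apply (Df x)) (at x)" "continuous_on UNIV Df" "locally_Holder Df"
      and large: "\<forall>U. open U \<and> U \<noteq> {} \<longrightarrow> (\<forall>n::nat. \<exists>\<psi>\<in>test_functions U. (\<forall>y. \<bar>\<psi> y\<bar> \<le> 1) \<and>
         real n \<le> (LINT y|L. f y * dd e (dd e \<psi>) y))"
      by (elim exE conjE)
    have "(SUP \<phi>\<in>{\<phi> \<in> test_functions U. \<forall>x. \<bar>\<phi> x\<bar> \<le> 1}. ereal (LINT x:U|L. f x * second_deriv \<phi> x e e)) = \<infinity>"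
      if U: "open U \<and> U \<noteq> {}" for U
    proof (rule SUP_PInfty)
      fix n :: nat
      from large[THEN spec, THEN mp, OF U, THEN spec, of n] obtain \<psi>
        where \<psi>: "\<psi> \<in> test_functions U" "\<forall>y. \<bar>\<psi> y\<bar> \<le> 1" "real n \<le> (LINT y|L. f y * dd e (dd e \<psi>) y)"
        by (elim bexE conjE)
      show "\<exists>\<phi>\<in>{\<phi> \<in> test_functions U. \<forall>x. \<bar>\<phi> x\<bar> \<le> 1}. ereal (real n) \<le> ereal (LINT x:U|L. f x * second_deriv \<phi> x e e)"
        using \<psi> by (intro bexI[of _ \<psi>]) (simp_all add: set_integral_second_deriv)
    qed
    \<comment> \<open>A single unit vector \<open>e\<close> serves all open sets.\<close>
    with e f show ?thesis by (intro exI[of _ f] exI[of _ Df] conjI allI impI exI[of _ e]) (auto elim: allE)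
  qed
  ultimately show ?thesis by (intro conjI iffI allI impI) blast+
qed

end
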